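(* Let $\nu\ge-1/2$ and $1<p<\infty$. Each of the operators $\mathfrak{R}_\nu$ and $\mathfrak{R}_\nu^M$ extends uniquely to a bounded linear operator on $L^p(d\eta_\nu)$. Moreover, $$\|\mathfrak{R}_\nu\|_{L^p(d\eta_\nu)\to L^p(d\eta_\nu)}\le 48(p^*-1),\qquad \|\mathfrak{R}^M_\nu\|_{L^p(d\eta_\nu)\to L^p(d\eta_\nu)}\le 48(p^*-1),$$ where $p^*=\max(p,p/(p-1))$.
   Context: All $L^p$ spaces are over the interval $(0,1)$. For $\nu>-1$ let $J_\nu$ be the Bessel function of the first kind of order $\nu$ on $(0,\infty)$, and let $0<\lambda_{1,\nu}<\lambda_{2,\nu}<\dots$ be its successive positive zeros. For $n\ge1$ and $x\in(0,1)$ set $$\phi_n^\nu(x)=\frac{\sqrt2}{|J_{\nu+1}(\lambda_{n,\nu})|}x^{-\nu}J_\nu(\lambda_{n,\nu}x),\qquad \varphi_n^\nu(x)=\frac{\phi_n^\nu(x)}{\phi_1^\nu(x)},\qquad d\eta_\nu(x)=x^{2\nu+1}[\phi_1^\nu(x)]^2dx.$$ The system $\{\varphi_n^\nu:n\ge1\}$ is an orthonormal basis of $L^2(d\eta_\nu)$. Let $d_\nu=\frac{d}{dx}$. The Riesz transforms are the operators, defined initially on $L^2(d\eta_\nu)$ (where they are contractions, the series converging in $L^2(d\eta_\nu)$), given by $$\mathfrak{R}_\nu f=\sum_{n\ge2}\lambda_{n,\nu}^{-1}\langle f,\varphi_n^\nu\rangle_{d\eta_\nu}\,d_\nu\varphi_n^\nu,\qquad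 \mathfrak{R}_\nu^M f=\sum_{n\ge2}\big(\lambda_{n,\nu}^2-\lambda_{1,\nu}^2\big)^{-1/2}\langle f,\varphi_n^\nu\rangle_{d\eta_\nu}\,d_\nu\varphi_n^\nu,$$ where $\langle\cdot,\cdot\rangle_{d\eta_\nu}$ is the inner product in $L^2(d\eta_\nu)$. *)

theory Defs
  imports "HOL-Analysis.Analysis"
begin

section \<open>Bessel functions and their positive zeros\<close>

definition bessel_J :: "real \<Rightarrow> real \<Rightarrow> real" where
  "bessel_J \<nu> x =
     (\<Sum>m. (-1) ^ m / (fact m * Gamma (real m + \<nu> + 1)) * (x / 2) powr (2 * real m + \<nu>))"

text \<open>The \<open>n\<close>-th positive zero, for \<open>n \<ge> 1\<close>: the positive zero \<open>x\<close> for which exactly \<open>n\<close>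
  zeros lie in \<open>(0, x]\<close>.\<close>

definition bessel_zero :: "real \<Rightarrow> nat \<Rightarrow> real" where
  "bessel_zero \<nu> n =
     (THE x. 0 < x \<and> bessel_J \<nu> x = 0 \<and> card {y. 0 < y \<and> y \<le> x \<and> bessel_J \<nu> y = 0} = n)"


section \<open>The Fourier-Bessel system\<close>

definition bessel_phi :: "real \<Rightarrow> nat \<Rightarrow> real \<Rightarrow> real" where
  "bessel_phi \<nu> n x =
     sqrt 2 / \<bar>bessel_J (\<nu> + 1) (bessel_zero \<nu> n)\<bar> * x powr (- \<nu>) * bessel_J \<nu> (bessel_zero \<nu> n * x)"

definition bessel_varphi :: "real \<Rightarrow> nat \<Rightarrow> real \<Rightarrow> real" where
  "bessel_varphi \<nu> n x = bessel_phi \<nu> n x / bessel_phi \<nu> 1 x"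

definition bessel_measure :: "real \<Rightarrow> real measure" where
  "bessel_measure \<nu> =
     density (restrict_space lborel {0<..<1})
       (\<lambda>x. ennreal (x powr (2 * \<nu> + 1) * (bessel_phi \<nu> 1 x)\<^sup>2))"


section \<open>Lebesgue spaces and their bounded operators\<close>

text \<open>Functions are complex-valued. Elements of \<open>L\<^sup>p\<close> are represented by functions and operators by
  maps on representatives, so identities between elements of \<open>L\<^sup>p\<close> are stated almost everywhere.
  Since the Bochner integral of a non-integrable function is 0, \<open>Lp_norm\<close> is meaningful only for
  members of \<open>Lp\<close>.\<close>

definition Lp :: "real \<Rightarrow> 'a measure \<Rightarrow> ('a \<Rightarrow> complex) set" where
  "Lp p M = {f \<in> borel_measurable M. integrable M (\<lambda>x. cmod (f x) powr p)}"

definition Lp_norm :: "real \<Rightarrow> 'a measure \<Rightarrow> ('a \<Rightarrow> complex) \<Rightarrow> real" where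
  "Lp_norm p M f = (LINT x|M. cmod (f x) powr p) powr (1 / p)"

definition Lp_tendsto ::
  "real \<Rightarrow> 'a measure \<Rightarrow> (nat \<Rightarrow> 'a \<Rightarrow> complex) \<Rightarrow> ('a \<Rightarrow> complex) \<Rightarrow> bool" where
  "Lp_tendsto p M s g \<longleftrightarrow>
     (\<forall>N. s N \<in> Lp p M) \<and> g \<in> Lp p M \<and> (\<lambda>N. Lp_norm p M (\<lambda>x. s N x - g x)) \<longlonglongrightarrow> 0"

definition L2_inner :: "'a measure \<Rightarrow> ('a \<Rightarrow> complex) \<Rightarrow> ('a \<Rightarrow> complex) \<Rightarrow> complex" where
  "L2_inner M f g = (LINT x|M. f x * cnj (g x))"

definition Lp_bounded_linear ::
  "real \<Rightarrow> 'a measure \<Rightarrow> (('a \<Rightarrow> complex) \<Rightarrow> ('a \<Rightarrow> complex)) \<Rightarrow> bool" where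
  "Lp_bounded_linear p M T \<longleftrightarrow>
     (\<forall>f\<in>Lp p M. T f \<in> Lp p M) \<and>
     (\<forall>f\<in>Lp p M. \<forall>g\<in>Lp p M. (AE x in M. f x = g x) \<longrightarrow> (AE x in M. T f x = T g x)) \<and>
     (\<forall>f\<in>Lp p M. \<forall>g\<in>Lp p M. AE x in M. T (\<lambda>y. f y + g y) x = T f x + T g x) \<and>
     (\<forall>c. \<forall>f\<in>Lp p M. AE x in M. T (\<lambda>y. c * f y) x = c * T f x) \<and>
     (\<exists>K. \<forall>f\<in>Lp p M. Lp_norm p M (T f) \<le> K * Lp_norm p M f)"

text \<open>As for \<open>onorm\<close>, the convention \<open>x / 0 = 0\<close> takes care of null functions \<open>f\<close>.\<close>

definition Lp_opnorm ::
  "real \<Rightarrow> 'a measure \<Rightarrow> (('a \<Rightarrow> complex) \<Rightarrow> ('a \<Rightarrow> complex)) \<Rightarrow> real" where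
  "Lp_opnorm p M T = (SUP f\<in>Lp p M. Lp_norm p M (T f) / Lp_norm p M f)"

text \<open>\<open>T\<close> is a bounded operator on \<open>L\<^sup>p\<close> extending the operator \<open>R\<close>, which is given on \<open>L\<^sup>2\<close>: the two
  agree on \<open>L\<^sup>2 \<inter> L\<^sup>p\<close>.\<close>

definition Lp_extension ::
  "real \<Rightarrow> 'a measure \<Rightarrow> (('a \<Rightarrow> complex) \<Rightarrow> ('a \<Rightarrow> complex)) \<Rightarrow>
    (('a \<Rightarrow> complex) \<Rightarrow> ('a \<Rightarrow> complex)) \<Rightarrow> bool" where
  "Lp_extension p M R T \<longleftrightarrow>
     Lp_bounded_linear p M T \<and> (\<forall>f \<in> Lp 2 M \<inter> Lp p M. AE x in M. T f x = R f x)"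


section \<open>The Riesz transforms\<close>

text \<open>The operator \<open>f \<mapsto> \<Sum>n\<ge>2. a n * \<langle>f, \<phi>\<^sub>n\<rangle> * \<phi>\<^sub>n'\<close>, with the series taken in \<open>L\<^sup>2\<close>; the choice
  operator selects a representative of the limit.\<close>

definition bessel_derivative_series ::
  "real \<Rightarrow> (nat \<Rightarrow> real) \<Rightarrow> (real \<Rightarrow> complex) \<Rightarrow> (real \<Rightarrow> complex)" where
  "bessel_derivative_series \<nu> a f =
     (SOME g. Lp_tendsto 2 (bessel_measure \<nu>)
        (\<lambda>N x. \<Sum>n=2..N. complex_of_real (a n) *
           L2_inner (bessel_measure \<nu>) f (\<lambda>y. complex_of_real (bessel_varphi \<nu> n y)) *
           complex_of_real (deriv (bessel_varphi \<nu> n) x)) g)"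

definition riesz_transform :: "real \<Rightarrow> (real \<Rightarrow> complex) \<Rightarrow> (real \<Rightarrow> complex)" where
  "riesz_transform \<nu> = bessel_derivative_series \<nu> (\<lambda>n. inverse (bessel_zero \<nu> n))"

definition riesz_transform_M :: "real \<Rightarrow> (real \<Rightarrow> complex) \<Rightarrow> (real \<Rightarrow> complex)" where
  "riesz_transform_M \<nu> =
     bessel_derivative_series \<nu>
       (\<lambda>n. ((bessel_zero \<nu> n)\<^sup>2 - (bessel_zero \<nu> 1)\<^sup>2) powr (- 1 / 2))"

end

theory Submission
  imports Defs
begin

text \<open>Write \<open>\<phi>\<^sub>n\<close> for the functions \<open>bessel_varphi \<nu> n\<close>, \<open>\<mu>\<^sub>n = \<lambda>\<^sub>n\<^sup>2 - \<lambda>\<^sub>1\<^sup>2\<close>, and let \<open>a\<close> be \<open>\<lambda>\<^sub>1\<^sup>2\<close> for the first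
  transform and 0 for the second, so that both map \<open>f = \<Sum> c\<^sub>n \<phi>\<^sub>n\<close> to \<open>R f = \<Sum> c\<^sub>n \<phi>\<^sub>n' / r\<^sub>n\<close> with
  \<open>r\<^sub>n = sqrt (\<mu>\<^sub>n + a)\<close>. The \<open>\<phi>\<^sub>n'\<close> are orthogonal with squared norms \<open>\<mu>\<^sub>n\<close>, hence the pairing of \<open>R f\<close> with
  \<open>g = \<Sum> d\<^sub>n \<phi>\<^sub>n'\<close> is \<open>\<Sum> c\<^sub>n d\<^sub>n \<mu>\<^sub>n / r\<^sub>n\<close>, and by duality it is enough to bound this by a multiple of
  \<open>(p\<^sup>* - 1) \<parallel>f\<parallel>\<^sub>p \<parallel>g\<parallel>\<^sub>q\<close>. Let \<open>U\<close> and \<open>V\<close> be the Poisson extensions of \<open>f\<close> and \<open>g\<close>, in which \<open>\<phi>\<^sub>n\<close> and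
  \<open>\<phi>\<^sub>n'\<close> are multiplied by \<open>exp (- r\<^sub>n t)\<close>. The pairing is the integral of \<open>- 4 t U\<^sub>x V\<^sub>t\<close>. A Bellman function
  \<open>b\<close> (after Nazarov and Treil) has a Hessian dominating the products of first derivatives of \<open>U\<close> and \<open>V\<close>; since the
  zero-order terms in the elliptic equations of \<open>U\<close> and \<open>V\<close> are nonnegative, integration by parts bounds
  the pairing by the integral of \<open>b(f, g)\<close>, which is at most \<open>14 (p\<^sup>* - 1)\<close> for \<open>f\<close> and \<open>g\<close> of norm 1. Real
  and imaginary parts give \<open>28 (p\<^sup>* - 1)\<close> for complex functions.

  The finite sums of the \<open>\<phi>\<^sub>n\<close>, and of the \<open>\<phi>\<^sub>n'\<close>, are dense in every \<open>L\<^sup>r\<close>, because the Fourier-Bessel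
  series of a smooth function vanishing to high order at 1 converges rapidly. That it converges to the
  function itself comes from Picone's identity.\<close>

section \<open>The Bellman function\<close>

text \<open>The Bellman function must be twice differentiable where the extensions vanish, so it is
  regularised by \<open>e > 0\<close>; \<open>e\<close> tends to 0 only in the final norm estimate.
  It is not symmetric in its arguments: with \<open>a = p - 1\<close> it serves p \<ge> 2, and for p
  < 2 the two functions change places. Its integral is at most 10 p - 6, and 10 p - 6 \<le> 14 (p -
  1) for p \<ge> 2. The factor 4 t in the pairing makes the time integral of 4 t exp(-2 r t) equal
  to 1 / r^2. The first-order coefficient is singular at 1 and in general at 0, so the integration
  by parts takes place on [d, 1 - d] times [0, T]. The flux through the ends dies as d tends to 0:
  the weight vanishes at 1, and at 0 the product of each function with its space derivative is O(x).
  The zero-order term in the equation of \<phi>_n' is nonnegative because the density is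
  log-concave, which rests on a comparison of Bessel functions of neighbouring orders.\<close>

definition bell_N :: "real \<Rightarrow> real \<Rightarrow> real \<Rightarrow> real \<Rightarrow> real" where
  "bell_N a e u v = (u\<^sup>2 + e) powr a + (v\<^sup>2 + e)"

text \<open>With \<open>a = p - 1\<close> and \<open>e = 0\<close> the second term is comparable to
  |u|^p where |v|^q \<le> |u|^p and to u^2 |v|^(2 - q) elsewhere: a smooth version of the two-region
  function of Nazarov and Treil. The coefficient 10 \<open>a\<close> of |v|^q is large enough for
  the lower bound 9 / n in \<open>bell_hessian_normal_form\<close>.\<close>

definition bell :: "real \<Rightarrow> real \<Rightarrow> real \<Rightarrow> real \<Rightarrow> real" where
  "bell a e u v = 10 * a * (v\<^sup>2 + e) powr ((a + 1) / (2 * a)) +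
     (u\<^sup>2 + e) * bell_N a e u v powr ((a - 1) / (2 * a))"

text \<open>The digits name the variables of a partial derivative of \<open>bell\<close>. The factor
  \<open>2 * u\<close> stays in front, as does \<open>2 * v\<close> in \<open>bell2\<close>, so that
  \<open>bell_sign\<close> can read off the signs.\<close>

definition bell1 :: "real \<Rightarrow> real \<Rightarrow> real \<Rightarrow> real \<Rightarrow> real" where
  "bell1 a e u v = 2 * u * (bell_N a e u v powr ((a - 1) / (2 * a)) +
     (a - 1) / 2 * (u\<^sup>2 + e) powr a * bell_N a e u v powr ((a - 1) / (2 * a) - 1))"

definition bell2 :: "real \<Rightarrow> real \<Rightarrow> real \<Rightarrow> real \<Rightarrow> real" where
  "bell2 a e u v = 2 * v * (5 * (a + 1) * (v\<^sup>2 + e) powr ((a + 1) / (2 * a) - 1) +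
     (a - 1) / (2 * a) * (u\<^sup>2 + e) * bell_N a e u v powr ((a - 1) / (2 * a) - 1))"

definition bell11 :: "real \<Rightarrow> real \<Rightarrow> real \<Rightarrow> real \<Rightarrow> real" where
  "bell11 a e u v =
     2 * (bell_N a e u v powr ((a - 1) / (2 * a)) +
       (a - 1) / 2 * (u\<^sup>2 + e) powr a * bell_N a e u v powr ((a - 1) / (2 * a) - 1)) +
     4 * u\<^sup>2 * ((a - 1) / 2 * (u\<^sup>2 + e) powr (a - 1) * bell_N a e u v powr ((a - 1) / (2 * a) - 1) +
       (a - 1) / 2 * a * (u\<^sup>2 + e) powr (a - 1) * bell_N a e u v powr ((a - 1) / (2 * a) - 1) +
       (a - 1) / 2 * (u\<^sup>2 + e) powr a * (((a - 1) / (2 * a) - 1) * a * (u\<^sup>2 + e) powr (a - 1) *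
         bell_N a e u v powr ((a - 1) / (2 * a) - 2)))"

definition bell12 :: "real \<Rightarrow> real \<Rightarrow> real \<Rightarrow> real \<Rightarrow> real" where
  "bell12 a e u v = 4 * u * v * ((a - 1) / (2 * a) * bell_N a e u v powr ((a - 1) / (2 * a) - 1) +
     (a - 1) / 2 * ((a - 1) / (2 * a) - 1) * (u\<^sup>2 + e) powr a * bell_N a e u v powr ((a - 1) / (2 * a) - 2))"

definition bell22 :: "real \<Rightarrow> real \<Rightarrow> real \<Rightarrow> real \<Rightarrow> real" where
  "bell22 a e u v =
     2 * (5 * (a + 1) * (v\<^sup>2 + e) powr ((a + 1) / (2 * a) - 1) +
       (a - 1) / (2 * a) * (u\<^sup>2 + e) * bell_N a e u v powr ((a - 1) / (2 * a) - 1)) +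
     4 * v\<^sup>2 * (5 * (a + 1) * ((a + 1) / (2 * a) - 1) * (v\<^sup>2 + e) powr ((a + 1) / (2 * a) - 2) +
       (a - 1) / (2 * a) * (u\<^sup>2 + e) * (((a - 1) / (2 * a) - 1) * bell_N a e u v powr ((a - 1) / (2 * a) - 2)))"

section \<open>Derivatives, signs and size of the Bellman function\<close>

lemma sq_add_pos: "0 < e \<Longrightarrow> 0 < u\<^sup>2 + (e::real)"
  by (simp add: add_nonneg_pos)

lemma bell_N_pos: "0 < e \<Longrightarrow> 0 < bell_N a e u v"
  unfolding bell_N_def by (simp add: add_nonneg_pos sq_add_pos)

lemma has_derivative_bell_N:
  assumes "0 < e" "(f has_real_derivative f') (at t)" "(g has_real_derivative g') (at t)"
  shows "((\<lambda>t. bell_N a e (f t) (g t)) has_real_derivative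
     (a * (f t ^ 2 + e) powr (a - 1) * (2 * f t * f') + 2 * g t * g')) (at t)"
  unfolding bell_N_def using assms sq_add_pos[OF assms(1)]
  by (auto intro!: derivative_eq_intros simp: powr_diff field_simps)

lemma has_derivative_sq_powr:
  assumes "0 < e" "(f has_real_derivative f') (at t)"
  shows "((\<lambda>t. (f t ^ 2 + e) powr a) has_real_derivative (a * (f t ^ 2 + e) powr (a - 1) * (2 * f t * f'))) (at t)"
  using assms sq_add_pos[OF assms(1)]
  by (auto intro!: derivative_eq_intros simp: powr_diff field_simps)

lemma has_derivative_bell_N_powr:
  assumes "0 < e" "(f has_real_derivative f') (at t)" "(g has_real_derivative g') (at t)"
  shows "((\<lambda>t. bell_N a e (f t) (g t) powr b) has_real_derivative
     b * bell_N a e (f t) (g t) powr (b - 1) *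
      (a * (f t ^ 2 + e) powr (a - 1) * (2 * f t * f') + 2 * g t * g')) (at t)"
  using DERIV_fun_powr[OF has_derivative_bell_N[OF assms] bell_N_pos[OF assms(1)]] by simp

text \<open>Stated along a curve (f, g), so that one rule gives the derivatives of
  \<open>bell\<close> at the two extensions both in time and in space.\<close>

lemma has_derivative_bell:
  assumes "0 < e" "1 \<le> a" "(f has_real_derivative f') (at t)" "(g has_real_derivative g') (at t)"
  shows "((\<lambda>t. bell a e (f t) (g t)) has_real_derivative
     bell1 a e (f t) (g t) * f' + bell2 a e (f t) (g t) * g') (at t)"
proof -
  \<comment> \<open>Opaque names for the exponents, and below for the powers, leave only a
    polynomial identity to the simplifier.\<close>
  obtain G c where G: "(a - 1) / (2 * a) = G" and c: "(a + 1) / (2 * a) = c" by blast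
  have Ga: "(a - 1) / 2 = G * a" and ca: "5 * (a + 1) = 10 * a * c"
    using assms(2) unfolding G[symmetric] c[symmetric] by simp_all
  have xx: "(f t ^ 2 + e) powr a = (f t ^ 2 + e) * (f t ^ 2 + e) powr (a - 1)"
    using sq_add_pos[OF assms(1), of "f t"] by (simp add: powr_diff)
  let ?X1 = "(f t ^ 2 + e) powr (a - 1)" let ?x = "f t ^ 2 + e"
  let ?Y1 = "(g t ^ 2 + e) powr (c - 1)"
  let ?N0 = "bell_N a e (f t) (g t) powr G" let ?N1 = "bell_N a e (f t) (g t) powr (G - 1)"
  have "((\<lambda>t. bell a e (f t) (g t)) has_real_derivative
     10 * a * (c * ?Y1 * (2 * g t * g')) +
     (2 * f t * f' * ?N0 + ?x * (G * ?N1 * (a * ?X1 * (2 * f t * f') + 2 * g t * g')))) (at t)"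
    unfolding bell_def G c
    by (rule has_derivative_sq_powr[OF assms(1)]
          has_derivative_bell_N_powr[OF assms(1)] assms(3,4) derivative_eq_intros refl)+
      (simp add: mult_ac)
  moreover have "10 * a * (c * y1 * (2 * g t * g')) +
     (2 * f t * f' * n0 + x * (G * n1 * (a * x1 * (2 * f t * f') + 2 * g t * g'))) =
     2 * f t * (n0 + G * a * (x * x1) * n1) * f' +
     2 * g t * (10 * a * c * y1 + G * x * n1) * g'" for n0 n1 x x1 y1
    by (simp add: algebra_simps)
  ultimately show ?thesis unfolding bell1_def bell2_def G c Ga ca xx by (simp only:)
qed

lemma has_derivative_bell1:
  assumes "0 < e" "1 \<le> a" "(f has_real_derivative f') (at t)" "(g has_real_derivative g') (at t)"
  shows "((\<lambda>t. bell1 a e (f t) (g t)) has_real_derivative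
     bell11 a e (f t) (g t) * f' + bell12 a e (f t) (g t) * g') (at t)"
proof -
  obtain G where G: "(a - 1) / (2 * a) = G" by blast
  have Ga: "(a - 1) / 2 = G * a" using assms(2) unfolding G[symmetric] by simp
  have m: "G - 1 - 1 = G - 2" by simp
  let ?X = "(f t ^ 2 + e) powr a" let ?X1 = "(f t ^ 2 + e) powr (a - 1)"
  let ?N0 = "bell_N a e (f t) (g t) powr G" let ?N1 = "bell_N a e (f t) (g t) powr (G - 1)"
  let ?N2 = "bell_N a e (f t) (g t) powr (G - 2)"
  have "((\<lambda>t. bell1 a e (f t) (g t)) has_real_derivative
     2 * f' * (?N0 + G * a * ?X * ?N1) +
      2 * f t * (G * ?N1 * (a * ?X1 * (2 * f t * f') + 2 * g t * g') +
        G * a * ((a * ?X1 * (2 * f t * f')) * ?N1 +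
          ?X * ((G - 1) * ?N2 * (a * ?X1 * (2 * f t * f') + 2 * g t * g'))))) (at t)"
    unfolding bell1_def G Ga
    apply (rule has_derivative_sq_powr[OF assms(1)]
          has_derivative_bell_N_powr[OF assms(1)] assms(3,4) derivative_eq_intros refl)+
    apply (unfold m)
    apply (simp add: algebra_simps)
    done
  moreover have "2 * f' * (n0 + G * a * x * n1) +
      2 * f t * (G * n1 * (a * x1 * (2 * f t * f') + 2 * g t * g') +
        G * a * ((a * x1 * (2 * f t * f')) * n1 +
          x * ((G - 1) * n2 * (a * x1 * (2 * f t * f') + 2 * g t * g')))) =
     (2 * (n0 + G * a * x * n1) +
     4 * (f t)\<^sup>2 * (G * a * x1 * n1 + G * a * a * x1 * n1 +
       G * a * x * ((G - 1) * a * x1 * n2))) * f' +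
     4 * f t * g t * (G * n1 + G * a * (G - 1) * x * n2) * g'" for n0 n1 n2 x x1
    by (simp add: algebra_simps power2_eq_square)
  ultimately show ?thesis unfolding bell11_def bell12_def G Ga by (simp only:)
qed

lemma has_derivative_bell2:
  assumes "0 < e" "1 \<le> a" "(f has_real_derivative f') (at t)" "(g has_real_derivative g') (at t)"
  shows "((\<lambda>t. bell2 a e (f t) (g t)) has_real_derivative
     bell12 a e (f t) (g t) * f' + bell22 a e (f t) (g t) * g') (at t)"
proof -
  obtain G c where G: "(a - 1) / (2 * a) = G" and c: "(a + 1) / (2 * a) = c" by blast
  have Ga: "(a - 1) / 2 = G * a" using assms(2) unfolding G[symmetric] by simp
  have m: "G - 1 - 1 = G - 2" "c - 1 - 1 = c - 2" by simp_all
  have xx: "(f t ^ 2 + e) powr a = (f t ^ 2 + e) * (f t ^ 2 + e) powr (a - 1)"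
    using sq_add_pos[OF assms(1), of "f t"] by (simp add: powr_diff)
  let ?X1 = "(f t ^ 2 + e) powr (a - 1)" let ?x = "f t ^ 2 + e"
  let ?Y1 = "(g t ^ 2 + e) powr (c - 1)" let ?Y2 = "(g t ^ 2 + e) powr (c - 2)"
  let ?N1 = "bell_N a e (f t) (g t) powr (G - 1)"
  let ?N2 = "bell_N a e (f t) (g t) powr (G - 2)"
  have "((\<lambda>t. bell2 a e (f t) (g t)) has_real_derivative
     2 * g' * (5 * (a + 1) * ?Y1 + G * ?x * ?N1) +
      2 * g t * (5 * (a + 1) * ((c - 1) * ?Y2 * (2 * g t * g')) +
        G * (2 * f t * f' * ?N1 + ?x * ((G - 1) * ?N2 * (a * ?X1 * (2 * f t * f') + 2 * g t * g'))))) (at t)"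
    unfolding bell2_def G c
    apply (rule has_derivative_sq_powr[OF assms(1)]
          has_derivative_bell_N_powr[OF assms(1)] assms(3,4) derivative_eq_intros refl)+
    apply (unfold m)
    apply (simp add: algebra_simps)
    done
  moreover have "2 * g' * (5 * (a + 1) * y1 + G * x * n1) +
      2 * g t * (5 * (a + 1) * ((c - 1) * y2 * (2 * g t * g')) +
        G * (2 * f t * f' * n1 + x * ((G - 1) * n2 * (a * x1 * (2 * f t * f') + 2 * g t * g')))) =
    4 * f t * g t * (G * n1 + G * a * (G - 1) * (x * x1) * n2) * f' +
    (2 * (5 * (a + 1) * y1 + G * x * n1) +
     4 * (g t)\<^sup>2 * (5 * (a + 1) * (c - 1) * y2 + G * x * ((G - 1) * n2))) * g'" for y1 y2 x x1 n1 n2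
    by (simp add: algebra_simps power2_eq_square)
  ultimately show ?thesis unfolding bell12_def bell22_def G c Ga xx by (simp only:)
qed

lemma continuous_on_bell:
  assumes "0 < e" "continuous_on S f" "continuous_on S g"
  shows "continuous_on S (\<lambda>x. bell a e (f x) (g x))"
    "continuous_on S (\<lambda>x. bell1 a e (f x) (g x))"
    "continuous_on S (\<lambda>x. bell2 a e (f x) (g x))"
    "continuous_on S (\<lambda>x. bell11 a e (f x) (g x))"
    "continuous_on S (\<lambda>x. bell12 a e (f x) (g x))"
    "continuous_on S (\<lambda>x. bell22 a e (f x) (g x))"
proof -
  note [simp] = less_imp_neq[OF sq_add_pos[OF assms(1)], symmetric]
  have N: "continuous_on S (\<lambda>x. bell_N a e (f x) (g x))"
    unfolding bell_N_def by (intro continuous_intros assms) auto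
  have Np: "continuous_on S (\<lambda>x. bell_N a e (f x) (g x) powr b)" for b
    using less_imp_neq[OF bell_N_pos[OF assms(1)], symmetric]
    by (intro continuous_on_powr N continuous_on_const) auto
  have Xp: "continuous_on S (\<lambda>x. ((f x)\<^sup>2 + e) powr b)" for b
    by (intro continuous_intros assms) auto
  have Yp: "continuous_on S (\<lambda>x. ((g x)\<^sup>2 + e) powr b)" for b
    by (intro continuous_intros assms) auto
  note i = continuous_on_add continuous_on_mult continuous_on_const continuous_on_power Np Xp Yp assms(2,3)
  show "continuous_on S (\<lambda>x. bell a e (f x) (g x))"
    unfolding bell_def by (intro i)
  show "continuous_on S (\<lambda>x. bell1 a e (f x) (g x))"
    unfolding bell1_def by (intro i)
  show "continuous_on S (\<lambda>x. bell2 a e (f x) (g x))"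
    unfolding bell2_def by (intro i)
  show "continuous_on S (\<lambda>x. bell11 a e (f x) (g x))"
    unfolding bell11_def by (intro i)
  show "continuous_on S (\<lambda>x. bell12 a e (f x) (g x))"
    unfolding bell12_def by (intro i)
  show "continuous_on S (\<lambda>x. bell22 a e (f x) (g x))"
    unfolding bell22_def by (intro i)
qed

text \<open>In \<open>box_inequality\<close> the zero-order terms contribute k1 V
  \<open>bell1\<close> and k2 W \<open>bell2\<close>; these signs make the contributions
  nonnegative.\<close>

lemma bell_sign:
  assumes "0 < e" "1 \<le> a"
  shows "0 \<le> bell a e u v" "0 \<le> bell1 a e u v * u" "0 \<le> bell2 a e u v * v"
proof -
  note [simp] = less_imp_le[OF sq_add_pos[OF assms(1)]]
  show "0 \<le> bell a e u v" unfolding bell_def using assms by auto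
  have "bell1 a e u v * u = 2 * u\<^sup>2 * (bell_N a e u v powr ((a - 1) / (2 * a)) +
     (a - 1) / 2 * (u\<^sup>2 + e) powr a * bell_N a e u v powr ((a - 1) / (2 * a) - 1))"
    by (simp add: bell1_def power2_eq_square)
  also have "\<dots> \<ge> 0" using assms by (intro mult_nonneg_nonneg add_nonneg_nonneg) auto
  finally show "0 \<le> bell1 a e u v * u" .
  have "bell2 a e u v * v = 2 * v\<^sup>2 * (5 * (a + 1) * (v\<^sup>2 + e) powr ((a + 1) / (2 * a) - 1) +
     (a - 1) / (2 * a) * (u\<^sup>2 + e) * bell_N a e u v powr ((a - 1) / (2 * a) - 1))"
    by (simp add: bell2_def power2_eq_square)
  also have "\<dots> \<ge> 0" using assms by (intro mult_nonneg_nonneg add_nonneg_nonneg) auto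
  finally show "0 \<le> bell2 a e u v * v" .
qed

text \<open>\<open>bell_N\<close> is at most twice its larger summand, and its exponent is at most
  1. For \<open>a = p - 1\<close> the two powers are |v|^q and |u|^p up to \<open>e\<close>.\<close>

lemma bell_le:
  assumes "0 < e" "1 \<le> a"
  shows "bell a e u v \<le> (10 * a + 2) * (v\<^sup>2 + e) powr ((a + 1) / (2 * a)) + 2 * (u\<^sup>2 + e) powr ((a + 1) / 2)"
proof -
  define x y where "x = u\<^sup>2 + e" and "y = v\<^sup>2 + e"
  define g where "g = (a - 1) / (2 * a)"
  have pos: "0 < x" "0 < y" using sq_add_pos[OF assms(1)] by (auto simp: x_def y_def)
  have g: "0 \<le> g" "g \<le> 1" "1 + a * g = (a + 1) / 2" "1 / a + g = (a + 1) / (2 * a)"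
    using assms by (auto simp: g_def field_simps)
  have "x * (x powr a + y) powr g \<le> 2 * (x powr ((a + 1) / 2) + y powr ((a + 1) / (2 * a)))"
  proof (cases "y \<le> x powr a")
    case True
    have "(x powr a + y) powr g \<le> (2 * x powr a) powr g" using True pos g by (intro powr_mono2) auto
    also have "\<dots> = 2 powr g * x powr (a * g)" using pos by (simp add: powr_mult powr_powr)
    also have "\<dots> \<le> 2 * x powr (a * g)" using g powr_mono[of g 1 2] by (intro mult_right_mono) auto
    finally have "x * (x powr a + y) powr g \<le> x * (2 * x powr (a * g))"
      using pos by (intro mult_left_mono) auto
    also have "\<dots> = 2 * x powr ((a + 1) / 2)" using pos unfolding g(3)[symmetric] by (simp add: powr_add)
    finally show ?thesis by (simp add: add_increasing2)
  next
    case False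
    have "(x powr a + y) powr g \<le> (2 * y) powr g" using False pos g by (intro powr_mono2) auto
    also have "\<dots> = 2 powr g * y powr g" using pos by (simp add: powr_mult)
    also have "\<dots> \<le> 2 * y powr g" using g powr_mono[of g 1 2] by (intro mult_right_mono) auto
    finally have 1: "(x powr a + y) powr g \<le> 2 * y powr g" .
    have "x = (x powr a) powr (1 / a)" using pos assms by (simp add: powr_powr)
    also have "\<dots> \<le> y powr (1 / a)" using False pos assms by (intro powr_mono2) auto
    finally have "x * (x powr a + y) powr g \<le> y powr (1 / a) * (2 * y powr g)"
      using 1 by (intro mult_mono) auto
    also have "\<dots> = 2 * y powr ((a + 1) / (2 * a))" unfolding g(4)[symmetric] by (simp add: powr_add)
    finally show ?thesis by (simp add: add_increasing)
  qed
  then show ?thesis unfolding bell_def bell_N_def x_def[symmetric] y_def[symmetric] g_def[symmetric]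
    by (simp add: algebra_simps)
qed

text \<open>In terms of \<open>\<theta> = (u\<^sup>2 + e) powr a / N\<close> and \<open>r = u\<^sup>2 / (u\<^sup>2 + e)\<close>, both in \<open>[0, 1]\<close>, the Hessian entries
  become polynomials in \<open>\<theta>\<close> and \<open>r\<close> up to powers of \<open>N\<close>.\<close>

lemma bell_hessian_normal_form:
  assumes e: "0 < e" and a: "1 \<le> a"
  obtains n r \<theta> where "0 < n" "0 \<le> r" "r \<le> 1" "0 \<le> \<theta>" "\<theta> \<le> 1"
    "bell11 a e u v = n * (2 + (a - 1) * \<theta> + (a - 1) * r * \<theta> * ((a + 1) * (2 - \<theta>)))"
    "(bell12 a e u v)\<^sup>2 \<le> 4 * ((a - 1) / a)\<^sup>2 * r * (1 - (a + 1) / 2 * \<theta>)\<^sup>2"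
    "9 / n \<le> bell22 a e u v"
proof -
  define x y N where "x = u\<^sup>2 + e" and "y = v\<^sup>2 + e" and "N = bell_N a e u v"
  define g where "g = (a - 1) / (2 * a)"
  define n \<theta> r where "n = N powr g" and "\<theta> = x powr a / N" and "r = u\<^sup>2 / x"
  have pos: "0 < x" "0 < y" "0 < N" using sq_add_pos[OF e] bell_N_pos[OF e] by (auto simp: x_def y_def N_def)
  have N: "N = x powr a + y" by (simp add: N_def bell_N_def x_def y_def)
  have n: "0 < n" using pos by (simp add: n_def)
  have r: "0 \<le> r" "r \<le> 1" using pos e by (auto simp: r_def x_def)
  have th: "0 \<le> \<theta>" "\<theta> \<le> 1" using pos by (auto simp: \<theta>_def N)
  have g: "0 \<le> g" "g \<le> 1/2" "g * a = (a - 1) / 2" "(a + 1) / (2 * a) = 1 - g" "2 * g - 1 = - 1 / a" "2 * g * a = a - 1"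
    using a by (auto simp: g_def field_simps)
  have N1: "N powr (g - 1) = n / N" and N2: "N powr (g - 2) = n / N / N"
    using pos by (simp_all add: n_def powr_diff powr_numeral power2_eq_square)
  have X: "x powr a = \<theta> * N" using pos by (simp add: \<theta>_def)
  have X1: "x powr (a - 1) = \<theta> * N / x" using pos X by (simp add: powr_diff)
  have u2: "u\<^sup>2 = r * x" using pos by (simp add: r_def)
  \<comment> \<open>The scales balance: \<open>x\<close> is at most \<open>N powr (1 / a)\<close>,
    and \<open>n\<close> is the power of \<open>N\<close> with
    \<open>n\<^sup>2 / N = N powr (- 1 / a)\<close>.\<close>
  have xN: "x * n\<^sup>2 / N \<le> 1"
  proof -
    have "x = (x powr a) powr (1 / a)" using pos a by (simp add: powr_powr)
    also have "\<dots> \<le> N powr (1 / a)" using pos a by (intro powr_mono2) (auto simp: N)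
    finally have "x \<le> N powr (1 / a)" .
    moreover have "n\<^sup>2 / N = N powr (- 1 / a)"
    proof -
      have "n\<^sup>2 = N powr (2 * g)" using pos by (simp add: n_def power2_eq_square powr_add[symmetric])
      then show ?thesis using pos unfolding g(5)[symmetric] by (simp add: powr_diff)
    qed
    ultimately have "x * (n\<^sup>2 / N) \<le> N powr (1 / a) * N powr (- 1 / a)" by (simp add: mult_right_mono)
    also have "\<dots> = 1" using pos by (simp add: powr_add[symmetric])
    finally show ?thesis by simp
  qed
  have h11: "bell11 a e u v = n * (2 + (a - 1) * \<theta> + (a - 1) * r * \<theta> * ((a + 1) * (2 - \<theta>)))"
  proof -
    have "bell11 a e u v = 2 * (n + (a - 1) / 2 * (\<theta> * N) * (n / N)) +
     4 * (r * x) * ((a - 1) / 2 * (\<theta> * N / x) * (n / N) + (a - 1) / 2 * a * (\<theta> * N / x) * (n / N) +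
       (a - 1) / 2 * (\<theta> * N) * ((g - 1) * a * (\<theta> * N / x) * (n / N / N)))"
      unfolding bell11_def N_def[symmetric] x_def[symmetric] g_def[symmetric] N1 N2 X X1 n_def[symmetric] unfolding u2 ..
    also have "\<dots> = 2 * (n + (a - 1) / 2 * \<theta> * n) +
     4 * r * ((a - 1) / 2 * \<theta> * n + (a - 1) / 2 * a * \<theta> * n + (a - 1) / 2 * \<theta> * ((g * a - a) * \<theta> * n))"
      using pos by (simp add: field_simps)
    also have "\<dots> = n * (2 + (a - 1) * \<theta> + (a - 1) * r * \<theta> * ((a + 1) * (2 - \<theta>)))"
      unfolding g(3) by (simp add: field_simps)
    finally show ?thesis .
  qed
  have h12: "(bell12 a e u v)\<^sup>2 \<le> 4 * ((a - 1) / a)\<^sup>2 * r * (1 - (a + 1) / 2 * \<theta>)\<^sup>2"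
  proof -
    have "bell12 a e u v = 4 * u * v * (g * (n / N) + (a - 1) / 2 * (g - 1) * (\<theta> * N) * (n / N / N))"
      unfolding bell12_def N_def[symmetric] x_def[symmetric] g_def[symmetric] N1 N2 X ..
    also have "\<dots> = 4 * u * v * (g * (n / N) + (g * a) * (g - 1) * \<theta> * (n / N))"
      using pos by (simp add: g(3))
    also have "\<dots> = 4 * u * v * (n / N) * g * (1 + (g * a - a) * \<theta>)" by (simp add: algebra_simps diff_divide_distrib add_divide_distrib)
    also have "\<dots> = 4 * u * v * (n / N) * g * (1 - (a + 1) / 2 * \<theta>)" unfolding g(3) by (simp add: field_simps)
    finally have "(bell12 a e u v)\<^sup>2 = 16 * g\<^sup>2 * u\<^sup>2 * (1 - (a + 1) / 2 * \<theta>)\<^sup>2 * (v\<^sup>2 / N) * (n\<^sup>2 / N)"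
      by (simp add: power_mult_distrib power_divide power2_eq_square)
    also have "\<dots> = (16 * g\<^sup>2 * r * (1 - (a + 1) / 2 * \<theta>)\<^sup>2) * ((v\<^sup>2 / N) * (x * n\<^sup>2 / N))"
      by (simp add: u2)
    also have "\<dots> \<le> (16 * g\<^sup>2 * r * (1 - (a + 1) / 2 * \<theta>)\<^sup>2) * 1"
    proof (intro mult_left_mono)
      have "v\<^sup>2 / N \<le> 1" using pos e by (simp add: N y_def)
      then show "v\<^sup>2 / N * (x * n\<^sup>2 / N) \<le> 1" using xN pos by (intro mult_le_one) auto
    qed (use r in auto)
    also have "\<dots> = 4 * ((a - 1) / a)\<^sup>2 * r * (1 - (a + 1) / 2 * \<theta>)\<^sup>2"
      by (simp add: g_def power_divide power_mult_distrib)
    finally show ?thesis .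
  qed
  have h22: "9 / n \<le> bell22 a e u v"
  proof -
    have Y1: "y powr (1 - g - 1) = y powr (- g)" "y powr (1 - g - 2) = y powr (- g) / y"
      using pos by (simp_all add: powr_diff powr_numeral power2_eq_square powr_minus field_simps)
    have "bell22 a e u v = 2 * (5 * (a + 1) * y powr (- g) + g * x * (n / N)) +
        4 * v\<^sup>2 * (5 * (a + 1) * (- g) * (y powr (- g) / y) + g * x * ((g - 1) * (n / N / N)))"
      unfolding bell22_def N_def[symmetric] x_def[symmetric] y_def[symmetric] g(4) Y1 g_def[symmetric] N1 N2 by simp
    also have "\<dots> = 10 * (a + 1) * y powr (- g) * (1 - 2 * g * (v\<^sup>2 / y)) + 2 * g * x * (n / N) * (1 - 2 * (1 - g) * (v\<^sup>2 / N))"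
      using pos by (simp add: field_simps)
    \<comment> \<open>The power of \<open>v\<close> yields 10 / n, because
      \<open>2 * g = 1 - 1 / a\<close> keeps the bracket above 1 / a and
      \<open>a + 1 \<ge> a\<close>; the other term costs at most 1 / n.\<close>
    also have "\<dots> \<ge> 10 / n - 1 / n"
    proof -
      have "v\<^sup>2 / y \<le> 1" using pos e by (simp add: y_def)
      then have "2 * g * (v\<^sup>2 / y) \<le> 2 * g * 1" using g by (intro mult_left_mono) auto
      then have 1: "1 / a \<le> 1 - 2 * g * (v\<^sup>2 / y)" using g(5) by simp
      have "1 / n = N powr (- g)" by (simp add: n_def powr_minus_divide)
      also have "\<dots> \<le> y powr (- g)" using pos g by (intro powr_mono2') (auto simp: N)
      finally have 2: "1 / n \<le> y powr (- g)" .
      have "10 / n \<le> 10 * ((a + 1) * (1 / a)) * (1 / n)" using a n by (simp add: field_simps)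
      also have "\<dots> = 10 * (a + 1) * (1 / n) * (1 / a)" by simp
      also have "\<dots> \<le> 10 * (a + 1) * y powr (- g) * (1 - 2 * g * (v\<^sup>2 / y))"
        using 1 2 a n by (intro mult_mono mult_nonneg_nonneg) auto
      finally have A: "10 / n \<le> 10 * (a + 1) * y powr (- g) * (1 - 2 * g * (v\<^sup>2 / y))" .
      have "v\<^sup>2 / N \<le> 1" using pos e by (simp add: N y_def)
      then have "2 * (1 - g) * (v\<^sup>2 / N) \<le> 2 * 1 * 1" using g pos by (intro mult_mono) auto
      then have "- 1 \<le> 1 - 2 * (1 - g) * (v\<^sup>2 / N)" by simp
      then have "2 * g * x * (n / N) * (- 1) \<le> 2 * g * x * (n / N) * (1 - 2 * (1 - g) * (v\<^sup>2 / N))"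
        using pos g n by (intro mult_left_mono) auto
      moreover have "2 * g * x * (n / N) \<le> 1 / n"
      proof -
        have "2 * g * x * (n / N) = (2 * g) * (x * n\<^sup>2 / N) * (1 / n)" using n by (simp add: power2_eq_square)
        also have "\<dots> \<le> 1 * 1 * (1 / n)" using g xN pos n by (intro mult_mono) auto
        finally show ?thesis by simp
      qed
      ultimately show ?thesis using A by linarith
    qed
    finally show ?thesis by simp
  qed
  show ?thesis by (rule that[OF n r th h11 h12 h22])
qed

text \<open>\<alpha> and \<alpha>' are the space and time derivatives of the first extension,
  \<beta> and \<beta>' the time and space derivatives of the second, hence the crossed mixed term.
  By the normal form it is enough that (2 + D)^2 \<le> 9 A, where D is the modulus of
  \<open>bell12\<close> and n A is \<open>bell11\<close>.\<close>

lemma bell_hessian: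
  assumes e: "0 < e" and a: "1 \<le> a"
  shows "4 * \<bar>\<alpha> * \<beta>\<bar> \<le> bell11 a e u v * (\<alpha>\<^sup>2 + \<alpha>'\<^sup>2) + 2 * bell12 a e u v * (\<alpha> * \<beta>' + \<alpha>' * \<beta>) + bell22 a e u v * (\<beta>\<^sup>2 + \<beta>'\<^sup>2)"
proof -
  obtain n r \<theta> :: real where n: "0 < n" and r: "0 \<le> r" "r \<le> 1" and th: "0 \<le> \<theta>" "\<theta> \<le> 1"
    and h11: "bell11 a e u v = n * (2 + (a - 1) * \<theta> + (a - 1) * r * \<theta> * ((a + 1) * (2 - \<theta>)))"
    and h12: "(bell12 a e u v)\<^sup>2 \<le> 4 * ((a - 1) / a)\<^sup>2 * r * (1 - (a + 1) / 2 * \<theta>)\<^sup>2"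
    and h22: "9 / n \<le> bell22 a e u v"
    using bell_hessian_normal_form[OF assms] by metis
  define A where "A = 2 + (a - 1) * \<theta> + (a - 1) * r * \<theta> * ((a + 1) * (2 - \<theta>))"
  define D where "D = \<bar>bell12 a e u v\<bar>"
  have q: "0 \<le> (a - 1) * r * \<theta> * ((a + 1) * (2 - \<theta>))" "0 \<le> (a - 1) * \<theta>" using a r th by auto
  have A2: "2 \<le> A" using q unfolding A_def by linarith
  have aa: "0 \<le> (a - 1) / a" "(a - 1) / a \<le> 1" using a by auto
  have "8 + 2 * D\<^sup>2 \<le> 9 * A"
  \<comment> \<open>In the first case D^2 \<le> 4, and A \<ge> 2 suffices. In the second, D^2 is
    absorbed by the last summand of \<open>A\<close>, because \<theta> \<le> 2 - \<theta>.\<close>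
  proof (cases "(a + 1) / 2 * \<theta> \<le> 2")
    case True
    have "(1 - (a + 1) / 2 * \<theta>)\<^sup>2 \<le> 1" using True a th by (subst abs_square_le_1) (auto simp: abs_le_iff)
    then have "4 * ((a - 1) / a)\<^sup>2 * r * (1 - (a + 1) / 2 * \<theta>)\<^sup>2 \<le> 4 * 1 * 1 * 1"
      using aa r by (intro mult_mono) (auto simp: power_le_one)
    then show ?thesis using h12 A2 by (simp add: D_def)
  next
    case False
    have "(1 - (a + 1) / 2 * \<theta>)\<^sup>2 = ((a + 1) / 2 * \<theta> - 1)\<^sup>2" by (simp add: power2_commute)
    also have "\<dots> \<le> ((a + 1) / 2 * \<theta>)\<^sup>2" using False by (intro power_mono) auto
    finally have s: "(1 - (a + 1) / 2 * \<theta>)\<^sup>2 \<le> ((a + 1) / 2 * \<theta>)\<^sup>2" .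
    have "2 * D\<^sup>2 \<le> 2 * (4 * ((a - 1) / a)\<^sup>2 * r * (1 - (a + 1) / 2 * \<theta>)\<^sup>2)" using h12 unfolding D_def power2_abs by linarith
    also have "\<dots> \<le> 2 * (4 * ((a - 1) / a) * r * ((a + 1) / 2 * \<theta>)\<^sup>2)"
    proof (intro mult_left_mono mult_mono s)
      show "((a - 1) / a)\<^sup>2 \<le> (a - 1) / a" using mult_right_mono[OF aa(2,1)] by (simp add: power2_eq_square)
    qed (use r aa a in auto)
    also have "\<dots> = ((a + 1) / a) * (2 * ((a - 1) * r * \<theta> * ((a + 1) * \<theta>)))"
      using a by (simp add: power2_eq_square divide_simps)
    also have "\<dots> \<le> 2 * (2 * ((a - 1) * r * \<theta> * ((a + 1) * \<theta>)))"
    proof (intro mult_right_mono)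
      show "(a + 1) / a \<le> 2" using a by (simp add: field_simps)
    qed (use a r th in \<open>auto intro!: mult_nonneg_nonneg\<close>)
    also have "\<dots> \<le> 9 * ((a - 1) * r * \<theta> * ((a + 1) * \<theta>))"
      using mult_nonneg_nonneg[of "(a - 1) * r * \<theta>" "(a + 1) * \<theta>"] a r th by simp
    also have "\<dots> \<le> 9 * ((a - 1) * r * \<theta> * ((a + 1) * (2 - \<theta>)))"
      using a r th by (intro mult_left_mono) auto
    finally show ?thesis using q unfolding A_def by (simp add: algebra_simps)
  qed
  moreover have "(2 + D)\<^sup>2 \<le> 8 + 2 * D\<^sup>2"
    using zero_le_power2[of "D - 2"] by (simp add: power2_eq_square algebra_simps)
  ultimately have AD: "(2 + D)\<^sup>2 \<le> 9 * A" by linarith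
  have D0: "0 \<le> D" by (simp add: D_def)
  define s \<tau> where "s = sqrt (\<alpha>\<^sup>2 + \<alpha>'\<^sup>2)" and "\<tau> = sqrt (\<beta>\<^sup>2 + \<beta>'\<^sup>2)"
  have st: "0 \<le> s" "0 \<le> \<tau>" "s\<^sup>2 = \<alpha>\<^sup>2 + \<alpha>'\<^sup>2" "\<tau>\<^sup>2 = \<beta>\<^sup>2 + \<beta>'\<^sup>2" by (simp_all add: s_def \<tau>_def)
  have "(\<alpha> * \<beta>' + \<alpha>' * \<beta>)\<^sup>2 \<le> (s * \<tau>)\<^sup>2"
    unfolding power_mult_distrib st using zero_le_power2[of "\<alpha> * \<beta> - \<alpha>' * \<beta>'"]
    by (simp add: power2_eq_square algebra_simps)
  then have c1: "\<bar>\<alpha> * \<beta>' + \<alpha>' * \<beta>\<bar> \<le> s * \<tau>" using st by (simp add: abs_le_square_iff[symmetric])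
  have "\<bar>\<alpha>\<bar> \<le> s" "\<bar>\<beta>\<bar> \<le> \<tau>" unfolding s_def \<tau>_def by (simp_all add: real_le_rsqrt)
  then have c2: "\<bar>\<alpha> * \<beta>\<bar> \<le> s * \<tau>" using st by (simp add: abs_mult mult_mono)
  have "4 * \<bar>\<alpha> * \<beta>\<bar> + 2 * D * (s * \<tau>) \<le> 2 * (2 + D) * (s * \<tau>)" using c2 by (simp add: algebra_simps)
  also have "\<dots> \<le> n * A * s\<^sup>2 + 9 / n * \<tau>\<^sup>2"
  proof -
    have "(2 + D) \<le> 3 * sqrt A"
      using AD D0 A2 real_le_rsqrt[OF AD] by (simp add: real_sqrt_mult)
    then have "2 * (2 + D) * (s * \<tau>) \<le> 2 * (3 * sqrt A) * (s * \<tau>)"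
      using st by (intro mult_right_mono mult_left_mono) auto
    also have "\<dots> = 2 * (sqrt (n * A) * s) * (3 / sqrt n * \<tau>)" using n by (simp add: real_sqrt_mult)
    also have "\<dots> \<le> (sqrt (n * A) * s)\<^sup>2 + (3 / sqrt n * \<tau>)\<^sup>2" by (rule sum_squares_bound)
    also have "\<dots> = n * A * s\<^sup>2 + 9 / n * \<tau>\<^sup>2" using n A2 by (simp add: power_mult_distrib power_divide)
    finally show ?thesis .
  qed
  also have "\<dots> \<le> bell11 a e u v * s\<^sup>2 + bell22 a e u v * \<tau>\<^sup>2"
    unfolding h11 A_def[symmetric] using h22 A2 by (intro add_mono mult_right_mono) auto
  finally have "4 * \<bar>\<alpha> * \<beta>\<bar> + 2 * D * (s * \<tau>) \<le> bell11 a e u v * s\<^sup>2 + bell22 a e u v * \<tau>\<^sup>2" .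
  moreover have "\<bar>bell12 a e u v * (\<alpha> * \<beta>' + \<alpha>' * \<beta>)\<bar> \<le> D * (s * \<tau>)"
    unfolding abs_mult D_def using c1 by (intro mult_left_mono) auto
  ultimately show ?thesis unfolding st(3,4) by linarith
qed

section \<open>Lebesgue spaces\<close>

lemma Lp_measurable [measurable_dest]: "f \<in> Lp p M \<Longrightarrow> f \<in> borel_measurable M"
  by (simp add: Lp_def)

lemma Lp_integrable: "f \<in> Lp p M \<Longrightarrow> integrable M (\<lambda>x. cmod (f x) powr p)"
  by (simp add: Lp_def)

lemma Lp_I: "f \<in> borel_measurable M \<Longrightarrow> integrable M (\<lambda>x. cmod (f x) powr p) \<Longrightarrow> f \<in> Lp p M"
  by (simp add: Lp_def)

lemma Lp_norm_nonneg [simp]: "0 \<le> Lp_norm p M f"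
  by (simp add: Lp_norm_def)

lemma Lp_norm_powr: "0 < p \<Longrightarrow> Lp_norm p M f powr p = (LINT x|M. cmod (f x) powr p)"
  by (simp add: Lp_norm_def powr_powr integral_nonneg)

lemma powr_le_imp_le: "x powr a \<le> y powr a \<Longrightarrow> 0 < a \<Longrightarrow> 0 \<le> y \<Longrightarrow> x \<le> (y::real)"
  by (metis not_less powr_less_mono2)

lemma Lp_zero [simp]: "0 < p \<Longrightarrow> (\<lambda>x. 0) \<in> Lp p M"
  by (simp add: Lp_def)

lemma Lp_norm_zero [simp]: "0 < p \<Longrightarrow> Lp_norm p M (\<lambda>x. 0) = 0"
  by (simp add: Lp_norm_def)

lemma Lp_cong_AE:
  assumes "f \<in> Lp p M" "g \<in> borel_measurable M" "AE x in M. f x = g x"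
  shows "g \<in> Lp p M"
proof (rule Lp_I)
  show "integrable M (\<lambda>x. cmod (g x) powr p)"
    by (rule integrable_cong_AE_imp[OF Lp_integrable[OF assms(1)]]) (use assms in auto)
qed fact

lemma Lp_norm_cong_AE:
  assumes "f \<in> borel_measurable M" "g \<in> borel_measurable M" "AE x in M. f x = g x"
  shows "Lp_norm p M f = Lp_norm p M g"
  unfolding Lp_norm_def using assms by (intro arg_cong[where f="\<lambda>z. z powr _"] integral_cong_AE) auto

lemma Lp_cmult: "f \<in> Lp p M \<Longrightarrow> (\<lambda>x. c * f x) \<in> Lp p M"
  by (auto simp: Lp_def norm_mult powr_mult)

lemma Lp_norm_cmult: "0 < p \<Longrightarrow> Lp_norm p M (\<lambda>x. c * f x) = cmod c * Lp_norm p M f"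
  by (simp add: Lp_norm_def norm_mult powr_mult powr_powr integral_nonneg)

lemma add_powr_le:
  fixes s t :: real
  assumes "0 \<le> s" "0 \<le> t" "0 < p"
  shows "(s + t) powr p \<le> 2 powr p * (s powr p + t powr p)"
proof -
  have "(s + t) powr p \<le> (2 * max s t) powr p" using assms by (intro powr_mono2) auto
  also have "\<dots> = 2 powr p * max s t powr p" by (simp add: powr_mult)
  also have "\<dots> \<le> 2 powr p * (s powr p + t powr p)" by (intro mult_left_mono) (auto simp: max_def)
  finally show ?thesis .
qed

lemma Lp_add:
  assumes "f \<in> Lp p M" "g \<in> Lp p M" "0 < p"
  shows "(\<lambda>x. f x + g x) \<in> Lp p M"
proof (rule Lp_I)
  have [measurable]: "f \<in> borel_measurable M" "g \<in> borel_measurable M" using assms Lp_measurable by auto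
  show "(\<lambda>x. f x + g x) \<in> borel_measurable M" by simp
  show "integrable M (\<lambda>x. cmod (f x + g x) powr p)"
  proof (rule Bochner_Integration.integrable_bound)
    show "integrable M (\<lambda>x. 2 powr p * (cmod (f x) powr p + cmod (g x) powr p))"
      using Lp_integrable[OF assms(1)] Lp_integrable[OF assms(2)] by simp
    have "cmod (f x + g x) powr p \<le> 2 powr p * (cmod (f x) powr p + cmod (g x) powr p)" for x
      using powr_mono2[of p "cmod (f x + g x)" "cmod (f x) + cmod (g x)"] add_powr_le[of "cmod (f x)" "cmod (g x)" p]
        norm_triangle_ineq[of "f x" "g x"] assms(3) by auto
    then show "AE x in M. norm (cmod (f x + g x) powr p) \<le> norm (2 powr p * (cmod (f x) powr p + cmod (g x) powr p))"
      by simp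
  qed simp
qed

lemma Lp_diff:
  assumes "f \<in> Lp p M" "g \<in> Lp p M" "0 < p"
  shows "(\<lambda>x. f x - g x) \<in> Lp p M"
  using Lp_add[OF assms(1) Lp_cmult[OF assms(2), of "-1"] assms(3)] by simp

lemma Lp_norm_minus_commute: "Lp_norm p M (\<lambda>x. f x - g x) = Lp_norm p M (\<lambda>x. g x - f x)"
  by (simp add: Lp_norm_def norm_minus_commute)

lemma Lp_norm_eq_0_iff:
  assumes "f \<in> Lp p M" "0 < p"
  shows "Lp_norm p M f = 0 \<longleftrightarrow> (AE x in M. f x = 0)"
proof -
  have "Lp_norm p M f = 0 \<longleftrightarrow> (LINT x|M. cmod (f x) powr p) = 0" by (simp add: Lp_norm_def)
  also have "\<dots> \<longleftrightarrow> (AE x in M. cmod (f x) powr p = 0)"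
    using Lp_integrable[OF assms(1)] by (intro integral_nonneg_eq_0_iff_AE) auto
  also have "\<dots> \<longleftrightarrow> (AE x in M. f x = 0)" by simp
  finally show ?thesis .
qed

text \<open>Convexity of the power at s / A and t / B with the weights A / (A + B) and B / (A + B).
  For A and B the norms of two functions, its integral is the triangle inequality.\<close>

lemma add_powr_convex:
  fixes s t A B p :: real
  assumes "0 \<le> s" "0 \<le> t" "0 < A" "0 < B" "1 \<le> p"
  shows "(s + t) powr p \<le> (A + B) powr p * (A / (A + B) * (s powr p / A powr p) + B / (A + B) * (t powr p / B powr p))"
proof -
  have conv: "(\<mu> * x + (1 - \<mu>) * y) powr p \<le> \<mu> * x powr p + (1 - \<mu>) * y powr p"
    if "0 \<le> x" "0 \<le> y" "0 < \<mu>" "\<mu> < 1" for \<mu> x y :: real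
  proof -
    \<comment> \<open>Where one of the two arguments is 0, convexity reduces to z powr p \<le> z for
      0 < z < 1.\<close>
    have one: "(z * x) powr p \<le> z * x powr p" if "0 < z" "z < 1" "0 \<le> x" for z x :: real
      using that powr_mono'[of 1 p z] assms(5) by (simp add: powr_mult mult_right_mono)
    show ?thesis
    proof (cases "x = 0 \<or> y = 0")
      case True then show ?thesis using one[of \<mu> x] one[of "1 - \<mu>" y] that by auto
    next
      case False
      then show ?thesis using powr_convex[OF assms(5)] that
        by (simp add: convex_on_def)
    qed
  qed
  have l: "A / (A + B) < 1" "0 < A / (A + B)" "1 - A / (A + B) = B / (A + B)" using assms by (auto simp: field_simps)
  have "(A / (A + B)) * (s / A) + (B / (A + B)) * (t / B) = (s + t) / (A + B)"
    using assms by (simp add: add_divide_distrib)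
  moreover have "((A / (A + B)) * (s / A) + (B / (A + B)) * (t / B)) powr p
      \<le> A / (A + B) * (s / A) powr p + B / (A + B) * (t / B) powr p"
    using conv[of "s / A" "t / B" "A / (A + B)"] l assms by simp
  ultimately have "((s + t) / (A + B)) powr p \<le> A / (A + B) * (s powr p / A powr p) + B / (A + B) * (t powr p / B powr p)"
    using assms by (simp add: powr_divide)
  then have "(A + B) powr p * ((s + t) / (A + B)) powr p
      \<le> (A + B) powr p * (A / (A + B) * (s powr p / A powr p) + B / (A + B) * (t powr p / B powr p))"
    by (intro mult_left_mono) auto
  then show ?thesis using assms by (simp add: powr_mult[symmetric])
qed

lemma Lp_minkowski:
  assumes f: "f \<in> Lp p M" and g: "g \<in> Lp p M" and p: "1 \<le> p"
  shows "Lp_norm p M (\<lambda>x. f x + g x) \<le> Lp_norm p M f + Lp_norm p M g"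
proof -
  define A B where "A = Lp_norm p M f" and "B = Lp_norm p M g"
  have [measurable]: "f \<in> borel_measurable M" "g \<in> borel_measurable M" using assms Lp_measurable by auto
  consider "A = 0" | "B = 0" | "0 < A" "0 < B" using Lp_norm_nonneg unfolding A_def B_def by (metis less_eq_real_def)
  then show ?thesis
  proof cases
    case 1
    then have "AE x in M. f x = 0" using Lp_norm_eq_0_iff[OF f] p by (simp add: A_def)
    then have "Lp_norm p M (\<lambda>x. f x + g x) = Lp_norm p M g" by (intro Lp_norm_cong_AE) auto
    then show ?thesis by simp
  next
    case 2
    then have "AE x in M. g x = 0" using Lp_norm_eq_0_iff[OF g] p by (simp add: B_def)
    then have "Lp_norm p M (\<lambda>x. f x + g x) = Lp_norm p M f" by (intro Lp_norm_cong_AE) auto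
    then show ?thesis by simp
  next
    case 3
    have i: "integrable M (\<lambda>x. cmod (f x) powr p)" "integrable M (\<lambda>x. cmod (g x) powr p)"
      using f g Lp_integrable by auto
    have "(LINT x|M. cmod (f x + g x) powr p) \<le> (LINT x|M. (A + B) powr p *
        (A / (A + B) * (cmod (f x) powr p / A powr p) + B / (A + B) * (cmod (g x) powr p / B powr p)))"
    proof (rule integral_mono)
      show "integrable M (\<lambda>x. cmod (f x + g x) powr p)" using Lp_add[OF f g] p Lp_integrable by auto
      fix x
      have "cmod (f x + g x) powr p \<le> (cmod (f x) + cmod (g x)) powr p"
        using p by (intro powr_mono2 norm_triangle_ineq) auto
      also have "\<dots> \<le> (A + B) powr p *
        (A / (A + B) * (cmod (f x) powr p / A powr p) + B / (A + B) * (cmod (g x) powr p / B powr p))"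
        using 3 p by (intro add_powr_convex) auto
      finally show "cmod (f x + g x) powr p \<le> \<dots>" .
    qed (use i in auto)
    also have "\<dots> = (A + B) powr p * (A / (A + B) * ((LINT x|M. cmod (f x) powr p) / A powr p) +
        B / (A + B) * ((LINT x|M. cmod (g x) powr p) / B powr p))"
      using i by simp
    also have "\<dots> = (A + B) powr p * (A / (A + B) * (A powr p / A powr p) + B / (A + B) * (B powr p / B powr p))"
      using p by (simp add: A_def B_def Lp_norm_powr)
    also have "\<dots> = (A + B) powr p" using 3 by (simp add: add_divide_distrib[symmetric])
    finally have "(LINT x|M. cmod (f x + g x) powr p) powr (1 / p) \<le> ((A + B) powr p) powr (1 / p)"
      using p by (intro powr_mono2) (auto intro: integral_nonneg)
    then show ?thesis using 3 p by (simp add: Lp_norm_def[symmetric] A_def[symmetric] B_def[symmetric] powr_powr)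
  qed
qed

lemma Lp_norm_triangle_diff:
  assumes "f \<in> Lp p M" "g \<in> Lp p M" "1 \<le> p"
  shows "Lp_norm p M (\<lambda>x. f x - g x) \<le> Lp_norm p M f + Lp_norm p M g"
  using Lp_minkowski[OF assms(1) Lp_cmult[OF assms(2), of "-1"] assms(3)] Lp_norm_cmult[of p M "-1" g] assms(3)
  by simp

section \<open>Hoelder's inequality and comparison of exponents\<close>

lemma Lp_holder:
  assumes f: "f \<in> Lp p M" and g: "g \<in> Lp q M" and pq: "1 < p" "1 < q" "1 / p + 1 / q = 1"
  shows "integrable M (\<lambda>x. f x * g x)"
    "(LINT x|M. cmod (f x) * cmod (g x)) \<le> Lp_norm p M f * Lp_norm q M g"
proof -
  have [measurable]: "f \<in> borel_measurable M" "g \<in> borel_measurable M" using assms Lp_measurable by auto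
  have i: "integrable M (\<lambda>x. cmod (f x) powr p)" "integrable M (\<lambda>x. cmod (g x) powr q)"
    using f g Lp_integrable by auto
  have Y: "a * b \<le> a powr p / p + b powr q / q" if "0 \<le> a" "0 \<le> b" for a b :: real
    using Youngs_inequality[of p q a b] pq that by simp
  have int: "integrable M (\<lambda>x. cmod (f x) * cmod (g x))"
    by (rule Bochner_Integration.integrable_bound[of _ "\<lambda>x. cmod (f x) powr p / p + cmod (g x) powr q / q"])
       (use i pq Y in \<open>auto intro!: order_trans[OF Y]\<close>)
  then show "integrable M (\<lambda>x. f x * g x)"
    by (rule Bochner_Integration.integrable_bound) (auto simp: norm_mult)
  define A B where "A = Lp_norm p M f" and "B = Lp_norm q M g"
  consider "A = 0" | "B = 0" | "0 < A" "0 < B" using Lp_norm_nonneg unfolding A_def B_def by (metis less_eq_real_def)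
  then show "(LINT x|M. cmod (f x) * cmod (g x)) \<le> Lp_norm p M f * Lp_norm q M g"
  proof cases
    case 1
    then have "AE x in M. f x = 0" using Lp_norm_eq_0_iff[OF f] pq by (simp add: A_def)
    then have "(LINT x|M. cmod (f x) * cmod (g x)) = 0" by (intro integral_eq_zero_AE) auto
    then show ?thesis by simp
  next
    case 2
    then have "AE x in M. g x = 0" using Lp_norm_eq_0_iff[OF g] pq by (simp add: B_def)
    then have "(LINT x|M. cmod (f x) * cmod (g x)) = 0" by (intro integral_eq_zero_AE) auto
    then show ?thesis by simp
  next
    case 3
    have "(LINT x|M. cmod (f x) * cmod (g x)) = A * B * (LINT x|M. (cmod (f x) / A) * (cmod (g x) / B))"
      using 3 by simp
    also have "\<dots> \<le> A * B * (LINT x|M. cmod (f x) powr p / A powr p / p + cmod (g x) powr q / B powr q / q)"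
    proof (intro mult_left_mono integral_mono)
      fix x
      show "cmod (f x) / A * (cmod (g x) / B) \<le> cmod (f x) powr p / A powr p / p + cmod (g x) powr q / B powr q / q"
        using Y[of "cmod (f x) / A" "cmod (g x) / B"] 3 by (simp add: powr_divide)
      show "integrable M (\<lambda>x. cmod (f x) / A * (cmod (g x) / B))" using int by simp
    qed (use i 3 in auto)
    also have "(LINT x|M. cmod (f x) powr p / A powr p / p + cmod (g x) powr q / B powr q / q) =
       (LINT x|M. cmod (f x) powr p) / A powr p / p + (LINT x|M. cmod (g x) powr q) / B powr q / q"
      using i by simp
    also have "\<dots> = A powr p / A powr p / p + B powr q / B powr q / q"
      using pq by (simp add: A_def B_def Lp_norm_powr)
    also have "\<dots> = 1" using 3 pq by simp
    finally show ?thesis by (simp add: A_def B_def)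
  qed
qed

lemma Lp_const: "finite_measure M \<Longrightarrow> (\<lambda>x. c) \<in> Lp p M"
  by (auto simp: Lp_def finite_measure.integrable_const)

text \<open>Hoelder's inequality for |f|^r and the constant 1, with the exponent p / r.\<close>

lemma Lp_norm_mono_exponent:
  assumes "finite_measure M" and f: "f \<in> Lp p M" and r: "1 \<le> r" "r \<le> p"
  shows "f \<in> Lp r M" "Lp_norm r M f \<le> Lp_norm p M f * measure M (space M) powr (1 / r - 1 / p)"
proof -
  interpret finite_measure M by fact
  have [measurable]: "f \<in> borel_measurable M" using f Lp_measurable by auto
  have "f \<in> Lp r M \<and> Lp_norm r M f \<le> Lp_norm p M f * measure M (space M) powr (1 / r - 1 / p)"
  \<comment> \<open>Equality is separate because Hoelder's inequality needs p / r > 1.\<close>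
  proof (cases "r = p")
    case True
    have "Lp_norm p M f \<le> Lp_norm p M f * measure M (space M) powr 0"
    \<comment> \<open>As 0 powr 0 is 0, the right-hand side vanishes on a null space; so does the
      norm.\<close>
    proof (cases "measure M (space M) = 0")
      case True
      then have "AE x in M. f x = 0" using emeasure_eq_measure by (intro AE_I'[of "space M"]) (auto simp: null_sets_def)
      then show ?thesis using Lp_norm_eq_0_iff[OF f] r by simp
    qed simp
    then show ?thesis using f True by simp
  next
    case False
    then have r': "1 < p / r" "r < p" using r by auto
    define q where "q = p / (p - r)"
    have q: "1 < q" "1 / (p / r) + 1 / q = 1" using r' r by (auto simp: q_def field_simps)
    let ?F = "\<lambda>x. complex_of_real (cmod (f x) powr r)"
    have F: "?F \<in> Lp (p / r) M"
      by (rule Lp_I) (use Lp_integrable[OF f] r in \<open>auto simp: powr_powr\<close>)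
    have one: "(\<lambda>x. 1) \<in> Lp q M" by (rule Lp_const) unfold_locales
    have int: "integrable M (\<lambda>x. ?F x * 1)" by (rule Lp_holder(1)[OF F one r'(1) q])
    then have "integrable M (\<lambda>x. cmod (?F x))" by (intro integrable_norm) simp
    then have fr: "f \<in> Lp r M" by (intro Lp_I) auto
    have nF: "Lp_norm (p / r) M ?F = Lp_norm p M f powr r"
      using r by (simp add: Lp_norm_def powr_powr)
    have "Lp_norm r M f powr r = (LINT x|M. cmod (?F x) * cmod 1)" using r by (simp add: Lp_norm_powr)
    also have "\<dots> \<le> Lp_norm (p / r) M ?F * Lp_norm q M (\<lambda>x. 1)"
      using Lp_holder(2)[OF F one r'(1) q] by simp
    also have "\<dots> = Lp_norm p M f powr r * measure M (space M) powr (1 / q)"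
      unfolding nF by (simp add: Lp_norm_def)
    also have "1 / q = (1 / r - 1 / p) * r" using r' r by (simp add: q_def field_simps)
    also have "Lp_norm p M f powr r * measure M (space M) powr ((1 / r - 1 / p) * r) =
      (Lp_norm p M f * measure M (space M) powr (1 / r - 1 / p)) powr r"
      by (simp add: powr_mult powr_powr)
    finally have "Lp_norm r M f \<le> Lp_norm p M f * measure M (space M) powr (1 / r - 1 / p)"
      using r by (elim powr_le_imp_le) auto
    then show ?thesis using fr by simp
  qed
  then show "f \<in> Lp r M" "Lp_norm r M f \<le> Lp_norm p M f * measure M (space M) powr (1 / r - 1 / p)" by auto
qed

lemma Lp_tendsto_mono_exponent:
  assumes "finite_measure M" "Lp_tendsto p M s f" "1 \<le> r" "r \<le> p"
  shows "Lp_tendsto r M s f"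
  unfolding Lp_tendsto_def
proof (intro conjI allI)
  have s: "s n \<in> Lp p M" "f \<in> Lp p M" for n using assms by (auto simp: Lp_tendsto_def)
  show "s n \<in> Lp r M" "f \<in> Lp r M" for n using Lp_norm_mono_exponent assms s by blast+
  have "(\<lambda>n. Lp_norm p M (\<lambda>x. s n x - f x) * measure M (space M) powr (1 / r - 1 / p)) \<longlonglongrightarrow>
      0 * measure M (space M) powr (1 / r - 1 / p)"
    using assms by (intro tendsto_intros) (auto simp: Lp_tendsto_def)
  then have l: "(\<lambda>n. Lp_norm p M (\<lambda>x. s n x - f x) * measure M (space M) powr (1 / r - 1 / p)) \<longlonglongrightarrow> 0" by simp
  show "(\<lambda>n. Lp_norm r M (\<lambda>x. s n x - f x)) \<longlonglongrightarrow> 0"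
  proof (rule tendsto_sandwich[OF _ _ tendsto_const l])
    show "\<forall>\<^sub>F n in sequentially. Lp_norm r M (\<lambda>x. s n x - f x) \<le>
        Lp_norm p M (\<lambda>x. s n x - f x) * measure M (space M) powr (1 / r - 1 / p)"
      using Lp_norm_mono_exponent(2)[OF assms(1) Lp_diff[OF s] assms(3,4)] assms(3,4) by simp
  qed simp
qed

section \<open>Fatou's lemma and completeness\<close>

lemma Lp_Fatou:
  assumes s: "\<And>k. s k \<in> Lp p M" and f: "f \<in> borel_measurable M" and lim: "AE x in M. (\<lambda>k. s k x) \<longlonglongrightarrow> f x"
    and b: "\<forall>\<^sub>F k in sequentially. Lp_norm p M (s k) \<le> K" and p: "0 < p"
  shows "f \<in> Lp p M" "Lp_norm p M f \<le> K"
proof -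
  note [measurable] = f
  have [measurable]: "s k \<in> borel_measurable M" for k using s Lp_measurable by auto
  have K: "0 \<le> K" using b Lp_norm_nonneg by (metis (no_types, lifting) eventually_happens' order_trans sequentially_bot)
  have "(\<integral>\<^sup>+x. ennreal (cmod (f x) powr p) \<partial>M) \<le> (\<integral>\<^sup>+x. liminf (\<lambda>k. ennreal (cmod (s k x) powr p)) \<partial>M)"
  proof (rule nn_integral_mono_AE, use lim in eventually_elim)
    fix x assume "(\<lambda>k. s k x) \<longlonglongrightarrow> f x"
    then have "(\<lambda>k. ennreal (cmod (s k x) powr p)) \<longlonglongrightarrow> ennreal (cmod (f x) powr p)"
      using p by (intro tendsto_ennrealI tendsto_powr2 tendsto_norm) auto
    then show "ennreal (cmod (f x) powr p) \<le> liminf (\<lambda>k. ennreal (cmod (s k x) powr p))"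
      by (metis lim_imp_Liminf order_refl trivial_limit_sequentially)
  qed
  also have "\<dots> \<le> liminf (\<lambda>k. \<integral>\<^sup>+x. ennreal (cmod (s k x) powr p) \<partial>M)"
    by (rule nn_integral_liminf) simp
  also have "\<dots> \<le> ennreal (K powr p)"
  proof (rule Liminf_le)
    show "\<forall>\<^sub>F k in sequentially. (\<integral>\<^sup>+x. ennreal (cmod (s k x) powr p) \<partial>M) \<le> ennreal (K powr p)"
      using b
    proof eventually_elim
      case (elim k)
      have "(\<integral>\<^sup>+x. ennreal (cmod (s k x) powr p) \<partial>M) = ennreal (LINT x|M. cmod (s k x) powr p)"
        by (rule nn_integral_eq_integral) (use s Lp_integrable in auto)
      also have "\<dots> = ennreal (Lp_norm p M (s k) powr p)" using p by (simp add: Lp_norm_powr)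
      also have "\<dots> \<le> ennreal (K powr p)" using elim p by (intro ennreal_leI powr_mono2) auto
      finally show ?case .
    qed
  qed simp
  finally have n: "(\<integral>\<^sup>+x. ennreal (cmod (f x) powr p) \<partial>M) \<le> ennreal (K powr p)" .
  then have i: "integrable M (\<lambda>x. cmod (f x) powr p)"
    by (intro integrableI_nonneg) (auto intro: le_less_trans)
  then show "f \<in> Lp p M" using f by (intro Lp_I)
  have "ennreal (LINT x|M. cmod (f x) powr p) \<le> ennreal (K powr p)"
    using nn_integral_eq_integral[OF i] n by simp
  then have "(LINT x|M. cmod (f x) powr p) \<le> K powr p" by (simp add: ennreal_le_iff)
  then have "(LINT x|M. cmod (f x) powr p) powr (1 / p) \<le> (K powr p) powr (1 / p)"
    using p by (intro powr_mono2) (auto intro: integral_nonneg)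
  then show "Lp_norm p M f \<le> K" using p K by (simp add: Lp_norm_def powr_powr)
qed

text \<open>A rapidly Cauchy subsequence has increments summable in L^1, the measure being finite;
  hence it converges almost everywhere, and Fatou's lemma bounds the distance to the limit.\<close>

lemma Lp_complete:
  assumes M: "finite_measure M" and s: "\<And>k. s k \<in> Lp p M" and p: "1 \<le> p"
    and cauchy: "\<And>e. 0 < e \<Longrightarrow> \<exists>N. \<forall>m\<ge>N. \<forall>n\<ge>N. Lp_norm p M (\<lambda>x. s m x - s n x) \<le> e"
  obtains f where "Lp_tendsto p M s f"
proof -
  interpret finite_measure M by fact
  have sm [measurable]: "s k \<in> borel_measurable M" for k using s Lp_measurable by auto
  have p0: "0 < p" using p by simp
  have d: "(\<lambda>x. s m x - s n x) \<in> Lp p M" for m n using s p by (intro Lp_diff) auto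
  define C where "C = measure M (space M) powr (1 - 1 / p)"
  define N where "N k = (SOME N. \<forall>m\<ge>N. \<forall>n\<ge>N. Lp_norm p M (\<lambda>x. s m x - s n x) \<le> (1/2) ^ k)" for k
  have N: "Lp_norm p M (\<lambda>x. s m x - s n x) \<le> (1/2) ^ k" if "N k \<le> m" "N k \<le> n" for k m n
    using someI_ex[OF cauchy[of "(1/2) ^ k"]] that unfolding N_def by auto
  \<comment> \<open>The sum puts both \<open>r k\<close> and \<open>r (Suc k)\<close> beyond
    \<open>N k\<close>; the summand \<open>k\<close> makes the indices unbounded.\<close>
  define r where "r k = k + (\<Sum>j\<le>k. N j)" for k
  have rN: "N k \<le> r k" "N k \<le> r (Suc k)" for k
    using member_le_sum[of k "{..k}" N] by (auto simp: r_def)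
  have rk: "k \<le> r k" for k by (simp add: r_def)
  have L1: "(LINT x|M. cmod (s (r (Suc k)) x - s (r k) x)) \<le> (1/2) ^ k * C"
    and I1: "integrable M (\<lambda>x. cmod (s (r (Suc k)) x - s (r k) x))" for k
  proof -
    have "Lp_norm 1 M (\<lambda>x. s (r (Suc k)) x - s (r k) x) \<le> Lp_norm p M (\<lambda>x. s (r (Suc k)) x - s (r k) x) * C"
      using Lp_norm_mono_exponent(2)[OF M d, of 1] p by (simp add: C_def)
    also have "\<dots> \<le> (1/2) ^ k * C" using N[OF rN(2,1)] by (intro mult_right_mono) (auto simp: C_def)
    finally show "(LINT x|M. cmod (s (r (Suc k)) x - s (r k) x)) \<le> (1/2) ^ k * C"
      by (simp add: Lp_norm_def integral_nonneg)
    have "(\<lambda>x. s (r (Suc k)) x - s (r k) x) \<in> Lp 1 M"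
      using Lp_norm_mono_exponent(1)[OF M d, of 1] p by simp
    then show "integrable M (\<lambda>x. cmod (s (r (Suc k)) x - s (r k) x))" by (simp add: Lp_def)
  qed
  have "(\<integral>\<^sup>+x. (\<Sum>k. ennreal (cmod (s (r (Suc k)) x - s (r k) x))) \<partial>M) =
      (\<Sum>k. \<integral>\<^sup>+x. ennreal (cmod (s (r (Suc k)) x - s (r k) x)) \<partial>M)"
    by (rule nn_integral_suminf) simp
  also have "\<dots> = (\<Sum>k. ennreal (LINT x|M. cmod (s (r (Suc k)) x - s (r k) x)))"
    using I1 by (intro suminf_cong nn_integral_eq_integral) auto
  also have "\<dots> \<le> (\<Sum>k. ennreal ((1/2) ^ k * C))"
    using L1 by (intro suminf_le ennreal_leI) auto
  also have "\<dots> = ennreal (\<Sum>k. (1/2) ^ k * C)"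
    by (rule suminf_ennreal2) (auto simp: C_def intro!: summable_mult2 summable_geometric)
  finally have "(\<integral>\<^sup>+x. (\<Sum>k. ennreal (cmod (s (r (Suc k)) x - s (r k) x))) \<partial>M) \<noteq> \<infinity>"
    by (auto simp: top_unique)
  then have "AE x in M. (\<Sum>k. ennreal (cmod (s (r (Suc k)) x - s (r k) x))) \<noteq> \<infinity>"
    by (intro nn_integral_PInf_AE) auto
  then have conv: "AE x in M. convergent (\<lambda>k. s (r k) x)"
  proof eventually_elim
    fix x assume "(\<Sum>k. ennreal (cmod (s (r (Suc k)) x - s (r k) x))) \<noteq> \<infinity>"
    then have "summable (\<lambda>k. cmod (s (r (Suc k)) x - s (r k) x))"
      by (intro summable_suminf_not_top) auto
    then have "summable (\<lambda>k. s (r (Suc k)) x - s (r k) x)" by (rule summable_norm_cancel)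
    moreover have "(\<Sum>i<n. s (r (Suc i)) x - s (r i) x) = s (r n) x - s (r 0) x" for n
      by (rule sum_lessThan_telescope)
    ultimately have "convergent (\<lambda>n. s (r n) x + (- s (r 0) x))" by (simp add: summable_iff_convergent)
    then show "convergent (\<lambda>k. s (r k) x)" by (simp only: convergent_add_const_right_iff)
  qed
  define f where "f x = lim (\<lambda>k. s (r k) x)" for x
  have f [measurable]: "f \<in> borel_measurable M" unfolding f_def by measurable
  have lim: "AE x in M. (\<lambda>k. s (r k) x) \<longlonglongrightarrow> f x"
    using conv by eventually_elim (simp add: f_def convergent_LIMSEQ_iff)
  have b: "(\<lambda>x. s n x - f x) \<in> Lp p M \<and> Lp_norm p M (\<lambda>x. s n x - f x) \<le> (1/2) ^ k" if "N k \<le> n" for n k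
  proof -
    have l: "AE x in M. (\<lambda>j. s n x - s (r j) x) \<longlonglongrightarrow> s n x - f x"
      using lim by eventually_elim (intro tendsto_intros)
    have e: "\<forall>\<^sub>F j in sequentially. Lp_norm p M (\<lambda>x. s n x - s (r j) x) \<le> (1/2) ^ k"
      using eventually_ge_at_top[of "N k"] by eventually_elim (use N[OF that] rk order_trans in blast)
    show ?thesis using Lp_Fatou[where s="\<lambda>j x. s n x - s (r j) x", OF d _ l e p0] by simp
  qed
  have "Lp_tendsto p M s f"
    unfolding Lp_tendsto_def
  proof (intro conjI allI s)
    have "(\<lambda>x. s (N 0) x - (s (N 0) x - f x)) \<in> Lp p M"
      using b[of 0 "N 0"] p0 by - (rule Lp_diff[OF s, of "\<lambda>x. s (N 0) x - f x"], simp_all)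
    then show "f \<in> Lp p M" by simp
    show "(\<lambda>n. Lp_norm p M (\<lambda>x. s n x - f x)) \<longlonglongrightarrow> 0"
    proof (rule LIMSEQ_I)
      fix e :: real assume "0 < e"
      then obtain k where k: "(1/2) ^ k < e" using real_arch_pow_inv[of e "1/2"] by auto
      show "\<exists>no. \<forall>n\<ge>no. norm (Lp_norm p M (\<lambda>x. s n x - f x) - 0) < e"
        using b[of k] k by (intro exI[of _ "N k"]) (auto intro: le_less_trans)
    qed
  qed
  then show ?thesis by (rule that)
qed

section \<open>Convergence and bounded operators\<close>

lemma Lp_tendsto_cong_AE:
  assumes "Lp_tendsto p M s f" "\<And>k. s' k \<in> borel_measurable M" "g \<in> borel_measurable M"
    "\<And>k. AE x in M. s k x = s' k x" "AE x in M. f x = g x"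
  shows "Lp_tendsto p M s' g"
proof -
  have m: "s k \<in> borel_measurable M" "f \<in> borel_measurable M" for k
    using assms(1) by (auto simp: Lp_tendsto_def Lp_def)
  have "Lp_norm p M (\<lambda>x. s' k x - g x) = Lp_norm p M (\<lambda>x. s k x - f x)" for k
  proof (rule Lp_norm_cong_AE)
    show "AE x in M. s' k x - g x = s k x - f x" using assms(4)[of k] assms(5) by eventually_elim simp
  qed (intro borel_measurable_diff m assms(2,3))+
  moreover have "s' k \<in> Lp p M" for k
    using assms(1) by (intro Lp_cong_AE[OF _ assms(2,4)]) (simp add: Lp_tendsto_def)
  moreover have "g \<in> Lp p M"
    using assms(1) by (intro Lp_cong_AE[OF _ assms(3,5)]) (simp add: Lp_tendsto_def)
  ultimately show ?thesis using assms(1) by (simp add: Lp_tendsto_def)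
qed

lemma Lp_tendsto_lincomb:
  assumes "Lp_tendsto p M s f" "Lp_tendsto p M t g" "1 \<le> p"
  shows "Lp_tendsto p M (\<lambda>k x. a * s k x + b * t k x) (\<lambda>x. a * f x + b * g x)"
  unfolding Lp_tendsto_def
proof (intro conjI allI)
  have m: "s k \<in> Lp p M" "f \<in> Lp p M" "t k \<in> Lp p M" "g \<in> Lp p M" for k
    using assms by (auto simp: Lp_tendsto_def)
  show "(\<lambda>x. a * s k x + b * t k x) \<in> Lp p M" "(\<lambda>x. a * f x + b * g x) \<in> Lp p M" for k
    using assms(3) by (intro Lp_add Lp_cmult m; simp)+
  have le: "Lp_norm p M (\<lambda>x. a * s k x + b * t k x - (a * f x + b * g x)) \<le>
     cmod a * Lp_norm p M (\<lambda>x. s k x - f x) + cmod b * Lp_norm p M (\<lambda>x. t k x - g x)" for k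
  proof -
    have d: "(\<lambda>x. s k x - f x) \<in> Lp p M" "(\<lambda>x. t k x - g x) \<in> Lp p M" using assms(3) by (intro Lp_diff m; simp)+
    have "Lp_norm p M (\<lambda>x. a * s k x + b * t k x - (a * f x + b * g x)) =
      Lp_norm p M (\<lambda>x. a * (s k x - f x) + b * (t k x - g x))" by (simp add: algebra_simps)
    also have "\<dots> \<le> Lp_norm p M (\<lambda>x. a * (s k x - f x)) + Lp_norm p M (\<lambda>x. b * (t k x - g x))"
      using assms(3) by (intro Lp_minkowski Lp_cmult d)
    finally show ?thesis using assms(3) by (simp add: Lp_norm_cmult)
  qed
  have "(\<lambda>k. cmod a * Lp_norm p M (\<lambda>x. s k x - f x) + cmod b * Lp_norm p M (\<lambda>x. t k x - g x)) \<longlonglongrightarrow>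
     cmod a * 0 + cmod b * 0"
    using assms by (intro tendsto_intros) (auto simp: Lp_tendsto_def)
  then have l: "(\<lambda>k. cmod a * Lp_norm p M (\<lambda>x. s k x - f x) + cmod b * Lp_norm p M (\<lambda>x. t k x - g x)) \<longlonglongrightarrow> 0"
    by simp
  show "(\<lambda>k. Lp_norm p M (\<lambda>x. a * s k x + b * t k x - (a * f x + b * g x))) \<longlonglongrightarrow> 0"
    by (rule tendsto_sandwich[OF _ _ tendsto_const l]) (use le in auto)
qed

lemma Lp_tendsto_norm:
  assumes "Lp_tendsto p M s f" "1 \<le> p"
  shows "(\<lambda>k. Lp_norm p M (s k)) \<longlonglongrightarrow> Lp_norm p M f"
proof -
  have m: "s k \<in> Lp p M" "f \<in> Lp p M" for k using assms by (auto simp: Lp_tendsto_def)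
  have d: "(\<lambda>x. s k x - f x) \<in> Lp p M" for k using assms(2) by (intro Lp_diff m) simp
  have "Lp_norm p M (s k) \<le> Lp_norm p M (\<lambda>x. s k x - f x) + Lp_norm p M f" for k
    using Lp_minkowski[OF d m(2) assms(2), of k] by simp
  moreover have "Lp_norm p M f \<le> Lp_norm p M (s k) + Lp_norm p M (\<lambda>x. s k x - f x)" for k
    using Lp_norm_triangle_diff[OF m(1) d assms(2), of k k] by simp
  ultimately have "\<bar>Lp_norm p M (s k) - Lp_norm p M f\<bar> \<le> Lp_norm p M (\<lambda>x. s k x - f x)" for k
    by (auto simp: abs_le_iff algebra_simps)
  moreover have "(\<lambda>k. Lp_norm p M (\<lambda>x. s k x - f x)) \<longlonglongrightarrow> 0" using assms by (simp add: Lp_tendsto_def)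
  ultimately have "(\<lambda>k. Lp_norm p M (s k) - Lp_norm p M f) \<longlonglongrightarrow> 0"
    by (intro tendsto_0_le[where K=1 and g="\<lambda>k. Lp_norm p M (s k) - Lp_norm p M f" and f="\<lambda>k. Lp_norm p M (\<lambda>x. s k x - f x)"]) auto
  then show ?thesis by (simp add: LIM_zero_iff)
qed

lemma Lp_tendsto_unique:
  assumes "Lp_tendsto p M s f" "Lp_tendsto p M s g" "1 \<le> p"
  shows "AE x in M. f x = g x"
proof -
  have "Lp_tendsto p M (\<lambda>k x. 1 * s k x + (-1) * s k x) (\<lambda>x. 1 * f x + (-1) * g x)"
    by (rule Lp_tendsto_lincomb[OF assms])
  from Lp_tendsto_norm[OF this assms(3)] have "(\<lambda>k::nat. 0) \<longlonglongrightarrow> Lp_norm p M (\<lambda>x. f x - g x)"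
    using assms(3) by simp
  then have "Lp_norm p M (\<lambda>x. f x - g x) = 0" by (simp add: tendsto_const_iff)
  moreover have "(\<lambda>x. f x - g x) \<in> Lp p M"
    using assms by (intro Lp_diff) (auto simp: Lp_tendsto_def)
  ultimately have "AE x in M. f x - g x = 0" using Lp_norm_eq_0_iff assms(3) by fastforce
  then show ?thesis by simp
qed

lemma Lp_bounded_linearD:
  assumes "Lp_bounded_linear p M T"
  shows "f \<in> Lp p M \<Longrightarrow> T f \<in> Lp p M"
    "f \<in> Lp p M \<Longrightarrow> g \<in> Lp p M \<Longrightarrow> AE x in M. T (\<lambda>y. f y + g y) x = T f x + T g x"
    "f \<in> Lp p M \<Longrightarrow> AE x in M. T (\<lambda>y. c * f y) x = c * T f x"
    "\<exists>K. \<forall>f\<in>Lp p M. Lp_norm p M (T f) \<le> K * Lp_norm p M f"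
  using assms unfolding Lp_bounded_linear_def by simp_all

lemma Lp_bounded_linear_lincomb:
  assumes T: "Lp_bounded_linear p M T" and f: "f \<in> Lp p M" and g: "g \<in> Lp p M" and p: "0 < p"
  shows "AE x in M. T (\<lambda>y. a * f y + b * g y) x = a * T f x + b * T g x"
  using Lp_bounded_linearD(2)[OF T Lp_cmult[OF f, of a] Lp_cmult[OF g, of b]]
    Lp_bounded_linearD(3)[OF T f, of a] Lp_bounded_linearD(3)[OF T g, of b]
  by eventually_elim simp

lemma Lp_bounded_linear_tendsto:
  assumes T: "Lp_bounded_linear p M T" and s: "Lp_tendsto p M s f" and p: "1 \<le> p"
  shows "Lp_tendsto p M (\<lambda>k. T (s k)) (T f)"
  unfolding Lp_tendsto_def
proof (intro conjI allI)
  have m: "s k \<in> Lp p M" "f \<in> Lp p M" for k using s by (auto simp: Lp_tendsto_def)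
  show Tm: "T (s k) \<in> Lp p M" "T f \<in> Lp p M" for k by (intro Lp_bounded_linearD(1)[OF T] m)+
  obtain K where K: "\<And>f. f \<in> Lp p M \<Longrightarrow> Lp_norm p M (T f) \<le> K * Lp_norm p M f"
    using Lp_bounded_linearD(4)[OF T] by blast
  have d: "(\<lambda>x. s k x - f x) \<in> Lp p M" for k using p by (intro Lp_diff m) simp
  have le: "Lp_norm p M (\<lambda>x. T (s k) x - T f x) \<le> K * Lp_norm p M (\<lambda>x. s k x - f x)" for k
  proof -
    have "AE x in M. T (\<lambda>y. s k y - f y) x = T (s k) x - T f x"
      using Lp_bounded_linear_lincomb[OF T m(1)[of k] m(2), of 1 "-1"] p by simp
    moreover have "T (\<lambda>y. s k y - f y) \<in> Lp p M" by (rule Lp_bounded_linearD(1)[OF T d])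
    ultimately have "Lp_norm p M (\<lambda>x. T (s k) x - T f x) = Lp_norm p M (T (\<lambda>y. s k y - f y))"
      using Tm Lp_measurable by (intro Lp_norm_cong_AE) (auto intro!: borel_measurable_diff)
    then show ?thesis using K[OF d] by simp
  qed
  have "(\<lambda>k. K * Lp_norm p M (\<lambda>x. s k x - f x)) \<longlonglongrightarrow> K * 0"
    using s by (intro tendsto_intros) (auto simp: Lp_tendsto_def)
  then have l: "(\<lambda>k. K * Lp_norm p M (\<lambda>x. s k x - f x)) \<longlonglongrightarrow> 0" by simp
  show "(\<lambda>k. Lp_norm p M (\<lambda>x. T (s k) x - T f x)) \<longlonglongrightarrow> 0"
    by (rule tendsto_sandwich[OF _ _ tendsto_const l]) (use le in auto)
qed

text \<open>Both operators are continuous on L^p and equal \<open>R\<close> along the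
  sequence.\<close>

lemma Lp_extension_unique:
  assumes T: "Lp_extension p M R T" and S: "Lp_extension p M R S" and p: "1 \<le> p"
    and s: "\<And>k. s k \<in> Lp 2 M \<inter> Lp p M" "Lp_tendsto p M s f"
  shows "AE x in M. S f x = T f x"
proof -
  have "AE x in M. T (s k) x = S (s k) x" for k
  proof -
    have "AE x in M. T (s k) x = R (s k) x" "AE x in M. S (s k) x = R (s k) x"
      using T S s(1) unfolding Lp_extension_def by blast+
    then show ?thesis by eventually_elim simp
  qed
  moreover have T': "Lp_tendsto p M (\<lambda>k. T (s k)) (T f)" and S': "Lp_tendsto p M (\<lambda>k. S (s k)) (S f)"
    using T S s(2) p by (auto simp: Lp_extension_def intro: Lp_bounded_linear_tendsto)
  ultimately have "Lp_tendsto p M (\<lambda>k. S (s k)) (T f)"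
    by (intro Lp_tendsto_cong_AE[OF T']) (simp_all add: Lp_tendsto_def Lp_def)
  then show ?thesis by (rule Lp_tendsto_unique[OF S' _ p])
qed

text \<open>The extension is the closure of the graph of \<open>R\<close> on \<open>D\<close>.
  Density of \<open>D\<close> in every L^r, not only in L^p, makes it agree with \<open>R\<close> on
  the whole intersection of L^2 and L^p.\<close>

theorem Lp_extension_exists:
  assumes M: "finite_measure M" and p: "1 < p"
    and R: "Lp_bounded_linear 2 M R"
    and D: "\<And>f r. f \<in> D \<Longrightarrow> 1 < r \<Longrightarrow> f \<in> Lp r M"
    and Dlin: "\<And>f g a b. f \<in> D \<Longrightarrow> g \<in> D \<Longrightarrow> (\<lambda>x. a * f x + b * g x) \<in> D"
    and bound: "\<And>f. f \<in> D \<Longrightarrow> R f \<in> Lp p M \<and> Lp_norm p M (R f) \<le> C * Lp_norm p M f" and C: "0 \<le> C"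
    and dense: "\<And>r f. 1 < r \<Longrightarrow> f \<in> Lp r M \<Longrightarrow> \<exists>s. (\<forall>k::nat. s k \<in> D) \<and> Lp_tendsto r M s f"
  shows "\<exists>T. Lp_extension p M R T \<and>
      (\<forall>S. Lp_extension p M R S \<longrightarrow> (\<forall>f \<in> Lp p M. AE x in M. S f x = T f x)) \<and> Lp_opnorm p M T \<le> C"
proof -
  define G where "G f g \<longleftrightarrow> (\<exists>s. (\<forall>k::nat. s k \<in> D) \<and> Lp_tendsto p M s f \<and> Lp_tendsto p M (\<lambda>k. R (s k)) g)" for f g
  have p1: "1 \<le> p" "0 < p" using p by auto
  have Gmem: "f \<in> Lp p M" "g \<in> Lp p M" if "G f g" for f g using that by (auto simp: G_def Lp_tendsto_def)
  have Rlin: "AE x in M. R (\<lambda>y. a * f y + b * g y) x = a * R f x + b * R g x" if "f \<in> D" "g \<in> D" for f g a b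
    using Lp_bounded_linear_lincomb[OF R D[OF that(1)] D[OF that(2)]] by simp
  have Rm: "R f \<in> borel_measurable M" if "f \<in> D" for f using bound[OF that] Lp_measurable by auto
  have Glin: "G (\<lambda>x. a * f x + b * f' x) (\<lambda>x. a * g x + b * g' x)" if "G f g" "G f' g'" for f g f' g' a b
  proof -
    obtain s s' where s: "\<And>k. s k \<in> D" "Lp_tendsto p M s f" "Lp_tendsto p M (\<lambda>k. R (s k)) g"
      and s': "\<And>k. s' k \<in> D" "Lp_tendsto p M s' f'" "Lp_tendsto p M (\<lambda>k. R (s' k)) g'"
      using \<open>G f g\<close> \<open>G f' g'\<close> by (auto simp: G_def)
    have "Lp_tendsto p M (\<lambda>k. R (\<lambda>x. a * s k x + b * s' k x)) (\<lambda>x. a * g x + b * g' x)"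
    proof (rule Lp_tendsto_cong_AE[OF Lp_tendsto_lincomb[OF s(3) s'(3) p1(1)]])
      show "R (\<lambda>x. a * s k x + b * s' k x) \<in> borel_measurable M" for k by (rule Rm[OF Dlin[OF s(1) s'(1)]])
      show "AE x in M. a * R (s k) x + b * R (s' k) x = R (\<lambda>x. a * s k x + b * s' k x) x" for k
        using Rlin[OF s(1) s'(1), of a k b k] by eventually_elim simp
      show "(\<lambda>x. a * g x + b * g' x) \<in> borel_measurable M"
        using Lp_measurable[OF Gmem(2)[OF \<open>G f g\<close>]] Lp_measurable[OF Gmem(2)[OF \<open>G f' g'\<close>]] by simp
    qed simp
    moreover have "\<forall>k. (\<lambda>x. a * s k x + b * s' k x) \<in> D" using Dlin[OF s(1) s'(1)] by blast
    ultimately show ?thesis unfolding G_def using Lp_tendsto_lincomb[OF s(2) s'(2) p1(1)]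
      by (intro exI[of _ "\<lambda>k x. a * s k x + b * s' k x"] conjI)
  qed
  have Gbound: "Lp_norm p M g \<le> C * Lp_norm p M f" if fg: "G f g" for f g
  proof -
    obtain s where s: "\<And>k. s k \<in> D" "Lp_tendsto p M s f" "Lp_tendsto p M (\<lambda>k. R (s k)) g"
      using fg by (auto simp: G_def)
    show ?thesis
      by (rule LIMSEQ_le[OF Lp_tendsto_norm[OF s(3) p1(1)] tendsto_mult_left[OF Lp_tendsto_norm[OF s(2) p1(1)], of C]])
         (use bound s(1) in blast)
  qed
  have Gunique: "AE x in M. g x = g' x" if "G f g" "G f' g'" "AE x in M. f x = f' x" for f f' g g'
  proof -
    have "Lp_norm p M (\<lambda>x. 1 * g x + (-1) * g' x) \<le> C * Lp_norm p M (\<lambda>x. 1 * f x + (-1) * f' x)"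
      by (rule Gbound[OF Glin[OF that(1,2)]])
    moreover have "Lp_norm p M (\<lambda>x. f x - f' x) = Lp_norm p M (\<lambda>x. 0)"
      by (rule Lp_norm_cong_AE) (use that(3) Lp_measurable[OF Gmem(1)[OF that(1)]] Lp_measurable[OF Gmem(1)[OF that(2)]] in auto)
    ultimately have "Lp_norm p M (\<lambda>x. g x - g' x) = 0" using p1 by (intro order_antisym) auto
    moreover have "(\<lambda>x. g x - g' x) \<in> Lp p M" by (intro Lp_diff Gmem(2)[OF that(1)] Gmem(2)[OF that(2)] p1)
    ultimately have "AE x in M. g x - g' x = 0" using Lp_norm_eq_0_iff p1 by fastforce
    then show ?thesis by simp
  qed
  have Gex: "\<exists>g. G f g" if f: "f \<in> Lp p M" for f
  proof -
    obtain s where s: "\<And>k. s k \<in> D" "Lp_tendsto p M s f" using dense[OF p f] by auto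
    have diffR: "Lp_norm p M (\<lambda>x. R (s m) x - R (s n) x) \<le> C * Lp_norm p M (\<lambda>x. s m x - s n x)" for m n
    proof -
      have "Lp_norm p M (\<lambda>x. R (s m) x - R (s n) x) = Lp_norm p M (R (\<lambda>y. 1 * s m y + (-1) * s n y))"
      proof (rule Lp_norm_cong_AE)
        show "R (\<lambda>y. 1 * s m y + (-1) * s n y) \<in> borel_measurable M" by (rule Rm[OF Dlin[OF s(1) s(1)]])
        show "AE x in M. R (s m) x - R (s n) x = R (\<lambda>y. 1 * s m y + (-1) * s n y) x"
          using Rlin[OF s(1)[of m] s(1)[of n], of 1 "-1"] by eventually_elim simp
      qed (intro borel_measurable_diff Rm s(1))
      also have "\<dots> \<le> C * Lp_norm p M (\<lambda>y. 1 * s m y + (-1) * s n y)"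
        by (rule conjunct2[OF bound[OF Dlin[OF s(1) s(1)]]])
      finally show ?thesis by simp
    qed
    have sm: "s k \<in> Lp p M" for k using s(2) by (simp add: Lp_tendsto_def)
    have fm: "f \<in> Lp p M" by fact
    obtain g where "Lp_tendsto p M (\<lambda>k. R (s k)) g"
    proof (rule Lp_complete[OF M _ p1(1), of "\<lambda>k. R (s k)"])
      show "R (s k) \<in> Lp p M" for k using bound s(1) by blast
      fix e :: real assume "0 < e"
      then have e: "0 < e / (2 * C + 1)" using C by simp
      have "(\<lambda>N. Lp_norm p M (\<lambda>x. s N x - f x)) \<longlonglongrightarrow> 0" using s(2) by (simp add: Lp_tendsto_def)
      from LIMSEQ_D[OF this e] obtain N where N: "\<And>n. n \<ge> N \<Longrightarrow> Lp_norm p M (\<lambda>x. s n x - f x) < e / (2 * C + 1)"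
        by auto
      have "Lp_norm p M (\<lambda>x. R (s m) x - R (s n) x) \<le> e" if "N \<le> m" "N \<le> n" for m n
      proof -
        have "Lp_norm p M (\<lambda>x. (s m x - f x) - (s n x - f x)) \<le>
            Lp_norm p M (\<lambda>x. s m x - f x) + Lp_norm p M (\<lambda>x. s n x - f x)"
          using p1 by (intro Lp_norm_triangle_diff Lp_diff sm fm)
        also have "\<dots> \<le> e / (2 * C + 1) + e / (2 * C + 1)" using N[OF that(1)] N[OF that(2)] by simp
        finally have "C * Lp_norm p M (\<lambda>x. s m x - s n x) \<le> C * (2 * (e / (2 * C + 1)))"
          using C by (intro mult_left_mono) auto
        also have "\<dots> \<le> e" using C \<open>0 < e\<close> by (simp add: field_simps)
        finally show ?thesis using diffR[of m n] by linarith
      qed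
      then show "\<exists>N. \<forall>m\<ge>N. \<forall>n\<ge>N. Lp_norm p M (\<lambda>x. R (s m) x - R (s n) x) \<le> e" by blast
    qed blast
    then show ?thesis using s unfolding G_def by blast
  qed
  \<comment> \<open>The choice is harmless: by \<open>Gunique\<close> any two candidates agree
    almost everywhere.\<close>
  define T where "T f = (SOME g. G f g)" for f
  have GT: "G f (T f)" if "f \<in> Lp p M" for f using someI_ex[OF Gex[OF that]] by (simp add: T_def)
  have lin: "Lp_bounded_linear p M T"
    unfolding Lp_bounded_linear_def
  proof (intro conjI ballI allI impI)
    show "T f \<in> Lp p M" if "f \<in> Lp p M" for f by (rule Gmem(2)[OF GT[OF that]])
    show "AE x in M. T f x = T g x" if "f \<in> Lp p M" "g \<in> Lp p M" "AE x in M. f x = g x" for f g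
      by (rule Gunique[OF GT[OF that(1)] GT[OF that(2)] that(3)])
    show "AE x in M. T (\<lambda>y. f y + g y) x = T f x + T g x" if "f \<in> Lp p M" "g \<in> Lp p M" for f g
      by (rule Gunique[OF GT[OF Lp_add[OF that p1(2)]] Glin[OF GT[OF that(1)] GT[OF that(2)], of 1 1], simplified mult_1]) simp
    show "AE x in M. T (\<lambda>y. c * f y) x = c * T f x" if "f \<in> Lp p M" for f c
    proof -
      have "AE x in M. T (\<lambda>y. c * f y) x = c * T f x + 0 * T f x"
        by (rule Gunique[OF GT[OF Lp_cmult[OF that]] Glin[OF GT[OF that] GT[OF that]]]) simp
      then show ?thesis by simp
    qed
    show "\<exists>K. \<forall>f\<in>Lp p M. Lp_norm p M (T f) \<le> K * Lp_norm p M f" by (intro exI[of _ C] ballI Gbound GT)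
  qed
  have ext: "AE x in M. T f x = R f x" if f: "f \<in> Lp 2 M \<inter> Lp p M" for f
  proof -
    \<comment> \<open>A sequence tending to \<open>f\<close> in the space of the larger exponent
      tends to it in L^p and in L^2 at once.\<close>
    define m where "m = max p 2"
    have m: "1 < m" "p \<le> m" "2 \<le> m" by (auto simp: m_def)
    have "f \<in> Lp m M" using f by (auto simp: m_def max_def)
    then obtain s where s: "\<And>k. s k \<in> D" "Lp_tendsto m M s f" using dense[OF m(1)] by blast
    have s2: "Lp_tendsto 2 M s f" "Lp_tendsto p M s f"
      using Lp_tendsto_mono_exponent[OF M s(2)] m p1 by auto
    have Ts: "Lp_tendsto p M (\<lambda>k. T (s k)) (T f)" by (rule Lp_bounded_linear_tendsto[OF lin s2(2) p1(1)])
    have TR: "AE x in M. T (s k) x = R (s k) x" for k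
    proof (rule Gunique[OF GT])
      show sk: "s k \<in> Lp p M" using s2(2) by (simp add: Lp_tendsto_def)
      have "Lp_tendsto p M (\<lambda>_. s k) (s k)" "Lp_tendsto p M (\<lambda>_. R (s k)) (R (s k))"
        using sk bound[OF s(1)[of k]] p1 by (auto simp: Lp_tendsto_def)
      then show "G (s k) (R (s k))" unfolding G_def using s(1)[of k] by (intro exI[of _ "\<lambda>_. s k"] conjI allI)
    qed simp
    have "T f \<in> Lp p M" using Gmem(2)[OF GT] f by simp
    then have "Lp_tendsto p M (\<lambda>k. R (s k)) (T f)"
      by (intro Lp_tendsto_cong_AE[OF Ts Rm _ TR]) (auto simp: s(1) Lp_measurable)
    \<comment> \<open>The images converge in L^p to \<open>T f\<close> and in L^2 to
      \<open>R f\<close>; the two limits are compared in L^1.\<close>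
    then have 1: "Lp_tendsto 1 M (\<lambda>k. R (s k)) (T f)" by (rule Lp_tendsto_mono_exponent[OF M]) (use p1 in auto)
    have "Lp_tendsto 2 M (\<lambda>k. R (s k)) (R f)" by (rule Lp_bounded_linear_tendsto[OF R s2(1)]) simp
    then have 2: "Lp_tendsto 1 M (\<lambda>k. R (s k)) (R f)" by (rule Lp_tendsto_mono_exponent[OF M]) auto
    show ?thesis by (rule Lp_tendsto_unique[OF 1 2]) simp
  qed
  have T: "Lp_extension p M R T" unfolding Lp_extension_def using lin ext by blast
  have "AE x in M. S f x = T f x" if S: "Lp_extension p M R S" and f: "f \<in> Lp p M" for S f
  proof -
    obtain s where s: "\<And>k. s k \<in> D" "Lp_tendsto p M s f" using dense[OF p f] by auto
    show ?thesis by (rule Lp_extension_unique[OF T S p1(1) _ s(2)]) (simp add: D[OF s(1)] p)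
  qed
  moreover have "Lp_opnorm p M T \<le> C"
    unfolding Lp_opnorm_def
  proof (rule cSUP_least)
    show "Lp p M \<noteq> {}" using Lp_zero[OF p1(2), of M] by blast
    fix f assume "f \<in> Lp p M"
    then have "Lp_norm p M (T f) \<le> C * Lp_norm p M f" by (intro Gbound GT)
    then show "Lp_norm p M (T f) / Lp_norm p M f \<le> C"
      using C order_le_neq_trans[OF Lp_norm_nonneg[of p M f]] by (cases "Lp_norm p M f = 0") (auto simp: divide_le_eq)
  qed
  ultimately show ?thesis using T by blast
qed

section \<open>Bessel functions\<close>

definition bessel_coeff :: "real \<Rightarrow> nat \<Rightarrow> real" where
  "bessel_coeff \<nu> m = (- 1 / 4) ^ m / (fact m * Gamma (real m + \<nu> + 1))"

text \<open>\<open>J\<^sub>\<nu>(x) = (x / 2)\<^sup>\<nu> bessel_E \<nu> x\<close>, where \<open>bessel_E \<nu>\<close> is entire and even, with derivative \<open>bessel_E1 \<nu>\<close>.\<close>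

definition bessel_F :: "real \<Rightarrow> real \<Rightarrow> real" where
  "bessel_F \<nu> s = (\<Sum>m. bessel_coeff \<nu> m * s ^ m)"

definition bessel_E :: "real \<Rightarrow> real \<Rightarrow> real" where
  "bessel_E \<nu> x = bessel_F \<nu> (x\<^sup>2)"

definition bessel_E1 :: "real \<Rightarrow> real \<Rightarrow> real" where
  "bessel_E1 \<nu> x = - (x / 2) * bessel_E (\<nu> + 1) x"

lemma Gamma_add_one_pos:
  fixes \<nu> :: real assumes "- 1 / 2 \<le> \<nu>" shows "0 < Gamma (real m + \<nu> + 1)"
  using assms by (intro Gamma_real_pos) simp

lemma Gamma_Suc_shift:
  fixes \<nu> :: real assumes "- 1 / 2 \<le> \<nu>"
  shows "Gamma (real m + \<nu> + 2) = (real m + \<nu> + 1) * Gamma (real m + \<nu> + 1)"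
proof -
  have "real m + \<nu> + 1 \<notin> \<int>\<^sub>\<le>\<^sub>0" using assms by (auto elim!: nonpos_Ints_cases)
  from Gamma_plus1[OF this] show ?thesis by (simp add: add.assoc)
qed

text \<open>The factors m + \<nu> + 1 in the recursion of the Gamma function are at least 1/2, so it
  loses at most a factor 2 per step, and the factorial wins.\<close>

lemma summable_bessel_coeff:
  assumes "- 1 / 2 \<le> \<nu>"
  shows "summable (\<lambda>m. bessel_coeff \<nu> m * s ^ m)"
proof -
  have G: "Gamma (\<nu> + 1) / 2 ^ m \<le> Gamma (real m + \<nu> + 1)" for m
  proof (induction m)
    case (Suc m)
    have "Gamma (\<nu> + 1) / 2 ^ Suc m = 1 / 2 * (Gamma (\<nu> + 1) / 2 ^ m)" by simp
    also have "\<dots> \<le> (real m + \<nu> + 1) * Gamma (real m + \<nu> + 1)"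
      using Suc assms Gamma_add_one_pos[OF assms, of 0] by (intro mult_mono) auto
    also have "\<dots> = Gamma (real (Suc m) + \<nu> + 1)" using Gamma_Suc_shift[OF assms, of m] by (simp add: algebra_simps)
    finally show ?case .
  qed simp
  have G0: "0 < Gamma (\<nu> + 1)" using Gamma_add_one_pos[OF assms, of 0] by simp
  have "summable (\<lambda>m. 1 / Gamma (\<nu> + 1) * (inverse (fact m) * (\<bar>s\<bar> / 2) ^ m))"
    by (intro summable_mult summable_exp)
  then show ?thesis
  proof (rule summable_comparison_test'[where N=0])
    fix m :: nat
    have "norm (bessel_coeff \<nu> m * s ^ m) = (1 / 4) ^ m * \<bar>s\<bar> ^ m / (fact m * Gamma (real m + \<nu> + 1))"
      using Gamma_add_one_pos[OF assms, of m] by (simp add: bessel_coeff_def abs_mult power_abs)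
    also have "\<dots> \<le> (1 / 4) ^ m * \<bar>s\<bar> ^ m / (fact m * (Gamma (\<nu> + 1) / 2 ^ m))"
      using G[of m] G0 by (intro divide_left_mono mult_left_mono mult_pos_pos) (auto simp: Gamma_add_one_pos[OF assms])
    also have "\<dots> = 1 / Gamma (\<nu> + 1) * (inverse (fact m) * ((2 * (1 / 4)) ^ m * \<bar>s\<bar> ^ m))"
      unfolding power_mult_distrib[of 2 "1/4"] by (simp add: field_simps)
    also have "\<dots> = 1 / Gamma (\<nu> + 1) * (inverse (fact m) * (\<bar>s\<bar> / 2) ^ m)"
      by (simp add: power_divide power_mult_distrib[symmetric])
    finally show "norm (bessel_coeff \<nu> m * s ^ m) \<le> 1 / Gamma (\<nu> + 1) * (inverse (fact m) * (\<bar>s\<bar> / 2) ^ m)" .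
  qed
qed

lemma bessel_coeff_shift:
  assumes "- 1 / 2 \<le> \<nu>"
  shows "bessel_coeff \<nu> m = (real m + \<nu> + 1) * bessel_coeff (\<nu> + 1) m"
    "real (Suc m) * bessel_coeff \<nu> (Suc m) = - 1 / 4 * bessel_coeff (\<nu> + 1) m"
proof -
  have "Gamma (real m + (\<nu> + 1) + 1) = (real m + \<nu> + 1) * Gamma (real m + \<nu> + 1)"
    using Gamma_Suc_shift[OF assms, of m] by (simp add: algebra_simps)
  moreover have "0 < real m + \<nu> + 1" using assms by simp
  ultimately show "bessel_coeff \<nu> m = (real m + \<nu> + 1) * bessel_coeff (\<nu> + 1) m"
    by (simp add: bessel_coeff_def)
  have e: "real (Suc m) + \<nu> + 1 = real m + (\<nu> + 1) + 1" by simp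
  show "real (Suc m) * bessel_coeff \<nu> (Suc m) = - 1 / 4 * bessel_coeff (\<nu> + 1) m"
    unfolding bessel_coeff_def e by (simp add: field_simps del: of_nat_Suc)
qed

lemma DERIV_bessel_F:
  assumes "- 1 / 2 \<le> \<nu>"
  shows "(bessel_F \<nu> has_real_derivative - 1 / 4 * bessel_F (\<nu> + 1) s) (at s)"
proof -
  have "((\<lambda>s. \<Sum>m. bessel_coeff \<nu> m * s ^ m) has_real_derivative (\<Sum>m. diffs (bessel_coeff \<nu>) m * s ^ m)) (at s)"
    by (rule termdiffs_strong_converges_everywhere[OF summable_bessel_coeff[OF assms]])
  also have "(\<Sum>m. diffs (bessel_coeff \<nu>) m * s ^ m) = (\<Sum>m. - 1 / 4 * (bessel_coeff (\<nu> + 1) m * s ^ m))"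
    using bessel_coeff_shift(2)[OF assms] by (simp add: diffs_def del: of_nat_Suc)
  also have "\<dots> = - 1 / 4 * bessel_F (\<nu> + 1) s"
    unfolding bessel_F_def using assms by (intro suminf_mult summable_bessel_coeff) simp
  finally show ?thesis unfolding bessel_F_def .
qed

text \<open>Since differentiation takes \<open>bessel_F \<nu>\<close> to - 1/4 times
  \<open>bessel_F (\<nu> + 1)\<close>, this is the equation 4 s F'' + 4 (\<nu> + 1) F' + F = 0. It
  holds coefficient by coefficient.\<close>

lemma bessel_F_recurrence:
  assumes "- 1 / 2 \<le> \<nu>"
  shows "s / 4 * bessel_F (\<nu> + 2) s - (\<nu> + 1) * bessel_F (\<nu> + 1) s + bessel_F \<nu> s = 0"
proof -
  let ?c = "\<lambda>m. - real m * bessel_coeff (\<nu> + 1) m"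
  have "(\<lambda>m. bessel_coeff (\<nu> + 2) m * s ^ m) sums bessel_F (\<nu> + 2) s"
    unfolding bessel_F_def using assms by (intro summable_sums summable_bessel_coeff) simp
  then have "(\<lambda>m. s / 4 * (bessel_coeff (\<nu> + 2) m * s ^ m)) sums (s / 4 * bessel_F (\<nu> + 2) s)"
    by (rule sums_mult)
  also have "(\<lambda>m. s / 4 * (bessel_coeff (\<nu> + 2) m * s ^ m)) = (\<lambda>m. ?c (Suc m) * s ^ Suc m)"
  proof
    fix m
    have e: "real (Suc m) * bessel_coeff (\<nu> + 1) (Suc m) = - 1 / 4 * bessel_coeff (\<nu> + 2) m"
      using bessel_coeff_shift(2)[of "\<nu> + 1" m] assms by (simp add: add.assoc)
    have "?c (Suc m) = 1 / 4 * bessel_coeff (\<nu> + 2) m" unfolding mult_minus_left e by simp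
    then show "s / 4 * (bessel_coeff (\<nu> + 2) m * s ^ m) = ?c (Suc m) * s ^ Suc m" by (simp only: power_Suc) simp
  qed
  \<comment> \<open>The index may be shifted because the term of index 0 vanishes.\<close>
  finally have 1: "(\<lambda>m. ?c m * s ^ m) sums (s / 4 * bessel_F (\<nu> + 2) s)"
    by (subst (asm) sums_Suc_iff) simp
  have 2: "(\<lambda>m. (\<nu> + 1) * (bessel_coeff (\<nu> + 1) m * s ^ m)) sums ((\<nu> + 1) * bessel_F (\<nu> + 1) s)"
    unfolding bessel_F_def using assms by (intro sums_mult summable_sums summable_bessel_coeff) simp
  have 3: "(\<lambda>m. bessel_coeff \<nu> m * s ^ m) sums bessel_F \<nu> s"
    unfolding bessel_F_def using assms by (intro summable_sums summable_bessel_coeff)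
  have "(\<lambda>m. ?c m * s ^ m - (\<nu> + 1) * (bessel_coeff (\<nu> + 1) m * s ^ m) + bessel_coeff \<nu> m * s ^ m) sums
     (s / 4 * bessel_F (\<nu> + 2) s - (\<nu> + 1) * bessel_F (\<nu> + 1) s + bessel_F \<nu> s)"
    by (intro sums_add sums_diff 1 2 3)
  also have "(\<lambda>m. ?c m * s ^ m - (\<nu> + 1) * (bessel_coeff (\<nu> + 1) m * s ^ m) + bessel_coeff \<nu> m * s ^ m) = (\<lambda>m. 0)"
    using bessel_coeff_shift(1)[OF assms] by (simp add: algebra_simps)
  finally show ?thesis using sums_unique2 sums_zero by blast
qed

lemma bessel_J_eq:
  assumes "- 1 / 2 \<le> \<nu>" "0 < x"
  shows "bessel_J \<nu> x = (x / 2) powr \<nu> * bessel_E \<nu> x"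
proof -
  have "(- 1) ^ m / (fact m * Gamma (real m + \<nu> + 1)) * (x / 2) powr (2 * real m + \<nu>) =
      (x / 2) powr \<nu> * (bessel_coeff \<nu> m * (x\<^sup>2) ^ m)" for m
  proof -
    have "(x / 2) powr (2 * real m + \<nu>) = (x / 2) powr real (2 * m) * (x / 2) powr \<nu>"
      by (simp add: powr_add)
    also have "(x / 2) powr real (2 * m) = (x / 2) ^ (2 * m)" using assms by (intro powr_realpow) simp
    also have "\<dots> = (x\<^sup>2 * (1 / 4)) ^ m" by (simp add: power_mult power_divide)
    also have "\<dots> = (x\<^sup>2) ^ m * (1 / 4) ^ m" by (rule power_mult_distrib)
    finally have "(x / 2) powr (2 * real m + \<nu>) = (x\<^sup>2) ^ m * (1 / 4) ^ m * (x / 2) powr \<nu>" .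
    moreover have "(- 1 / 4 :: real) ^ m = (- 1) ^ m * (1 / 4) ^ m" by (simp add: power_mult_distrib[symmetric])
    ultimately show ?thesis by (simp add: bessel_coeff_def)
  qed
  then show ?thesis unfolding bessel_J_def bessel_E_def bessel_F_def
    using suminf_mult[OF summable_bessel_coeff[OF assms(1)]] by simp
qed

lemma DERIV_bessel_E:
  assumes "- 1 / 2 \<le> \<nu>"
  shows "(bessel_E \<nu> has_real_derivative bessel_E1 \<nu> x) (at x)"
proof -
  have "((\<lambda>x. bessel_F \<nu> (x\<^sup>2)) has_real_derivative - 1 / 4 * bessel_F (\<nu> + 1) (x\<^sup>2) * (2 * x)) (at x)"
    by (rule DERIV_chain2[OF DERIV_bessel_F[OF assms]]) (auto intro!: derivative_eq_intros)
  then show ?thesis unfolding bessel_E_def[abs_def] bessel_E1_def by simp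
qed

text \<open>In this form the second derivative involves no division by x, so it is available at 0,
  where continuity of \<open>bessel_E1\<close> is needed as well.\<close>

lemma DERIV_bessel_E1:
  assumes "- 1 / 2 \<le> \<nu>"
  shows "(bessel_E1 \<nu> has_real_derivative (\<nu> + 1 / 2) * bessel_E (\<nu> + 1) x - bessel_E \<nu> x) (at x)"
proof -
  have "((\<lambda>x. - (x / 2) * bessel_E (\<nu> + 1) x) has_real_derivative
      (- (1 / 2) * bessel_E (\<nu> + 1) x + bessel_E1 (\<nu> + 1) x * (- (x / 2)))) (at x)"
    using assms by (intro DERIV_mult DERIV_bessel_E) (auto intro!: derivative_eq_intros)
  moreover have "- (1 / 2) * bessel_E (\<nu> + 1) x + bessel_E1 (\<nu> + 1) x * (- (x / 2)) =
      (\<nu> + 1 / 2) * bessel_E (\<nu> + 1) x - bessel_E \<nu> x"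
    using bessel_F_recurrence[OF assms, of "x\<^sup>2"] unfolding bessel_E_def bessel_E1_def
    by (simp add: power2_eq_square field_simps)
  ultimately show ?thesis unfolding bessel_E1_def[abs_def] by simp
qed

lemma bessel_E_0: "bessel_E \<nu> 0 = 1 / Gamma (\<nu> + 1)"
  unfolding bessel_E_def bessel_F_def using powser_zero[of "bessel_coeff \<nu>"] by (simp add: bessel_coeff_def)

subsection \<open>Zeros\<close>

locale bessel_order =
  fixes \<nu> :: real
  assumes nu: "- 1 / 2 \<le> \<nu>"
begin

abbreviation "E \<equiv> bessel_E \<nu>"
abbreviation "E1 \<equiv> bessel_E1 \<nu>"
abbreviation "\<beta> \<equiv> 2 * \<nu> + 1"

lemma beta_nonneg: "0 \<le> \<beta>" using nu by simp

lemma E0_pos: "0 < E 0"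
  using Gamma_add_one_pos[OF nu, of 0] by (simp add: bessel_E_0)

lemma E1_0 [simp]: "E1 0 = 0" by (simp add: bessel_E1_def)

lemmas DERIV_E = DERIV_bessel_E[OF nu]

text \<open>Bessel's equation as E'' + (\<beta> / x) E' + E = 0: an oscillator with friction, or the
  radial eigenvalue equation in dimension \<beta> + 1.\<close>

lemma DERIV_E1: "x \<noteq> 0 \<Longrightarrow> (E1 has_real_derivative - E x - \<beta> / x * E1 x) (at x)"
  using DERIV_bessel_E1[OF nu, of x] by (simp add: bessel_E1_def algebra_simps add_divide_distrib)

lemma continuous_E: "continuous_on S E" "continuous_on S E1"
  using DERIV_E DERIV_bessel_E1[OF nu] by (auto intro!: DERIV_continuous_on[where f=E] DERIV_continuous_on[where f=E1] intro: DERIV_subset)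

lemma continuous_E_compose [continuous_intros]:
  "continuous_on S f \<Longrightarrow> continuous_on S (\<lambda>x. E (f x))"
  "continuous_on S f \<Longrightarrow> continuous_on S (\<lambda>x. E1 (f x))"
  by (rule continuous_on_compose2[OF continuous_E(1)[of UNIV]] continuous_on_compose2[OF continuous_E(2)[of UNIV]]; simp)+

text \<open>Friction makes the energy decrease, and at 0 the derivative contributes nothing to
  it.\<close>

lemma energy_le:
  assumes "0 \<le> x"
  shows "(E x)\<^sup>2 + (E1 x)\<^sup>2 \<le> (E 0)\<^sup>2"
proof -
  have "(E x)\<^sup>2 + (E1 x)\<^sup>2 \<le> (E 0)\<^sup>2 + (E1 0)\<^sup>2"
  proof (rule DERIV_nonpos_imp_decreasing_open[OF assms])
    fix y assume y: "0 < y" "y < x"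
    have A: "((\<lambda>y. (E y)\<^sup>2 + (E1 y)\<^sup>2) has_real_derivative 2 * E y * E1 y + 2 * E1 y * (- E y - \<beta> / y * E1 y)) (at y)"
      using y by (auto intro!: derivative_eq_intros DERIV_E DERIV_E1)
    have B: "2 * E y * E1 y + 2 * E1 y * (- E y - \<beta> / y * E1 y) = - (2 * (\<beta> / y) * (E1 y)\<^sup>2)"
      by (simp add: algebra_simps power2_eq_square)
    have C: "- (2 * (\<beta> / y) * (E1 y)\<^sup>2) \<le> 0" using y beta_nonneg by simp
    show "\<exists>z. ((\<lambda>y. (E y)\<^sup>2 + (E1 y)\<^sup>2) has_real_derivative z) (at y) \<and> z \<le> 0" using A C unfolding B by blast
  qed (intro continuous_intros continuous_E)
  then show ?thesis by simp
qed

lemma abs_E_le: "0 \<le> x \<Longrightarrow> \<bar>E x\<bar> \<le> E 0" "0 \<le> x \<Longrightarrow> \<bar>E1 x\<bar> \<le> E 0"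
proof -
  assume "0 \<le> x"
  from energy_le[OF this] have "(E x)\<^sup>2 \<le> (E 0)\<^sup>2" "(E1 x)\<^sup>2 \<le> (E 0)\<^sup>2"
    by (auto intro: order_trans[rotated])
  then show "\<bar>E x\<bar> \<le> E 0" "\<bar>E1 x\<bar> \<le> E 0" using E0_pos by (auto simp: abs_le_square_iff[symmetric])
qed

text \<open>The weight outgrows the loss by friction, so a lower bound at one point persists at all
  later points.\<close>

lemma weighted_energy_mono:
  assumes "0 < x" "x \<le> y"
  shows "x powr (2 * \<beta>) * ((E x)\<^sup>2 + (E1 x)\<^sup>2) \<le> y powr (2 * \<beta>) * ((E y)\<^sup>2 + (E1 y)\<^sup>2)"
proof (rule DERIV_nonneg_imp_nondecreasing[OF assms(2)])
  fix z assume z: "x \<le> z" "z \<le> y"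
  then have z0: "0 < z" using assms by simp
  have A: "((\<lambda>z. z powr (2 * \<beta>) * ((E z)\<^sup>2 + (E1 z)\<^sup>2)) has_real_derivative
     (2 * \<beta>) * z powr (2 * \<beta> - 1) * ((E z)\<^sup>2 + (E1 z)\<^sup>2) +
       (2 * E z * E1 z + 2 * E1 z * (- E z - \<beta> / z * E1 z)) * z powr (2 * \<beta>)) (at z)"
    using z0 by (auto intro!: derivative_eq_intros DERIV_E DERIV_E1)
  have B: "(2 * \<beta>) * z powr (2 * \<beta> - 1) * ((E z)\<^sup>2 + (E1 z)\<^sup>2) +
       (2 * E z * E1 z + 2 * E1 z * (- E z - \<beta> / z * E1 z)) * z powr (2 * \<beta>) =
       2 * \<beta> * z powr (2 * \<beta>) / z * (E z)\<^sup>2"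
  proof -
    define b P where "b = \<beta>" and "P = z powr (2 * \<beta>)"
    have P: "z powr (2 * \<beta> - 1) = P / z" unfolding P_def using z0 powr_diff[of z "2 * \<beta>" 1] by simp
    show ?thesis unfolding P P_def[symmetric] unfolding b_def[symmetric] using z0
      by (simp add: field_simps power2_eq_square)
  qed
  have C: "0 \<le> 2 * \<beta> * z powr (2 * \<beta>) / z * (E z)\<^sup>2" using z0 beta_nonneg by simp
  show "\<exists>d. ((\<lambda>z. z powr (2 * \<beta>) * ((E z)\<^sup>2 + (E1 z)\<^sup>2)) has_real_derivative d) (at z) \<and> 0 \<le> d" using A C unfolding B by blast
qed

definition Z :: "real set" where "Z = {x. 0 < x \<and> E x = 0}"

lemma Z_bessel_J: "{y. 0 < y \<and> y \<le> x \<and> bessel_J \<nu> y = 0} = {y \<in> Z. y \<le> x}"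
  "0 < x \<and> bessel_J \<nu> x = 0 \<longleftrightarrow> x \<in> Z"
  using bessel_J_eq[OF nu] by (auto simp: Z_def)

lemma E_pos_near_0: "\<exists>d>0. \<forall>x. 0 \<le> x \<and> x < d \<longrightarrow> 0 < E x"
proof -
  have "isCont E 0" using DERIV_E by (rule DERIV_isCont)
  then have "\<forall>\<^sub>F x in at 0. 0 < E x" using E0_pos by (auto simp: isCont_def dest: order_tendstoD)
  then obtain d where "0 < d" "\<And>x. x \<noteq> 0 \<Longrightarrow> dist x 0 < d \<Longrightarrow> 0 < E x" by (auto simp: eventually_at)
  then show ?thesis using E0_pos by (intro exI[of _ d]) (metis abs_of_nonneg dist_0_norm dist_commute real_norm_def)
qed

text \<open>\<open>x\<^sup>2\<^sup>\<beta>(E\<^sup>2 + E1\<^sup>2)\<close> is nondecreasing, so it is bounded below at all zeros; in particular they are simple.\<close>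

lemma E1_zero_lower: "\<exists>c>0. \<forall>z\<in>Z. c \<le> z powr \<beta> * \<bar>E1 z\<bar>"
proof -
  obtain d where d: "0 < d" "\<And>x. 0 \<le> x \<Longrightarrow> x < d \<Longrightarrow> 0 < E x" using E_pos_near_0 by blast
  define c where "c = (d / 2) powr \<beta> * E (d / 2)"
  have E: "0 < E (d / 2)" using d by simp
  have "c \<le> z powr \<beta> * \<bar>E1 z\<bar>" if z: "z \<in> Z" for z
  proof -
    have z': "0 < z" "E z = 0" "d \<le> z" using z d(2)[of z] by (auto simp: Z_def not_less[symmetric])
    have sq: "t powr (2 * \<beta>) = (t powr \<beta>)\<^sup>2" for t :: real
      unfolding power2_eq_square powr_add[symmetric] by simp
    have "c\<^sup>2 \<le> (d / 2) powr (2 * \<beta>) * ((E (d / 2))\<^sup>2 + (E1 (d / 2))\<^sup>2)"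
      unfolding c_def sq power_mult_distrib by (intro mult_left_mono) auto
    also have "\<dots> \<le> z powr (2 * \<beta>) * ((E z)\<^sup>2 + (E1 z)\<^sup>2)"
      using d z' by (intro weighted_energy_mono) auto
    also have "\<dots> = (z powr \<beta> * \<bar>E1 z\<bar>)\<^sup>2" using z' unfolding sq by (simp add: power_mult_distrib)
    finally show ?thesis by (rule power2_le_imp_le) simp
  qed
  moreover have "0 < c" using d E by (simp add: c_def)
  ultimately show ?thesis by blast
qed

lemma E1_zero_nonzero: "z \<in> Z \<Longrightarrow> E1 z \<noteq> 0"
  using E1_zero_lower by fastforce

text \<open>Comparison of \<open>x powr (\<nu> + 1 / 2) * E x\<close> with \<open>sin ((x - a) / 2)\<close> on a period.\<close>

lemma Z_unbounded: "\<exists>z\<in>Z. a < z"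
proof (rule ccontr)
  assume "\<not> (\<exists>z\<in>Z. a < z)"
  then have nz: "E x \<noteq> 0" if "0 < x" "a < x" for x using that by (auto simp: Z_def)
  \<comment> \<open>From 2 |\<nu>| on, (\<nu>^2 - 1/4) / x^2 is at most 1/4, so the equation for
    \<open>y\<close> below oscillates at least as fast as with the potential 3/4.\<close>
  define b where "b = max (\<bar>a\<bar> + 1) (2 * \<bar>\<nu>\<bar>)"
  have b: "0 < b" "a < b" "2 * \<bar>\<nu>\<bar> \<le> b" by (auto simp: b_def)
  define c where "c = b + 2 * pi"
  have bc: "b < c" using pi_gt_zero by (simp add: c_def)
  define \<sigma> where "\<sigma> = sgn (E b)"
  have pos: "0 < \<sigma> * E x" if x: "b \<le> x" for x
  proof (rule ccontr)
    assume n: "\<not> 0 < \<sigma> * E x"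
    have b0: "0 < \<sigma> * E b" using nz[of b] b by (auto simp: \<sigma>_def sgn_if)
    have "\<exists>y. b \<le> y \<and> y \<le> x \<and> \<sigma> * E y = 0"
      using n b0 x by (intro IVT2') (auto intro!: continuous_intros continuous_E)
    then obtain y where "b \<le> y" "\<sigma> * E y = 0" by auto
    then show False using nz[of y] b b0 by auto
  qed
  \<comment> \<open>Multiplication by x^(\<nu> + 1/2) removes the first-order term from the
    equation.\<close>
  define k where "k = \<nu> + 1 / 2"
  define y y1 where "y x = x powr k * (\<sigma> * E x)"
    and "y1 x = k * x powr (k - 1) * (\<sigma> * E x) + x powr k * (\<sigma> * E1 x)" for x
  have dy: "(y has_real_derivative y1 x) (at x)" if "0 < x" for x
    unfolding y_def y1_def using that by (auto intro!: derivative_eq_intros DERIV_E)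
  have dy1: "(y1 has_real_derivative (k * (k - 1) / x\<^sup>2 - 1) * y x) (at x)" if "0 < x" for x
  proof -
    have dE1: "(E1 has_real_derivative - E x - 2 * k / x * E1 x) (at x)"
      using DERIV_E1[of x] that by (simp add: k_def algebra_simps)
    have "(y1 has_real_derivative k * ((k - 1) * x powr (k - 1 - 1) * (\<sigma> * E x) + x powr (k - 1) * (\<sigma> * E1 x)) +
       (k * x powr (k - 1) * (\<sigma> * E1 x) + x powr k * (\<sigma> * (- E x - 2 * k / x * E1 x)))) (at x)"
      unfolding y1_def[abs_def]
      by (rule has_real_derivative_powr[OF that] DERIV_E dE1 derivative_eq_intros refl)+ (simp add: algebra_simps)
    moreover have pw: "x powr (k - 1 - 1) = x powr k / x\<^sup>2" "x powr (k - 1) = x powr k / x"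
      using that powr_diff[of x k 1] powr_diff[of x "k - 1" 1] by (auto simp: power2_eq_square)
    moreover have "k * ((k - 1) * (P / x\<^sup>2) * (\<sigma> * E x) + P / x * (\<sigma> * E1 x)) +
       (k * (P / x) * (\<sigma> * E1 x) + P * (\<sigma> * (- E x - 2 * k / x * E1 x))) =
       (k * (k - 1) / x\<^sup>2 - 1) * (P * (\<sigma> * E x))" for P
      using that by (simp add: field_simps power2_eq_square)
    ultimately show ?thesis unfolding y_def pw by (simp only:)
  qed
  \<comment> \<open>The Wronskian of \<open>y\<close> and the slower sine. It cannot increase while
    \<open>y\<close> is positive, yet over half a period of the sine it goes from - y(b) / 2 to y(c)
    / 2.\<close>
  define W where "W x = y1 x * sin ((x - b) / 2) - y x * (cos ((x - b) / 2) / 2)" for x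
  have dW: "(W has_real_derivative (k * (k - 1) / x\<^sup>2 - 1 + 1 / 4) * y x * sin ((x - b) / 2)) (at x)" if "0 < x" for x
    unfolding W_def[abs_def]
    by (rule derivative_eq_intros dy[OF that] dy1[OF that] refl | simp)+ (simp add: algebra_simps)
  have "W c \<le> W b"
  proof (rule DERIV_nonpos_imp_nonincreasing[OF less_imp_le[OF bc]])
    fix x assume x: "b \<le> x" "x \<le> c"
    then have x0: "0 < x" using b by simp
    have "k * (k - 1) = \<nu>\<^sup>2 - 1 / 4" by (simp add: k_def power2_eq_square algebra_simps)
    also have "\<dots> \<le> x\<^sup>2 / 4"
    proof -
      have "(2 * \<bar>\<nu>\<bar>)\<^sup>2 \<le> x\<^sup>2" using b x by (intro power_mono) auto
      then show ?thesis by (simp add: power_mult_distrib)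
    qed
    finally have "k * (k - 1) / x\<^sup>2 \<le> 1 / 4" using x0 by (simp add: field_simps)
    moreover have "0 \<le> sin ((x - b) / 2)" using x by (intro sin_ge_zero) (auto simp: c_def)
    moreover have "0 \<le> y x" using pos[OF x(1)] by (simp add: y_def)
    ultimately have "(k * (k - 1) / x\<^sup>2 - 1 + 1 / 4) * y x * sin ((x - b) / 2) \<le> 0"
      by (intro mult_nonpos_nonneg) auto
    then show "\<exists>d. (W has_real_derivative d) (at x) \<and> d \<le> 0" using dW[OF x0] by blast
  qed
  moreover have "W b = - y b / 2" "W c = y c / 2" by (auto simp: W_def c_def)
  moreover have "0 < y b" "0 < y c" using pos[of b] pos[of c] b bc by (auto simp: y_def)
  ultimately show False by simp
qed

end

section \<open>The Fourier-Bessel system\<close>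

definition c1_on01 :: "(real \<Rightarrow> real) \<Rightarrow> (real \<Rightarrow> real) \<Rightarrow> bool" where
  "c1_on01 f f' \<longleftrightarrow> (\<forall>x\<in>{0..1}. (f has_real_derivative f' x) (at x within {0..1})) \<and> continuous_on {0..1} f'"

lemma c1_continuous: "c1_on01 f f' \<Longrightarrow> continuous_on {0..1} f" "c1_on01 f f' \<Longrightarrow> continuous_on {0..1} f'"
  unfolding c1_on01_def by (blast intro: DERIV_continuous_on)+

lemma c1_deriv: "c1_on01 f f' \<Longrightarrow> 0 < x \<Longrightarrow> x < 1 \<Longrightarrow> (f has_real_derivative f' x) (at x)"
  unfolding c1_on01_def by (metis at_within_Icc_at atLeastAtMost_iff less_imp_le)

lemma c1_add: "c1_on01 f f' \<Longrightarrow> c1_on01 g g' \<Longrightarrow> c1_on01 (\<lambda>x. f x + g x) (\<lambda>x. f' x + g' x)"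
  unfolding c1_on01_def by (auto intro!: derivative_intros continuous_intros)

lemma c1_cmult: "c1_on01 f f' \<Longrightarrow> c1_on01 (\<lambda>x. c * f x) (\<lambda>x. c * f' x)"
  unfolding c1_on01_def by (auto intro!: derivative_intros continuous_intros DERIV_cmult)

lemma c1_zero: "c1_on01 (\<lambda>x. 0) (\<lambda>x. 0)"
  unfolding c1_on01_def by auto

lemma c1_sum:
  assumes "\<And>i. i \<in> I \<Longrightarrow> c1_on01 (f i) (f' i)"
  shows "c1_on01 (\<lambda>x. \<Sum>i\<in>I. f i x) (\<lambda>x. \<Sum>i\<in>I. f' i x)"
  using assms
proof (induction I rule: infinite_finite_induct)
  case (insert i I)
  then show ?case using c1_add[of "f i" "f' i" "\<lambda>x. \<Sum>i\<in>I. f i x" "\<lambda>x. \<Sum>i\<in>I. f' i x"] by simp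
qed (auto simp: c1_zero)

lemma c1_from_DERIV:
  assumes "\<And>x. (f has_real_derivative f' x) (at x)" "continuous_on {0..1} f'"
  shows "c1_on01 f f'"
  using assms unfolding c1_on01_def by (blast intro: DERIV_subset)

text \<open>Gaussian elimination: a pivot \<open>y0\<close> of the equation \<open>x\<close> is
  eliminated from the other equations. It supplies the nontrivial combination in
  \<open>orthogonal_poincare\<close>.\<close>

lemma underdetermined_system:
  fixes A :: "'a \<Rightarrow> 'b \<Rightarrow> real"
  assumes "finite T" "finite S" "card T < card S"
  shows "\<exists>b. (\<exists>y\<in>S. b y \<noteq> 0) \<and> (\<forall>x\<in>T. (\<Sum>y\<in>S. b y * A y x) = 0)"
  using assms
proof (induction T arbitrary: S A rule: finite_induct)
  case empty
  then have "S \<noteq> {}" by auto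
  then show ?case by (intro exI[of _ "\<lambda>_. 1"]) auto
next
  case (insert x T)
  show ?case
  proof (cases "\<forall>y\<in>S. A y x = 0")
    case True
    have "card T < card S" using insert by simp
    from insert.IH[OF insert.prems(1) this, of A] True show ?thesis by auto
  next
    case False
    then obtain y0 where y0: "y0 \<in> S" "A y0 x \<noteq> 0" by auto
    define S' where "S' = S - {y0}"
    define A' where "A' y z = A y z - A y x / A y0 x * A y0 z" for y z
    have "card T < card S'" using insert y0 by (simp add: S'_def)
    from insert.IH[OF _ this, of A'] insert.prems obtain b
      where b: "\<exists>y\<in>S'. b y \<noteq> 0" "\<And>z. z \<in> T \<Longrightarrow> (\<Sum>y\<in>S'. b y * A' y z) = 0"
      by (auto simp: S'_def)
    define c where "c = - (\<Sum>y\<in>S'. b y * A y x) / A y0 x"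
    define b' where "b' y = (if y = y0 then c else b y)" for y
    have sum: "(\<Sum>y\<in>S. b' y * A y z) = c * A y0 z + (\<Sum>y\<in>S'. b y * A y z)" for z
    proof -
      have "(\<Sum>y\<in>S. b' y * A y z) = b' y0 * A y0 z + (\<Sum>y\<in>S'. b' y * A y z)"
        unfolding S'_def using insert.prems y0 by (intro sum.remove) auto
      also have "(\<Sum>y\<in>S'. b' y * A y z) = (\<Sum>y\<in>S'. b y * A y z)"
        by (intro sum.cong) (auto simp: S'_def b'_def)
      finally show ?thesis by (simp add: b'_def)
    qed
    have "(\<Sum>y\<in>S. b' y * A y z) = 0" if "z \<in> insert x T" for z
    proof (cases "z = x")
      case True then show ?thesis using y0 sum[of x] by (simp add: c_def)
    next
      case False
      have "(\<Sum>y\<in>S'. b y * A y z) = (\<Sum>y\<in>S'. b y * A' y z + b y * A y x * (A y0 z / A y0 x))"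
        by (intro sum.cong) (auto simp: A'_def algebra_simps)
      also have "\<dots> = (\<Sum>y\<in>S'. b y * A y x) * (A y0 z / A y0 x)"
        using b(2)[of z] False that by (simp add: sum.distrib sum_distrib_right sum_divide_distrib)
      finally show ?thesis unfolding sum by (simp add: c_def)
    qed
    moreover have "\<exists>y\<in>S. b' y \<noteq> 0" using b(1) by (auto simp: S'_def b'_def)
    ultimately show ?thesis by blast
  qed
qed

context bessel_order
begin

text \<open>For \<nu> = - 1/2 the power would be 0 powr 0 = 0 at the origin; the case distinction
  makes the weight continuous there.\<close>

definition wt :: "real \<Rightarrow> real" where "wt x = (if \<nu> = - 1 / 2 then 1 else x powr \<beta>)"

lemma wt_pos_eq: "0 < x \<Longrightarrow> wt x = x powr \<beta>"
  by (simp add: wt_def)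

lemma wt_pos: "0 < x \<Longrightarrow> 0 < wt x"
  by (simp add: wt_pos_eq)

lemma wt_nonneg [simp]: "0 \<le> wt x"
  by (simp add: wt_def)

lemma wt_1 [simp]: "wt 1 = 1"
  by (simp add: wt_def)

lemma wt_le_1: "0 \<le> x \<Longrightarrow> x \<le> 1 \<Longrightarrow> wt x \<le> 1"
  using nu by (auto simp: wt_def intro: powr_le1)

lemma continuous_wt: "continuous_on {0..} wt"
proof (cases "\<nu> = - 1 / 2")
  case True then show ?thesis unfolding wt_def[abs_def] by simp
next
  case False
  then have "0 < \<beta>" using nu by simp
  have "continuous_on {0..} (\<lambda>x. x powr \<beta>)"
    by (rule continuous_on_powr') (use \<open>0 < \<beta>\<close> in \<open>auto intro!: continuous_intros\<close>)
  then show ?thesis using False by (simp add: wt_def[abs_def])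
qed

lemma continuous_wt01 [continuous_intros]: "continuous_on {0..1} wt"
  by (rule continuous_on_subset[OF continuous_wt]) auto

lemma DERIV_wt:
  assumes "0 < x"
  shows "(wt has_real_derivative \<beta> / x * wt x) (at x)"
proof -
  have "((\<lambda>x. x powr \<beta>) has_real_derivative \<beta> / x * wt x) (at x)"
    using has_real_derivative_powr[OF assms, of \<beta>] powr_diff[of x \<beta> 1] assms by (simp add: wt_pos_eq)
  then show ?thesis
    by (rule has_field_derivative_transform_within_open[of _ _ _ "{0<..}"]) (use assms in \<open>auto simp: wt_pos_eq\<close>)
qed

section \<open>The weighted inner product\<close>

definition ip :: "(real \<Rightarrow> real) \<Rightarrow> (real \<Rightarrow> real) \<Rightarrow> real" where
  "ip f g = integral {0..1} (\<lambda>x. wt x * (f x * g x))"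

abbreviation "cont01 \<equiv> continuous_on {0..1::real} :: (real \<Rightarrow> real) \<Rightarrow> bool"

lemma ip_integrable: "cont01 f \<Longrightarrow> cont01 g \<Longrightarrow> (\<lambda>x. wt x * (f x * g x)) integrable_on {0..1}"
  by (intro integrable_continuous_real continuous_intros)

lemma ip_commute: "ip f g = ip g f"
  by (simp add: ip_def mult.commute)

lemma ip_add: "cont01 f \<Longrightarrow> cont01 g \<Longrightarrow> cont01 h \<Longrightarrow> ip f (\<lambda>x. g x + h x) = ip f g + ip f h"
  using integral_add[OF ip_integrable[of f g] ip_integrable[of f h]] by (simp add: ip_def algebra_simps)

lemma ip_cmult: "ip f (\<lambda>x. c * g x) = c * ip f g"
  unfolding ip_def integral_mult_right[symmetric] by (simp add: mult_ac)

lemma ip_cmult_square: "ip (\<lambda>x. c * f x) (\<lambda>x. c * f x) = c\<^sup>2 * ip f f"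
  using ip_cmult[of "\<lambda>x. c * f x" c f] ip_cmult[of f c f] ip_commute[of "\<lambda>x. c * f x" f]
  by (simp add: power2_eq_square)

lemma ip_sum:
  assumes "cont01 f" "\<And>i. i \<in> I \<Longrightarrow> cont01 (g i)"
  shows "ip f (\<lambda>x. \<Sum>i\<in>I. g i x) = (\<Sum>i\<in>I. ip f (g i))"
  using assms
proof (induction I rule: infinite_finite_induct)
  case (insert i I)
  then show ?case using ip_add[of f "g i" "\<lambda>x. \<Sum>i\<in>I. g i x"] by (simp add: continuous_on_sum)
qed (auto simp: ip_def)

lemma ip_nonneg: "cont01 f \<Longrightarrow> 0 \<le> ip f f"
  unfolding ip_def by (intro integral_nonneg ip_integrable) auto

lemma ip_eq_0:
  assumes "cont01 f" "ip f f = 0" "0 \<le> x" "x \<le> 1"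
  shows "f x = 0"
proof -
  have z: "f y = 0" if "0 < y" "y \<le> 1" for y
  proof -
    have "continuous_on {0..1} (\<lambda>x. wt x * (f x * f x))" by (intro continuous_intros assms(1))
    from integral_eq_0_iff[OF this] have "\<forall>y\<in>{0..1}. wt y * (f y * f y) = 0"
      using assms(2) by (simp add: ip_def)
    then have "wt y * (f y * f y) = 0" using that by simp
    then show ?thesis using wt_pos[OF that(1)] by simp
  qed
  show ?thesis
  proof (cases "x = 0")
    \<comment> \<open>The weight may vanish at 0, so there the continuity of \<open>f\<close>
      decides.\<close>
    case True
    have "((\<lambda>y. f y) \<longlongrightarrow> f 0) (at 0 within {0..1})" using assms(1) by (auto simp: continuous_on_def)
    moreover have "\<forall>\<^sub>F y in at 0 within {0..1}. f y = 0"
      by (auto simp: eventually_at_filter intro!: always_eventually z)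
    ultimately have "((\<lambda>y. 0) \<longlongrightarrow> f 0) (at 0 within {0..1::real})" by (rule Lim_transform_eventually)
    moreover have "at 0 within {0..1::real} \<noteq> bot" by (simp add: at_within_Icc_at_right)
    ultimately show ?thesis using True by (simp add: tendsto_const_iff)
  qed (use z assms in auto)
qed

lemma ip_bound:
  assumes "cont01 f" "cont01 g" "\<And>x. 0 \<le> x \<Longrightarrow> x \<le> 1 \<Longrightarrow> \<bar>f x\<bar> \<le> A" "\<And>x. 0 \<le> x \<Longrightarrow> x \<le> 1 \<Longrightarrow> \<bar>g x\<bar> \<le> B"
  shows "\<bar>ip f g\<bar> \<le> A * B"
proof -
  have "norm (ip f g) \<le> A * B * (1 - 0)"
    unfolding ip_def
  proof (rule integral_bound)
    show "continuous_on {0..1} (\<lambda>x. wt x * (f x * g x))" using assms by (intro continuous_intros)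
    fix x :: real assume x: "x \<in> {0..1}"
    have "\<bar>wt x\<bar> * (\<bar>f x\<bar> * \<bar>g x\<bar>) \<le> 1 * (A * B)"
      using x wt_le_1[of x] assms(3,4)[of x] by (intro mult_mono) auto
    then show "norm (wt x * (f x * g x)) \<le> A * B" by (simp add: abs_mult)
  qed simp
  then show ?thesis by simp
qed

text \<open>\<open>dG\<close> says that (wt G)' = wt h, so this is integration by parts.
  \<open>G 0 = 0\<close> removes the boundary term at 0, where \<open>wt\<close> need not
  vanish.\<close>

lemma ip_green:
  assumes f: "c1_on01 f f'" and G: "cont01 G" "G 0 = 0" and h: "cont01 h"
    and dG: "\<And>x. 0 < x \<Longrightarrow> x < 1 \<Longrightarrow> (G has_real_derivative h x - \<beta> / x * G x) (at x)"
  shows "ip f h = f 1 * G 1 - ip f' G"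
proof -
  have "((\<lambda>x. wt x * (f x * h x) + wt x * (f' x * G x)) has_integral wt 1 * f 1 * G 1 - wt 0 * f 0 * G 0) {0..1}"
  proof (rule fundamental_theorem_of_calculus_interior)
    show "continuous_on {0..1} (\<lambda>x. wt x * f x * G x)" by (intro continuous_intros G c1_continuous[OF f])
    fix x :: real assume x: "x \<in> {0<..<1}"
    have "((\<lambda>x. wt x * f x * G x) has_real_derivative
       ((\<beta> / x * wt x) * f x + f' x * wt x) * G x + (h x - \<beta> / x * G x) * (wt x * f x)) (at x)"
      using x by (intro DERIV_mult DERIV_wt c1_deriv[OF f] dG) auto
    moreover have "((\<beta> / x * wt x) * f x + f' x * wt x) * G x + (h x - \<beta> / x * G x) * (wt x * f x) =
        wt x * (f x * h x) + wt x * (f' x * G x)" by (simp add: algebra_simps)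
    ultimately show "((\<lambda>x. wt x * f x * G x) has_vector_derivative wt x * (f x * h x) + wt x * (f' x * G x)) (at x)"
      by (simp add: has_real_derivative_iff_has_vector_derivative)
  qed simp
  then have "integral {0..1} (\<lambda>x. wt x * (f x * h x) + wt x * (f' x * G x)) = f 1 * G 1"
    using G(2) by (simp add: integral_unique)
  moreover have "integral {0..1} (\<lambda>x. wt x * (f x * h x) + wt x * (f' x * G x)) = ip f h + ip f' G"
    unfolding ip_def by (intro integral_add ip_integrable G h c1_continuous[OF f])
  ultimately show ?thesis by simp
qed

section \<open>The eigenfunctions and their orthogonality\<close>

definition nrm :: "real \<Rightarrow> real" where "nrm z = sqrt 2 / \<bar>E1 z\<bar>"

text \<open>At the n-th zero this is \<open>bessel_phi \<nu> n\<close> on the positive axis (see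
  \<open>bessel_phi_eq\<close>), continued smoothly through 0.\<close>

definition u :: "real \<Rightarrow> real \<Rightarrow> real" where "u z x = nrm z * E (z * x)"

definition u1 :: "real \<Rightarrow> real \<Rightarrow> real" where "u1 z x = nrm z * (z * E1 (z * x))"

lemma nrm_pos: "z \<in> Z \<Longrightarrow> 0 < nrm z"
  using E1_zero_nonzero by (simp add: nrm_def)

lemma Z_pos: "z \<in> Z \<Longrightarrow> 0 < z" by (simp add: Z_def)

lemma u_at_1: "z \<in> Z \<Longrightarrow> u z 1 = 0" by (simp add: u_def Z_def)

lemma continuous_u: "continuous_on S (u z)" "continuous_on S (u1 z)"
  unfolding u_def[abs_def] u1_def[abs_def] by (intro continuous_intros)+

lemma DERIV_u: "(u z has_real_derivative u1 z x) (at x)"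
  unfolding u_def[abs_def] u1_def
  by (rule DERIV_cmult, rule DERIV_chain2[OF DERIV_E, THEN DERIV_cong]) (auto intro!: derivative_eq_intros)

lemma DERIV_u1: "0 < z \<Longrightarrow> 0 < x \<Longrightarrow> (u1 z has_real_derivative - z\<^sup>2 * u z x - \<beta> / x * u1 z x) (at x)"
proof -
  assume zx: "0 < z" "0 < x"
  have "((\<lambda>x. E1 (z * x)) has_real_derivative (- E (z * x) - \<beta> / (z * x) * E1 (z * x)) * z) (at x)"
    by (rule DERIV_chain2[OF DERIV_E1]) (use zx in \<open>auto intro!: derivative_eq_intros\<close>)
  then have "(u1 z has_real_derivative nrm z * (z * ((- E (z * x) - \<beta> / (z * x) * E1 (z * x)) * z))) (at x)"
    unfolding u1_def[abs_def] by (intro DERIV_cmult)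
  moreover have "nrm z * (z * ((- E (z * x) - \<beta> / (z * x) * E1 (z * x)) * z)) = - z\<^sup>2 * u z x - \<beta> / x * u1 z x"
    unfolding u_def u1_def using zx by (simp add: field_simps power2_eq_square)
  ultimately show ?thesis by simp
qed

lemma c1_u: "c1_on01 (u z) (u1 z)"
  by (rule c1_from_DERIV[OF DERIV_u continuous_u(2)])

lemma u1_0 [simp]: "u1 z 0 = 0" by (simp add: u1_def)

lemma u1_1_square: "z \<in> Z \<Longrightarrow> (u1 z 1)\<^sup>2 = 2 * z\<^sup>2"
  using E1_zero_nonzero[of z] by (simp add: u1_def nrm_def power_mult_distrib power_divide)

lemma ip_u:
  assumes f: "c1_on01 f f'" and z: "0 < z"
  shows "z\<^sup>2 * ip f (u z) = ip f' (u1 z) - f 1 * u1 z 1"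
proof -
  have "ip f (\<lambda>x. - z\<^sup>2 * u z x) = f 1 * u1 z 1 - ip f' (u1 z)"
  proof (rule ip_green[OF f continuous_u(2)])
    show "cont01 (\<lambda>x. - z\<^sup>2 * u z x)" by (intro continuous_intros continuous_u)
  qed (use DERIV_u1[OF z] in \<open>simp_all\<close>)
  then show ?thesis unfolding ip_cmult by simp
qed

lemma ip_u1_eq:
  assumes "y \<in> Z" "0 < z"
  shows "ip (u1 y) (u1 z) = z\<^sup>2 * ip (u y) (u z)"
  using ip_u[OF c1_u[of y] assms(2)] u_at_1[OF assms(1)] by simp

text \<open>Integrating by parts in either order, the pairing of the derivatives is z^2 and also y^2
  times that of the functions.\<close>

lemma ip_u_orthogonal:
  assumes "y \<in> Z" "z \<in> Z" "y \<noteq> z"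
  shows "ip (u y) (u z) = 0"
proof -
  have "z\<^sup>2 * ip (u y) (u z) = y\<^sup>2 * ip (u y) (u z)"
    using ip_u1_eq[OF assms(1) Z_pos[OF assms(2)]] ip_u1_eq[OF assms(2) Z_pos[OF assms(1)]] ip_commute by metis
  moreover have "z\<^sup>2 \<noteq> y\<^sup>2" using assms Z_pos by (metis power2_eq_iff_nonneg less_imp_le)
  ultimately show ?thesis by simp
qed

text \<open>A Rellich identity: multiplying the equation by x u' and by u leads to the expression
  \<open>?D\<close>, whose derivative is a multiple of the integrand; \<open>u1_1_square\<close>
  gives its value at 1.\<close>

lemma ip_u_norm:
  assumes z: "z \<in> Z"
  shows "ip (u z) (u z) = 1"
proof -
  have z0: "0 < z" using Z_pos[OF z] .
  let ?D = "\<lambda>x. x * wt x * ((u1 z x)\<^sup>2 + z\<^sup>2 * (u z x)\<^sup>2) + (\<beta> - 1) * (wt x * (u z x * u1 z x))"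
  have "((\<lambda>x. 2 * z\<^sup>2 * (wt x * (u z x * u z x))) has_integral ?D 1 - ?D 0) {0..1}"
  proof (rule fundamental_theorem_of_calculus_interior)
    show "continuous_on {0..1} ?D" by (intro continuous_intros continuous_u)
    fix x :: real assume x: "x \<in> {0<..<1}"
    define b where "b = \<beta>"
    note dw = DERIV_wt[of x, folded b_def] and du1 = DERIV_u1[OF z0, of x, folded b_def]
    have "((\<lambda>x. x * wt x * ((u1 z x)\<^sup>2 + z\<^sup>2 * (u z x)\<^sup>2) + (b - 1) * (wt x * (u z x * u1 z x))) has_real_derivative
        (wt x + x * (b / x * wt x)) * ((u1 z x)\<^sup>2 + z\<^sup>2 * (u z x)\<^sup>2) +
        x * wt x * (2 * u1 z x * (- z\<^sup>2 * u z x - b / x * u1 z x) + z\<^sup>2 * (2 * u z x * u1 z x)) +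
        (b - 1) * ((b / x * wt x) * (u z x * u1 z x) +
          wt x * (u1 z x * u1 z x + u z x * (- z\<^sup>2 * u z x - b / x * u1 z x)))) (at x)"
      using x by (auto intro!: derivative_eq_intros dw du1 DERIV_u simp: algebra_simps)
    moreover have "(wt x + x * (b / x * wt x)) * ((u1 z x)\<^sup>2 + z\<^sup>2 * (u z x)\<^sup>2) +
        x * wt x * (2 * u1 z x * (- z\<^sup>2 * u z x - b / x * u1 z x) + z\<^sup>2 * (2 * u z x * u1 z x)) +
        (b - 1) * ((b / x * wt x) * (u z x * u1 z x) +
          wt x * (u1 z x * u1 z x + u z x * (- z\<^sup>2 * u z x - b / x * u1 z x))) =
        2 * z\<^sup>2 * (wt x * (u z x * u z x))"
      using x by (simp add: field_simps power2_eq_square)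
    ultimately show "(?D has_vector_derivative 2 * z\<^sup>2 * (wt x * (u z x * u z x))) (at x)"
      unfolding has_real_derivative_iff_has_vector_derivative b_def by metis
  qed simp
  then have "integral {0..1} (\<lambda>x. 2 * z\<^sup>2 * (wt x * (u z x * u z x))) = ?D 1 - ?D 0"
    by (rule integral_unique)
  moreover have "?D 1 - ?D 0 = 2 * z\<^sup>2" using u_at_1[OF z] u1_1_square[OF z] by simp
  ultimately have "2 * z\<^sup>2 * ip (u z) (u z) = 2 * z\<^sup>2" by (simp add: ip_def)
  then show ?thesis using z0 by simp
qed

lemma ip_u_delta: "y \<in> Z \<Longrightarrow> z \<in> Z \<Longrightarrow> ip (u y) (u z) = (if y = z then 1 else 0)"
  using ip_u_norm ip_u_orthogonal by simp

lemma ip_u1_delta: "y \<in> Z \<Longrightarrow> z \<in> Z \<Longrightarrow> ip (u1 y) (u1 z) = (if y = z then z\<^sup>2 else 0)"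
  using ip_u1_eq[of y z] ip_u_delta[of y z] Z_pos by simp

lemma ip_remainder:
  assumes f: "cont01 f" and S: "finite S" "S \<subseteq> Z"
  defines "r \<equiv> (\<lambda>x. f x + (\<Sum>z\<in>S. - ip f (u z) * u z x))"
  shows "ip r r = ip f f - (\<Sum>z\<in>S. (ip f (u z))\<^sup>2)" "cont01 r" "\<And>y. y \<in> Z \<Longrightarrow> ip r (u y) = (if y \<in> S then 0 else ip f (u y))"
proof -
  define a where "a z = - ip f (u z)" for z
  let ?s = "\<lambda>x. \<Sum>z\<in>S. a z * u z x"
  have r_eq: "r = (\<lambda>x. f x + ?s x)" by (simp add: r_def a_def)
  have c: "cont01 (\<lambda>x. a z * u z x)" for z by (intro continuous_intros continuous_u)
  have cs: "cont01 ?s" by (intro continuous_on_sum c)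
  show r: "cont01 r" unfolding r_eq by (intro continuous_on_add f cs)
  have ips: "ip g ?s = (\<Sum>z\<in>S. a z * ip g (u z))" if "cont01 g" for g
    by (subst ip_sum) (auto intro!: that c simp: ip_cmult)
  show ru: "ip r (u y) = (if y \<in> S then 0 else ip f (u y))" if y: "y \<in> Z" for y
  proof -
    have "ip r (u y) = ip (u y) f + ip (u y) ?s"
      unfolding r_eq by (subst ip_commute) (intro ip_add continuous_u f cs)
    also have "ip (u y) ?s = (\<Sum>z\<in>S. if y = z then a z else 0)"
      unfolding ips[OF continuous_u(1)] using S y by (intro sum.cong) (auto simp: ip_u_delta subset_iff)
    also have "\<dots> = (if y \<in> S then a y else 0)" using S by (simp add: sum.delta')
    finally show ?thesis using ip_commute[of f "u y"] by (simp add: a_def)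
  qed
  have "ip r r = ip r f + ip r ?s" using ip_add[OF r f cs] by (simp add: r_eq)
  also have "ip r ?s = (\<Sum>z\<in>S. a z * ip r (u z))" by (rule ips[OF r])
  also have "\<dots> = 0" using S ru by (intro sum.neutral) auto
  also have "ip r f = ip f f + ip f ?s" unfolding r_eq by (subst ip_commute) (intro ip_add f cs)
  also have "ip f ?s = (\<Sum>z\<in>S. a z * ip f (u z))" by (rule ips[OF f])
  finally show "ip r r = ip f f - (\<Sum>z\<in>S. (ip f (u z))\<^sup>2)"
    by (simp add: a_def power2_eq_square sum_negf)
qed

lemma bessel_inequality:
  assumes "cont01 f" "finite S" "S \<subseteq> Z"
  shows "(\<Sum>z\<in>S. (ip f (u z))\<^sup>2) \<le> ip f f"
  using ip_remainder(1)[OF assms] ip_nonneg[OF ip_remainder(2)[OF assms]] by simp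

text \<open>Bessel's inequality for the constant function 1.\<close>

lemma sum_inverse_square_zeros:
  assumes "finite S" "S \<subseteq> Z"
  shows "(\<Sum>z\<in>S. 2 / z\<^sup>2) \<le> 1"
proof -
  have 1: "c1_on01 (\<lambda>x. 1) (\<lambda>x. 0)" by (rule c1_from_DERIV) auto
  have "(ip (\<lambda>x. 1) (u z))\<^sup>2 = 2 / z\<^sup>2" if "z \<in> S" for z
  proof -
    have z: "z \<in> Z" "0 < z" using that assms Z_pos by auto
    have "z\<^sup>2 * ip (\<lambda>x. 1) (u z) = - u1 z 1" using ip_u[OF 1 z(2)] by (simp add: ip_def)
    then have "(z\<^sup>2)\<^sup>2 * (ip (\<lambda>x. 1) (u z))\<^sup>2 = 2 * z\<^sup>2" using u1_1_square[OF z(1)] by (metis power2_minus power_mult_distrib)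
    then show ?thesis using z by (simp add: field_simps power2_eq_square)
  qed
  then have "(\<Sum>z\<in>S. 2 / z\<^sup>2) = (\<Sum>z\<in>S. (ip (\<lambda>x. 1) (u z))\<^sup>2)" by simp
  also have "\<dots> \<le> ip (\<lambda>x. 1) (\<lambda>x. 1)" using assms by (intro bessel_inequality) auto
  also have "\<dots> \<le> 1" using ip_bound[of "\<lambda>x. 1" "\<lambda>x. 1" 1 1] by simp
  finally show ?thesis .
qed

text \<open>Each zero in (0, a] contributes at least 2 / a^2 to a sum that never exceeds 1.\<close>

lemma finite_Z_le: "finite {z \<in> Z. z \<le> a}"
proof (rule ccontr)
  assume inf: "infinite {z \<in> Z. z \<le> a}"
  define n where "n = nat \<lceil>a\<^sup>2\<rceil> + 1"
  obtain S where S: "S \<subseteq> {z \<in> Z. z \<le> a}" "finite S" "card S = n"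
    using infinite_arbitrarily_large[OF inf] by blast
  have a: "0 < a" using S Z_pos by (cases "S = {}") (use S in \<open>auto simp: n_def intro: less_le_trans\<close>)
  have "real n * (2 / a\<^sup>2) = (\<Sum>z\<in>S. 2 / a\<^sup>2)" using S by simp
  also have "\<dots> \<le> (\<Sum>z\<in>S. 2 / z\<^sup>2)"
    using S Z_pos a by (intro sum_mono divide_left_mono power_mono mult_pos_pos) (auto simp: subset_iff less_imp_le)
  also have "\<dots> \<le> 1" using S by (intro sum_inverse_square_zeros) auto
  finally have "real n * 2 \<le> a\<^sup>2" using a by (simp add: field_simps)
  moreover have "a\<^sup>2 \<le> real n" unfolding n_def by linarith
  ultimately show False using zero_less_power[OF a, of 2] by linarith
qed

lemma finite_Z_less: "finite {z \<in> Z. z < a}"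
  by (rule finite_subset[OF _ finite_Z_le[of a]]) auto

text \<open>Picone's identity: \<open>wt * F\<^sup>2 * e' / e\<close>, with \<open>e = u z\<close>, has derivative
  \<open>wt * (F'\<^sup>2 - z\<^sup>2 * F\<^sup>2) - wt * (F' - F * e' / e)\<^sup>2\<close>. Division by zero makes both expressions behave well
  at the zeros of \<open>e\<close>.\<close>

lemma picone:
  assumes z: "z \<in> Z" and F: "c1_on01 F F'" and F1: "F 1 = 0"
    and Fz: "\<And>y. y \<in> Z \<Longrightarrow> y < z \<Longrightarrow> F (y / z) = 0"
  shows "z\<^sup>2 * ip F F \<le> ip F' F'"
proof -
  have z0: "0 < z" using Z_pos[OF z] .
  define X where "X = {x. 0 \<le> x \<and> x \<le> 1 \<and> u z x = 0}"
  have uX: "x \<in> X \<Longrightarrow> x * z \<in> Z" for x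
    using E0_pos nrm_pos[OF z] z0 by (auto simp: X_def u_def Z_def mult.commute less_le)
  have "X \<subseteq> (\<lambda>y. y / z) ` {y \<in> Z. y \<le> z}"
  proof
    fix x assume x: "x \<in> X"
    then have "x * z \<le> z" using z0 by (auto simp: X_def)
    then show "x \<in> (\<lambda>y. y / z) ` {y \<in> Z. y \<le> z}"
      using uX[OF x] z0 by (intro image_eqI[where x="x * z"]) auto
  qed
  then have finX: "finite X" using finite_Z_le by (meson finite_imageI finite_subset)
  have FX: "F x = 0" if x: "x \<in> X" for x
  proof (cases "x = 1")
    case False
    then have "x * z < z" using x z0 by (auto simp: X_def)
    then show ?thesis using Fz[OF uX[OF x]] z0 by simp
  qed (simp add: F1)
  define H where "H x = wt x * (F x)\<^sup>2 * u1 z x / u z x" for x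
  define H' where "H' x = wt x * (F' x * F' x) - z\<^sup>2 * (wt x * (F x * F x)) - wt x * (F' x - F x * u1 z x / u z x)\<^sup>2" for x
  have contH: "continuous_on {0..1} H"
    unfolding continuous_on_def
  proof
    fix x :: real assume x: "x \<in> {0..1}"
    have lims: "(wt \<longlongrightarrow> wt x) (at x within {0..1})" "(F \<longlongrightarrow> F x) (at x within {0..1})"
      "(u z \<longlongrightarrow> u z x) (at x within {0..1})" "(u1 z \<longlongrightarrow> u1 z x) (at x within {0..1})"
      using x continuous_wt01 c1_continuous[OF F] continuous_u[of "{0..1}" z] unfolding continuous_on_def by auto
    show "(H \<longlongrightarrow> H x) (at x within {0..1})"
    proof (cases "x \<in> X")
      case False
      then have "u z x \<noteq> 0" using x by (auto simp: X_def)
      then show ?thesis unfolding H_def[abs_def] by (intro tendsto_intros lims) auto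
    next
      case True
      then have ux: "u z x = 0" by (simp add: X_def)
      have x0: "0 < x" using uX[OF True] z0 by (auto simp: Z_def zero_less_mult_iff)
      have u1x: "u1 z x \<noteq> 0"
        using E1_zero_nonzero[OF uX[OF True]] nrm_pos[OF z] z0 by (simp add: u1_def mult.commute)
      have dF: "((\<lambda>t. (F t - F x) / (t - x)) \<longlongrightarrow> F' x) (at x within {0..1})"
        using F x unfolding c1_on01_def has_field_derivative_iff by blast
      have du: "((\<lambda>t. (u z t - u z x) / (t - x)) \<longlongrightarrow> u1 z x) (at x within {0..1})"
        using has_field_derivative_at_within[OF DERIV_u[of z x], of "{0..1}"] unfolding has_field_derivative_iff by blast
      \<comment> \<open>Near a zero of \<open>u z\<close> the quotient of F^2 by \<open>u z\<close>
        is rewritten with difference quotients. The zero is simple, so the limit exists, and it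
        vanishes together with \<open>F\<close>.\<close>
      have L: "((\<lambda>t. wt t * ((F t - F x) / (t - x)) * F t * u1 z t / ((u z t - u z x) / (t - x))) \<longlongrightarrow>
          wt x * F' x * F x * u1 z x / u1 z x) (at x within {0..1})"
        by (intro tendsto_intros lims dF du u1x)
      have Hx: "wt x * F' x * F x * u1 z x / u1 z x = H x" using FX[OF True] by (simp add: H_def)
      have ev: "\<forall>\<^sub>F t in at x within {0..1}.
         wt t * ((F t - F x) / (t - x)) * F t * u1 z t / ((u z t - u z x) / (t - x)) = H t"
        unfolding eventually_at_filter
      proof (rule always_eventually, intro allI impI)
        fix t assume "t \<noteq> x"
        have *: "w0 * (a / d) * a * w / (b / d) = w0 * a\<^sup>2 * w / b" if "d \<noteq> 0" for w0 a d w b :: real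
          using that by (simp add: power2_eq_square)
        show "wt t * ((F t - F x) / (t - x)) * F t * u1 z t / ((u z t - u z x) / (t - x)) = H t"
          using *[of "t - x" "wt t" "F t" "u1 z t" "u z t"] \<open>t \<noteq> x\<close> by (simp add: H_def ux FX[OF True])
      qed
      show ?thesis using Lim_transform_eventually[OF L ev] unfolding Hx .
    qed
  qed
  \<comment> \<open>The zeros of \<open>u z\<close> are finitely many, and the fundamental theorem
    exempts them from differentiability.\<close>
  have "(H' has_integral H 1 - H 0) {0..1}"
  proof (rule fundamental_theorem_of_calculus_interior_strong)
    show "finite (X \<union> {0, 1})" using finX by simp
    show "continuous_on {0..1} H" by fact
    fix x :: real assume "x \<in> {0<..<1} - (X \<union> {0, 1})"
    then have x: "0 < x" "x < 1" "u z x \<noteq> 0" by (auto simp: X_def)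
    define b where "b = \<beta>"
    have "((\<lambda>x. wt x * (F x)\<^sup>2 * u1 z x / u z x) has_real_derivative
       ((((b / x * wt x) * (F x)\<^sup>2 + (2 * F x * F' x) * wt x) * u1 z x +
         (- z\<^sup>2 * u z x - b / x * u1 z x) * (wt x * (F x)\<^sup>2)) * u z x - (wt x * (F x)\<^sup>2 * u1 z x) * u1 z x) / (u z x * u z x)) (at x)"
      using x DERIV_power[OF c1_deriv[OF F x(1,2)], of 2] DERIV_wt[OF x(1)] DERIV_u1[OF z0 x(1)] unfolding b_def
      by (intro DERIV_divide DERIV_mult DERIV_u) (auto simp: mult_ac)
    moreover have "((((b / x * wt x) * (F x)\<^sup>2 + (2 * F x * F' x) * wt x) * u1 z x +
         (- z\<^sup>2 * u z x - b / x * u1 z x) * (wt x * (F x)\<^sup>2)) * u z x - (wt x * (F x)\<^sup>2 * u1 z x) * u1 z x) / (u z x * u z x) = H' x"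
      unfolding H'_def using x by (simp add: field_simps power2_eq_square)
    ultimately show "(H has_vector_derivative H' x) (at x)"
      unfolding H_def[abs_def] has_real_derivative_iff_has_vector_derivative[symmetric] by metis
  qed simp
  moreover have "H 1 = 0" "H 0 = 0" using F1 by (auto simp: H_def)
  ultimately have "(H' has_integral 0) {0..1}" by simp
  moreover have "((\<lambda>x. wt x * (F' x * F' x) - z\<^sup>2 * (wt x * (F x * F x))) has_integral ip F' F' - z\<^sup>2 * ip F F) {0..1}"
    unfolding ip_def
    by (intro has_integral_diff has_integral_mult_right integrable_integral ip_integrable c1_continuous[OF F])
  ultimately have "0 \<le> ip F' F' - z\<^sup>2 * ip F F"
    by (rule has_integral_le) (simp add: H'_def)
  then show ?thesis by simp
qed

lemma ip_lincomb:
  assumes "finite S" "S \<subseteq> Z"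
  shows "ip (\<lambda>x. \<Sum>y\<in>S. b y * u y x) (\<lambda>x. \<Sum>y\<in>S. b y * u y x) = (\<Sum>y\<in>S. (b y)\<^sup>2)"
    "ip (\<lambda>x. \<Sum>y\<in>S. b y * u1 y x) (\<lambda>x. \<Sum>y\<in>S. b y * u1 y x) = (\<Sum>y\<in>S. (b y)\<^sup>2 * y\<^sup>2)"
proof -
  have *: "ip (\<lambda>x. \<Sum>y\<in>S. b y * v y x) (\<lambda>x. \<Sum>y\<in>S. b y * v y x) = (\<Sum>y\<in>S. (b y)\<^sup>2 * c y)"
    if v: "\<And>y. cont01 (v y)" "\<And>y z. y \<in> S \<Longrightarrow> z \<in> S \<Longrightarrow> ip (v y) (v z) = (if y = z then c z else 0)" for v c
  proof -
    have cv: "cont01 (\<lambda>x. b y * v y x)" for y by (intro continuous_intros v)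
    have cs: "cont01 (\<lambda>x. \<Sum>y\<in>S. b y * v y x)" by (intro continuous_on_sum cv)
    have inner: "ip (v y) (\<lambda>x. \<Sum>z\<in>S. b z * v z x) = b y * c y" if "y \<in> S" for y
    proof -
      have "ip (v y) (\<lambda>x. \<Sum>z\<in>S. b z * v z x) = (\<Sum>z\<in>S. b z * ip (v y) (v z))"
        by (subst ip_sum) (auto intro!: v(1) cv simp: ip_cmult)
      also have "\<dots> = (\<Sum>z\<in>S. if y = z then b z * c z else 0)" using that v(2) by (intro sum.cong) auto
      finally show ?thesis using that assms(1) by (simp add: sum.delta')
    qed
    have "ip (\<lambda>x. \<Sum>y\<in>S. b y * v y x) (\<lambda>x. \<Sum>y\<in>S. b y * v y x) =
        (\<Sum>y\<in>S. b y * ip (v y) (\<lambda>x. \<Sum>y\<in>S. b y * v y x))"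
      by (subst ip_sum) (auto intro!: cs cv simp: ip_cmult ip_commute)
    also have "\<dots> = (\<Sum>y\<in>S. (b y)\<^sup>2 * c y)" using inner by (simp add: power2_eq_square mult.assoc)
    finally show ?thesis .
  qed
  show "ip (\<lambda>x. \<Sum>y\<in>S. b y * u y x) (\<lambda>x. \<Sum>y\<in>S. b y * u y x) = (\<Sum>y\<in>S. (b y)\<^sup>2)"
    using *[of u "\<lambda>_. 1"] assms ip_u_delta by (simp add: subset_iff continuous_u)
  show "ip (\<lambda>x. \<Sum>y\<in>S. b y * u1 y x) (\<lambda>x. \<Sum>y\<in>S. b y * u1 y x) = (\<Sum>y\<in>S. (b y)\<^sup>2 * y\<^sup>2)"
    using *[of u1 "\<lambda>y. y\<^sup>2"] assms ip_u1_delta by (simp add: subset_iff continuous_u)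
qed

lemma ip_deriv_u1:
  assumes "c1_on01 F F'" "F 1 = 0" "y \<in> Z"
  shows "ip F' (u1 y) = y\<^sup>2 * ip F (u y)"
  using ip_u[OF assms(1) Z_pos[OF assms(3)]] assms(2) by simp

lemma ip_add_square:
  assumes "cont01 f" "cont01 g"
  shows "ip (\<lambda>x. f x + g x) (\<lambda>x. f x + g x) = ip f f + 2 * ip f g + ip g g"
proof -
  have fg: "cont01 (\<lambda>x. f x + g x)" by (intro continuous_intros assms)
  show ?thesis using ip_add[OF fg assms] ip_add[OF assms(1) assms] ip_add[OF assms(2) assms] ip_commute by simp
qed

text \<open>If \<open>F\<close> is orthogonal to \<open>u y\<close> for \<open>y < z\<close>, some nontrivial \<open>f = b z F + \<Sum>y<z. b y * u y\<close> vanishes at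
  all interior zeros of \<open>u z\<close>; the inequality of Picone for \<open>f\<close> forces \<open>b z \<noteq> 0\<close> and passes to \<open>F\<close>.\<close>

lemma orthogonal_poincare:
  assumes z: "z \<in> Z" and F: "c1_on01 F F'" and F1: "F 1 = 0"
    and perp: "\<And>y. y \<in> Z \<Longrightarrow> y < z \<Longrightarrow> ip F (u y) = 0"
  shows "z\<^sup>2 * ip F F \<le> ip F' F'"
proof -
  define S where "S = {y \<in> Z. y < z}"
  have S: "finite S" "S \<subseteq> Z" "z \<notin> S" using finite_Z_less[of z] by (auto simp: S_def)
  define T where "T = (\<lambda>y. y / z) ` S"
  have T: "finite T" "card T < card (insert z S)" using S card_image_le[OF S(1), of "\<lambda>y. y / z"] by (auto simp: T_def)
  \<comment> \<open>The unknowns are the coefficients of \<open>F\<close> and of the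
    \<open>u y\<close>; they outnumber the interior zeros y / z of \<open>u z\<close>.\<close>
  from underdetermined_system[OF T(1) _ T(2), of "\<lambda>y x. if y = z then F x else u y x"] S(1)
  obtain b where b: "\<exists>y\<in>insert z S. b y \<noteq> 0"
    "\<And>x. x \<in> T \<Longrightarrow> (\<Sum>y\<in>insert z S. b y * (if y = z then F x else u y x)) = 0" by auto
  define g g1 where "g x = (\<Sum>y\<in>S. b y * u y x)" and "g1 x = (\<Sum>y\<in>S. b y * u1 y x)" for x
  have sum_eq: "(\<Sum>y\<in>insert z S. b y * (if y = z then F x else u y x)) = b z * F x + g x" for x
  proof -
    have "(\<Sum>y\<in>S. b y * (if y = z then F x else u y x)) = g x"
      unfolding g_def using S(3) by (intro sum.cong) auto
    then show ?thesis using S by simp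
  qed
  have cg: "c1_on01 g g1" unfolding g_def[abs_def] g1_def[abs_def] by (intro c1_sum c1_cmult c1_u)
  have cf: "c1_on01 (\<lambda>x. b z * F x + g x) (\<lambda>x. b z * F' x + g1 x)" by (intro c1_add c1_cmult F cg)
  have "z\<^sup>2 * ip (\<lambda>x. b z * F x + g x) (\<lambda>x. b z * F x + g x) \<le> ip (\<lambda>x. b z * F' x + g1 x) (\<lambda>x. b z * F' x + g1 x)"
  proof (rule picone[OF z cf])
    show "b z * F 1 + g 1 = 0" using F1 S(2) u_at_1 by (simp add: g_def subset_iff)
    show "b z * F (y / z) + g (y / z) = 0" if "y \<in> Z" "y < z" for y
      using b(2)[of "y / z"] that unfolding sum_eq by (auto simp: T_def S_def)
  qed
  moreover have "ip (\<lambda>x. b z * F x + g x) (\<lambda>x. b z * F x + g x) = (b z)\<^sup>2 * ip F F + (\<Sum>y\<in>S. (b y)\<^sup>2)"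
  proof -
    have "ip F g = (\<Sum>y\<in>S. b y * ip F (u y))" unfolding g_def
      by (subst ip_sum) (auto intro!: c1_continuous[OF F] continuous_intros continuous_u simp: ip_cmult)
    also have "\<dots> = 0" using perp by (intro sum.neutral) (auto simp: S_def)
    finally have "ip (\<lambda>x. b z * F x) g = 0" using ip_cmult[of g "b z" F] ip_commute[of g] by simp
    moreover have "ip (\<lambda>x. b z * F x) (\<lambda>x. b z * F x) = (b z)\<^sup>2 * ip F F"
      by (rule ip_cmult_square)
    moreover have "ip g g = (\<Sum>y\<in>S. (b y)\<^sup>2)" unfolding g_def[abs_def] by (rule ip_lincomb(1)[OF S(1,2)])
    ultimately show ?thesis
      using ip_add_square[of "\<lambda>x. b z * F x" g] c1_continuous(1)[OF c1_cmult[OF F]] c1_continuous(1)[OF cg] by simp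
  qed
  moreover have "ip (\<lambda>x. b z * F' x + g1 x) (\<lambda>x. b z * F' x + g1 x) = (b z)\<^sup>2 * ip F' F' + (\<Sum>y\<in>S. (b y)\<^sup>2 * y\<^sup>2)"
  proof -
    have "ip F' g1 = (\<Sum>y\<in>S. b y * ip F' (u1 y))" unfolding g1_def
      by (subst ip_sum) (auto intro!: c1_continuous[OF F] continuous_intros continuous_u simp: ip_cmult)
    also have "\<dots> = 0" using perp ip_deriv_u1[OF F F1] by (intro sum.neutral) (auto simp: S_def)
    finally have "ip (\<lambda>x. b z * F' x) g1 = 0" using ip_cmult[of g1 "b z" F'] ip_commute[of g1] by simp
    moreover have "ip (\<lambda>x. b z * F' x) (\<lambda>x. b z * F' x) = (b z)\<^sup>2 * ip F' F'"
      by (rule ip_cmult_square)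
    moreover have "ip g1 g1 = (\<Sum>y\<in>S. (b y)\<^sup>2 * y\<^sup>2)" unfolding g1_def[abs_def] by (rule ip_lincomb(2)[OF S(1,2)])
    ultimately show ?thesis
      using ip_add_square[of "\<lambda>x. b z * F' x" g1] c1_continuous(2)[OF c1_cmult[OF F]] c1_continuous(2)[OF cg] by simp
  qed
  ultimately have "z\<^sup>2 * ((b z)\<^sup>2 * ip F F + (\<Sum>y\<in>S. (b y)\<^sup>2)) \<le> (b z)\<^sup>2 * ip F' F' + (\<Sum>y\<in>S. (b y)\<^sup>2 * y\<^sup>2)"
    by simp
  moreover have "z\<^sup>2 * (\<Sum>y\<in>S. (b y)\<^sup>2) - (\<Sum>y\<in>S. (b y)\<^sup>2 * y\<^sup>2) = (\<Sum>y\<in>S. (b y)\<^sup>2 * (z\<^sup>2 - y\<^sup>2))"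
    by (simp add: sum_distrib_left sum_subtractf[symmetric] algebra_simps)
  ultimately have key: "(\<Sum>y\<in>S. (b y)\<^sup>2 * (z\<^sup>2 - y\<^sup>2)) \<le> (b z)\<^sup>2 * (ip F' F' - z\<^sup>2 * ip F F)"
    by (simp add: algebra_simps)
  have gap: "0 < z\<^sup>2 - y\<^sup>2" if "y \<in> S" for y
    using that Z_pos[of y] power_strict_mono[of y z 2] by (auto simp: S_def)
  have nn: "0 \<le> (b y)\<^sup>2 * (z\<^sup>2 - y\<^sup>2)" if "y \<in> S" for y using gap[OF that] by simp
  have nns: "0 \<le> (\<Sum>y\<in>S. (b y)\<^sup>2 * (z\<^sup>2 - y\<^sup>2))" by (intro sum_nonneg nn)
  \<comment> \<open>Otherwise \<open>key\<close> would make every \<open>b y\<close> vanish, since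
    z^2 - y^2 is positive.\<close>
  have bz: "b z \<noteq> 0"
  proof
    assume bz: "b z = 0"
    then have "(\<Sum>y\<in>S. (b y)\<^sup>2 * (z\<^sup>2 - y\<^sup>2)) = 0" using key nns by simp
    then have "\<forall>y\<in>S. (b y)\<^sup>2 * (z\<^sup>2 - y\<^sup>2) = 0" using S(1) nn by (simp add: sum_nonneg_eq_0_iff)
    then show False using b(1) bz gap by fastforce
  qed
  have "0 \<le> (b z)\<^sup>2 * (ip F' F' - z\<^sup>2 * ip F F)" using order_trans[OF nns key] .
  then show ?thesis using bz by (simp add: zero_le_mult_iff)
qed

text \<open>The remainder is orthogonal to the \<open>u y\<close> with y < z, so
  \<open>orthogonal_poincare\<close> applies, and removing the projection does not increase the norm
  of the derivative. As z grows, the expansion of \<open>F\<close> converges to \<open>F\<close> in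
  the mean.\<close>

lemma remainder_bound:
  assumes z: "z \<in> Z" and F: "c1_on01 F F'" and F1: "F 1 = 0"
  defines "r \<equiv> (\<lambda>x. F x + (\<Sum>y\<in>{y\<in>Z. y < z}. - ip F (u y) * u y x))"
  shows "ip r r \<le> ip F' F' / z\<^sup>2"
proof -
  define S where "S = {y \<in> Z. y < z}"
  have S: "finite S" "S \<subseteq> Z" using finite_Z_less[of z] by (auto simp: S_def)
  define a where "a y = - ip F (u y)" for y
  define g g1 where "g x = (\<Sum>y\<in>S. a y * u y x)" and "g1 x = (\<Sum>y\<in>S. a y * u1 y x)" for x
  have r_eq: "r = (\<lambda>x. F x + g x)" by (simp add: r_def g_def[abs_def] a_def S_def)
  have cg: "c1_on01 g g1" unfolding g_def[abs_def] g1_def[abs_def] by (intro c1_sum c1_cmult c1_u)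
  have cr: "c1_on01 r (\<lambda>x. F' x + g1 x)" unfolding r_eq by (intro c1_add F cg)
  have r1: "r 1 = 0" using F1 S(2) u_at_1 by (simp add: r_eq g_def subset_iff)
  have perp: "ip r (u y) = 0" if "y \<in> Z" "y < z" for y
    using ip_remainder(3)[OF c1_continuous(1)[OF F] S that(1)] that by (simp add: r_def S_def)
  have "z\<^sup>2 * ip r r \<le> ip (\<lambda>x. F' x + g1 x) (\<lambda>x. F' x + g1 x)"
    by (rule orthogonal_poincare[OF z cr r1 perp])
  also have "\<dots> = ip F' F' + 2 * ip F' g1 + ip g1 g1"
    by (rule ip_add_square[OF c1_continuous(2)[OF F] c1_continuous(2)[OF cg]])
  also have "ip F' g1 = (\<Sum>y\<in>S. a y * ip F' (u1 y))" unfolding g1_def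
    by (subst ip_sum) (auto intro!: c1_continuous[OF F] continuous_intros continuous_u simp: ip_cmult)
  also have "\<dots> = (\<Sum>y\<in>S. - ((a y)\<^sup>2 * y\<^sup>2))"
    using S(2) ip_deriv_u1[OF F F1] by (intro sum.cong) (auto simp: a_def power2_eq_square subset_iff)
  also have "ip g1 g1 = (\<Sum>y\<in>S. (a y)\<^sup>2 * y\<^sup>2)" unfolding g1_def[abs_def] by (rule ip_lincomb(2)[OF S])
  also have "ip F' F' + 2 * (\<Sum>y\<in>S. - ((a y)\<^sup>2 * y\<^sup>2)) + (\<Sum>y\<in>S. (a y)\<^sup>2 * y\<^sup>2) \<le> ip F' F'"
    by (simp add: sum_negf sum_nonneg)
  finally show ?thesis using Z_pos[OF z] by (simp add: field_simps)
qed

end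

subsection \<open>Enumeration of the zeros and growth bounds\<close>

context bessel_order
begin

text \<open>This gives the description operator in \<open>bessel_zero\<close> its meaning. The next
  zero after x exists as a minimum, because the zeros are unbounded and locally finite.\<close>

lemma ex1_zero:
  assumes "1 \<le> n"
  shows "\<exists>!x. 0 < x \<and> bessel_J \<nu> x = 0 \<and> card {y. 0 < y \<and> y \<le> x \<and> bessel_J \<nu> y = 0} = n"
proof -
  \<comment> \<open>The induction starts with n = 0 and x = 0, which is not a zero; hence the guard
    on the last conjunct.\<close>
  have "\<exists>x\<ge>0. card {y \<in> Z. y \<le> x} = n \<and> (1 \<le> n \<longrightarrow> x \<in> Z)"
  proof (induction n)
    case 0
    have "{y \<in> Z. y \<le> 0} = {}" using Z_pos by force
    then show ?case by (intro exI[of _ 0]) (simp only:, simp)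
  next
    case (Suc n)
    then obtain x where x: "0 \<le> x" "card {y \<in> Z. y \<le> x} = n" by auto
    obtain z where z: "z \<in> Z" "x < z" using Z_unbounded by blast
    define A where "A = {y \<in> Z. x < y \<and> y \<le> z}"
    have A: "finite A" "A \<noteq> {}" using z by (auto simp: A_def intro: finite_subset[OF _ finite_Z_le[of z]])
    have m: "Min A \<in> Z" "x < Min A" using Min_in[OF A] by (auto simp: A_def)
    have "{y \<in> Z. y \<le> Min A} = insert (Min A) {y \<in> Z. y \<le> x}"
      using m Min_le[OF A(1)] Min_in[OF A] by (auto simp: A_def not_less intro: order_trans)
        (smt (verit) A_def Min_le[OF A(1)] mem_Collect_eq)
    then have "card {y \<in> Z. y \<le> Min A} = Suc n" using m x finite_Z_le by simp
    then show ?case using m x by (intro exI[of _ "Min A"]) auto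
  qed
  then obtain x where x: "x \<in> Z" "card {y \<in> Z. y \<le> x} = n" using assms by blast
  show ?thesis
  proof (rule ex1I[of _ x])
    show "0 < x \<and> bessel_J \<nu> x = 0 \<and> card {y. 0 < y \<and> y \<le> x \<and> bessel_J \<nu> y = 0} = n"
      using x Z_bessel_J by auto
    fix x' assume "0 < x' \<and> bessel_J \<nu> x' = 0 \<and> card {y. 0 < y \<and> y \<le> x' \<and> bessel_J \<nu> y = 0} = n"
    then have x': "x' \<in> Z" "card {y \<in> Z. y \<le> x'} = n" using Z_bessel_J by auto
    have *: "card {y \<in> Z. y \<le> a} < card {y \<in> Z. y \<le> b}" if "a < b" "b \<in> Z" for a b
    proof (rule psubset_card_mono[OF finite_Z_le])
      have b: "b \<in> {y \<in> Z. y \<le> b}" "b \<notin> {y \<in> Z. y \<le> a}" using that by auto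
      show "{y \<in> Z. y \<le> a} \<subset> {y \<in> Z. y \<le> b}"
      proof (rule psubsetI)
        show "{y \<in> Z. y \<le> a} \<noteq> {y \<in> Z. y \<le> b}" using b by metis
      qed (use that(1) in auto)
    qed
    show "x' = x" using *[of x x'] *[of x' x] x x' by (metis less_irrefl linorder_neqE_linordered_idom)
  qed
qed

abbreviation "lam \<equiv> bessel_zero \<nu>"

lemma lam: "1 \<le> n \<Longrightarrow> lam n \<in> Z" "1 \<le> n \<Longrightarrow> card {y \<in> Z. y \<le> lam n} = n"
proof -
  assume "1 \<le> n"
  from theI'[OF ex1_zero[OF this], folded bessel_zero_def] show "lam n \<in> Z" "card {y \<in> Z. y \<le> lam n} = n"
    unfolding Z_bessel_J by (auto simp: Z_bessel_J(2)[symmetric])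
qed

lemma lam_surj: "z \<in> Z \<Longrightarrow> \<exists>n\<ge>1. z = lam n"
proof -
  assume z: "z \<in> Z"
  define n where "n = card {y \<in> Z. y \<le> z}"
  have "0 < n" unfolding n_def using z finite_Z_le by (subst card_gt_0_iff) auto
  then have n: "1 \<le> n" by simp
  have 1: "0 < z \<and> bessel_J \<nu> z = 0 \<and> card {y. 0 < y \<and> y \<le> z \<and> bessel_J \<nu> y = 0} = n"
    using z Z_bessel_J by (auto simp: n_def)
  have "lam n = z" unfolding bessel_zero_def by (rule the1_equality[OF ex1_zero[OF n] 1])
  then show ?thesis using n by auto
qed

lemma lam_less_iff: "1 \<le> m \<Longrightarrow> 1 \<le> n \<Longrightarrow> lam m < lam n \<longleftrightarrow> m < n"
proof -
  have *: "m \<le> n" if "1 \<le> m" "1 \<le> n" "lam m \<le> lam n" for m n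
    using card_mono[OF finite_Z_le, of "{y \<in> Z. y \<le> lam m}" "lam n"] lam(2)[OF that(1)] lam(2)[OF that(2)] that(3)
    by (auto intro: order_trans)
  show "1 \<le> m \<Longrightarrow> 1 \<le> n \<Longrightarrow> lam m < lam n \<longleftrightarrow> m < n"
    using *[of m n] *[of n m] by (metis le_antisym less_imp_le linorder_not_less)
qed

lemma lam_inj: "inj_on lam {1..}"
proof (rule linorder_inj_onI)
  fix m n :: nat assume "m < n" "m \<in> {1..}" "n \<in> {1..}"
  then have "lam m < lam n" using lam_less_iff[of m n] by simp
  then show "lam m \<noteq> lam n" by simp
qed auto

lemma Z_less_lam: "{y \<in> Z. y < lam (Suc N)} = lam ` {1..N}"
proof (intro set_eqI iffI)
  fix y assume y: "y \<in> {y \<in> Z. y < lam (Suc N)}"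
  then obtain n where n: "1 \<le> n" "y = lam n" using lam_surj by blast
  then have "n < Suc N" using y lam_less_iff[of n "Suc N"] by simp
  then show "y \<in> lam ` {1..N}" using n by auto
next
  fix y assume "y \<in> lam ` {1..N}"
  then obtain n where n: "1 \<le> n" "n \<le> N" "y = lam n" by auto
  then show "y \<in> {y \<in> Z. y < lam (Suc N)}" using lam(1)[of n] lam_less_iff[of n "Suc N"] by simp
qed

lemma lam_pos: "1 \<le> n \<Longrightarrow> 0 < lam n"
  using lam(1) Z_pos by blast

lemma summable_inverse_lam_square: "summable (\<lambda>n. 1 / (lam (Suc n))\<^sup>2)"
proof (rule summableI_nonneg_bounded[where x="1/2"])
  fix N
  have inj: "inj_on (\<lambda>n. lam (Suc n)) {..<N}" using lam_inj by (auto simp: inj_on_def)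
  have "(\<Sum>n<N. 2 / (lam (Suc n))\<^sup>2) = (\<Sum>z\<in>(\<lambda>n. lam (Suc n)) ` {..<N}. 2 / z\<^sup>2)"
    using inj by (simp add: sum.reindex)
  also have "\<dots> \<le> 1" using lam(1) by (intro sum_inverse_square_zeros) auto
  finally have "2 * (\<Sum>n<N. 1 / (lam (Suc n))\<^sup>2) \<le> 1" by (simp add: sum_distrib_left)
  then show "(\<Sum>n<N. 1 / (lam (Suc n))\<^sup>2) \<le> 1 / 2" by simp
qed simp

abbreviation "z1 \<equiv> lam 1"

lemma z1: "z1 \<in> Z" "0 < z1" using lam(1)[of 1] Z_pos by auto

lemma z1_le: "z \<in> Z \<Longrightarrow> z1 \<le> z"
proof -
  assume "z \<in> Z"
  then obtain n where n: "1 \<le> n" "z = lam n" using lam_surj by blast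
  then have "\<not> lam n < z1" using lam_less_iff[of n 1] by simp
  then show ?thesis using n by simp
qed

lemma E_pos: "0 \<le> x \<Longrightarrow> x < z1 \<Longrightarrow> 0 < E x"
proof (rule ccontr)
  assume x: "0 \<le> x" "x < z1" and n: "\<not> 0 < E x"
  have "\<exists>y. 0 \<le> y \<and> y \<le> x \<and> E y = 0"
    using n E0_pos x by (intro IVT2') (auto intro!: continuous_E)
  then obtain y where y: "0 \<le> y" "y \<le> x" "E y = 0" by auto
  then have "y \<in> Z" using E0_pos by (cases "y = 0") (auto simp: Z_def)
  then show False using z1_le[of y] y x by simp
qed

lemma u_z1_pos: "0 \<le> x \<Longrightarrow> x < 1 \<Longrightarrow> 0 < u z1 x"
  unfolding u_def using nrm_pos[OF z1(1)] z1(2) by (intro mult_pos_pos E_pos) auto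

end

text \<open>\<open>wt * E1\<close> vanishes at 0 and has the derivative \<open>- wt * E\<close>.\<close>

lemma bessel_E1_neg:
  assumes nu: "- 1 / 2 \<le> \<nu>" and pos: "\<And>y. 0 < y \<Longrightarrow> y < a \<Longrightarrow> 0 < bessel_E \<nu> y" and x: "0 < x" "x \<le> a"
  shows "bessel_E1 \<nu> x < 0" "0 < bessel_E (\<nu> + 1) x"
proof -
  interpret bessel_order \<nu> by unfold_locales fact
  have "wt x * E1 x < wt 0 * E1 0"
  proof (rule DERIV_neg_imp_decreasing_open[OF x(1)])
    fix y assume y: "0 < y" "y < x"
    have "((\<lambda>x. wt x * E1 x) has_real_derivative \<beta> / y * wt y * E1 y + (- E y - \<beta> / y * E1 y) * wt y) (at y)"
      using y by (intro DERIV_mult DERIV_wt DERIV_E1) auto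
    moreover have "\<beta> / y * wt y * E1 y + (- E y - \<beta> / y * E1 y) * wt y = - (wt y * E y)" by (simp add: algebra_simps)
    moreover have "0 < wt y * E y" using y x pos wt_pos by auto
    ultimately show "\<exists>d. ((\<lambda>x. wt x * E1 x) has_real_derivative d) (at y) \<and> d < 0"
      by (intro exI[of _ "- (wt y * E y)"]) simp
  qed (intro continuous_intros continuous_E continuous_on_subset[OF continuous_wt]; auto)
  then have "wt x * E1 x < 0" by simp
  then show *: "bessel_E1 \<nu> x < 0" using wt_pos[OF x(1)] by (simp add: mult_less_0_iff)
  show "0 < bessel_E (\<nu> + 1) x" using * x zero_less_mult_pos[of x "bessel_E (\<nu> + 1) x"] by (simp add: bessel_E1_def)
qed

context bessel_order
begin

text \<open>With \<open>G = bessel_E (\<nu> + 1)\<close>, so \<open>E1 x = - x G(x) / 2\<close>, the function \<open>wt * (G' E - G E')\<close> is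
  nondecreasing and vanishes at 0. Hence \<open>G / E\<close> is nondecreasing, and \<open>E' / E\<close> is decreasing.\<close>

lemma log_deriv_E_decreasing:
  assumes x: "0 < x" "x < z1"
  shows "(- E x - \<beta> / x * E1 x) * E x - (E1 x)\<^sup>2 \<le> 0"
proof -
  define G G' where "G = bessel_E (\<nu> + 1)" and "G' = bessel_E1 (\<nu> + 1)"
  have nu1: "- 1 / 2 \<le> \<nu> + 1" using nu by simp
  have Epos: "0 < E y" if "0 < y" "y < z1" for y using E_pos[of y] that by simp
  have Gpos: "0 < G y" if "0 < y" "y \<le> z1" for y
    using bessel_E1_neg(2)[OF nu Epos that] by (simp add: G_def)
  have G'neg: "G' y < 0" if "0 < y" "y \<le> z1" for y
    unfolding G'_def by (rule bessel_E1_neg(1)[OF nu1 _ that]) (use Gpos in \<open>auto simp: G_def\<close>)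
  have dG: "(G has_real_derivative G' y) (at y)" for y unfolding G_def G'_def by (rule DERIV_bessel_E[OF nu1])
  interpret G: bessel_order "\<nu> + 1" by unfold_locales (rule nu1)
  have dG': "(G' has_real_derivative - G y - (\<beta> + 2) / y * G' y) (at y)" if "0 < y" for y
    using G.DERIV_E1[of y] that by (simp add: G_def G'_def algebra_simps)
  have EG: "E1 y = - (y / 2) * G y" for y by (simp add: bessel_E1_def G_def)
  have "wt 0 * (G' 0 * E 0 - G 0 * E1 0) \<le> wt x * (G' x * E x - G x * E1 x)"
  proof (rule DERIV_nonneg_imp_increasing_open[OF less_imp_le[OF x(1)]])
    show "continuous_on {0..x} (\<lambda>x. wt x * (G' x * E x - G x * E1 x))"
      unfolding G_def G'_def
      by (intro continuous_intros continuous_E G.continuous_E continuous_on_subset[OF continuous_wt]) auto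
    fix y assume y: "0 < y" "y < x"
    define b where "b = \<beta>"
    have A: "((\<lambda>x. wt x * (G' x * E x - G x * E1 x)) has_real_derivative
        b / y * wt y * (G' y * E y - G y * E1 y) +
        (((- G y - (b + 2) / y * G' y) * E y + E1 y * G' y) - (G' y * E1 y + (- E y - b / y * E1 y) * G y)) * wt y) (at y)"
      unfolding b_def using y by (intro DERIV_mult DERIV_wt DERIV_diff dG dG' DERIV_E DERIV_E1) auto
    have B: "b / y * wt y * (G' y * E y - G y * E1 y) +
        (((- G y - (b + 2) / y * G' y) * E y + E1 y * G' y) - (G' y * E1 y + (- E y - b / y * E1 y) * G y)) * wt y =
        - (2 / y * wt y * G' y * E y)"
      using y by (simp add: field_simps)
    have C: "0 \<le> - (2 / y * wt y * G' y * E y)"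
    proof -
      have "2 / y * wt y * G' y * E y \<le> 0"
        using y x G'neg[of y] Epos[of y] wt_pos[of y]
        by (intro mult_nonpos_nonneg mult_nonneg_nonpos) auto
      then show ?thesis by linarith
    qed
    show "\<exists>d. ((\<lambda>x. wt x * (G' x * E x - G x * E1 x)) has_real_derivative d) (at y) \<and> 0 \<le> d"
      using A C unfolding B by blast
  qed
  moreover have "G' 0 = 0" by (simp add: G'_def bessel_E1_def)
  ultimately have W: "0 \<le> G' x * E x - G x * E1 x"
    using wt_pos[OF x(1)] by (simp add: zero_le_mult_iff)
  have dEG: "(E1 has_real_derivative - (1 / 2) * G x - x / 2 * G' x) (at x)"
    unfolding EG[abs_def] by (auto intro!: derivative_eq_intros dG simp: field_simps)
  \<comment> \<open>The second derivative of \<open>E\<close> computed in two ways, from Bessel's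
    equation and from E1 = - x G / 2.\<close>
  have E1': "- E x - \<beta> / x * E1 x = - (1 / 2) * G x - x / 2 * G' x"
    by (rule DERIV_unique[OF DERIV_E1 dEG]) (use x in simp)
  have "(- E x - \<beta> / x * E1 x) * E x - (E1 x)\<^sup>2 = - (1 / 2) * G x * E x - x / 2 * (G' x * E x - G x * E1 x)"
    unfolding E1' by (simp add: EG algebra_simps power2_eq_square)
  also have "\<dots> \<le> 0"
  proof -
    have "0 < G x * E x" using x by (intro mult_pos_pos Gpos Epos) auto
    moreover have "0 \<le> x / 2 * (G' x * E x - G x * E1 x)" using W x by (intro mult_nonneg_nonneg) auto
    ultimately show ?thesis by linarith
  qed
  finally show ?thesis .
qed

lemma u1_z1_neg: "0 < x \<Longrightarrow> x \<le> 1 \<Longrightarrow> u1 z1 x < 0"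
  unfolding u1_def using nrm_pos[OF z1(1)] z1(2) E_pos
  by (intro mult_pos_neg bessel_E1_neg(1)[OF nu, of z1]) auto

lemma nrm_bound: "\<exists>C\<ge>0. \<forall>z\<in>Z. nrm z \<le> C * z powr \<beta>"
proof -
  obtain c where c: "0 < c" "\<And>z. z \<in> Z \<Longrightarrow> c \<le> z powr \<beta> * \<bar>E1 z\<bar>" using E1_zero_lower by blast
  have "nrm z \<le> sqrt 2 / c * z powr \<beta>" if "z \<in> Z" for z
  proof -
    have "sqrt 2 * c \<le> sqrt 2 * (z powr \<beta> * \<bar>E1 z\<bar>)" using c(2)[OF that] by (intro mult_left_mono) auto
    then show ?thesis using E1_zero_nonzero[OF that] c(1) by (simp add: nrm_def field_simps)
  qed
  then show ?thesis using c(1) by (intro exI[of _ "sqrt 2 / c"]) auto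
qed

text \<open>Polynomial growth in z is enough, since the coefficients in the expansions below decay
  faster than any prescribed power.\<close>

lemma u_bound: "\<exists>C\<ge>0. \<forall>z\<in>Z. \<forall>x\<ge>0. \<bar>u z x\<bar> \<le> C * z powr \<beta> \<and> \<bar>u1 z x\<bar> \<le> C * z powr (\<beta> + 1)"
proof -
  obtain C where C: "0 \<le> C" "\<And>z. z \<in> Z \<Longrightarrow> nrm z \<le> C * z powr \<beta>" using nrm_bound by blast
  have "\<bar>u z x\<bar> \<le> C * E 0 * z powr \<beta> \<and> \<bar>u1 z x\<bar> \<le> C * E 0 * z powr (\<beta> + 1)" if z: "z \<in> Z" and x: "0 \<le> x" for z x
  proof -
    note z0 = Z_pos[OF z]
    have e: "\<bar>E (z * x)\<bar> \<le> E 0" "\<bar>E1 (z * x)\<bar> \<le> E 0" using abs_E_le[of "z * x"] z0 x by auto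
    have "\<bar>u z x\<bar> \<le> (C * z powr \<beta>) * E 0"
      unfolding u_def abs_mult using C z e nrm_pos[OF z] by (intro mult_mono) auto
    moreover have "\<bar>u1 z x\<bar> \<le> (C * z powr \<beta>) * (z * E 0)"
      unfolding u1_def abs_mult using C z e nrm_pos[OF z] z0 by (intro mult_mono) auto
    moreover have "z powr (\<beta> + 1) = z powr \<beta> * z" using powr_add[of z \<beta> 1] z0 by (simp only: powr_one)
    ultimately show ?thesis by (simp only: mult_ac)
  qed
  then show ?thesis using C(1) E0_pos by (intro exI[of _ "C * E 0"]) auto
qed

text \<open>The factor 1 - x pays for the later division by \<open>u z1\<close>, which vanishes to
  first order at 1.\<close>

lemma u_bound_at_1: "\<exists>C\<ge>0. \<forall>z\<in>Z. \<forall>x\<in>{0..1}. \<bar>u z x\<bar> \<le> C * z powr (\<beta> + 1) * (1 - x)"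
proof -
  obtain C where C: "0 \<le> C" "\<And>z x. z \<in> Z \<Longrightarrow> 0 \<le> x \<Longrightarrow> \<bar>u1 z x\<bar> \<le> C * z powr (\<beta> + 1)" using u_bound by blast
  have "\<bar>u z x\<bar> \<le> C * z powr (\<beta> + 1) * (1 - x)" if z: "z \<in> Z" and x: "0 \<le> x" "x \<le> 1" for z x
  proof (cases "x = 1")
    case False
    then obtain y where y: "x < y" "y < 1" "u z 1 - u z x = (1 - x) * u1 z y"
      using MVT2[of x 1 "u z" "u1 z"] DERIV_u x by auto
    then have "u z x = - ((1 - x) * u1 z y)" using u_at_1[OF z] by simp
    then have "\<bar>u z x\<bar> = (1 - x) * \<bar>u1 z y\<bar>" using x by (simp add: abs_mult)
    also have "\<dots> \<le> (1 - x) * (C * z powr (\<beta> + 1))" using C(2)[OF z, of y] x y by (intro mult_left_mono) auto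
    finally show ?thesis by (simp add: mult.commute)
  qed (use u_at_1[OF z] in simp)
  then show ?thesis using C(1) by (intro exI[of _ C]) auto
qed

text \<open>\<open>u z1\<close> is decreasing, and its slope is bounded away from 0 on
  [1/2, 1].\<close>

lemma u_z1_lower: "\<exists>c>0. \<forall>x\<in>{0..1}. c * (1 - x) \<le> u z1 x"
proof -
  have "\<exists>y\<in>{1/2..1}. \<forall>x\<in>{1/2..1}. u1 z1 x \<le> u1 z1 y"
    by (rule continuous_attains_sup) (auto intro: continuous_u)
  then obtain y where y: "1/2 \<le> y" "y \<le> 1" "\<And>x. 1/2 \<le> x \<Longrightarrow> x \<le> 1 \<Longrightarrow> u1 z1 x \<le> u1 z1 y" by auto
  define c where "c = - u1 z1 y / 2"
  have c: "0 < c" using u1_z1_neg[of y] y by (simp add: c_def)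
  have high: "2 * c * (1 - x) \<le> u z1 x" if x: "1/2 \<le> x" "x \<le> 1" for x
  proof (cases "x = 1")
    case False
    then obtain t where t: "x < t" "t < 1" "u z1 1 - u z1 x = (1 - x) * u1 z1 t"
      using MVT2[of x 1 "u z1" "u1 z1"] DERIV_u x by auto
    have "u z1 x = (1 - x) * (- u1 z1 t)" using t u_at_1[OF z1(1)] by simp
    also have "\<dots> \<ge> (1 - x) * (2 * c)" using y(3)[of t] t x by (intro mult_left_mono) (auto simp: c_def)
    finally show ?thesis by (simp add: mult.commute)
  qed (use u_at_1[OF z1(1)] in simp)
  have "c * (1 - x) \<le> u z1 x" if x: "0 \<le> x" "x \<le> 1" for x
  proof (cases "1/2 \<le> x")
    case True
    have "c * (1 - x) \<le> 2 * c * (1 - x)" using c x by (simp add: mult_right_mono)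
    then show ?thesis using high[OF True x(2)] by linarith
  next
    case False
    have "u z1 (1/2) \<le> u z1 x"
    proof (rule DERIV_nonpos_imp_decreasing_open[of x "1/2" "u z1"])
      fix t :: real assume "x < t" "t < 1 / 2"
      then have "u1 z1 t < 0" using x by (intro u1_z1_neg) auto
      then show "\<exists>d. (u z1 has_real_derivative d) (at t) \<and> d \<le> 0" using DERIV_u[of z1 t] by (meson less_imp_le)
    qed (use False in \<open>auto intro: continuous_u\<close>)
    moreover have "c \<le> u z1 (1/2)" using high[of "1/2"] by simp
    moreover have "c * (1 - x) \<le> c * 1" using c x by (intro mult_left_mono) auto
    ultimately show ?thesis by linarith
  qed
  then show ?thesis using c by (intro exI[of _ c]) auto
qed

end

subsection \<open>The functions \<open>\<phi>\<^sub>n\<close> relative to the first one\<close>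

context bessel_order
begin

definition phi :: "real \<Rightarrow> real \<Rightarrow> real" where "phi z x = u z x / u z1 x"

definition phi1 :: "real \<Rightarrow> real \<Rightarrow> real" where
  "phi1 z x = (u1 z x * u z1 x - u z x * u1 z1 x) / (u z1 x)\<^sup>2"

text \<open>The weighted Wronskian of \<open>u z1\<close> and \<open>u z\<close>. It equals
  \<open>dens * phi1 z\<close> but is free of the division by \<open>u z1\<close>, hence continuous
  on [0, 1].\<close>

definition wron :: "real \<Rightarrow> real \<Rightarrow> real" where
  "wron z x = wt x * (u1 z x * u z1 x - u z x * u1 z1 x)"

definition mu :: "real \<Rightarrow> real" where "mu z = z\<^sup>2 - z1\<^sup>2"

definition dens :: "real \<Rightarrow> real" where "dens x = wt x * (u z1 x)\<^sup>2"

text \<open>The logarithmic derivative of \<open>dens\<close>, with derivative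
  \<open>drift1\<close>.\<close>

definition drift :: "real \<Rightarrow> real" where "drift x = \<beta> / x + 2 * (u1 z1 x / u z1 x)"

definition drift1 :: "real \<Rightarrow> real" where
  "drift1 x = - (\<beta> / x\<^sup>2) + 2 * (((- z1\<^sup>2 * u z1 x - \<beta> / x * u1 z1 x) * u z1 x - (u1 z1 x)\<^sup>2) / (u z1 x)\<^sup>2)"

text \<open>The second derivative of \<open>phi z\<close>, solved from \<phi>'' + drift \<phi>' +
  \<mu> \<phi> = 0, so that this equation holds by definition; \<open>phi3\<close> is its
  derivative.\<close>

definition phi2 :: "real \<Rightarrow> real \<Rightarrow> real" where
  "phi2 z x = - mu z * phi z x - drift x * phi1 z x"

definition phi3 :: "real \<Rightarrow> real \<Rightarrow> real" where
  "phi3 z x = - mu z * phi1 z x - drift1 x * phi1 z x - drift x * phi2 z x"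

lemma u_z1_nz: "0 \<le> x \<Longrightarrow> x < 1 \<Longrightarrow> u z1 x \<noteq> 0"
  using u_z1_pos[of x] by simp

lemma dens_pos: "0 < x \<Longrightarrow> x < 1 \<Longrightarrow> 0 < dens x"
  unfolding dens_def using wt_pos[of x] u_z1_pos[of x] by simp

lemma dens_nonneg [simp]: "0 \<le> dens x"
  by (simp add: dens_def)

lemma dens_1 [simp]: "dens 1 = 0"
  using u_at_1[OF z1(1)] by (simp add: dens_def)

lemma wron_0 [simp]: "wron z 0 = 0"
  by (simp add: wron_def)

lemma wron_1: "z \<in> Z \<Longrightarrow> wron z 1 = 0"
  using u_at_1[OF z1(1)] u_at_1 by (simp add: wron_def)

lemma continuous_wron: "cont01 (wron z)"
  unfolding wron_def[abs_def] by (intro continuous_intros continuous_u)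

lemma continuous_dens: "cont01 dens"
  unfolding dens_def[abs_def] by (intro continuous_intros continuous_u)

lemma continuous_phi: "continuous_on {0..<1} (phi z)" "continuous_on {0..<1} (phi1 z)"
  unfolding phi_def[abs_def] phi1_def[abs_def] using u_z1_nz
  by (intro continuous_intros continuous_u; simp)+

lemma dens_phi1: "0 \<le> x \<Longrightarrow> x < 1 \<Longrightarrow> dens x * phi1 z x = wron z x"
  using u_z1_nz[of x] by (simp add: dens_def phi1_def wron_def)

lemma DERIV_phi: "0 \<le> x \<Longrightarrow> x < 1 \<Longrightarrow> (phi z has_real_derivative phi1 z x) (at x)"
  unfolding phi_def[abs_def] phi1_def power2_eq_square
  by (intro DERIV_divide DERIV_u u_z1_nz)

lemma DERIV_phi1:
  assumes x: "0 < x" "x < 1" and z: "0 < z"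
  shows "(phi1 z has_real_derivative phi2 z x) (at x)"
proof -
  define b where "b = \<beta>"
  have nz: "u z1 x \<noteq> 0" using u_z1_nz x by simp
  have "(phi1 z has_real_derivative
     ((((- z\<^sup>2 * u z x - b / x * u1 z x) * u z1 x + u1 z1 x * u1 z x) -
       (u1 z x * u1 z1 x + (- z1\<^sup>2 * u z1 x - b / x * u1 z1 x) * u z x)) * (u z1 x)\<^sup>2 -
      (u1 z x * u z1 x - u z x * u1 z1 x) * (2 * u z1 x * u1 z1 x)) / ((u z1 x)\<^sup>2 * (u z1 x)\<^sup>2)) (at x)"
    unfolding phi1_def[abs_def] b_def
    using DERIV_power[OF DERIV_u[of z1 x], of 2] nz
    by (intro DERIV_divide DERIV_diff DERIV_mult DERIV_u DERIV_u1 x z z1(2)) (auto simp: mult_ac)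
  moreover have "((((- z\<^sup>2 * u z x - b / x * u1 z x) * u z1 x + u1 z1 x * u1 z x) -
       (u1 z x * u1 z1 x + (- z1\<^sup>2 * u z1 x - b / x * u1 z1 x) * u z x)) * (u z1 x)\<^sup>2 -
      (u1 z x * u z1 x - u z x * u1 z1 x) * (2 * u z1 x * u1 z1 x)) / ((u z1 x)\<^sup>2 * (u z1 x)\<^sup>2) = phi2 z x"
    unfolding phi2_def phi_def phi1_def mu_def drift_def b_def[symmetric] using nz x
    by (simp add: field_simps power2_eq_square)
  ultimately show ?thesis by (simp only:)
qed

lemma DERIV_wron:
  assumes x: "0 < x" and z: "0 < z"
  shows "(wron z has_real_derivative - mu z * (wt x * (u z x * u z1 x))) (at x)"
proof -
  define b where "b = \<beta>"
  have "(wron z has_real_derivative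
     b / x * wt x * (u1 z x * u z1 x - u z x * u1 z1 x) +
     (((- z\<^sup>2 * u z x - b / x * u1 z x) * u z1 x + u1 z1 x * u1 z x) -
       (u1 z x * u1 z1 x + (- z1\<^sup>2 * u z1 x - b / x * u1 z1 x) * u z x)) * wt x) (at x)"
    unfolding wron_def[abs_def] b_def
    by (intro DERIV_mult DERIV_wt DERIV_diff DERIV_u DERIV_u1 x z z1(2))
  moreover have "b / x * wt x * (u1 z x * u z1 x - u z x * u1 z1 x) +
     (((- z\<^sup>2 * u z x - b / x * u1 z x) * u z1 x + u1 z1 x * u1 z x) -
       (u1 z x * u1 z1 x + (- z1\<^sup>2 * u z1 x - b / x * u1 z1 x) * u z x)) * wt x =
      - mu z * (wt x * (u z x * u z1 x))"
    unfolding mu_def using x by (simp add: field_simps)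
  ultimately show ?thesis by (simp only:)
qed

lemma DERIV_dens:
  assumes x: "0 < x" "x < 1"
  shows "(dens has_real_derivative dens x * drift x) (at x)"
proof -
  define b where "b = \<beta>"
  have nz: "u z1 x \<noteq> 0" using u_z1_nz x by simp
  have "(dens has_real_derivative b / x * wt x * (u z1 x)\<^sup>2 + (2 * u z1 x * u1 z1 x) * wt x) (at x)"
    unfolding dens_def[abs_def] b_def using DERIV_power[OF DERIV_u[of z1 x], of 2]
    by (intro DERIV_mult DERIV_wt x) (auto simp: mult_ac)
  moreover have "b / x * wt x * (u z1 x)\<^sup>2 + (2 * u z1 x * u1 z1 x) * wt x = dens x * drift x"
    unfolding dens_def drift_def b_def[symmetric] using nz x by (simp add: field_simps power2_eq_square)
  ultimately show ?thesis by (simp only:)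
qed

lemma DERIV_drift:
  assumes x: "0 < x" "x < 1"
  shows "(drift has_real_derivative drift1 x) (at x)"
proof -
  have nz: "u z1 x \<noteq> 0" using u_z1_nz x by simp
  have "((\<lambda>x. \<beta> / x) has_real_derivative - (\<beta> / x\<^sup>2)) (at x)"
    using x DERIV_cmult[OF DERIV_inverse[of x UNIV], of \<beta>]
    by (simp add: divide_inverse power2_eq_square)
  moreover have "((\<lambda>x. u1 z1 x / u z1 x) has_real_derivative
      ((- z1\<^sup>2 * u z1 x - \<beta> / x * u1 z1 x) * u z1 x - (u1 z1 x)\<^sup>2) / (u z1 x)\<^sup>2) (at x)"
    unfolding power2_eq_square[of "u z1 x"] power2_eq_square[of "u1 z1 x"]
    by (intro DERIV_divide DERIV_u DERIV_u1 x z1(2) nz)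
  ultimately show ?thesis unfolding drift_def[abs_def] drift1_def by (intro DERIV_add DERIV_cmult)
qed

lemma DERIV_phi2:
  assumes x: "0 < x" "x < 1" and z: "0 < z"
  shows "(phi2 z has_real_derivative phi3 z x) (at x)"
proof -
  have "((\<lambda>x. - mu z * phi z x - drift x * phi1 z x) has_real_derivative
      - mu z * phi1 z x - (drift1 x * phi1 z x + phi2 z x * drift x)) (at x)"
    by (intro DERIV_diff DERIV_cmult DERIV_mult DERIV_phi DERIV_drift DERIV_phi1 x z less_imp_le[OF x(1)])
  moreover have "(\<lambda>x. - mu z * phi z x - drift x * phi1 z x) = phi2 z" by (simp add: phi2_def fun_eq_iff)
  moreover have "- mu z * phi1 z x - (drift1 x * phi1 z x + phi2 z x * drift x) = phi3 z x"
    by (simp add: phi3_def)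
  ultimately show ?thesis by (simp only:)
qed

text \<open>\<open>dens\<close> is log-concave, by \<open>log_deriv_E_decreasing\<close>.
  Differentiating the equation of \<phi> puts - \<open>drift1\<close> into the zero-order term of
  the equation of \<phi>'.\<close>

lemma drift1_nonpos:
  assumes x: "0 < x" "x < 1"
  shows "drift1 x \<le> 0"
proof -
  have y: "0 < z1 * x" "z1 * x < z1" using x z1 by auto
  have "(- z1\<^sup>2 * u z1 x - \<beta> / x * u1 z1 x) * u z1 x - (u1 z1 x)\<^sup>2 =
     (nrm z1 * z1)\<^sup>2 * ((- E (z1 * x) - \<beta> / (z1 * x) * E1 (z1 * x)) * E (z1 * x) - (E1 (z1 * x))\<^sup>2)"
    unfolding u_def u1_def using x z1(2) by (simp add: field_simps power2_eq_square)
  also have "\<dots> \<le> 0" using log_deriv_E_decreasing[OF y] by (intro mult_nonneg_nonpos) auto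
  finally have "((- z1\<^sup>2 * u z1 x - \<beta> / x * u1 z1 x) * u z1 x - (u1 z1 x)\<^sup>2) / (u z1 x)\<^sup>2 \<le> 0"
    by (intro divide_nonpos_nonneg) auto
  moreover have "0 \<le> \<beta> / x\<^sup>2" using beta_nonneg by simp
  ultimately show ?thesis unfolding drift1_def by linarith
qed

text \<open>Numerator and denominator both vanish at 1, the denominator to first order only.\<close>

lemma phi_bound: "\<exists>C\<ge>0. \<forall>z\<in>Z. \<forall>x\<in>{0..<1}. \<bar>phi z x\<bar> \<le> C * z powr (\<beta> + 1)"
proof -
  obtain C where C: "0 \<le> C" "\<And>z x. z \<in> Z \<Longrightarrow> x \<in> {0..1} \<Longrightarrow> \<bar>u z x\<bar> \<le> C * z powr (\<beta> + 1) * (1 - x)"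
    using u_bound_at_1 by blast
  obtain c where c: "0 < c" "\<And>x. x \<in> {0..1} \<Longrightarrow> c * (1 - x) \<le> u z1 x" using u_z1_lower by blast
  have "\<bar>phi z x\<bar> \<le> C / c * z powr (\<beta> + 1)" if z: "z \<in> Z" and x: "0 \<le> x" "x < 1" for z x
  proof -
    have "\<bar>phi z x\<bar> = \<bar>u z x\<bar> / u z1 x" using u_z1_pos[OF x] by (simp add: phi_def)
    also have "\<dots> \<le> (C * z powr (\<beta> + 1) * (1 - x)) / (c * (1 - x))"
      using C(2)[OF z, of x] c(2)[of x] c(1) x by (intro frac_le) auto
    also have "\<dots> = C / c * z powr (\<beta> + 1)" using x by simp
    finally show ?thesis .
  qed
  then show ?thesis using C(1) c(1) by (intro exI[of _ "C / c"]) auto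
qed

lemma wt_mono: "0 < x \<Longrightarrow> x \<le> y \<Longrightarrow> wt x \<le> wt y"
  using nu by (simp add: wt_pos_eq powr_mono2)

text \<open>The mean value theorem from the nearer endpoint, compared with dens \<ge> c^2 wt (1 -
  x)^2. A single constant for all \<open>R\<close> is needed, since it is applied to
  \<open>wron z\<close> for every zero z and to the error of an expansion.\<close>

lemma bound_by_dens:
  "\<exists>A\<ge>0. \<forall>R r K. cont01 R \<and> R 0 = 0 \<and> R 1 = 0 \<and> 0 \<le> K \<and>
     (\<forall>y. 0 < y \<and> y < 1 \<longrightarrow> (R has_real_derivative r y) (at y) \<and> \<bar>r y\<bar> \<le> wt y * K * (1 - y)\<^sup>2) \<longrightarrow>
     (\<forall>x. 0 < x \<and> x < 1 \<longrightarrow> \<bar>R x\<bar> \<le> A * K * (x * (1 - x)) * dens x)"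
proof -
  obtain c where c: "0 < c" "\<And>x. x \<in> {0..1} \<Longrightarrow> c * (1 - x) \<le> u z1 x" using u_z1_lower by blast
  \<comment> \<open>The power of 2 comes from the weight on [1/2, 1], and 8 from (1 - x)^3 \<ge> 1/8
    on [0, 1/2].\<close>
  define A where "A = 8 * 2 powr \<beta> / c\<^sup>2"
  have A: "0 \<le> A" by (simp add: A_def)
  have "\<bar>R x\<bar> \<le> A * K * (x * (1 - x)) * dens x"
    if R: "cont01 R" "R 0 = 0" "R 1 = 0" and K: "0 \<le> K"
      and d: "\<And>y. 0 < y \<Longrightarrow> y < 1 \<Longrightarrow> (R has_real_derivative r y) (at y)"
      and b: "\<And>y. 0 < y \<Longrightarrow> y < 1 \<Longrightarrow> \<bar>r y\<bar> \<le> wt y * K * (1 - y)\<^sup>2" and x: "0 < x" "x < 1" for R r K x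
  proof -
    have dens_lower: "c\<^sup>2 * wt x * (1 - x)\<^sup>2 \<le> dens x"
    proof -
      have "(c * (1 - x))\<^sup>2 \<le> (u z1 x)\<^sup>2" using c(2)[of x] c(1) x by (intro power_mono) auto
      then have "wt x * (c * (1 - x))\<^sup>2 \<le> dens x" unfolding dens_def by (intro mult_left_mono) auto
      then show ?thesis by (simp add: power_mult_distrib mult_ac)
    qed
    have dd: "R differentiable (at y)" if "0 < y" "y < 1" for y
      using d[OF that] real_differentiable_def by blast
    have "\<bar>R x\<bar> \<le> (A * K * (x * (1 - x))) * (c\<^sup>2 * wt x * (1 - x)\<^sup>2)"
    proof (cases "x \<le> 1 / 2")
      case True
      have "\<exists>l y. 0 < y \<and> y < x \<and> DERIV R y :> l \<and> R x - R 0 = (x - 0) * l"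
        using x dd by (intro MVT continuous_on_subset[OF R(1)]) auto
      then obtain l y where y: "0 < y" "y < x" "DERIV R y :> l" "R x = x * l" using R(2) by auto
      have l: "l = r y" using y x by (intro DERIV_unique[OF y(3) d]) auto
      have "\<bar>l\<bar> \<le> wt y * K * (1 - y)\<^sup>2" unfolding l using b[of y] y x by simp
      also have "\<dots> \<le> wt x * K * 1"
        using wt_mono[of y x] y x K by (intro mult_mono power_le_one) auto
      also have "\<dots> \<le> wt x * K * (8 * 2 powr \<beta> * (1 - x) ^ 3)"
      proof (intro mult_left_mono)
        have "(1 / 2) ^ 3 \<le> (1 - x) ^ 3" using True by (intro power_mono) auto
        moreover have "1 \<le> (2::real) powr \<beta>" using beta_nonneg by (intro ge_one_powr_ge_zero) auto
        ultimately have "8 * 1 * (1 / 2) ^ 3 \<le> 8 * 2 powr \<beta> * (1 - x) ^ 3" using x by (intro mult_mono) auto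
        then show "1 \<le> 8 * 2 powr \<beta> * (1 - x) ^ 3" by (simp add: power3_eq_cube)
      qed (use K in auto)
      finally have "\<bar>x * l\<bar> \<le> x * (wt x * K * (8 * 2 powr \<beta> * (1 - x) ^ 3))"
        using x by (simp add: abs_mult)
      also have "\<dots> = (A * K * (x * (1 - x))) * (c\<^sup>2 * wt x * (1 - x)\<^sup>2)"
        using c(1) by (simp add: A_def power2_eq_square power3_eq_cube)
      finally show ?thesis using y(4) by simp
    next
      case False
      have "\<exists>l y. x < y \<and> y < 1 \<and> DERIV R y :> l \<and> R 1 - R x = (1 - x) * l"
        using x dd by (intro MVT continuous_on_subset[OF R(1)]) auto
      then obtain l y where y: "x < y" "y < 1" "DERIV R y :> l" "R x = - ((1 - x) * l)" using R(3) by auto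
      have y0: "0 < y" using x y by simp
      have l: "l = r y" using y0 y by (intro DERIV_unique[OF y(3) d]) auto
      have "\<bar>l\<bar> \<le> wt y * K * (1 - y)\<^sup>2" unfolding l using b[of y] y0 y by simp
      also have "\<dots> \<le> 1 * K * (1 - x)\<^sup>2"
        using wt_le_1[of y] y y0 K by (intro mult_mono power_mono) auto
      also have "\<dots> \<le> (2 powr \<beta> * wt x * (8 * x)) * K * (1 - x)\<^sup>2"
      proof (intro mult_right_mono)
        have "1 \<le> (2 * x) powr \<beta>" using False beta_nonneg by (intro ge_one_powr_ge_zero) auto
        then have "1 \<le> 2 powr \<beta> * wt x" using x by (simp add: wt_pos_eq powr_mult)
        then have "1 * 1 \<le> 2 powr \<beta> * wt x * (8 * x)" using False by (intro mult_mono) auto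
        then show "1 \<le> 2 powr \<beta> * wt x * (8 * x)" by simp
      qed (use K in auto)
      finally have "\<bar>(1 - x) * l\<bar> \<le> (1 - x) * ((2 powr \<beta> * wt x * (8 * x)) * K * (1 - x)\<^sup>2)"
        using x by (simp add: abs_mult)
      also have "\<dots> = (A * K * (x * (1 - x))) * (c\<^sup>2 * wt x * (1 - x)\<^sup>2)"
        using c(1) by (simp add: A_def power2_eq_square)
      finally show ?thesis using y(4) by simp
    qed
    also have "\<dots> \<le> (A * K * (x * (1 - x))) * dens x"
      using dens_lower A K x by (intro mult_left_mono) auto
    finally show ?thesis .
  qed
  then show ?thesis using A by (intro exI[of _ A]) blast
qed

text \<open>The factor x (1 - x) compensates the poles of \<open>drift\<close> at both endpoints,
  which keeps \<open>phi2\<close> bounded.\<close>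

lemma phi1_bound: "\<exists>C\<ge>0. \<forall>z\<in>Z. \<forall>x\<in>{0<..<1}. \<bar>phi1 z x\<bar> \<le> C * (z\<^sup>2 * z powr (\<beta> + 1)) * (x * (1 - x))"
proof -
  obtain C where C: "0 \<le> C" "\<And>z x. z \<in> Z \<Longrightarrow> x \<in> {0..1} \<Longrightarrow> \<bar>u z x\<bar> \<le> C * z powr (\<beta> + 1) * (1 - x)"
    using u_bound_at_1 by blast
  obtain A where A: "0 \<le> A" "\<And>R r K x. cont01 R \<Longrightarrow> R 0 = 0 \<Longrightarrow> R 1 = 0 \<Longrightarrow> 0 \<le> K \<Longrightarrow>
     (\<And>y. 0 < y \<Longrightarrow> y < 1 \<Longrightarrow> (R has_real_derivative r y) (at y) \<and> \<bar>r y\<bar> \<le> wt y * K * (1 - y)\<^sup>2) \<Longrightarrow>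
     0 < x \<Longrightarrow> x < 1 \<Longrightarrow> \<bar>R x\<bar> \<le> A * K * (x * (1 - x)) * dens x"
    using bound_by_dens by metis
  define B where "B = C * z1 powr (\<beta> + 1)"
  have B: "0 \<le> B" using C by (simp add: B_def)
  have "\<bar>phi1 z x\<bar> \<le> A * (C * B) * (z\<^sup>2 * z powr (\<beta> + 1)) * (x * (1 - x))" if z: "z \<in> Z" and x: "0 < x" "x < 1" for z x
  proof -
    define P where "P = z\<^sup>2 * z powr (\<beta> + 1)"
    have z0: "0 < z" using Z_pos[OF z] .
    have mu: "\<bar>mu z\<bar> \<le> z\<^sup>2" using z1_le[OF z] z1(2) power_mono[of z1 z 2] by (simp add: mu_def)
    have d: "\<bar>- mu z * (wt y * (u z y * u z1 y))\<bar> \<le> wt y * (P * (C * B)) * (1 - y)\<^sup>2" if "0 < y" "y < 1" for y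
    proof -
      have "\<bar>mu z\<bar> * (wt y * (\<bar>u z y\<bar> * \<bar>u z1 y\<bar>)) \<le> z\<^sup>2 * (wt y * ((C * z powr (\<beta> + 1) * (1 - y)) * (B * (1 - y))))"
        using mu C(2)[OF z, of y] C(2)[OF z1(1), of y] that C(1)
        by (intro mult_mono mult_left_mono) (auto simp: B_def)
      also have "\<dots> = wt y * (P * (C * B)) * (1 - y)\<^sup>2" by (simp add: P_def power2_eq_square)
      finally show ?thesis by (simp add: abs_mult)
    qed
    have "\<bar>wron z x\<bar> \<le> A * (P * (C * B)) * (x * (1 - x)) * dens x"
      using DERIV_wron z0 d B C by (intro A(2)[OF continuous_wron _ _ _ _ x]) (auto simp: wron_1[OF z] P_def)
    then have "\<bar>phi1 z x\<bar> * dens x \<le> A * (P * (C * B)) * (x * (1 - x)) * dens x"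
      using dens_phi1[of x z] x dens_nonneg[of x] by (metis abs_mult abs_of_nonneg less_imp_le mult.commute)
    then show ?thesis using dens_pos[OF x] by (simp add: P_def mult_ac)
  qed
  then show ?thesis using A(1) B C(1) by (intro exI[of _ "A * (C * B)"]) auto
qed

lemma drift_bound: "\<exists>C\<ge>0. \<forall>x\<in>{0<..<1}. \<bar>drift x\<bar> * (x * (1 - x)) \<le> C"
proof -
  obtain C where C: "0 \<le> C" "\<And>z x. z \<in> Z \<Longrightarrow> 0 \<le> x \<Longrightarrow> \<bar>u1 z x\<bar> \<le> C * z powr (\<beta> + 1)" using u_bound by blast
  obtain c where c: "0 < c" "\<And>x. x \<in> {0..1} \<Longrightarrow> c * (1 - x) \<le> u z1 x" using u_z1_lower by blast
  define B where "B = C * z1 powr (\<beta> + 1)"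
  have "\<bar>drift x\<bar> * (x * (1 - x)) \<le> \<beta> + 2 * (B / c)" if x: "0 < x" "x < 1" for x
  proof -
    have "\<bar>u1 z1 x / u z1 x\<bar> \<le> B / (c * (1 - x))"
      using C(2)[OF z1(1), of x] c(2)[of x] c(1) x u_z1_pos[of x] by (auto simp: B_def abs_divide intro!: frac_le)
    then have "\<bar>drift x\<bar> \<le> \<beta> / x + 2 * (B / (c * (1 - x)))"
      unfolding drift_def using x beta_nonneg by (intro order_trans[OF abs_triangle_ineq]) (auto simp: abs_mult)
    then have "\<bar>drift x\<bar> * (x * (1 - x)) \<le> (\<beta> / x + 2 * (B / (c * (1 - x)))) * (x * (1 - x))"
      using x by (intro mult_right_mono) auto
    also have "\<dots> = \<beta> * (1 - x) + 2 * (B / c) * x" using x c(1) by (simp add: field_simps)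
    also have "\<dots> \<le> \<beta> * 1 + 2 * (B / c) * 1"
      using x beta_nonneg c(1) C(1) by (intro add_mono mult_left_mono) (auto simp: B_def)
    finally show ?thesis by simp
  qed
  moreover have "0 \<le> \<beta> + 2 * (B / c)" using beta_nonneg c(1) C(1) by (simp add: B_def)
  ultimately show ?thesis by (intro exI[of _ "\<beta> + 2 * (B / c)"]) auto
qed

lemma phi2_bound:
  assumes z: "z \<in> Z"
  shows "\<exists>C. \<forall>x\<in>{0<..<1}. \<bar>phi2 z x\<bar> \<le> C"
proof -
  obtain C where C: "\<And>x. x \<in> {0..<1} \<Longrightarrow> \<bar>phi z x\<bar> \<le> C * z powr (\<beta> + 1)" using phi_bound z by blast
  obtain D where D: "0 \<le> D" "\<And>x. x \<in> {0<..<1} \<Longrightarrow> \<bar>phi1 z x\<bar> \<le> D * (z\<^sup>2 * z powr (\<beta> + 1)) * (x * (1 - x))"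
    using phi1_bound z by blast
  obtain K where K: "\<And>x. x \<in> {0<..<1} \<Longrightarrow> \<bar>drift x\<bar> * (x * (1 - x)) \<le> K" using drift_bound by blast
  define D' where "D' = D * (z\<^sup>2 * z powr (\<beta> + 1))"
  have D': "0 \<le> D'" using D by (simp add: D'_def)
  have "\<bar>phi2 z x\<bar> \<le> \<bar>mu z\<bar> * (C * z powr (\<beta> + 1)) + K * D'" if x: "x \<in> {0<..<1}" for x
  proof -
    have "\<bar>drift x * phi1 z x\<bar> \<le> \<bar>drift x\<bar> * (D' * (x * (1 - x)))"
      unfolding abs_mult D'_def using D(2)[OF x] by (intro mult_left_mono) auto
    also have "\<dots> = (\<bar>drift x\<bar> * (x * (1 - x))) * D'" by simp
    also have "\<dots> \<le> K * D'" using K[OF x] D' by (intro mult_right_mono) auto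
    finally have 1: "\<bar>drift x * phi1 z x\<bar> \<le> K * D'" .
    have 2: "\<bar>mu z * phi z x\<bar> \<le> \<bar>mu z\<bar> * (C * z powr (\<beta> + 1))"
      unfolding abs_mult using C[of x] x by (intro mult_left_mono) auto
    show ?thesis unfolding phi2_def using 1 2 by linarith
  qed
  then show ?thesis by blast
qed

text \<open>The relation \<open>(dens \<phi>\<^sub>y')' = - \<mu>\<^sub>y dens \<phi>\<^sub>y\<close>, integrated against \<open>\<phi>\<^sub>z\<close>.\<close>

lemma phi1_orthogonal:
  assumes y: "y \<in> Z" and z: "z \<in> Z"
  shows "((\<lambda>x. dens x * (phi1 y x * phi1 z x)) has_integral (if y = z then mu z else 0)) {0..1}"
proof -
  obtain C where C: "\<And>x. x \<in> {0..<1} \<Longrightarrow> \<bar>phi z x\<bar> \<le> C * z powr (\<beta> + 1)" using phi_bound z by blast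
  define K where "K = C * z powr (\<beta> + 1)"
  \<comment> \<open>A default value, 0 / 0 = 0, and not the limit at 1. The product with
    \<open>wron y\<close> is continuous at 1 all the same, because \<open>phi z\<close> is
    bounded.\<close>
  have phi1: "phi z 1 = 0" using u_at_1[OF z] by (simp add: phi_def)
  have K0: "0 \<le> K" using C[of 0] by (simp add: K_def)
  have K: "\<bar>phi z x\<bar> \<le> K" if "x \<in> {0..1}" for x
    using C[of x] that phi1 K0 by (cases "x = 1") (auto simp: K_def)
  have cont: "continuous_on {0..1} (\<lambda>x. wron y x * phi z x)"
    unfolding continuous_on_def
  proof
    fix x :: real assume x: "x \<in> {0..1}"
    show "((\<lambda>x. wron y x * phi z x) \<longlongrightarrow> wron y x * phi z x) (at x within {0..1})"
    proof (cases "x = 1")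
      case True
      have "(wron y \<longlongrightarrow> 0) (at 1 within {0..1})"
        using continuous_wron[of y, unfolded continuous_on_def, THEN bspec[of _ _ 1]] by (simp add: wron_1[OF y])
      then have "((\<lambda>x. wron y x * K) \<longlongrightarrow> 0) (at 1 within {0..1})" by (rule tendsto_mult_left_zero)
      then have "((\<lambda>x. wron y x * phi z x) \<longlongrightarrow> 0) (at 1 within {0..1})"
        by (rule Lim_null_comparison[rotated, OF tendsto_norm_zero])
           (auto simp: eventually_at_filter abs_mult K0 intro!: always_eventually mult_left_mono order_trans[OF K])
      then show ?thesis using True phi1 by simp
    next
      case False
      then have "isCont (phi z) x" using x DERIV_phi[of x z] by (auto intro: DERIV_isCont)
      then have "(phi z \<longlongrightarrow> phi z x) (at x within {0..1})"
        by (auto simp: isCont_def intro: tendsto_within_subset)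
      moreover have "(wron y \<longlongrightarrow> wron y x) (at x within {0..1})"
        using continuous_wron[of y] x unfolding continuous_on_def by auto
      ultimately show ?thesis by (intro tendsto_mult)
    qed
  qed
  have "((\<lambda>x. - mu y * (wt x * (u y x * u z x)) + dens x * (phi1 y x * phi1 z x)) has_integral
      wron y 1 * phi z 1 - wron y 0 * phi z 0) {0..1}"
  proof (rule fundamental_theorem_of_calculus_interior[OF _ cont])
    fix x :: real assume x: "x \<in> {0<..<1}"
    have nz: "u z1 x \<noteq> 0" using u_z1_nz x by simp
    have "((\<lambda>x. wron y x * phi z x) has_real_derivative
        - mu y * (wt x * (u y x * u z1 x)) * phi z x + phi1 z x * wron y x) (at x)"
      using x Z_pos[OF y] by (intro DERIV_mult DERIV_wron DERIV_phi) auto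
    moreover have "- mu y * (wt x * (u y x * u z1 x)) * phi z x = - mu y * (wt x * (u y x * u z x))"
      using nz by (simp add: phi_def)
    moreover have "phi1 z x * wron y x = dens x * (phi1 y x * phi1 z x)"
      using dens_phi1[of x y] x by simp
    ultimately show "((\<lambda>x. wron y x * phi z x) has_vector_derivative
        - mu y * (wt x * (u y x * u z x)) + dens x * (phi1 y x * phi1 z x)) (at x)"
      unfolding has_real_derivative_iff_has_vector_derivative[symmetric] by (simp only:)
  qed simp
  then have 1: "((\<lambda>x. - mu y * (wt x * (u y x * u z x)) + dens x * (phi1 y x * phi1 z x)) has_integral 0) {0..1}"
    using phi1 by simp
  have "((\<lambda>x. wt x * (u y x * u z x)) has_integral ip (u y) (u z)) {0..1}"
    unfolding ip_def by (intro integrable_integral ip_integrable continuous_u)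
  then have "((\<lambda>x. - mu y * (wt x * (u y x * u z x))) has_integral - mu y * ip (u y) (u z)) {0..1}"
    by (rule has_integral_mult_right)
  from has_integral_diff[OF 1 this] show ?thesis using ip_u_delta[OF y z] by (auto split: if_splits)
qed

end

subsection \<open>Rapidly converging expansions\<close>

text \<open>Infinite differentiability: each derivative is again required to be smooth, so no
  iterated derivatives have to be named.\<close>

coinductive smooth :: "(real \<Rightarrow> real) \<Rightarrow> bool" where
  "(\<And>x. (f has_real_derivative f' x) (at x)) \<Longrightarrow> smooth f' \<Longrightarrow> smooth f"

text \<open>The derivative of a product is a sum of products, so the coinduction has to run over the
  algebra generated by the smooth functions.\<close>

inductive smooth_alg :: "(real \<Rightarrow> real) \<Rightarrow> bool" where
  base: "smooth f \<Longrightarrow> smooth_alg f"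
| add: "smooth_alg f \<Longrightarrow> smooth_alg g \<Longrightarrow> smooth_alg (\<lambda>x. f x + g x)"
| mult: "smooth_alg f \<Longrightarrow> smooth_alg g \<Longrightarrow> smooth_alg (\<lambda>x. f x * g x)"

lemma smoothD: "smooth f \<Longrightarrow> \<exists>f'. (\<forall>x. (f has_real_derivative f' x) (at x)) \<and> smooth f'"
  by (cases rule: smooth.cases) auto

lemma smooth_alg_deriv: "smooth_alg f \<Longrightarrow> \<exists>f'. (\<forall>x. (f has_real_derivative f' x) (at x)) \<and> smooth_alg f'"
proof (induction rule: smooth_alg.induct)
  case (base f)
  then show ?case using smoothD smooth_alg.base by blast
next
  case (add f g)
  then obtain f' g' where "\<And>x. (f has_real_derivative f' x) (at x)" "\<And>x. (g has_real_derivative g' x) (at x)"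
    "smooth_alg f'" "smooth_alg g'" by auto
  then show ?case
    by (intro exI[of _ "\<lambda>x. f' x + g' x"]) (auto intro: smooth_alg.add DERIV_add)
next
  case (mult f g)
  then obtain f' g' where d: "\<And>x. (f has_real_derivative f' x) (at x)" "\<And>x. (g has_real_derivative g' x) (at x)"
    "smooth_alg f'" "smooth_alg g'" by auto
  then have "smooth_alg (\<lambda>x. f' x * g x + g' x * f x)" using mult by (intro smooth_alg.add smooth_alg.mult)
  then show ?case by (intro exI[of _ "\<lambda>x. f' x * g x + g' x * f x"] conjI allI DERIV_mult d)
qed

lemma smooth_alg_smooth: "smooth_alg f \<Longrightarrow> smooth f"
proof (coinduction arbitrary: f)
  case smooth
  then obtain f' where "\<And>x. (f has_real_derivative f' x) (at x)" "smooth_alg f'" using smooth_alg_deriv by blast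
  then show ?case by auto
qed

lemma smooth_add: "smooth f \<Longrightarrow> smooth g \<Longrightarrow> smooth (\<lambda>x. f x + g x)"
  by (rule smooth_alg_smooth[OF smooth_alg.add[OF smooth_alg.base smooth_alg.base]])

lemma smooth_mult: "smooth f \<Longrightarrow> smooth g \<Longrightarrow> smooth (\<lambda>x. f x * g x)"
  by (rule smooth_alg_smooth[OF smooth_alg.mult[OF smooth_alg.base smooth_alg.base]])

lemma smooth_const: "smooth (\<lambda>x. c)"
proof (coinduction arbitrary: c)
  case smooth
  have "((\<lambda>x. c) has_real_derivative 0) (at x)" for x by simp
  then show ?case by (intro exI[of _ "\<lambda>x. c"] exI[of _ "\<lambda>x. 0"]) auto
qed

lemma smooth_id: "smooth (\<lambda>x. x)"
  by (rule smooth.intros[OF DERIV_ident smooth_const])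

text \<open>Differentiation raises the order and rescales, so the family in which \<open>c\<close>
  and \<nu> vary is closed under it.\<close>

lemma smooth_bessel_F: "- 1 / 2 \<le> \<nu> \<Longrightarrow> smooth (\<lambda>s. c * bessel_F \<nu> (k * s))"
proof (coinduction arbitrary: c \<nu>)
  case smooth
  have "((\<lambda>s. c * bessel_F \<nu> (k * s)) has_real_derivative (c * (- 1 / 4) * k) * bessel_F (\<nu> + 1) (k * s)) (at s)" for s
  proof -
    have "((\<lambda>s. bessel_F \<nu> (k * s)) has_real_derivative - 1 / 4 * bessel_F (\<nu> + 1) (k * s) * k) (at s)"
      by (rule DERIV_chain2[OF DERIV_bessel_F[OF smooth]]) (auto intro!: derivative_eq_intros)
    from DERIV_cmult[OF this, of c] show ?thesis by (simp add: mult_ac)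
  qed
  moreover have "- 1 / 2 \<le> \<nu> + 1" using smooth by simp
  ultimately show ?case
    by (intro exI[of _ "\<lambda>s. c * bessel_F \<nu> (k * s)"]
        exI[of _ "\<lambda>s. (c * (- 1 / 4) * k) * bessel_F (\<nu> + 1) (k * s)"]) blast
qed

lemma smooth_real_polynomial: "real_polynomial_function P \<Longrightarrow> smooth P"
proof (induction rule: real_polynomial_function.induct)
  case (linear f)
  have eq: "f = (\<lambda>x. f 1 * x)"
  proof
    fix x show "f x = f 1 * x" using linear_simps(5)[OF linear, of x 1] by (simp add: mult.commute)
  qed
  have "smooth (\<lambda>x. f 1 * x)" by (rule smooth_mult[OF smooth_const smooth_id])
  then show ?case by (subst eq)
qed (auto intro: smooth_const smooth_add smooth_mult)

lemma smooth_continuous: "smooth f \<Longrightarrow> continuous_on S f"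
proof -
  assume f: "smooth f"
  obtain f' where "(\<forall>x. (f has_real_derivative f' x) (at x)) \<and> smooth f'" using smoothD[OF f] by (rule exE)
  then have "(f has_real_derivative f' x) (at x within S)" for x by (simp add: has_field_derivative_at_within)
  then show ?thesis by (rule DERIV_continuous_on)
qed

text \<open>One differentiation costs one order of vanishing at 1, while the cofactor remains
  smooth.\<close>

lemma smooth_one_minus_power:
  assumes "smooth Q"
  shows "\<exists>Q'. smooth Q' \<and> (\<forall>s. ((\<lambda>s. (1 - s) ^ Suc n * Q s) has_real_derivative (1 - s) ^ n * Q' s) (at s))"
proof -
  obtain R where R': "(\<forall>x. (Q has_real_derivative R x) (at x)) \<and> smooth R" using smoothD[OF assms] by (rule exE)
  then have R: "(Q has_real_derivative R x) (at x)" "smooth R" for x by auto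
  define Q' where "Q' s = - real (Suc n) * Q s + (1 + (-1) * s) * R s" for s
  have "smooth Q'" unfolding Q'_def[abs_def]
    by (intro smooth_add smooth_mult smooth_const smooth_id assms R(2))
  moreover have "((\<lambda>s. (1 - s) ^ Suc n * Q s) has_real_derivative (1 - s) ^ n * Q' s) (at s)" for s
  proof -
    have "((\<lambda>s. (1 - s) ^ Suc n) has_real_derivative real (Suc n) * (1 - s) ^ n * (-1)) (at s)"
      by (rule derivative_eq_intros refl | simp)+
    from DERIV_mult[OF this R(1)]
    show ?thesis by (simp add: Q'_def algebra_simps)
  qed
  ultimately show ?thesis by blast
qed

context bessel_order
begin

text \<open>The operator \<open>F \<mapsto> F'' + \<beta>/x F'\<close> is symmetric and lowers the order of vanishing at 1 by two, so it can be
  moved \<open>m\<close> times from \<open>u z\<close> to \<open>F\<close>.\<close>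

lemma smooth_coefficient_decay:
  assumes "smooth Q"
  shows "\<exists>C\<ge>0. \<forall>z\<in>Z. \<bar>ip (\<lambda>x. (1 - x\<^sup>2) ^ (2 * m) * Q (x\<^sup>2)) (u z)\<bar> \<le> C * z powr \<beta> / (z\<^sup>2) ^ m"
  using assms
proof (induction m arbitrary: Q)
  case 0
  obtain C where C: "0 \<le> C" "\<And>z x. z \<in> Z \<Longrightarrow> 0 \<le> x \<Longrightarrow> \<bar>u z x\<bar> \<le> C * z powr \<beta>" using u_bound by blast
  have cQ: "cont01 (\<lambda>x. Q (x\<^sup>2))"
    by (rule continuous_on_compose2[OF smooth_continuous[OF 0, of UNIV]]) (auto intro!: continuous_intros)
  then have "bounded ((\<lambda>x. Q (x\<^sup>2)) ` {0..1})" by (intro compact_imp_bounded compact_continuous_image) auto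
  then obtain A where A: "0 < A" "\<And>x. x \<in> {0..1} \<Longrightarrow> \<bar>Q (x\<^sup>2)\<bar> \<le> A" unfolding bounded_pos by auto
  have "\<bar>ip (\<lambda>x. Q (x\<^sup>2)) (u z)\<bar> \<le> A * (C * z powr \<beta>)" if "z \<in> Z" for z
    using A(2) C(2)[OF that] by (intro ip_bound cQ continuous_u) auto
  then show ?case using A(1) C(1) by (intro exI[of _ "A * C"]) (auto simp: mult.assoc)
next
  case (Suc m)
  obtain Q1 where Q1': "smooth Q1 \<and> (\<forall>s. ((\<lambda>s. (1 - s) ^ Suc (2 * m + 1) * Q s) has_real_derivative (1 - s) ^ (2 * m + 1) * Q1 s) (at s))"
    using smooth_one_minus_power[OF Suc.prems] by (rule exE)
  then have Q1: "smooth Q1" "((\<lambda>s. (1 - s) ^ Suc (2 * m + 1) * Q s) has_real_derivative (1 - s) ^ (2 * m + 1) * Q1 s) (at s)" for s by auto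
  obtain Q2 where Q2': "smooth Q2 \<and> (\<forall>s. ((\<lambda>s. (1 - s) ^ Suc (2 * m) * Q1 s) has_real_derivative (1 - s) ^ (2 * m) * Q2 s) (at s))"
    using smooth_one_minus_power[OF Q1(1)] by (rule exE)
  then have Q2: "smooth Q2" "((\<lambda>s. (1 - s) ^ Suc (2 * m) * Q1 s) has_real_derivative (1 - s) ^ (2 * m) * Q2 s) (at s)" for s by auto
  define F F' where "F x = (1 - x\<^sup>2) ^ (2 * Suc m) * Q (x\<^sup>2)" and "F' x = 2 * x * ((1 - x\<^sup>2) ^ (2 * m + 1) * Q1 (x\<^sup>2))" for x
  \<comment> \<open>For F(x) = f(x^2) the operator becomes 4 s f'' + 4 (\<nu> + 1) f', here with (1
    - s)^(2 m) taken out.\<close>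
  define Q3 where "Q3 s = 4 * s * Q2 s + 4 * (\<nu> + 1) * ((1 + (-1) * s) * Q1 s)" for s
  have Q3: "smooth Q3" unfolding Q3_def[abs_def]
    by (intro smooth_add smooth_mult smooth_const smooth_id Q1 Q2)
  have dsq: "((\<lambda>x. x\<^sup>2) has_real_derivative 2 * x) (at x)" for x :: real by (auto intro!: derivative_eq_intros)
  have dF: "(F has_real_derivative F' x) (at x)" for x
  proof -
    have "((\<lambda>x. (1 - x\<^sup>2) ^ Suc (2 * m + 1) * Q (x\<^sup>2)) has_real_derivative
        ((1 - x\<^sup>2) ^ (2 * m + 1) * Q1 (x\<^sup>2)) * (2 * x)) (at x)"
      by (rule DERIV_chain2[OF Q1(2) dsq])
    then show ?thesis unfolding F_def[abs_def] F'_def by (simp add: mult_ac)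
  qed
  have dF': "(F' has_real_derivative (1 - x\<^sup>2) ^ (2 * m) * Q3 (x\<^sup>2) - \<beta> / x * F' x) (at x)" if "x \<noteq> 0" for x
  proof -
    have "((\<lambda>x. (1 - x\<^sup>2) ^ Suc (2 * m) * Q1 (x\<^sup>2)) has_real_derivative
        ((1 - x\<^sup>2) ^ (2 * m) * Q2 (x\<^sup>2)) * (2 * x)) (at x)"
      by (rule DERIV_chain2[OF Q2(2) dsq])
    moreover have "((\<lambda>x. 2 * x) has_real_derivative 2) (at x)" by (auto intro!: derivative_eq_intros)
    ultimately have "((\<lambda>x. 2 * x * ((1 - x\<^sup>2) ^ Suc (2 * m) * Q1 (x\<^sup>2))) has_real_derivative
        2 * ((1 - x\<^sup>2) ^ Suc (2 * m) * Q1 (x\<^sup>2)) + ((1 - x\<^sup>2) ^ (2 * m) * Q2 (x\<^sup>2)) * (2 * x) * (2 * x)) (at x)"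
      by (intro DERIV_mult)
    moreover have "2 * ((1 - x\<^sup>2) ^ Suc (2 * m) * Q1 (x\<^sup>2)) + ((1 - x\<^sup>2) ^ (2 * m) * Q2 (x\<^sup>2)) * (2 * x) * (2 * x) =
        (1 - x\<^sup>2) ^ (2 * m) * Q3 (x\<^sup>2) - \<beta> / x * F' x"
    proof -
      have "\<beta> / x * F' x = \<beta> * (2 * ((1 - x\<^sup>2) ^ (2 * m + 1) * Q1 (x\<^sup>2)))" using that by (simp add: F'_def)
      then show ?thesis unfolding Q3_def by (simp add: algebra_simps power2_eq_square)
    qed
    ultimately show ?thesis unfolding F'_def[abs_def] by simp
  qed
  have cF': "cont01 F'" unfolding F'_def[abs_def]
    by (intro continuous_intros continuous_on_compose2[OF smooth_continuous[OF Q1(1), of UNIV]]) auto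
  have cH: "cont01 (\<lambda>x. (1 - x\<^sup>2) ^ (2 * m) * Q3 (x\<^sup>2))"
    by (intro continuous_intros continuous_on_compose2[OF smooth_continuous[OF Q3, of UNIV]]) auto
  have c1F: "c1_on01 F F'" by (rule c1_from_DERIV[OF dF cF'])
  obtain C where C: "0 \<le> C" "\<And>z. z \<in> Z \<Longrightarrow> \<bar>ip (\<lambda>x. (1 - x\<^sup>2) ^ (2 * m) * Q3 (x\<^sup>2)) (u z)\<bar> \<le> C * z powr \<beta> / (z\<^sup>2) ^ m"
    using Suc.IH[OF Q3] by blast
  have "\<bar>ip F (u z)\<bar> \<le> C * z powr \<beta> / (z\<^sup>2) ^ Suc m" if z: "z \<in> Z" for z
  proof -
    have z0: "0 < z" using Z_pos[OF z] .
    have "z\<^sup>2 * ip F (u z) = ip F' (u1 z)" using ip_u[OF c1F z0] by (simp add: F_def)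
    moreover have "ip (u z) (\<lambda>x. (1 - x\<^sup>2) ^ (2 * m) * Q3 (x\<^sup>2)) = u z 1 * F' 1 - ip (u1 z) F'"
      by (rule ip_green[OF c1_u cF' _ cH dF']) (auto simp: F'_def)
    ultimately have "z\<^sup>2 * ip F (u z) = - ip (\<lambda>x. (1 - x\<^sup>2) ^ (2 * m) * Q3 (x\<^sup>2)) (u z)"
      using u_at_1[OF z] ip_commute[of F' "u1 z"] ip_commute[of "u z" "\<lambda>x. (1 - x\<^sup>2) ^ (2 * m) * Q3 (x\<^sup>2)"] by simp
    then have "ip F (u z) = - ip (\<lambda>x. (1 - x\<^sup>2) ^ (2 * m) * Q3 (x\<^sup>2)) (u z) / z\<^sup>2" using z0 by (simp add: field_simps)
    then have "\<bar>ip F (u z)\<bar> = \<bar>ip (\<lambda>x. (1 - x\<^sup>2) ^ (2 * m) * Q3 (x\<^sup>2)) (u z)\<bar> / z\<^sup>2" by (simp add: abs_divide)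
    also have "\<dots> \<le> C * z powr \<beta> / (z\<^sup>2) ^ m / z\<^sup>2" using C(2)[OF z] by (intro divide_right_mono) auto
    finally show ?thesis by (simp add: mult.commute)
  qed
  then show ?case using C(1) unfolding F_def by blast
qed

text \<open>The exponent a + 2 - 2 m is not positive, so the smallest zero provides the
  constant.\<close>

lemma zero_powr_le:
  assumes "a + 2 \<le> 2 * real m"
  shows "\<exists>C\<ge>0. \<forall>z\<in>Z. z powr a / (z\<^sup>2) ^ m \<le> C * (1 / z\<^sup>2)"
proof -
  have "z powr a / (z\<^sup>2) ^ m \<le> z1 powr (a + 2 - 2 * real m) * (1 / z\<^sup>2)" if z: "z \<in> Z" for z
  proof -
    have z0: "0 < z" using Z_pos[OF z] .
    have e: "z powr (2 * real m) = (z\<^sup>2) ^ m" using powr_realpow[OF z0, of "2 * m"] by (simp add: power_mult)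
    have e2: "z powr 2 = z\<^sup>2" using z0 by simp
    have "z powr (a + 2 - 2 * real m) = z powr a * z\<^sup>2 / (z\<^sup>2) ^ m"
      by (simp only: powr_add powr_diff e e2)
    then have "z powr a / (z\<^sup>2) ^ m = z powr (a + 2 - 2 * real m) * (1 / z\<^sup>2)" using z0 by simp
    also have "\<dots> \<le> z1 powr (a + 2 - 2 * real m) * (1 / z\<^sup>2)"
      using assms z1(2) z1_le[OF z] by (intro mult_right_mono powr_mono2') auto
    finally show ?thesis .
  qed
  then show ?thesis by (intro exI[of _ "z1 powr (a + 2 - 2 * real m)"]) auto
qed

text \<open>The coefficient grows like z^\<beta> and \<open>u z\<close> like z^(\<beta> + 1) before
  the decay z^(- 2 m), so the choice of m leaves the summable factor z^(-2) and the series converges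
  uniformly. \<open>remainder_bound\<close> identifies its sum. The error carries 1 - x in view of
  the division by \<open>u z1\<close>.\<close>

lemma u_expansion:
  assumes Q: "smooth Q" and m: "1 \<le> m" "2 * \<beta> + 3 \<le> 2 * real m" and e: "0 < e"
  defines "F \<equiv> \<lambda>x. (1 - x\<^sup>2) ^ (2 * m) * Q (x\<^sup>2)"
  shows "\<exists>N. \<forall>x\<in>{0..1}. \<bar>F x - (\<Sum>n=1..N. ip F (u (lam n)) * u (lam n) x)\<bar> \<le> e * (1 - x)"
proof -
  obtain C1 where C1: "0 \<le> C1" "\<And>z. z \<in> Z \<Longrightarrow> \<bar>ip F (u z)\<bar> \<le> C1 * z powr \<beta> / (z\<^sup>2) ^ m"
    using smooth_coefficient_decay[OF Q, of m] unfolding F_def by blast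
  obtain C2 where C2: "0 \<le> C2" "\<And>z x. z \<in> Z \<Longrightarrow> x \<in> {0..1} \<Longrightarrow> \<bar>u z x\<bar> \<le> C2 * z powr (\<beta> + 1) * (1 - x)"
    using u_bound_at_1 by blast
  obtain C3 where C3: "0 \<le> C3" "\<And>z. z \<in> Z \<Longrightarrow> z powr (2 * \<beta> + 1) / (z\<^sup>2) ^ m \<le> C3 * (1 / z\<^sup>2)"
    using zero_powr_le[of "2 * \<beta> + 1" m] m by auto
  define M where "M n = C1 * C2 * C3 * (1 / (lam (Suc n))\<^sup>2)" for n
  define t where "t n x = ip F (u (lam (Suc n))) * u (lam (Suc n)) x" for n x
  have sM: "summable M" unfolding M_def by (intro summable_mult summable_inverse_lam_square)
  have M0: "0 \<le> M n" for n using C1 C2 C3 by (simp add: M_def)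
  have tM: "\<bar>t n x\<bar> \<le> M n * (1 - x)" if x: "x \<in> {0..1}" for n x
  proof -
    define z where "z = lam (Suc n)"
    have z: "z \<in> Z" using lam(1) by (simp add: z_def)
    have "\<bar>t n x\<bar> \<le> (C1 * z powr \<beta> / (z\<^sup>2) ^ m) * (C2 * z powr (\<beta> + 1) * (1 - x))"
      unfolding t_def abs_mult z_def[symmetric] using C1 C2 z x by (intro mult_mono) auto
    also have "\<dots> = C1 * C2 * (z powr (2 * \<beta> + 1) / (z\<^sup>2) ^ m) * (1 - x)"
    proof -
      have "z powr (2 * \<beta> + 1) = z powr \<beta> * z powr (\<beta> + 1)"
        unfolding powr_add[symmetric] by (rule arg_cong[where f="\<lambda>a. z powr a"]) simp
      then show ?thesis by (simp only: times_divide_eq_left times_divide_eq_right mult_ac)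
    qed
    also have "\<dots> \<le> C1 * C2 * (C3 * (1 / z\<^sup>2)) * (1 - x)"
      using C1 C2 C3(2)[OF z] x by (intro mult_right_mono mult_left_mono) auto
    finally show ?thesis by (simp add: M_def z_def mult_ac)
  qed
  have tM1: "norm (t n x) \<le> M n" if "x \<in> {0..1}" for n x
    using tM[OF that, of n] mult_left_mono[of "1 - x" 1 "M n"] M0[of n] that by simp
  define S where "S x = (\<Sum>n. t n x)" for x
  have ul: "uniform_limit {0..1} (\<lambda>N x. \<Sum>n<N. t n x) S sequentially"
    unfolding S_def by (rule Weierstrass_m_test[OF tM1 sM])
  have ct: "cont01 (t n)" for n unfolding t_def by (intro continuous_intros continuous_u)
  have cS: "cont01 S"
    by (rule uniform_limit_theorem[OF _ ul]) (auto intro!: always_eventually continuous_on_sum ct)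
  obtain Q1 where Q1': "smooth Q1 \<and> (\<forall>s. ((\<lambda>s. (1 - s) ^ Suc (2 * m - 1) * Q s) has_real_derivative (1 - s) ^ (2 * m - 1) * Q1 s) (at s))"
    using smooth_one_minus_power[OF Q] by (rule exE)
  then have Q1: "smooth Q1" "((\<lambda>s. (1 - s) ^ Suc (2 * m - 1) * Q s) has_real_derivative (1 - s) ^ (2 * m - 1) * Q1 s) (at s)" for s by auto
  have "c1_on01 F (\<lambda>x. ((1 - x\<^sup>2) ^ (2 * m - 1) * Q1 (x\<^sup>2)) * (2 * x))"
  proof (rule c1_from_DERIV)
    have "((\<lambda>x. (1 - x\<^sup>2) ^ Suc (2 * m - 1) * Q (x\<^sup>2)) has_real_derivative
        ((1 - x\<^sup>2) ^ (2 * m - 1) * Q1 (x\<^sup>2)) * (2 * x)) (at x)" for x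
      by (rule DERIV_chain2[OF Q1(2)]) (auto intro!: derivative_eq_intros)
    then show "(F has_real_derivative ((1 - x\<^sup>2) ^ (2 * m - 1) * Q1 (x\<^sup>2)) * (2 * x)) (at x)" for x
      unfolding F_def using m by simp
    show "cont01 (\<lambda>x. ((1 - x\<^sup>2) ^ (2 * m - 1) * Q1 (x\<^sup>2)) * (2 * x))"
      by (intro continuous_intros continuous_on_compose2[OF smooth_continuous[OF Q1(1), of UNIV]]) auto
  qed
  then obtain F' where F: "c1_on01 F F'" by blast
  have F1: "F 1 = 0" using m by (simp add: F_def)
  have cF: "cont01 F" by (rule c1_continuous(1)[OF F])
  \<comment> \<open>The zeros below \<open>lam (Suc N)\<close> are exactly the first N, which
    matches the partial sums.\<close>
  have rem: "ip (\<lambda>x. F x - (\<Sum>n<N. t n x)) (\<lambda>x. F x - (\<Sum>n<N. t n x)) \<le> ip F' F' / (lam (Suc N))\<^sup>2" for N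
  proof -
    have "(\<Sum>y\<in>{y\<in>Z. y < lam (Suc N)}. - ip F (u y) * u y x) = - (\<Sum>n<N. t n x)" for x
    proof -
      have "(\<Sum>y\<in>{y\<in>Z. y < lam (Suc N)}. - ip F (u y) * u y x) = (\<Sum>n\<in>{1..N}. - ip F (u (lam n)) * u (lam n) x)"
        unfolding Z_less_lam using inj_on_subset[OF lam_inj, of "{1..N}"] by (subst sum.reindex) auto
      also have "\<dots> = (\<Sum>n<N. - t n x)"
        by (rule sum.reindex_bij_witness[of _ Suc "\<lambda>n. n - 1"]) (auto simp: t_def)
      finally show ?thesis by (simp add: sum_negf)
    qed
    then show ?thesis using remainder_bound[OF lam(1)[of "Suc N"] F F1] by simp
  qed
  \<comment> \<open>F - S is split at a partial sum: \<open>a\<close> is small in the mean by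
    \<open>rem\<close>, and \<open>b\<close> is small uniformly.\<close>
  have "ip (\<lambda>x. F x - S x) (\<lambda>x. F x - S x) \<le> d" if d: "0 < d" for d
  proof -
    define d' where "d' = min 1 (d / 4)"
    have d': "0 < d'" "d' * d' \<le> d / 4" using d mult_mono[of d' 1 d' "d/4"] by (auto simp: d'_def)
    have "\<forall>\<^sub>F N in sequentially. \<forall>x\<in>{0..1}. dist (\<Sum>n<N. t n x) (S x) < d'"
      using ul d'(1) by (simp add: uniform_limit_iff)
    moreover have "((\<lambda>N. ip F' F' / (lam (Suc N))\<^sup>2) \<longlonglongrightarrow> 0)"
      using summable_LIMSEQ_zero[OF summable_mult[OF summable_inverse_lam_square, of "ip F' F'"]] by simp
    then have "\<forall>\<^sub>F N in sequentially. ip F' F' / (lam (Suc N))\<^sup>2 < d / 4" using d by (intro order_tendstoD) auto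
    ultimately have "\<forall>\<^sub>F N in sequentially. (\<forall>x\<in>{0..1}. dist (\<Sum>n<N. t n x) (S x) < d') \<and> ip F' F' / (lam (Suc N))\<^sup>2 < d / 4"
      by (rule eventually_conj)
    then obtain N where N: "\<And>x. x \<in> {0..1} \<Longrightarrow> dist (\<Sum>n<N. t n x) (S x) < d'" "ip F' F' / (lam (Suc N))\<^sup>2 < d / 4"
      using eventually_happens'[OF sequentially_bot] by blast
    define a b where "a x = F x - (\<Sum>n<N. t n x)" and "b x = (\<Sum>n<N. t n x) - S x" for x
    have ca: "cont01 a" and cb: "cont01 b" unfolding a_def[abs_def] b_def[abs_def]
      by (intro continuous_intros cF cS ct)+
    have cb': "cont01 (\<lambda>x. - b x)" by (intro continuous_intros cb)
    \<comment> \<open>The nonnegative square of a - b controls the cross term in place of the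
      Cauchy-Schwarz inequality.\<close>
    have "0 \<le> ip (\<lambda>x. a x + - b x) (\<lambda>x. a x + - b x)" by (intro ip_nonneg continuous_on_add ca cb')
    also have "\<dots> = ip a a + 2 * ip a (\<lambda>x. - b x) + ip (\<lambda>x. - b x) (\<lambda>x. - b x)" by (rule ip_add_square[OF ca cb'])
    also have "\<dots> = ip a a - 2 * ip a b + ip b b"
      using ip_cmult[of a "-1" b] ip_cmult_square[of "-1" b] by simp
    finally have "2 * ip a b \<le> ip a a + ip b b" by simp
    moreover have "ip (\<lambda>x. F x - S x) (\<lambda>x. F x - S x) = ip a a + 2 * ip a b + ip b b"
      using ip_add_square[OF ca cb] by (simp add: a_def b_def)
    moreover have "ip a a \<le> d / 4" using rem[of N] N(2) unfolding a_def[abs_def] by linarith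
    moreover have "\<bar>ip b b\<bar> \<le> d' * d'" using N(1) by (intro ip_bound cb) (auto simp: b_def dist_real_def less_imp_le)
    ultimately show ?thesis using d'(2) by linarith
  qed
  then have le0: "ip (\<lambda>x. F x - S x) (\<lambda>x. F x - S x) \<le> 0" by (rule dense_ge)
  have cFS: "cont01 (\<lambda>x. F x - S x)" by (rule continuous_on_diff[OF cF cS])
  have eq0: "ip (\<lambda>x. F x - S x) (\<lambda>x. F x - S x) = 0" by (rule order_antisym[OF le0 ip_nonneg[OF cFS]])
  have FS: "F x = S x" if "x \<in> {0..1}" for x
  proof -
    have x: "0 \<le> x" "x \<le> 1" using that by auto
    show ?thesis using ip_eq_0[OF cFS eq0 x] by simp
  qed
  have "(\<lambda>N. \<Sum>n. M (n + N)) \<longlonglongrightarrow> 0" by (rule suminf_exist_split2[OF sM])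
  then have "\<forall>\<^sub>F N in sequentially. (\<Sum>n. M (n + N)) < e" using e by (rule order_tendstoD)
  then obtain N where N: "(\<Sum>n. M (n + N)) < e" using eventually_happens'[OF sequentially_bot] by blast
  have "\<bar>F x - (\<Sum>n=1..N. ip F (u (lam n)) * u (lam n) x)\<bar> \<le> e * (1 - x)" if x: "x \<in> {0..1}" for x
  proof -
    have st: "summable (\<lambda>n. t n x)" by (rule summable_comparison_test'[OF sM, of 0]) (use tM1[OF x] in auto)
    have "(\<Sum>n=1..N. ip F (u (lam n)) * u (lam n) x) = (\<Sum>n<N. t n x)"
      by (rule sum.reindex_bij_witness[of _ Suc "\<lambda>n. n - 1"]) (auto simp: t_def)
    then have "F x - (\<Sum>n=1..N. ip F (u (lam n)) * u (lam n) x) = (\<Sum>n. t (n + N) x)"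
      using suminf_split_initial_segment[OF st, of N] FS[OF x] by (simp add: S_def)
    also have "\<bar>\<dots>\<bar> \<le> (\<Sum>n. \<bar>t (n + N) x\<bar>)"
      by (rule summable_rabs, rule summable_comparison_test'[OF summable_ignore_initial_segment[OF sM, of N], of 0])
        (use tM1[OF x] in auto)
    also have "\<dots> \<le> (\<Sum>n. M (n + N) * (1 - x))"
      using tM[OF x] tM1[OF x]
      by (intro suminf_le summable_mult2 summable_ignore_initial_segment[OF sM]
          summable_comparison_test'[OF summable_ignore_initial_segment[OF sM, of N], of 0 "\<lambda>n. \<bar>t (n + N) x\<bar>"]) auto
    also have "\<dots> = (\<Sum>n. M (n + N)) * (1 - x)"
      by (rule suminf_mult2[symmetric, OF summable_ignore_initial_segment[OF sM]])
    also have "\<dots> \<le> e * (1 - x)" using N x by (intro mult_right_mono) auto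
    finally show ?thesis .
  qed
  then show ?thesis by blast
qed

lemma smooth_exponent: "\<exists>m\<ge>1. 2 * \<beta> + 3 \<le> 2 * real m"
proof -
  obtain m where "2 * \<beta> + 3 \<le> real m" using real_arch_simple by blast
  then show ?thesis by (intro exI[of _ "Suc m"]) auto
qed

text \<open>Division by \<open>u z1\<close> consumes the factor 1 - x of the error in
  \<open>u_expansion\<close>.\<close>

lemma phi_expansion:
  assumes Q: "smooth Q" and m: "1 \<le> m" "2 * \<beta> + 3 \<le> 2 * real m" and e: "0 < e"
  shows "\<exists>N c. \<forall>x\<in>{0<..<1}. \<bar>(1 - x\<^sup>2) ^ (2 * m) * Q (x\<^sup>2) / u z1 x - (\<Sum>n=1..N. c n * phi (lam n) x)\<bar> \<le> e"
proof -
  obtain k where k: "0 < k" "\<And>x. x \<in> {0..1} \<Longrightarrow> k * (1 - x) \<le> u z1 x" using u_z1_lower by blast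
  obtain N where N: "\<And>x. x \<in> {0..1} \<Longrightarrow> \<bar>(1 - x\<^sup>2) ^ (2 * m) * Q (x\<^sup>2) -
     (\<Sum>n=1..N. ip (\<lambda>x. (1 - x\<^sup>2) ^ (2 * m) * Q (x\<^sup>2)) (u (lam n)) * u (lam n) x)\<bar> \<le> e * k * (1 - x)"
    using u_expansion[OF Q m, of "e * k"] mult_pos_pos[OF e k(1)] by blast
  define c where "c n = ip (\<lambda>x. (1 - x\<^sup>2) ^ (2 * m) * Q (x\<^sup>2)) (u (lam n))" for n
  have "\<bar>(1 - x\<^sup>2) ^ (2 * m) * Q (x\<^sup>2) / u z1 x - (\<Sum>n=1..N. c n * phi (lam n) x)\<bar> \<le> e" if x: "x \<in> {0<..<1}" for x
  proof -
    have ux: "0 < u z1 x" using u_z1_pos x by simp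
    have "(1 - x\<^sup>2) ^ (2 * m) * Q (x\<^sup>2) / u z1 x - (\<Sum>n=1..N. c n * phi (lam n) x) =
       ((1 - x\<^sup>2) ^ (2 * m) * Q (x\<^sup>2) - (\<Sum>n=1..N. c n * u (lam n) x)) / u z1 x"
      by (simp add: phi_def diff_divide_distrib sum_divide_distrib)
    also have "\<bar>\<dots>\<bar> \<le> e * k * (1 - x) / u z1 x"
      using N[of x] x ux by (simp add: abs_divide divide_right_mono c_def)
    also have "\<dots> \<le> e"
      using mult_left_mono[OF k(2)[of x], of e] e x ux by (simp add: divide_le_eq mult_ac)
    finally show ?thesis .
  qed
  then show ?thesis by blast
qed

lemma mu_pos: "2 \<le> n \<Longrightarrow> 0 < mu (lam n)"
  using lam_less_iff[of 1 n] z1(2) power_strict_mono[of z1 "lam n" 2] by (simp add: mu_def)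

text \<open>The function \<open>wt * u z1 * H\<close>, for \<open>H\<close> as below, is the derivative of \<open>dens * g\<close>, where \<open>g\<close> is the function to be
  expanded; integrating the expansion of \<open>H\<close> yields that of \<open>g\<close>.\<close>

lemma phi1_expansion:
  assumes P: "smooth P" and m: "1 \<le> m" "2 * \<beta> + 3 \<le> 2 * real m" and e: "0 < e"
  shows "\<exists>N c. \<forall>x\<in>{0<..<1}. \<bar>x * ((1 - x\<^sup>2) ^ Suc (2 * m) * P (x\<^sup>2)) - (\<Sum>n=2..N. c n * phi1 (lam n) x)\<bar> \<le> e"
proof -
  obtain P1 where P1': "smooth P1 \<and> (\<forall>s. ((\<lambda>s. (1 - s) ^ Suc (2 * m) * P s) has_real_derivative (1 - s) ^ (2 * m) * P1 s) (at s))"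
    using smooth_one_minus_power[OF P] by (rule exE)
  then have P1: "smooth P1" "((\<lambda>s. (1 - s) ^ Suc (2 * m) * P s) has_real_derivative (1 - s) ^ (2 * m) * P1 s) (at s)" for s by auto
  obtain A where A: "0 \<le> A" "\<And>R r K x. cont01 R \<Longrightarrow> R 0 = 0 \<Longrightarrow> R 1 = 0 \<Longrightarrow> 0 \<le> K \<Longrightarrow>
     (\<And>y. 0 < y \<Longrightarrow> y < 1 \<Longrightarrow> (R has_real_derivative r y) (at y) \<and> \<bar>r y\<bar> \<le> wt y * K * (1 - y)\<^sup>2) \<Longrightarrow>
     0 < x \<Longrightarrow> x < 1 \<Longrightarrow> \<bar>R x\<bar> \<le> A * K * (x * (1 - x)) * dens x"
    using bound_by_dens by metis
  obtain C where C: "0 \<le> C" "\<And>z x. z \<in> Z \<Longrightarrow> x \<in> {0..1} \<Longrightarrow> \<bar>u z x\<bar> \<le> C * z powr (\<beta> + 1) * (1 - x)"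
    using u_bound_at_1 by blast
  define B where "B = C * z1 powr (\<beta> + 1)"
  have B: "0 \<le> B" "\<And>x. x \<in> {0..1} \<Longrightarrow> \<bar>u z1 x\<bar> \<le> B * (1 - x)" using C(1) C(2)[OF z1(1)] by (auto simp: B_def)
  \<comment> \<open>\<open>u z1\<close> and, up to a factor x, its derivative are smooth functions
    of x^2; this makes \<open>Q\<close> below one too.\<close>
  define U V where "U s = nrm z1 * bessel_F \<nu> (z1\<^sup>2 * s)" and "V s = (- (nrm z1 * z1\<^sup>2 / 2)) * bessel_F (\<nu> + 1) (z1\<^sup>2 * s)" for s
  have U: "u z1 x = U (x\<^sup>2)" and V: "u1 z1 x = x * V (x\<^sup>2)" for x
  proof -
    show "u z1 x = U (x\<^sup>2)" by (simp add: u_def U_def bessel_E_def power_mult_distrib)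
    show "u1 z1 x = x * V (x\<^sup>2)"
      unfolding u1_def V_def bessel_E1_def bessel_E_def power_mult_distrib by (simp add: power2_eq_square)
  qed
  have sU: "smooth U" unfolding U_def[abs_def] using nu by (rule smooth_bessel_F)
  have sV: "smooth V" unfolding V_def[abs_def] using nu by (intro smooth_bessel_F) simp
  define g where "g x = x * ((1 - x\<^sup>2) ^ Suc (2 * m) * P (x\<^sup>2))" for x
  define g' where "g' x = (1 - x\<^sup>2) ^ Suc (2 * m) * P (x\<^sup>2) + x * ((1 - x\<^sup>2) ^ (2 * m) * P1 (x\<^sup>2) * (2 * x))" for x
  define Q where "Q s = U s * (((1 + \<beta>) * ((1 + (-1) * s) * P s)) + 2 * (s * P1 s)) + 2 * (V s * (s * ((1 + (-1) * s) * P s)))" for s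
  have Q: "smooth Q" unfolding Q_def[abs_def]
    by (intro smooth_add smooth_mult smooth_const smooth_id P P1(1) sU sV)
  define H where "H = (\<lambda>x. (1 - x\<^sup>2) ^ (2 * m) * Q (x\<^sup>2))"
  have H_eq: "H x = u z1 x * (g' x + \<beta> / x * g x) + 2 * u1 z1 x * g x" if "x \<noteq> 0" for x
  proof -
    have bg: "\<beta> / x * g x = \<beta> * ((1 - x\<^sup>2) ^ Suc (2 * m) * P (x\<^sup>2))" using that by (simp add: g_def)
    show ?thesis unfolding bg unfolding H_def Q_def U V g_def g'_def by (simp add: algebra_simps power2_eq_square)
  qed
  have dg: "(g has_real_derivative g' x) (at x)" for x
  proof -
    have "((\<lambda>x. (1 - x\<^sup>2) ^ Suc (2 * m) * P (x\<^sup>2)) has_real_derivative ((1 - x\<^sup>2) ^ (2 * m) * P1 (x\<^sup>2)) * (2 * x)) (at x)"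
      by (rule DERIV_chain2[OF P1(2)]) (auto intro!: derivative_eq_intros)
    from DERIV_mult[OF DERIV_ident this] show ?thesis unfolding g_def[abs_def] g'_def by (simp add: mult_ac)
  qed
  have ddg: "((\<lambda>x. dens x * g x) has_real_derivative wt x * (H x * u z1 x)) (at x)" if x: "0 < x" "x < 1" for x
  proof -
    have "((\<lambda>x. dens x * g x) has_real_derivative dens x * drift x * g x + g' x * dens x) (at x)"
      by (intro DERIV_mult DERIV_dens x dg)
    moreover have "dens x * drift x * g x + g' x * dens x = wt x * (H x * u z1 x)"
    proof -
      define b where "b = \<beta>"
      have nz: "u z1 x \<noteq> 0" using u_z1_nz x by simp
      have Hx: "H x = u z1 x * (g' x + b / x * g x) + 2 * u1 z1 x * g x" using H_eq[of x] x by (simp add: b_def)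
      show ?thesis unfolding Hx dens_def drift_def b_def[symmetric] using nz x
        by (simp add: field_simps power2_eq_square)
    qed
    ultimately show ?thesis by simp
  qed
  have cg: "cont01 g" using dg DERIV_isCont by (intro continuous_at_imp_continuous_on) blast
  have cH: "cont01 H" unfolding H_def
    by (intro continuous_intros continuous_on_compose2[OF smooth_continuous[OF Q, of UNIV]]) auto
  have cdg: "cont01 (\<lambda>x. dens x * g x)" by (intro continuous_on_mult continuous_dens cg)
  have dg0: "dens 0 * g 0 = 0" "dens 1 * g 1 = 0" by (simp_all add: g_def)
  \<comment> \<open>The integrand is the derivative of dens g, which vanishes at both ends, so
    \<open>H\<close> has no first coefficient. The other coefficients are divided by
    \<open>mu\<close>, and \<open>mu z1\<close> is 0.\<close>
  have c1: "ip H (u z1) = 0"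
  proof -
    have "((\<lambda>x. wt x * (H x * u z1 x)) has_integral dens 1 * g 1 - dens 0 * g 0) {0..1}"
      using ddg by (intro fundamental_theorem_of_calculus_interior cdg)
        (auto simp: has_real_derivative_iff_has_vector_derivative[symmetric])
    then show ?thesis unfolding ip_def using dg0 by (simp add: integral_unique)
  qed
  \<comment> \<open>\<open>A * B\<close> is the loss when the error in the expansion of
    \<open>H\<close> is integrated.\<close>
  define d where "d = e / (A * B + 1)"
  have AB: "0 < A * B + 1" using A(1) B(1) by (simp add: add_nonneg_pos)
  have d: "0 < d" "A * B * d \<le> e"
  proof -
    show "0 < d" using e AB by (simp add: d_def)
    have "A * B * e \<le> (A * B + 1) * e" using e by (intro mult_right_mono) auto
    then show "A * B * d \<le> e" using AB by (simp add: d_def divide_le_eq mult_ac)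
  qed
  obtain N where N: "\<And>x. x \<in> {0..1} \<Longrightarrow> \<bar>H x - (\<Sum>n=1..N. ip H (u (lam n)) * u (lam n) x)\<bar> \<le> d * (1 - x)"
    using u_expansion[OF Q m d(1)] unfolding H_def by blast
  define c where "c n = ip H (u (lam n))" for n
  \<comment> \<open>The error of the final expansion times \<open>dens\<close>. Its derivative is wt
    times \<open>u z1\<close> times the error in expanding \<open>H\<close>, so
    \<open>bound_by_dens\<close> applies.\<close>
  define R where "R x = dens x * g x + (\<Sum>n=2..N. c n / mu (lam n) * wron (lam n) x)" for x
  have sumc: "(\<Sum>n=1..N. c n * u (lam n) x) = (\<Sum>n=2..N. c n * u (lam n) x)" for x
  proof (rule sum.mono_neutral_right)
    show "\<forall>i\<in>{1..N} - {2..N}. c i * u (lam i) x = 0"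
    proof
      fix i assume "i \<in> {1..N} - {2..N}"
      then have "i = 1" by auto
      then show "c i * u (lam i) x = 0" using c1 by (simp add: c_def)
    qed
  qed auto
  have "\<bar>R x\<bar> \<le> A * (d * B) * (x * (1 - x)) * dens x" if x: "0 < x" "x < 1" for x
  proof (rule A(2)[OF _ _ _ _ _ x])
    show "cont01 R" unfolding R_def[abs_def] by (intro continuous_intros cdg continuous_wron)
    show "R 0 = 0" unfolding R_def using dg0 by simp
    show "R 1 = 0" unfolding R_def using dg0 wron_1 lam(1) by simp
    show "0 \<le> d * B" using d B by simp
    fix y :: real assume y: "0 < y" "y < 1"
    have "(R has_real_derivative wt y * (H y * u z1 y) +
       (\<Sum>n=2..N. c n / mu (lam n) * (- mu (lam n) * (wt y * (u (lam n) y * u z1 y))))) (at y)"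
      unfolding R_def[abs_def] using y lam_pos
      by (intro DERIV_add ddg DERIV_sum DERIV_cmult DERIV_wron) auto
    moreover have "(\<Sum>n=2..N. c n / mu (lam n) * (- mu (lam n) * (wt y * (u (lam n) y * u z1 y)))) =
        - (wt y * u z1 y * (\<Sum>n=2..N. c n * u (lam n) y))"
      unfolding sum_distrib_left sum_negf[symmetric]
    proof (intro sum.cong refl)
      fix n assume "n \<in> {2..N}"
      then show "c n / mu (lam n) * (- mu (lam n) * (wt y * (u (lam n) y * u z1 y))) = - (wt y * u z1 y * (c n * u (lam n) y))"
        using mu_pos[of n] by simp
    qed
    ultimately have "(R has_real_derivative wt y * u z1 y * (H y - (\<Sum>n=1..N. c n * u (lam n) y))) (at y)"
      unfolding sumc by (simp add: algebra_simps)
    moreover have "\<bar>wt y * u z1 y * (H y - (\<Sum>n=1..N. c n * u (lam n) y))\<bar> \<le> wt y * (d * B) * (1 - y)\<^sup>2"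
    proof -
      have "wt y * (\<bar>u z1 y\<bar> * \<bar>H y - (\<Sum>n=1..N. c n * u (lam n) y)\<bar>) \<le> wt y * ((B * (1 - y)) * (d * (1 - y)))"
        using B(2)[of y] N[of y] y B(1) by (intro mult_left_mono mult_mono) (auto simp: c_def)
      then show ?thesis by (simp add: abs_mult power2_eq_square mult_ac)
    qed
    ultimately show "(R has_real_derivative wt y * u z1 y * (H y - (\<Sum>n=1..N. c n * u (lam n) y))) (at y) \<and>
       \<bar>wt y * u z1 y * (H y - (\<Sum>n=1..N. c n * u (lam n) y))\<bar> \<le> wt y * (d * B) * (1 - y)\<^sup>2" by blast
  qed
  note R_bound = this
  have "\<bar>g x - (\<Sum>n=2..N. - c n / mu (lam n) * phi1 (lam n) x)\<bar> \<le> e" if x: "x \<in> {0<..<1}" for x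
  proof -
    have dx: "0 < dens x" using dens_pos x by simp
    have "R x = dens x * (g x - (\<Sum>n=2..N. - c n / mu (lam n) * phi1 (lam n) x))"
    proof -
      have "(\<Sum>n=2..N. c n / mu (lam n) * wron (lam n) x) = dens x * - (\<Sum>n=2..N. - c n / mu (lam n) * phi1 (lam n) x)"
        unfolding sum_negf[symmetric] sum_distrib_left using x
        by (intro sum.cong) (auto simp: dens_phi1[symmetric])
      then show ?thesis unfolding R_def by (simp add: algebra_simps)
    qed
    then have "\<bar>g x - (\<Sum>n=2..N. - c n / mu (lam n) * phi1 (lam n) x)\<bar> * dens x = \<bar>R x\<bar>"
      using dx by (simp add: abs_mult)
    also have "\<dots> \<le> A * (d * B) * (x * (1 - x)) * dens x" using R_bound x by simp
    finally have "\<bar>g x - (\<Sum>n=2..N. - c n / mu (lam n) * phi1 (lam n) x)\<bar> \<le> A * (d * B) * (x * (1 - x))"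
      using dx by simp
    also have "\<dots> \<le> A * (d * B) * 1"
      using x A(1) B(1) d(1) by (intro mult_left_mono mult_le_one) auto
    also have "\<dots> \<le> e" using d(2) by (simp add: mult_ac)
    finally show ?thesis .
  qed
  then show ?thesis unfolding g_def by (intro exI[of _ N] exI[of _ "\<lambda>n. - c n / mu (lam n)"]) blast
qed

end

section \<open>The bilinear estimate\<close>

definition heat_sum :: "nat set \<Rightarrow> (nat \<Rightarrow> real) \<Rightarrow> (nat \<Rightarrow> real) \<Rightarrow> (nat \<Rightarrow> real \<Rightarrow> real) \<Rightarrow> real \<Rightarrow> real \<Rightarrow> real" where
  "heat_sum I a r f x t = (\<Sum>n\<in>I. a n * exp (- r n * t) * f n x)"

lemma DERIV_heat_sum_t:
  "(heat_sum I a r f x has_real_derivative heat_sum I (\<lambda>n. - r n * a n) r f x t) (at t)"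
proof -
  have "((\<lambda>t. a n * exp (- r n * t) * f n x) has_real_derivative - r n * a n * exp (- r n * t) * f n x) (at t)" for n
    by (auto intro!: derivative_eq_intros)
  then show ?thesis unfolding heat_sum_def[abs_def] by (intro DERIV_sum)
qed

lemma DERIV_heat_sum_x:
  "(\<And>n. n \<in> I \<Longrightarrow> (f n has_real_derivative f1 n x) (at x)) \<Longrightarrow>
     ((\<lambda>x. heat_sum I a r f x t) has_real_derivative heat_sum I a r f1 x t) (at x)"
  unfolding heat_sum_def by (intro DERIV_sum DERIV_cmult)

lemma continuous_heat_sum:
  assumes "\<And>n. n \<in> I \<Longrightarrow> continuous_on S (f n)"
  shows "continuous_on (S \<times> T) (\<lambda>z. heat_sum I a r f (fst z) (snd z))"
proof -
  have "continuous_on (S \<times> T) (\<lambda>z. f n (fst z))" if "n \<in> I" for n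
    by (rule continuous_on_compose2[OF assms[OF that]]) (auto intro!: continuous_intros)
  then show ?thesis unfolding heat_sum_def by (intro continuous_intros)
qed

lemma DERIV_imp_continuous_on:
  "(\<And>x. x \<in> S \<Longrightarrow> (f has_real_derivative f' x) (at x)) \<Longrightarrow> continuous_on S f"
  by (meson DERIV_isCont continuous_at_imp_continuous_on)

text \<open>The zero-order coefficient \<open>k\<close> is the same for all n, so the equation
  survives summation.\<close>

lemma heat_sum_pde:
  assumes "\<And>n. n \<in> I \<Longrightarrow> (r n)\<^sup>2 * f n x + f2 n x + l * f1 n x = k * f n x"
  shows "heat_sum I (\<lambda>n. - r n * (- r n * a n)) r f x t + heat_sum I a r f2 x t + l * heat_sum I a r f1 x t =
     k * heat_sum I a r f x t"
proof -
  have "heat_sum I (\<lambda>n. - r n * (- r n * a n)) r f x t + heat_sum I a r f2 x t + l * heat_sum I a r f1 x t =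
     (\<Sum>n\<in>I. a n * exp (- r n * t) * ((r n)\<^sup>2 * f n x + f2 n x + l * f1 n x))"
    unfolding heat_sum_def sum_distrib_left sum.distrib[symmetric]
    by (intro sum.cong refl) (simp add: algebra_simps power2_eq_square)
  also have "\<dots> = (\<Sum>n\<in>I. k * (a n * exp (- r n * t) * f n x))" using assms by (intro sum.cong refl) simp
  finally show ?thesis unfolding heat_sum_def sum_distrib_left .
qed

text \<open>The left-hand sides are functions of \<open>(x, t)\<close>; integrating \<open>t w (b\<^sub>t\<^sub>t + b\<^sub>x\<^sub>x + l b\<^sub>x)\<close> by parts leaves only
  the boundary terms on the right, while the Hessian estimate for the Bellman function bounds it below.\<close>

lemma box_inequality:
  fixes f g f1 g1 f2 g2 :: "nat \<Rightarrow> real \<Rightarrow> real" and a c r :: "nat \<Rightarrow> real" and I J :: "nat set"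
    and A e p q T :: real and w l k1 k2 :: "real \<Rightarrow> real" and th :: "real \<Rightarrow> real \<Rightarrow> real"
  defines "V \<equiv> heat_sum I a r f" and "W \<equiv> heat_sum J c r g"
    and "Vx \<equiv> heat_sum I a r f1" and "Wx \<equiv> heat_sum J c r g1"
    and "Vt \<equiv> heat_sum I (\<lambda>n. - r n * a n) r f" and "Wt \<equiv> heat_sum J (\<lambda>n. - r n * c n) r g"
  defines "b \<equiv> \<lambda>x t. bell A e (V x t) (W x t)"
    and "bx \<equiv> \<lambda>x t. bell1 A e (V x t) (W x t) * Vx x t + bell2 A e (V x t) (W x t) * Wx x t"
    and "bt \<equiv> \<lambda>x t. bell1 A e (V x t) (W x t) * Vt x t + bell2 A e (V x t) (W x t) * Wt x t"
  assumes e: "0 < e" and A: "1 \<le> A" and pq: "p \<le> q" and T: "0 \<le> T"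
    and df: "\<And>n x. n \<in> I \<Longrightarrow> x \<in> {p..q} \<Longrightarrow> (f n has_real_derivative f1 n x) (at x) \<and> (f1 n has_real_derivative f2 n x) (at x)"
    and dg: "\<And>n x. n \<in> J \<Longrightarrow> x \<in> {p..q} \<Longrightarrow> (g n has_real_derivative g1 n x) (at x) \<and> (g1 n has_real_derivative g2 n x) (at x)"
    and cf: "\<And>n. n \<in> I \<Longrightarrow> continuous_on {p..q} (f2 n)" and cg: "\<And>n. n \<in> J \<Longrightarrow> continuous_on {p..q} (g2 n)"
    and dw: "\<And>x. x \<in> {p..q} \<Longrightarrow> (w has_real_derivative w x * l x) (at x)"
    and w: "\<And>x. x \<in> {p..q} \<Longrightarrow> 0 \<le> w x" and cl: "continuous_on {p..q} l"
    and k1: "\<And>n x. n \<in> I \<Longrightarrow> x \<in> {p..q} \<Longrightarrow> (r n)\<^sup>2 * f n x + f2 n x + l x * f1 n x = k1 x * f n x"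
    and k2: "\<And>n x. n \<in> J \<Longrightarrow> x \<in> {p..q} \<Longrightarrow> (r n)\<^sup>2 * g n x + g2 n x + l x * g1 n x = k2 x * g n x"
    and k0: "\<And>x. x \<in> {p..q} \<Longrightarrow> 0 \<le> k1 x \<and> 0 \<le> k2 x"
    and th: "\<And>x t. th x t \<le> \<bar>Vx x t * Wt x t\<bar> \<or> th x t \<le> \<bar>Vt x t * Wx x t\<bar>"
    and cth: "continuous_on ({p..q} \<times> {0..T}) (\<lambda>z. th (fst z) (snd z))"
  shows "integral {p..q} (\<lambda>x. integral {0..T} (\<lambda>t. t * (w x * (4 * th x t)))) \<le>
     integral {p..q} (\<lambda>x. w x * (T * bt x T - b x T + b x 0)) +
     integral {0..T} (\<lambda>t. t * (w q * bx q t - w p * bx p t))"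
proof -
  define Vxx Wxx where "Vxx = heat_sum I a r f2" and "Wxx = heat_sum J c r g2"
  define Vtt Wtt where "Vtt = heat_sum I (\<lambda>n. - r n * (- r n * a n)) r f"
    and "Wtt = heat_sum J (\<lambda>n. - r n * (- r n * c n)) r g"
  define btt where "btt x t = (bell11 A e (V x t) (W x t) * Vt x t + bell12 A e (V x t) (W x t) * Wt x t) * Vt x t +
     Vtt x t * bell1 A e (V x t) (W x t) +
     ((bell12 A e (V x t) (W x t) * Vt x t + bell22 A e (V x t) (W x t) * Wt x t) * Wt x t + Wtt x t * bell2 A e (V x t) (W x t))" for x t
  define bxx where "bxx x t = (bell11 A e (V x t) (W x t) * Vx x t + bell12 A e (V x t) (W x t) * Wx x t) * Vx x t +
     Vxx x t * bell1 A e (V x t) (W x t) +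
     ((bell12 A e (V x t) (W x t) * Vx x t + bell22 A e (V x t) (W x t) * Wx x t) * Wx x t + Wxx x t * bell2 A e (V x t) (W x t))" for x t
  have dV: "(V x has_real_derivative Vt x t) (at t)" "(W x has_real_derivative Wt x t) (at t)"
    "(Vt x has_real_derivative Vtt x t) (at t)" "(Wt x has_real_derivative Wtt x t) (at t)" for x t
    unfolding V_def W_def Vt_def Wt_def Vtt_def Wtt_def by (rule DERIV_heat_sum_t)+
  have dVx: "((\<lambda>x. V x t) has_real_derivative Vx x t) (at x)" "((\<lambda>x. W x t) has_real_derivative Wx x t) (at x)"
    "((\<lambda>x. Vx x t) has_real_derivative Vxx x t) (at x)" "((\<lambda>x. Wx x t) has_real_derivative Wxx x t) (at x)"
    if "x \<in> {p..q}" for x t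
    unfolding V_def W_def Vx_def Wx_def Vxx_def Wxx_def using that df dg by (auto intro!: DERIV_heat_sum_x)
  have db_t: "(b x has_real_derivative bt x t) (at t)" for x t
    unfolding b_def bt_def by (rule has_derivative_bell[OF e A dV(1,2)])
  have dbt_t: "(bt x has_real_derivative btt x t) (at t)" for x t
    unfolding bt_def btt_def
    by (intro DERIV_add DERIV_mult has_derivative_bell1[OF e A] has_derivative_bell2[OF e A] dV)
  have dbx_x: "((\<lambda>x. bx x t) has_real_derivative bxx x t) (at x)" if "x \<in> {p..q}" for x t
    unfolding bx_def bxx_def
    by (intro DERIV_add DERIV_mult has_derivative_bell1[OF e A] has_derivative_bell2[OF e A] dVx that)
  let ?S = "{p..q} \<times> {0..T}"
  have cfs: "continuous_on {p..q} (f n)" "continuous_on {p..q} (f1 n)" if "n \<in> I" for n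
    using df[OF that] DERIV_imp_continuous_on by blast+
  have cgs: "continuous_on {p..q} (g n)" "continuous_on {p..q} (g1 n)" if "n \<in> J" for n
    using dg[OF that] DERIV_imp_continuous_on by blast+
  have cVs: "continuous_on ?S (\<lambda>z. V (fst z) (snd z))" "continuous_on ?S (\<lambda>z. W (fst z) (snd z))"
    "continuous_on ?S (\<lambda>z. Vt (fst z) (snd z))" "continuous_on ?S (\<lambda>z. Wt (fst z) (snd z))"
    "continuous_on ?S (\<lambda>z. Vtt (fst z) (snd z))" "continuous_on ?S (\<lambda>z. Wtt (fst z) (snd z))"
    "continuous_on ?S (\<lambda>z. Vx (fst z) (snd z))" "continuous_on ?S (\<lambda>z. Wx (fst z) (snd z))"
    "continuous_on ?S (\<lambda>z. Vxx (fst z) (snd z))" "continuous_on ?S (\<lambda>z. Wxx (fst z) (snd z))"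
    unfolding V_def W_def Vt_def Wt_def Vtt_def Wtt_def Vx_def Wx_def Vxx_def Wxx_def
    by (intro continuous_heat_sum cfs cgs cf cg; assumption)+
  note cb = continuous_on_bell[OF e cVs(1,2)]
  have cw: "continuous_on {p..q} w" using dw by (rule DERIV_imp_continuous_on)
  have cw2: "continuous_on ?S (\<lambda>z. w (fst z))" "continuous_on ?S (\<lambda>z. l (fst z))"
    by (rule continuous_on_compose2[OF cw] continuous_on_compose2[OF cl]; auto intro!: continuous_intros)+
  have cbb: "continuous_on ?S (\<lambda>z. b (fst z) (snd z))" unfolding b_def by (rule cb(1))
  have cbt: "continuous_on ?S (\<lambda>z. bt (fst z) (snd z))" unfolding bt_def
    by (intro continuous_on_add continuous_on_mult cb cVs)
  have cbx: "continuous_on ?S (\<lambda>z. bx (fst z) (snd z))" unfolding bx_def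
    by (intro continuous_on_add continuous_on_mult cb cVs)
  have cbtt: "continuous_on ?S (\<lambda>z. btt (fst z) (snd z))" unfolding btt_def
    by (intro continuous_on_add continuous_on_mult cb cVs)
  have cbxx: "continuous_on ?S (\<lambda>z. bxx (fst z) (snd z))" unfolding bxx_def
    by (intro continuous_on_add continuous_on_mult cb cVs)
  have csnd: "continuous_on ?S (\<lambda>z. snd z)" by (intro continuous_intros)
  define G1 where "G1 x t = t * (w x * btt x t)" for x t
  define G2 where "G2 x t = t * (w x * (bxx x t + l x * bx x t))" for x t
  define G3 where "G3 x t = t * (w x * (4 * th x t))" for x t
  have cG1: "continuous_on ?S (\<lambda>z. G1 (fst z) (snd z))" unfolding G1_def
    by (intro continuous_on_mult csnd cw2 cbtt)
  have cG2: "continuous_on ?S (\<lambda>z. G2 (fst z) (snd z))" unfolding G2_def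
    by (intro continuous_on_mult continuous_on_add csnd cw2 cbxx cbx)
  have cG3: "continuous_on ?S (\<lambda>z. G3 (fst z) (snd z))" unfolding G3_def
    by (intro continuous_on_mult csnd cw2 continuous_on_const cth)
  have box: "cbox (p, 0) (q, T) = ?S" by (simp add: cbox_Pair_eq)
  have inner: "continuous_on {0..T} (G x)" "continuous_on {p..q} (\<lambda>x. integral {0..T} (G x))"
    if "continuous_on ?S (\<lambda>z. G (fst z) (snd z))" "x \<in> {p..q}" for G :: "real \<Rightarrow> real \<Rightarrow> real" and x
  proof -
    have c: "continuous_on (cbox (p, 0) (q, T)) (\<lambda>(x, t). G x t)" using that(1) by (simp add: box case_prod_beta)
    show "continuous_on {0..T} (G x)"
      by (rule continuous_on_compose2[OF that(1), of "{0..T}" "\<lambda>t. (x, t)", simplified])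
        (use that(2) in \<open>auto intro!: continuous_intros\<close>)
    have "continuous_on ({p..q} \<times> cbox 0 T) (\<lambda>(x, t). G x t)" using that(1) by (simp add: case_prod_beta)
    from integral_continuous_on_param[OF this] show "continuous_on {p..q} (\<lambda>x. integral {0..T} (G x))" by simp
  qed
  have pp: "p \<in> {p..q}" "q \<in> {p..q}" using pq by auto
  have pointwise: "G3 x t \<le> G1 x t + G2 x t" if x: "x \<in> {p..q}" and t: "t \<in> {0..T}" for x t
  proof -
    define B1 B2 B11 B12 B22 where "B1 = bell1 A e (V x t) (W x t)" and "B2 = bell2 A e (V x t) (W x t)"
      and "B11 = bell11 A e (V x t) (W x t)" and "B12 = bell12 A e (V x t) (W x t)" and "B22 = bell22 A e (V x t) (W x t)"
    have eqV: "Vtt x t + Vxx x t + l x * Vx x t = k1 x * V x t"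
      unfolding Vtt_def Vxx_def Vx_def V_def using k1 x by (intro heat_sum_pde) auto
    have eqW: "Wtt x t + Wxx x t + l x * Wx x t = k2 x * W x t"
      unfolding Wtt_def Wxx_def Wx_def W_def using k2 x by (intro heat_sum_pde) auto
    have "btt x t + (bxx x t + l x * bx x t) =
       (B11 * ((Vx x t)\<^sup>2 + (Vt x t)\<^sup>2) + 2 * B12 * (Vx x t * Wx x t + Vt x t * Wt x t) + B22 * ((Wt x t)\<^sup>2 + (Wx x t)\<^sup>2)) +
       (Vtt x t + Vxx x t + l x * Vx x t) * B1 + (Wtt x t + Wxx x t + l x * Wx x t) * B2"
      unfolding btt_def bxx_def bx_def B1_def[symmetric] B2_def[symmetric] B11_def[symmetric] B12_def[symmetric] B22_def[symmetric]
      by (simp add: algebra_simps power2_eq_square)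
    also have "\<dots> \<ge> 4 * th x t + 0 + 0"
    proof (intro add_mono)
      \<comment> \<open>The Hessian bound is used twice, with space and time exchanged. Which
        product is needed depends on the order in which the two functions enter
        \<open>bell\<close>.\<close>
      have "4 * \<bar>Vx x t * Wt x t\<bar> \<le> B11 * ((Vx x t)\<^sup>2 + (Vt x t)\<^sup>2) + 2 * B12 * (Vx x t * Wx x t + Vt x t * Wt x t) + B22 * ((Wt x t)\<^sup>2 + (Wx x t)\<^sup>2)"
        unfolding B11_def B12_def B22_def by (rule bell_hessian[OF e A])
      moreover have "4 * \<bar>Vt x t * Wx x t\<bar> \<le> B11 * ((Vt x t)\<^sup>2 + (Vx x t)\<^sup>2) + 2 * B12 * (Vt x t * Wt x t + Vx x t * Wx x t) + B22 * ((Wx x t)\<^sup>2 + (Wt x t)\<^sup>2)"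
        unfolding B11_def B12_def B22_def by (rule bell_hessian[OF e A])
      ultimately show "4 * th x t \<le> B11 * ((Vx x t)\<^sup>2 + (Vt x t)\<^sup>2) + 2 * B12 * (Vx x t * Wx x t + Vt x t * Wt x t) + B22 * ((Wt x t)\<^sup>2 + (Wx x t)\<^sup>2)"
        using th[of x t] by (auto simp: add.commute)
      show "0 \<le> (Vtt x t + Vxx x t + l x * Vx x t) * B1"
        unfolding eqV B1_def using mult_nonneg_nonneg[OF _ bell_sign(2)[OF e A], of "k1 x" "V x t" "W x t"] k0[OF x] by (simp add: mult_ac)
      show "0 \<le> (Wtt x t + Wxx x t + l x * Wx x t) * B2"
        unfolding eqW B2_def using mult_nonneg_nonneg[OF _ bell_sign(3)[OF e A], of "k2 x" "V x t" "W x t"] k0[OF x] by (simp add: mult_ac)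
    qed
    finally have "4 * th x t \<le> btt x t + (bxx x t + l x * bx x t)" by simp
    then have "t * (w x * (4 * th x t)) \<le> t * (w x * (btt x t + (bxx x t + l x * bx x t)))"
      using t w[OF x] by (intro mult_left_mono) auto
    then show ?thesis unfolding G1_def G2_def G3_def by (simp add: algebra_simps)
  qed
  have "integral {p..q} (\<lambda>x. integral {0..T} (G3 x)) \<le> integral {p..q} (\<lambda>x. integral {0..T} (G1 x) + integral {0..T} (G2 x))"
  proof (rule integral_le)
    show "(\<lambda>x. integral {0..T} (G3 x)) integrable_on {p..q}"
      by (rule integrable_continuous_real[OF inner(2)[OF cG3 pp(1)]])
    show "(\<lambda>x. integral {0..T} (G1 x) + integral {0..T} (G2 x)) integrable_on {p..q}"
      by (intro integrable_add integrable_continuous_real inner(2)[OF cG1 pp(1)] inner(2)[OF cG2 pp(1)])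
    fix x assume x: "x \<in> {p..q}"
    have "integral {0..T} (G3 x) \<le> integral {0..T} (\<lambda>t. G1 x t + G2 x t)"
      using pointwise[OF x]
      by (intro integral_le integrable_add integrable_continuous_real inner(1)[OF cG1 x] inner(1)[OF cG2 x] inner(1)[OF cG3 x]) auto
    also have "\<dots> = integral {0..T} (G1 x) + integral {0..T} (G2 x)"
      by (intro integral_add integrable_continuous_real inner(1)[OF cG1 x] inner(1)[OF cG2 x])
    finally show "integral {0..T} (G3 x) \<le> integral {0..T} (G1 x) + integral {0..T} (G2 x)" .
  qed
  also have "\<dots> = integral {p..q} (\<lambda>x. integral {0..T} (G1 x)) + integral {p..q} (\<lambda>x. integral {0..T} (G2 x))"
    by (intro integral_add integrable_continuous_real inner(2)[OF cG1 pp(1)] inner(2)[OF cG2 pp(1)])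
  also have "integral {p..q} (\<lambda>x. integral {0..T} (G1 x)) = integral {p..q} (\<lambda>x. w x * (T * bt x T - b x T + b x 0))"
  proof (rule integral_cong)
    fix x assume x: "x \<in> {p..q}"
    \<comment> \<open>t b_tt is the time derivative of t b_t - b.\<close>
    have "(G1 x has_integral w x * (T * bt x T - b x T) - w x * (0 * bt x 0 - b x 0)) {0..T}"
    proof (rule fundamental_theorem_of_calculus[OF T])
      fix t
      have "((\<lambda>t. w x * (t * bt x t - b x t)) has_real_derivative w x * ((1 * bt x t + btt x t * t) - bt x t)) (at t)"
        by (intro DERIV_cmult DERIV_diff DERIV_mult DERIV_ident dbt_t db_t)
      then have "((\<lambda>t. w x * (t * bt x t - b x t)) has_real_derivative G1 x t) (at t)"
        by (simp add: G1_def mult_ac)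
      then show "((\<lambda>t. w x * (t * bt x t - b x t)) has_vector_derivative G1 x t) (at t within {0..T})"
        by (simp add: has_real_derivative_iff_has_vector_derivative has_vector_derivative_at_within)
    qed
    then show "integral {0..T} (G1 x) = w x * (T * bt x T - b x T + b x 0)"
      by (simp add: integral_unique algebra_simps)
  qed
  \<comment> \<open>In the space part the integrals are exchanged, since w (b_xx + l b_x) is the
    x-derivative of w b_x.\<close>
  also have "integral {p..q} (\<lambda>x. integral {0..T} (G2 x)) = integral {0..T} (\<lambda>t. integral {p..q} (\<lambda>x. G2 x t))"
    using integral_swap_continuous[of p 0 q T G2] cG2 by (simp add: box case_prod_beta)
  also have "\<dots> = integral {0..T} (\<lambda>t. t * (w q * bx q t - w p * bx p t))"
  proof (rule integral_cong)
    fix t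
    have "((\<lambda>x. G2 x t) has_integral t * (w q * bx q t) - t * (w p * bx p t)) {p..q}"
    proof (rule fundamental_theorem_of_calculus[OF pq])
      fix x assume x: "x \<in> {p..q}"
      have "((\<lambda>x. t * (w x * bx x t)) has_real_derivative t * ((w x * l x) * bx x t + bxx x t * w x)) (at x)"
        by (intro DERIV_cmult DERIV_mult dw dbx_x x)
      then have "((\<lambda>x. t * (w x * bx x t)) has_real_derivative G2 x t) (at x)"
        by (simp add: G2_def algebra_simps)
      then show "((\<lambda>x. t * (w x * bx x t)) has_vector_derivative G2 x t) (at x within {p..q})"
        by (simp add: has_real_derivative_iff_has_vector_derivative has_vector_derivative_at_within)
    qed
    then show "integral {p..q} (\<lambda>x. G2 x t) = t * (w q * bx q t - w p * bx p t)"
      by (simp add: integral_unique algebra_simps)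
  qed
  finally show ?thesis unfolding G3_def .
qed

text \<open>The factors |u| and |v| matter at the endpoint 0: for the family \<phi>_n' the space
  derivative is \<phi>_n'', for which only boundedness is known there, while the products \<phi>_n'
  \<phi>_m'' are O(x).\<close>

lemma bell_gradient_bound:
  assumes e: "0 < e" and a: "1 \<le> a"
  shows "\<exists>M\<ge>0. \<forall>u v. \<bar>u\<bar> \<le> R \<longrightarrow> \<bar>v\<bar> \<le> R \<longrightarrow> \<bar>bell1 a e u v\<bar> \<le> M * \<bar>u\<bar> \<and> \<bar>bell2 a e u v\<bar> \<le> M * \<bar>v\<bar>"
proof -
  define Q g where "Q = R\<^sup>2 + e" and "g = (a - 1) / (2 * a)"
  define M where "M = 2 * ((Q powr a + Q) powr g * (1 + (a - 1) / 2)) +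
     2 * (5 * (a + 1) * e powr ((a + 1) / (2 * a) - 1) + g * Q * e powr (g - 1))"
  have Q: "0 < Q" using e by (simp add: Q_def add_nonneg_pos)
  have g: "0 \<le> g" "g \<le> 1" "(a + 1) / (2 * a) \<le> 1" using a by (auto simp: g_def field_simps)
  have "\<bar>bell1 a e u v\<bar> \<le> M * \<bar>u\<bar> \<and> \<bar>bell2 a e u v\<bar> \<le> M * \<bar>v\<bar>" if uv: "\<bar>u\<bar> \<le> R" "\<bar>v\<bar> \<le> R" for u v
  proof -
    define x y N where "x = u\<^sup>2 + e" and "y = v\<^sup>2 + e" and "N = bell_N a e u v"
    have N: "N = x powr a + y" by (simp add: N_def bell_N_def x_def y_def)
    have sq: "u\<^sup>2 \<le> R\<^sup>2" "v\<^sup>2 \<le> R\<^sup>2" using uv by (auto simp: abs_le_square_iff[symmetric])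
    have xy: "e \<le> x" "x \<le> Q" "e \<le> y" "y \<le> Q" using sq by (auto simp: x_def y_def Q_def)
    have NN: "e \<le> N" "N \<le> Q powr a + Q" "x powr a \<le> N" "0 < N"
      using xy e a by (auto simp: N add_increasing intro!: add_mono powr_mono2 add_nonneg_pos)
    have NN2: "N * N powr (g - 1) = N powr g" using NN by (simp add: powr_diff)
    have "N powr g + (a - 1) / 2 * x powr a * N powr (g - 1) \<le> N powr g + (a - 1) / 2 * N * N powr (g - 1)"
      using NN a by (intro add_left_mono mult_right_mono mult_left_mono) auto
    also have "\<dots> = N powr g * (1 + (a - 1) / 2)" unfolding mult.assoc NN2 by (simp add: algebra_simps)
    also have "\<dots> \<le> (Q powr a + Q) powr g * (1 + (a - 1) / 2)"
      using NN g a by (intro mult_right_mono powr_mono2) auto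
    finally have h1: "N powr g + (a - 1) / 2 * x powr a * N powr (g - 1) \<le> (Q powr a + Q) powr g * (1 + (a - 1) / 2)" .
    have h1': "0 \<le> N powr g + (a - 1) / 2 * x powr a * N powr (g - 1)" using a by auto
    have h2: "5 * (a + 1) * y powr ((a + 1) / (2 * a) - 1) + g * x * N powr (g - 1) \<le>
       5 * (a + 1) * e powr ((a + 1) / (2 * a) - 1) + g * Q * e powr (g - 1)"
      using xy NN g a e by (intro add_mono mult_mono powr_mono2') auto
    have h2': "0 \<le> 5 * (a + 1) * y powr ((a + 1) / (2 * a) - 1) + g * x * N powr (g - 1)" using xy a g e by auto
    have nn: "0 \<le> 2 * ((Q powr a + Q) powr g * (1 + (a - 1) / 2))"
      "0 \<le> 2 * (5 * (a + 1) * e powr ((a + 1) / (2 * a) - 1) + g * Q * e powr (g - 1))"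
      using a g Q by auto
    have "\<bar>bell1 a e u v\<bar> = 2 * (N powr g + (a - 1) / 2 * x powr a * N powr (g - 1)) * \<bar>u\<bar>"
      unfolding bell1_def N_def[symmetric] x_def[symmetric] g_def[symmetric] using h1' by (simp add: abs_mult)
    also have "\<dots> \<le> M * \<bar>u\<bar>" using h1 nn by (intro mult_right_mono) (auto simp: M_def)
    finally have 1: "\<bar>bell1 a e u v\<bar> \<le> M * \<bar>u\<bar>" .
    have "\<bar>bell2 a e u v\<bar> = 2 * (5 * (a + 1) * y powr ((a + 1) / (2 * a) - 1) + g * x * N powr (g - 1)) * \<bar>v\<bar>"
      unfolding bell2_def N_def[symmetric] x_def[symmetric] y_def[symmetric] g_def[symmetric] using h2' by (simp add: abs_mult)
    also have "\<dots> \<le> M * \<bar>v\<bar>" using h2 nn by (intro mult_right_mono) (auto simp: M_def)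
    finally show ?thesis using 1 by simp
  qed
  moreover have "0 \<le> M" unfolding M_def using a g Q by auto
  ultimately show ?thesis by blast
qed

lemma heat_sum_bound:
  assumes "\<And>n. n \<in> I \<Longrightarrow> 0 \<le> r n" "0 \<le> t" "\<And>n. n \<in> I \<Longrightarrow> \<bar>f n x\<bar> \<le> K"
  shows "\<bar>heat_sum I a r f x t\<bar> \<le> (\<Sum>n\<in>I. \<bar>a n\<bar>) * K"
proof -
  have "\<bar>heat_sum I a r f x t\<bar> \<le> (\<Sum>n\<in>I. \<bar>a n * exp (- r n * t) * f n x\<bar>)"
    unfolding heat_sum_def by (rule sum_abs)
  also have "\<dots> \<le> (\<Sum>n\<in>I. \<bar>a n\<bar> * 1 * K)"
  proof (rule sum_mono)
    fix n assume n: "n \<in> I"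
    show "\<bar>a n * exp (- r n * t) * f n x\<bar> \<le> \<bar>a n\<bar> * 1 * K"
      unfolding abs_mult using assms n by (intro mult_mono) auto
  qed
  finally show ?thesis by (simp add: sum_distrib_right)
qed

text \<open>The product is expanded so that only bounds on the pairwise products of
  \<open>f n\<close> and \<open>f1 m\<close> are used.\<close>

lemma heat_sum_product_bound:
  assumes "\<And>n. n \<in> I \<Longrightarrow> 0 \<le> r n" "0 \<le> t" "\<And>n m. n \<in> I \<Longrightarrow> m \<in> I \<Longrightarrow> \<bar>f n x * f1 m x\<bar> \<le> K"
  shows "\<bar>heat_sum I a r f x t * heat_sum I a r f1 x t\<bar> \<le> (\<Sum>n\<in>I. \<bar>a n\<bar>)\<^sup>2 * K"
proof -
  have "\<bar>heat_sum I a r f x t * heat_sum I a r f1 x t\<bar> =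
     \<bar>\<Sum>n\<in>I. \<Sum>m\<in>I. (a n * exp (- r n * t) * f n x) * (a m * exp (- r m * t) * f1 m x)\<bar>"
    unfolding heat_sum_def sum_product ..
  also have "\<dots> \<le> (\<Sum>n\<in>I. \<Sum>m\<in>I. \<bar>(a n * exp (- r n * t) * f n x) * (a m * exp (- r m * t) * f1 m x)\<bar>)"
    by (intro order_trans[OF sum_abs] sum_mono sum_abs)
  also have "\<dots> \<le> (\<Sum>n\<in>I. \<Sum>m\<in>I. \<bar>a n\<bar> * \<bar>a m\<bar> * K)"
  proof (intro sum_mono)
    fix n m assume nm: "n \<in> I" "m \<in> I"
    have "\<bar>(a n * exp (- r n * t) * f n x) * (a m * exp (- r m * t) * f1 m x)\<bar> =
        (\<bar>a n\<bar> * \<bar>a m\<bar>) * ((exp (- r n * t) * exp (- r m * t)) * \<bar>f n x * f1 m x\<bar>)"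
      by (simp add: abs_mult mult_ac)
    also have "\<dots> \<le> (\<bar>a n\<bar> * \<bar>a m\<bar>) * (1 * K)"
      using assms nm by (intro mult_left_mono mult_mono mult_le_one) auto
    finally show "\<bar>(a n * exp (- r n * t) * f n x) * (a m * exp (- r m * t) * f1 m x)\<bar> \<le> \<bar>a n\<bar> * \<bar>a m\<bar> * K" by simp
  qed
  also have "\<dots> = (\<Sum>n\<in>I. \<bar>a n\<bar>)\<^sup>2 * K"
    unfolding power2_eq_square sum_product by (simp add: sum_distrib_right)
  finally show ?thesis .
qed

lemma heat_sum_time_decay:
  assumes "\<And>n. n \<in> I \<Longrightarrow> 0 \<le> r n" "0 \<le> (K::real)"
  shows "((\<lambda>T. K * (\<Sum>n\<in>I. \<bar>a n\<bar> * (r n * T * exp (- r n * T)))) \<longlongrightarrow> 0) at_top"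
proof -
  have "((\<lambda>T. r n * T * exp (- r n * T)) \<longlongrightarrow> 0) at_top" if "n \<in> I" for n
  \<comment> \<open>The rate of the first function is 0 when the shift \<open>a\<close> is 0; the
    factor \<open>r n\<close> then makes the whole term vanish.\<close>
  proof (cases "r n = 0")
    case False
    then have "0 < r n" using assms(1)[OF that] by simp
    then have "filterlim (\<lambda>T. r n * T) at_top at_top"
      by (intro filterlim_tendsto_pos_mult_at_top[OF tendsto_const] filterlim_ident)
    from filterlim_compose[OF tendsto_power_div_exp_0[of 1] this] show ?thesis
      by (simp add: exp_minus divide_inverse)
  qed simp
  then have "((\<lambda>T. K * (\<Sum>n\<in>I. \<bar>a n\<bar> * (r n * T * exp (- r n * T)))) \<longlongrightarrow> K * (\<Sum>n\<in>I. \<bar>a n\<bar> * 0)) at_top"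
    by (intro tendsto_intros)
  then show ?thesis by simp
qed

lemma heat_sum_time_derivative_bound:
  assumes "\<And>n. n \<in> I \<Longrightarrow> 0 \<le> r n" "0 \<le> T" "\<And>n. n \<in> I \<Longrightarrow> \<bar>f n x\<bar> \<le> K"
  shows "T * \<bar>heat_sum I (\<lambda>n. - r n * a n) r f x T\<bar> \<le> K * (\<Sum>n\<in>I. \<bar>a n\<bar> * (r n * T * exp (- r n * T)))"
proof -
  have "T * \<bar>heat_sum I (\<lambda>n. - r n * a n) r f x T\<bar> \<le> T * (\<Sum>n\<in>I. \<bar>- r n * a n * exp (- r n * T) * f n x\<bar>)"
    unfolding heat_sum_def using assms(2) by (intro mult_left_mono sum_abs)
  also have "\<dots> \<le> T * (\<Sum>n\<in>I. r n * \<bar>a n\<bar> * exp (- r n * T) * K)"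
  proof (intro mult_left_mono sum_mono)
    fix n assume n: "n \<in> I"
    show "\<bar>- r n * a n * exp (- r n * T) * f n x\<bar> \<le> r n * \<bar>a n\<bar> * exp (- r n * T) * K"
      unfolding abs_mult using assms n by (intro mult_mono) auto
  qed fact
  finally show ?thesis by (simp add: sum_distrib_left mult_ac)
qed

context bessel_order
begin

text \<open>The families \<open>(\<phi>\<^sub>n)\<close> and \<open>(\<phi>\<^sub>n')\<close> both satisfy this. The bound on products serves at the endpoint 0.\<close>

definition heat_family :: "nat set \<Rightarrow> (nat \<Rightarrow> real) \<Rightarrow> (nat \<Rightarrow> real \<Rightarrow> real) \<Rightarrow> (nat \<Rightarrow> real \<Rightarrow> real) \<Rightarrow> (nat \<Rightarrow> real \<Rightarrow> real) \<Rightarrow> bool" where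
  "heat_family I r f f1 f2 \<longleftrightarrow>
     (\<forall>n\<in>I. 0 \<le> r n) \<and>
     (\<forall>n\<in>I. \<forall>x\<in>{0<..<1}. (f n has_real_derivative f1 n x) (at x) \<and> (f1 n has_real_derivative f2 n x) (at x)) \<and>
     (\<forall>n\<in>I. continuous_on {0<..<1} (f2 n)) \<and>
     (\<exists>k. \<forall>x\<in>{0<..<1}. 0 \<le> k x \<and> (\<forall>n\<in>I. (r n)\<^sup>2 * f n x + f2 n x + drift x * f1 n x = k x * f n x)) \<and>
     (\<exists>K\<ge>0. \<forall>x\<in>{0<..<1}. \<forall>n\<in>I. \<bar>f n x\<bar> \<le> K \<and> (\<forall>m\<in>I. \<bar>f n x * f1 m x\<bar> \<le> K * x))"

text \<open>First d tends to 0 for fixed T: the flux at 1 dies with \<open>dens\<close>, and the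
  flux at 0, where \<open>dens\<close> stays positive if \<nu> = - 1/2, by the O(x) bound on
  products. Then T grows, and T b_t tends to 0 uniformly in x.\<close>

lemma box_limit:
  fixes th :: "real \<Rightarrow> real \<Rightarrow> real"
  assumes F: "heat_family I r f f1 f2" and G: "heat_family J r g g1 g2" and e: "0 < e" and A: "1 \<le> A"
    and th: "\<And>x t. th x t \<le> \<bar>heat_sum I a r f1 x t * heat_sum J (\<lambda>n. - r n * c n) r g x t\<bar> \<or>
        th x t \<le> \<bar>heat_sum I (\<lambda>n. - r n * a n) r f x t * heat_sum J c r g1 x t\<bar>"
    and cth: "\<And>p q T. 0 < p \<Longrightarrow> q < 1 \<Longrightarrow> continuous_on ({p..q} \<times> {0..T}) (\<lambda>z. th (fst z) (snd z))"
    and X: "\<And>p q. 0 < p \<Longrightarrow> p \<le> q \<Longrightarrow> q < 1 \<Longrightarrow>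
       integral {p..q} (\<lambda>x. dens x * bell A e (heat_sum I a r f x 0) (heat_sum J c r g x 0)) \<le> X"
    and eta: "0 < \<eta>"
  shows "\<forall>\<^sub>F T in at_top. \<forall>\<^sub>F d in at_right 0.
     integral {d..1 - d} (\<lambda>x. integral {0..T} (\<lambda>t. t * (dens x * (4 * th x t)))) \<le> X + \<eta>"
proof -
  define V W where "V = heat_sum I a r f" and "W = heat_sum J c r g"
  define Vx Wx where "Vx = heat_sum I a r f1" and "Wx = heat_sum J c r g1"
  define Vt Wt where "Vt = heat_sum I (\<lambda>n. - r n * a n) r f" and "Wt = heat_sum J (\<lambda>n. - r n * c n) r g"
  define b where "b x t = bell A e (V x t) (W x t)" for x t
  define bx where "bx x t = bell1 A e (V x t) (W x t) * Vx x t + bell2 A e (V x t) (W x t) * Wx x t" for x t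
  define bt where "bt x t = bell1 A e (V x t) (W x t) * Vt x t + bell2 A e (V x t) (W x t) * Wt x t" for x t
  from F have Fr: "\<And>n. n \<in> I \<Longrightarrow> 0 \<le> r n"
    and Fd: "\<And>n x. n \<in> I \<Longrightarrow> x \<in> {0<..<1} \<Longrightarrow> (f n has_real_derivative f1 n x) (at x) \<and> (f1 n has_real_derivative f2 n x) (at x)"
    and Fc: "\<And>n. n \<in> I \<Longrightarrow> continuous_on {0<..<1} (f2 n)" unfolding heat_family_def by blast+
  from G have Gr: "\<And>n. n \<in> J \<Longrightarrow> 0 \<le> r n"
    and Gd: "\<And>n x. n \<in> J \<Longrightarrow> x \<in> {0<..<1} \<Longrightarrow> (g n has_real_derivative g1 n x) (at x) \<and> (g1 n has_real_derivative g2 n x) (at x)"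
    and Gc: "\<And>n. n \<in> J \<Longrightarrow> continuous_on {0<..<1} (g2 n)" unfolding heat_family_def by blast+
  obtain k1 where k1: "\<And>x. x \<in> {0<..<1} \<Longrightarrow> 0 \<le> k1 x"
    "\<And>x n. x \<in> {0<..<1} \<Longrightarrow> n \<in> I \<Longrightarrow> (r n)\<^sup>2 * f n x + f2 n x + drift x * f1 n x = k1 x * f n x"
    using F unfolding heat_family_def by blast
  obtain k2 where k2: "\<And>x. x \<in> {0<..<1} \<Longrightarrow> 0 \<le> k2 x"
    "\<And>x n. x \<in> {0<..<1} \<Longrightarrow> n \<in> J \<Longrightarrow> (r n)\<^sup>2 * g n x + g2 n x + drift x * g1 n x = k2 x * g n x"
    using G unfolding heat_family_def by blast
  obtain K1 where K1: "0 \<le> K1" "\<And>x n. x \<in> {0<..<1} \<Longrightarrow> n \<in> I \<Longrightarrow> \<bar>f n x\<bar> \<le> K1"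
    "\<And>x n m. x \<in> {0<..<1} \<Longrightarrow> n \<in> I \<Longrightarrow> m \<in> I \<Longrightarrow> \<bar>f n x * f1 m x\<bar> \<le> K1 * x"
    using F unfolding heat_family_def by blast
  obtain K2 where K2: "0 \<le> K2" "\<And>x n. x \<in> {0<..<1} \<Longrightarrow> n \<in> J \<Longrightarrow> \<bar>g n x\<bar> \<le> K2"
    "\<And>x n m. x \<in> {0<..<1} \<Longrightarrow> n \<in> J \<Longrightarrow> m \<in> J \<Longrightarrow> \<bar>g n x * g1 m x\<bar> \<le> K2 * x"
    using G unfolding heat_family_def by blast
  define S1 S2 where "S1 = (\<Sum>n\<in>I. \<bar>a n\<bar>)" and "S2 = (\<Sum>n\<in>J. \<bar>c n\<bar>)"
  have S: "0 \<le> S1" "0 \<le> S2" by (auto simp: S1_def S2_def sum_nonneg)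
  define R where "R = S1 * K1 + S2 * K2"
  have VW: "\<bar>V x t\<bar> \<le> R" "\<bar>W x t\<bar> \<le> R" if "x \<in> {0<..<1}" "0 \<le> t" for x t
  proof -
    have "\<bar>V x t\<bar> \<le> S1 * K1" unfolding V_def S1_def using Fr that K1(2) by (intro heat_sum_bound) auto
    moreover have "\<bar>W x t\<bar> \<le> S2 * K2" unfolding W_def S2_def using Gr that K2(2) by (intro heat_sum_bound) auto
    ultimately show "\<bar>V x t\<bar> \<le> R" "\<bar>W x t\<bar> \<le> R" using mult_nonneg_nonneg[OF S(1) K1(1)] mult_nonneg_nonneg[OF S(2) K2(1)]
      unfolding R_def by linarith+
  qed
  have R0: "0 \<le> R" using S K1(1) K2(1) by (simp add: R_def)
  obtain M where M: "0 \<le> M" "\<And>u v. \<bar>u\<bar> \<le> R \<Longrightarrow> \<bar>v\<bar> \<le> R \<Longrightarrow> \<bar>bell1 A e u v\<bar> \<le> M * \<bar>u\<bar> \<and> \<bar>bell2 A e u v\<bar> \<le> M * \<bar>v\<bar>"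
    using bell_gradient_bound[OF e A, of R] by blast
  have grad: "\<bar>bell1 A e (V x t) (W x t) * y\<bar> \<le> M * \<bar>V x t * y\<bar>" "\<bar>bell2 A e (V x t) (W x t) * y\<bar> \<le> M * \<bar>W x t * y\<bar>"
    if "x \<in> {0<..<1}" "0 \<le> t" for x t y
    unfolding abs_mult mult.assoc[symmetric] using M(2)[OF VW[OF that]] by (auto intro!: mult_right_mono)
  obtain D where D: "0 < D" "\<And>x. x \<in> {0..1} \<Longrightarrow> dens x \<le> D"
  proof -
    have "bounded (dens ` {0..1})" by (intro compact_imp_bounded compact_continuous_image continuous_dens) auto
    then show ?thesis using that unfolding bounded_pos by (metis abs_le_D1 imageI real_norm_def)
  qed
  define B where "B = M * (S1\<^sup>2 * K1 + S2\<^sup>2 * K2)"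
  have B0: "0 \<le> B" using M(1) K1(1) K2(1) by (simp add: B_def)
  have bx: "\<bar>bx x t\<bar> \<le> B * x" if x: "x \<in> {0<..<1}" and t: "0 \<le> t" for x t
  proof -
    have "\<bar>V x t * Vx x t\<bar> \<le> S1\<^sup>2 * (K1 * x)" unfolding V_def Vx_def S1_def
      using Fr t K1(3)[OF x] by (intro heat_sum_product_bound) auto
    moreover have "\<bar>W x t * Wx x t\<bar> \<le> S2\<^sup>2 * (K2 * x)" unfolding W_def Wx_def S2_def
      using Gr t K2(3)[OF x] by (intro heat_sum_product_bound) auto
    ultimately have "M * \<bar>V x t * Vx x t\<bar> + M * \<bar>W x t * Wx x t\<bar> \<le> M * (S1\<^sup>2 * (K1 * x)) + M * (S2\<^sup>2 * (K2 * x))"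
      using M(1) by (intro add_mono mult_left_mono)
    also have "\<dots> = B * x" by (simp add: B_def algebra_simps)
    finally show ?thesis unfolding bx_def using grad[OF x t, of "Vx x t"] grad[OF x t, of "Wx x t"] by linarith
  qed
  define E1 where "E1 T = M * R * (K1 * (\<Sum>n\<in>I. \<bar>a n\<bar> * (r n * T * exp (- r n * T))) +
     K2 * (\<Sum>n\<in>J. \<bar>c n\<bar> * (r n * T * exp (- r n * T))))" for T
  have "(E1 \<longlongrightarrow> M * R * (0 + 0)) at_top"
    unfolding E1_def by (intro tendsto_intros heat_sum_time_decay Fr Gr K1(1) K2(1))
  then have E1: "(E1 \<longlongrightarrow> 0) at_top" by simp
  have bt: "T * bt x T \<le> E1 T" if x: "x \<in> {0<..<1}" and T: "0 \<le> T" for x T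
  proof -
    have "\<bar>V x T * Vt x T\<bar> \<le> R * \<bar>Vt x T\<bar>" "\<bar>W x T * Wt x T\<bar> \<le> R * \<bar>Wt x T\<bar>"
      unfolding abs_mult using VW[OF x T] by (auto intro!: mult_right_mono)
    then have "M * \<bar>V x T * Vt x T\<bar> + M * \<bar>W x T * Wt x T\<bar> \<le> M * (R * \<bar>Vt x T\<bar>) + M * (R * \<bar>Wt x T\<bar>)"
      using M(1) by (intro add_mono mult_left_mono)
    moreover have "M * R * (\<bar>Vt x T\<bar> + \<bar>Wt x T\<bar>) = M * (R * \<bar>Vt x T\<bar>) + M * (R * \<bar>Wt x T\<bar>)"
      by (simp add: algebra_simps)
    ultimately have "bt x T \<le> M * R * (\<bar>Vt x T\<bar> + \<bar>Wt x T\<bar>)"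
      unfolding bt_def using grad(1)[OF x T, of "Vt x T"] grad(2)[OF x T, of "Wt x T"] by linarith
    then have "T * bt x T \<le> T * (M * R * (\<bar>Vt x T\<bar> + \<bar>Wt x T\<bar>))" using T by (intro mult_left_mono)
    also have "\<dots> = M * R * (T * \<bar>Vt x T\<bar> + T * \<bar>Wt x T\<bar>)" by (simp add: algebra_simps)
    also have "\<dots> \<le> E1 T"
      unfolding E1_def Vt_def Wt_def using M(1) R0 K1(2)[OF x] K2(2)[OF x]
      by (intro mult_left_mono add_mono heat_sum_time_derivative_bound Fr Gr T) auto
    finally show ?thesis .
  qed
  have main: "integral {d..1 - d} (\<lambda>x. integral {0..T} (\<lambda>t. t * (dens x * (4 * th x t)))) \<le>
     E1 T * D + X + T * T * (B * (dens (1 - d) + D * d))" if d: "0 < d" "d < 1 / 2" and T: "0 \<le> T" and E1T: "0 \<le> E1 T" for d T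
  proof -
    have sub: "x \<in> {d..1 - d} \<Longrightarrow> x \<in> {0<..<1}" for x using d by auto
    have dd: "d \<le> 1 - d" using d by simp
    have cs: "continuous_on {d..1 - d} (f2 n)" if "n \<in> I" for n using Fc[OF that] by (rule continuous_on_subset) (use sub in auto)
    have cs2: "continuous_on {d..1 - d} (g2 n)" if "n \<in> J" for n using Gc[OF that] by (rule continuous_on_subset) (use sub in auto)
    have cdr: "continuous_on {d..1 - d} drift"
      by (rule DERIV_imp_continuous_on[of _ drift drift1]) (use DERIV_drift d in auto)
    have "integral {d..1 - d} (\<lambda>x. integral {0..T} (\<lambda>t. t * (dens x * (4 * th x t)))) \<le>
       integral {d..1 - d} (\<lambda>x. dens x * (T * bt x T - b x T + b x 0)) +
       integral {0..T} (\<lambda>t. t * (dens (1 - d) * bx (1 - d) t - dens d * bx d t))"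
      unfolding b_def bx_def bt_def V_def W_def Vx_def Wx_def Vt_def Wt_def
    proof (rule box_inequality[where l=drift and ?k1.0=k1 and ?k2.0=k2 and ?f2.0=f2 and ?g2.0=g2, OF e A dd T])
      show "(dens has_real_derivative dens x * drift x) (at x)" if "x \<in> {d..1 - d}" for x
        using DERIV_dens sub[OF that] by auto
      show "continuous_on ({d..1 - d} \<times> {0..T}) (\<lambda>z. th (fst z) (snd z))" using d by (intro cth) auto
    qed (use Fd Gd sub cs cs2 cdr k1 k2 th in auto)
    also have "integral {d..1 - d} (\<lambda>x. dens x * (T * bt x T - b x T + b x 0)) \<le> E1 T * D + X"
    proof -
      have cV: "continuous_on {d..1 - d} (\<lambda>x. V x t)" "continuous_on {d..1 - d} (\<lambda>x. W x t)"
         "continuous_on {d..1 - d} (\<lambda>x. Vt x t)" "continuous_on {d..1 - d} (\<lambda>x. Wt x t)" for t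
        unfolding V_def W_def Vt_def Wt_def heat_sum_def using Fd Gd sub
        by (intro continuous_intros DERIV_imp_continuous_on[of _ "f _" "f1 _"] DERIV_imp_continuous_on[of _ "g _" "g1 _"]; blast)+
      have cd: "continuous_on {d..1 - d} dens" by (rule continuous_on_subset[OF continuous_dens]) (use d in auto)
      have cb: "continuous_on {d..1 - d} (\<lambda>x. b x t)" for t unfolding b_def by (rule continuous_on_bell(1)[OF e cV(1,2)])
      have cbt: "continuous_on {d..1 - d} (\<lambda>x. bt x t)" for t unfolding bt_def
        by (intro continuous_on_add continuous_on_mult continuous_on_bell[OF e] cV)
      have "integral {d..1 - d} (\<lambda>x. dens x * (T * bt x T - b x T + b x 0)) \<le>
         integral {d..1 - d} (\<lambda>x. E1 T * D + dens x * b x 0)"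
      proof (rule integral_le)
        fix x assume x: "x \<in> {d..1 - d}"
        \<comment> \<open>The term - b at time T has the favourable sign and is dropped.\<close>
        have "dens x * (T * bt x T - b x T) \<le> dens x * E1 T"
          using bt[OF sub[OF x] T] bell_sign(1)[OF e A, of "V x T" "W x T"] by (intro mult_left_mono) (auto simp: b_def)
        also have "\<dots> \<le> D * E1 T" using D(2)[of x] sub[OF x] E1T by (intro mult_right_mono) auto
        finally show "dens x * (T * bt x T - b x T + b x 0) \<le> E1 T * D + dens x * b x 0" by (simp add: algebra_simps)
      qed (intro integrable_continuous_real continuous_intros cd cb cbt)+
      also have "\<dots> = integral {d..1 - d} (\<lambda>x. E1 T * D) + integral {d..1 - d} (\<lambda>x. dens x * b x 0)"
        by (intro integral_add integrable_continuous_real continuous_intros cd cb)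
      also have "integral {d..1 - d} (\<lambda>x. E1 T * D) = (1 - 2 * d) * (E1 T * D)" using d by simp
      also have "\<dots> \<le> 1 * (E1 T * D)" using d D(1) E1T by (intro mult_right_mono) auto
      also have "integral {d..1 - d} (\<lambda>x. dens x * b x 0) \<le> X"
        unfolding b_def V_def W_def using d by (intro X) auto
      finally show ?thesis by simp
    qed
    also have "integral {0..T} (\<lambda>t. t * (dens (1 - d) * bx (1 - d) t - dens d * bx d t)) \<le> T * T * (B * (dens (1 - d) + D * d))"
    proof -
      have "norm (integral {0..T} (\<lambda>t. t * (dens (1 - d) * bx (1 - d) t - dens d * bx d t))) \<le> (T * (B * (dens (1 - d) + D * d))) * (T - 0)"
      proof (rule integral_bound[OF T])
        have d2: "DERIV (\<lambda>t. V x t) t :> Vt x t" "DERIV (\<lambda>t. W x t) t :> Wt x t" for x t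
          unfolding V_def W_def Vt_def Wt_def by (rule DERIV_heat_sum_t)+
        have cV: "continuous_on {0..T} (V x)" "continuous_on {0..T} (W x)" for x
          by (rule DERIV_imp_continuous_on[OF d2(1)] DERIV_imp_continuous_on[OF d2(2)])+
        have cVx: "continuous_on {0..T} (Vx x)" "continuous_on {0..T} (Wx x)" for x
          unfolding Vx_def Wx_def by (rule DERIV_imp_continuous_on[OF DERIV_heat_sum_t])+
        have "continuous_on {0..T} (bx x)" for x unfolding bx_def
          by (intro continuous_on_add continuous_on_mult continuous_on_bell[OF e] cV cVx)
        then show "continuous_on {0..T} (\<lambda>t. t * (dens (1 - d) * bx (1 - d) t - dens d * bx d t))"
          by (intro continuous_intros)
        fix t assume t: "t \<in> {0..T}"
        have "\<bar>bx (1 - d) t\<bar> \<le> B * 1" "\<bar>bx d t\<bar> \<le> B * d"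
          using bx[of "1 - d" t] bx[of d t] d t mult_left_mono[of "1 - d" 1 B] B0 by auto
        then have "dens (1 - d) * \<bar>bx (1 - d) t\<bar> + dens d * \<bar>bx d t\<bar> \<le> dens (1 - d) * (B * 1) + D * (B * d)"
          using D d B0 by (intro add_mono mult_mono mult_left_mono) auto
        then have "\<bar>dens (1 - d) * bx (1 - d) t - dens d * bx d t\<bar> \<le> B * (dens (1 - d) + D * d)"
          by (intro order_trans[OF abs_triangle_ineq4]) (simp add: abs_mult algebra_simps)
        then show "norm (t * (dens (1 - d) * bx (1 - d) t - dens d * bx d t)) \<le> T * (B * (dens (1 - d) + D * d))"
          unfolding real_norm_def abs_mult using t by (intro mult_mono) auto
      qed
      then show ?thesis by (simp add: mult_ac)
    qed
    finally show ?thesis by simp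
  qed
  have E1nn: "0 \<le> E1 T" if "0 \<le> T" for T
    unfolding E1_def using that M(1) R0 K1(1) K2(1) Fr Gr by (intro mult_nonneg_nonneg add_nonneg_nonneg sum_nonneg) auto
  have "\<forall>\<^sub>F T in at_top. E1 T < \<eta> / (2 * D)" using order_tendstoD(2)[OF E1] eta D(1) by simp
  then show ?thesis
    using eventually_ge_at_top[of 0]
  proof eventually_elim
    case (elim T)
    have "E1 T * D \<le> \<eta> / 2" using elim(1) D(1) by (simp add: field_simps less_imp_le)
    have "((\<lambda>d. T * T * (B * (dens (1 - d) + D * d))) \<longlongrightarrow> T * T * (B * (0 + D * 0))) (at_right 0)"
    proof (intro tendsto_intros)
      have "(dens \<longlongrightarrow> 0) (at_left 1)"
        using continuous_dens[unfolded continuous_on_def, THEN bspec[of _ _ 1]] by (simp add: at_within_Icc_at_left)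
      then have "((\<lambda>d. dens (1 - d)) \<longlongrightarrow> 0) (at_right 0)"
        by (rule filterlim_compose) (auto simp: filterlim_at_left_to_right filterlim_at eventually_at_filter intro!: tendsto_eq_intros)
      then show "((\<lambda>d. dens (1 - d)) \<longlongrightarrow> 0) (at_right 0)" .
    qed
    then have "\<forall>\<^sub>F d in at_right 0. T * T * (B * (dens (1 - d) + D * d)) < \<eta> / 2"
      using eta by (intro order_tendstoD(2)) auto
    moreover have "\<forall>\<^sub>F d in at_right (0::real). 0 < d \<and> d < 1 / 2"
      using eventually_at_right_less[of 0] eventually_at_right_field by (auto simp: eventually_at_right_field intro!: exI[of _ "1/2"])
    ultimately show ?case
    proof eventually_elim
      case (elim d)
      show ?case using main[of d T] elim \<open>0 \<le> T\<close> E1nn[of T] \<open>E1 T * D \<le> \<eta> / 2\<close> by linarith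
    qed
  qed
qed

lemma continuous_drift1: "continuous_on {0<..<1} drift1"
proof -
  have "continuous_on {0<..<1} (u z1)" "continuous_on {0<..<1} (u1 z1)" by (rule continuous_u)+
  then show ?thesis unfolding drift1_def[abs_def] using u_z1_nz by (intro continuous_intros) auto
qed

lemma continuous_phi3: "0 < z \<Longrightarrow> continuous_on {0<..<1} (phi3 z)"
  unfolding phi3_def[abs_def] using DERIV_phi1 DERIV_phi2 DERIV_drift continuous_drift1
  by (intro continuous_intros DERIV_imp_continuous_on[of _ "phi1 z" "phi2 z"]
      DERIV_imp_continuous_on[of _ "phi2 z" "phi3 z"] DERIV_imp_continuous_on[of _ drift drift1]) auto

lemma phi_family_bound:
  assumes "finite I" "I \<subseteq> {1..}"
  shows "\<exists>K\<ge>0. \<forall>n\<in>I. \<forall>x\<in>{0<..<1}. \<bar>phi (lam n) x\<bar> \<le> K \<and> \<bar>phi1 (lam n) x\<bar> \<le> K * x \<and> \<bar>phi2 (lam n) x\<bar> \<le> K"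
proof -
  have "\<exists>K\<ge>0. \<forall>x\<in>{0<..<1}. \<bar>phi (lam n) x\<bar> \<le> K \<and> \<bar>phi1 (lam n) x\<bar> \<le> K * x \<and> \<bar>phi2 (lam n) x\<bar> \<le> K"
    if n: "n \<in> I" for n
  proof -
    have z: "lam n \<in> Z" using lam(1) n assms(2) by auto
    obtain C1 where C1: "0 \<le> C1" "\<And>x. x \<in> {0..<1} \<Longrightarrow> \<bar>phi (lam n) x\<bar> \<le> C1 * lam n powr (\<beta> + 1)" using phi_bound z by blast
    obtain C2 where C2: "0 \<le> C2" "\<And>x. x \<in> {0<..<1} \<Longrightarrow> \<bar>phi1 (lam n) x\<bar> \<le> C2 * ((lam n)\<^sup>2 * lam n powr (\<beta> + 1)) * (x * (1 - x))"
      using phi1_bound z by blast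
    obtain C3 where C3: "\<And>x. x \<in> {0<..<1} \<Longrightarrow> \<bar>phi2 (lam n) x\<bar> \<le> C3" using phi2_bound z by blast
    define B1 B2 where "B1 = C1 * lam n powr (\<beta> + 1)" and "B2 = C2 * ((lam n)\<^sup>2 * lam n powr (\<beta> + 1))"
    have B: "0 \<le> B1" "0 \<le> B2" "0 \<le> \<bar>C3\<bar>" using C1 C2 by (auto simp: B1_def B2_def)
    have "\<bar>phi (lam n) x\<bar> \<le> B1 + B2 + \<bar>C3\<bar> \<and> \<bar>phi1 (lam n) x\<bar> \<le> (B1 + B2 + \<bar>C3\<bar>) * x \<and> \<bar>phi2 (lam n) x\<bar> \<le> B1 + B2 + \<bar>C3\<bar>"
      if x: "x \<in> {0<..<1}" for x
    proof -
      have "\<bar>phi1 (lam n) x\<bar> \<le> B2 * (x * (1 - x))" using C2(2)[OF x] by (simp add: B2_def)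
      also have "\<dots> \<le> (B1 + B2 + \<bar>C3\<bar>) * (x * 1)" using B x by (intro mult_mono) auto
      finally show ?thesis using C1(2)[of x] C3[OF x] x B by (auto simp: B1_def)
    qed
    then show ?thesis using B by (intro exI[of _ "B1 + B2 + \<bar>C3\<bar>"]) auto
  qed
  then obtain K where K: "\<And>n. n \<in> I \<Longrightarrow> 0 \<le> K n" "\<And>n x. n \<in> I \<Longrightarrow> x \<in> {0<..<1} \<Longrightarrow>
     \<bar>phi (lam n) x\<bar> \<le> K n \<and> \<bar>phi1 (lam n) x\<bar> \<le> K n * x \<and> \<bar>phi2 (lam n) x\<bar> \<le> K n" by metis
  have le: "K n \<le> sum K I" if "n \<in> I" for n using member_le_sum[of n I K] that K(1) assms(1) by auto
  have "\<bar>phi (lam n) x\<bar> \<le> sum K I \<and> \<bar>phi1 (lam n) x\<bar> \<le> sum K I * x \<and> \<bar>phi2 (lam n) x\<bar> \<le> sum K I"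
    if "n \<in> I" "x \<in> {0<..<1}" for n x
  proof -
    have "K n * x \<le> sum K I * x" using le[OF that(1)] that(2) by (intro mult_right_mono) auto
    then show ?thesis using K(2)[OF that] le[OF that(1)] by linarith
  qed
  moreover have "0 \<le> sum K I" using K(1) by (rule sum_nonneg)
  ultimately show ?thesis by blast
qed

lemma mu_nonneg: "1 \<le> n \<Longrightarrow> 0 \<le> mu (lam n)"
  using z1_le[OF lam(1)] z1(2) power_mono[of z1 "lam n" 2] by (simp add: mu_def)

text \<open>The zero-order coefficients are \<open>a\<close> for the \<phi>_n and
  \<open>a - drift1\<close> for the \<phi>_n', the latter nonnegative by
  \<open>drift1_nonpos\<close>.\<close>

lemma heat_family_phi:
  assumes I: "finite I" "I \<subseteq> {1..}" and a: "0 \<le> a"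
  defines "r \<equiv> \<lambda>n. sqrt (mu (lam n) + a)"
  shows "heat_family I r (\<lambda>n. phi (lam n)) (\<lambda>n. phi1 (lam n)) (\<lambda>n. phi2 (lam n))"
    "heat_family I r (\<lambda>n. phi1 (lam n)) (\<lambda>n. phi2 (lam n)) (\<lambda>n. phi3 (lam n))"
proof -
  have n: "0 < lam n" "0 \<le> mu (lam n)" if "n \<in> I" for n using lam_pos mu_nonneg I(2) that by auto
  have r: "0 \<le> r n" "(r n)\<^sup>2 = mu (lam n) + a" if "n \<in> I" for n using n[OF that] a by (auto simp: r_def)
  obtain K where K: "0 \<le> K" "\<And>n x. n \<in> I \<Longrightarrow> x \<in> {0<..<1} \<Longrightarrow> \<bar>phi (lam n) x\<bar> \<le> K \<and> \<bar>phi1 (lam n) x\<bar> \<le> K * x \<and> \<bar>phi2 (lam n) x\<bar> \<le> K"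
    using phi_family_bound[OF I] by blast
  have K': "\<bar>phi1 (lam n) x\<bar> \<le> K" if "n \<in> I" "x \<in> {0<..<1}" for n x
    using K(2)[OF that] mult_left_mono[of x 1 K] that(2) K(1) by auto
  have p1: "\<bar>phi (lam n) x * phi1 (lam m) x\<bar> \<le> (K + K * K) * x" if "n \<in> I" "m \<in> I" "x \<in> {0<..<1}" for n m x
  proof -
    have "\<bar>phi (lam n) x * phi1 (lam m) x\<bar> \<le> K * (K * x)"
      unfolding abs_mult using K(2)[OF that(1,3)] K(2)[OF that(2,3)] K(1) by (intro mult_mono) auto
    also have "\<dots> \<le> (K + K * K) * x" using K(1) that(3) by (simp add: algebra_simps)
    finally show ?thesis .
  qed
  have p2: "\<bar>phi1 (lam n) x * phi2 (lam m) x\<bar> \<le> (K + K * K) * x" if "n \<in> I" "m \<in> I" "x \<in> {0<..<1}" for n m x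
  proof -
    have "\<bar>phi1 (lam n) x * phi2 (lam m) x\<bar> \<le> (K * x) * K"
      unfolding abs_mult using K(2)[OF that(1,3)] K(2)[OF that(2,3)] K(1) that(3) by (intro mult_mono) auto
    also have "\<dots> \<le> (K + K * K) * x" using K(1) that(3) by (simp add: algebra_simps)
    finally show ?thesis .
  qed
  have KK: "0 \<le> K + K * K" "y \<le> K \<Longrightarrow> y \<le> K + K * K" for y using K(1) by (auto intro: add_increasing2)
  have cphi2: "continuous_on {0<..<1} (phi2 (lam n))" if "n \<in> I" for n
    by (rule DERIV_imp_continuous_on[of _ _ "phi3 (lam n)"]) (use DERIV_phi2 n[OF that] in auto)
  show "heat_family I r (\<lambda>n. phi (lam n)) (\<lambda>n. phi1 (lam n)) (\<lambda>n. phi2 (lam n))"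
    unfolding heat_family_def
  proof (intro conjI)
    show "\<exists>k. \<forall>x\<in>{0<..<1}. 0 \<le> k x \<and> (\<forall>n\<in>I. (r n)\<^sup>2 * phi (lam n) x + phi2 (lam n) x + drift x * phi1 (lam n) x = k x * phi (lam n) x)"
      using r(2) a by (intro exI[of _ "\<lambda>x. a"]) (auto simp: phi2_def algebra_simps)
    show "\<exists>K\<ge>0. \<forall>x\<in>{0<..<1}. \<forall>n\<in>I. \<bar>phi (lam n) x\<bar> \<le> K \<and> (\<forall>m\<in>I. \<bar>phi (lam n) x * phi1 (lam m) x\<bar> \<le> K * x)"
      using KK K(2) p1 by (intro exI[of _ "K + K * K"]) blast
  qed (use r(1) n DERIV_phi DERIV_phi1 cphi2 in auto)
  show "heat_family I r (\<lambda>n. phi1 (lam n)) (\<lambda>n. phi2 (lam n)) (\<lambda>n. phi3 (lam n))"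
    unfolding heat_family_def
  proof (intro conjI)
    show "\<exists>k. \<forall>x\<in>{0<..<1}. 0 \<le> k x \<and> (\<forall>n\<in>I. (r n)\<^sup>2 * phi1 (lam n) x + phi3 (lam n) x + drift x * phi2 (lam n) x = k x * phi1 (lam n) x)"
    proof (intro exI[of _ "\<lambda>x. a - drift1 x"] ballI conjI)
      fix x :: real assume x: "x \<in> {0<..<1}"
      then show "0 \<le> a - drift1 x" using drift1_nonpos[of x] a by auto
      fix n assume "n \<in> I"
      then show "(r n)\<^sup>2 * phi1 (lam n) x + phi3 (lam n) x + drift x * phi2 (lam n) x = (a - drift1 x) * phi1 (lam n) x"
        using r(2) by (simp add: phi3_def algebra_simps)
    qed
    show "\<exists>K\<ge>0. \<forall>x\<in>{0<..<1}. \<forall>n\<in>I. \<bar>phi1 (lam n) x\<bar> \<le> K \<and> (\<forall>m\<in>I. \<bar>phi1 (lam n) x * phi2 (lam m) x\<bar> \<le> K * x)"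
      using KK K' p2 by (intro exI[of _ "K + K * K"]) blast
  qed (use r(1) n DERIV_phi1 DERIV_phi2 continuous_phi3 in auto)
qed

section \<open>Evaluation of the pairing\<close>

lemma phi1_inner_limit:
  assumes "y \<in> Z" "z \<in> Z"
  shows "((\<lambda>d. integral {d..1 - d} (\<lambda>x. dens x * (phi1 y x * phi1 z x))) \<longlongrightarrow> (if y = z then mu z else 0)) (at_right 0)"
proof -
  define h where "h x = dens x * (phi1 y x * phi1 z x)" for x
  have i: "h integrable_on {0..1}" and v: "integral {0..1} h = (if y = z then mu z else 0)"
    using phi1_orthogonal[OF assms] unfolding h_def by (auto simp: integral_unique has_integral_integrable)
  define H where "H x = integral {0..x} h" for x
  have cH: "continuous_on {0..1} H" unfolding H_def by (rule indefinite_integral_continuous_1[OF i])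
  have lim0: "(H \<longlongrightarrow> H 0) (at_right 0)"
    using cH[unfolded continuous_on_def, THEN bspec[of _ _ 0]] by (simp add: at_within_Icc_at_right)
  have "(H \<longlongrightarrow> H 1) (at_left 1)"
    using cH[unfolded continuous_on_def, THEN bspec[of _ _ 1]] by (simp add: at_within_Icc_at_left)
  then have lim1: "((\<lambda>d. H (1 - d)) \<longlongrightarrow> H 1) (at_right 0)"
    by (rule filterlim_compose) (auto simp: filterlim_at eventually_at_filter intro!: tendsto_eq_intros)
  have L: "((\<lambda>d. H (1 - d) - H d) \<longlongrightarrow> H 1 - H 0) (at_right 0)" by (intro tendsto_diff lim0 lim1)
  have V: "H 1 - H 0 = (if y = z then mu z else 0)" by (simp add: H_def v)
  have ev: "\<forall>\<^sub>F d in at_right 0. H (1 - d) - H d = integral {d..1 - d} h"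
  proof -
    have "\<forall>\<^sub>F d in at_right (0::real). 0 < d \<and> d < 1 / 2"
      by (auto simp: eventually_at_right_field intro!: exI[of _ "1/2"])
    then show ?thesis
    proof eventually_elim
      case (elim d)
      have "integral {0..d} h + integral {d..1 - d} h = integral {0..1 - d} h"
        using elim by (intro Henstock_Kurzweil_Integration.integral_combine integrable_on_subinterval[OF i]) auto
      then show ?case by (simp add: H_def)
    qed
  qed
  show ?thesis using Lim_transform_eventually[OF L ev] unfolding V h_def[abs_def] .
qed

lemma integral_time_limit:
  assumes r: "0 < (r::real)"
  shows "((\<lambda>T. integral {0..T} (\<lambda>t. t * (exp (- r * t) * exp (- r * t)))) \<longlongrightarrow> 1 / (4 * r\<^sup>2)) at_top"
proof -
  define G where "G t = - (2 * r * t) * exp (- (2 * r * t)) / (4 * r\<^sup>2) - exp (- (2 * r * t)) / (4 * r\<^sup>2)" for t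
  have eq: "integral {0..T} (\<lambda>t. t * (exp (- r * t) * exp (- r * t))) = G T - G 0" if "0 \<le> T" for T
  proof (rule integral_unique, rule fundamental_theorem_of_calculus[OF that])
    fix t
    have "(G has_real_derivative t * (exp (- r * t) * exp (- r * t))) (at t)"
      unfolding G_def[abs_def] using r
      by (auto intro!: derivative_eq_intros simp: exp_add[symmetric] field_simps power2_eq_square)
    then show "(G has_vector_derivative t * (exp (- r * t) * exp (- r * t))) (at t within {0..T})"
      by (simp add: has_real_derivative_iff_has_vector_derivative has_vector_derivative_at_within)
  qed
  have lim: "((\<lambda>T. G T - G 0) \<longlongrightarrow> 0 - G 0) at_top"
  proof (intro tendsto_diff tendsto_const)
    have f: "filterlim (\<lambda>T. 2 * r * T) at_top at_top"
      using r by (intro filterlim_tendsto_pos_mult_at_top[OF tendsto_const] filterlim_ident) auto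
    have 1: "((\<lambda>T. (2 * r * T) * exp (- (2 * r * T))) \<longlongrightarrow> 0) at_top"
      using filterlim_compose[OF tendsto_power_div_exp_0[of 1] f] by (simp add: exp_minus divide_inverse)
    have 2: "((\<lambda>T. exp (- (2 * r * T))) \<longlongrightarrow> 0) at_top"
      using filterlim_compose[OF tendsto_power_div_exp_0[of 0] f] by (simp add: exp_minus divide_inverse)
    have "((\<lambda>T. - ((2 * r * T) * exp (- (2 * r * T))) / (4 * r\<^sup>2) - exp (- (2 * r * T)) / (4 * r\<^sup>2)) \<longlongrightarrow> - 0 / (4 * r\<^sup>2) - 0 / (4 * r\<^sup>2)) at_top"
      using r by (intro tendsto_intros 1 2) auto
    then show "(G \<longlongrightarrow> 0) at_top" unfolding G_def[abs_def] by simp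
  qed
  have "\<forall>\<^sub>F T in at_top. G T - G 0 = integral {0..T} (\<lambda>t. t * (exp (- r * t) * exp (- r * t)))"
    using eventually_ge_at_top[of 0] by eventually_elim (simp only: eq)
  from Lim_transform_eventually[OF lim this] show ?thesis by (simp add: G_def)
qed

text \<open>As \<delta> tends to 0, orthogonality leaves the diagonal terms. As T grows, their time
  integrals tend to 1 / (4 r^2), which the factor - 4 r, with r from the time derivative, turns into
  - 1 / r.\<close>

lemma bilinear_from_limit:
  fixes c d r :: "nat \<Rightarrow> real" and N :: nat and \<sigma> a X :: real
  assumes a: "0 \<le> a" and r_def: "r = (\<lambda>n. sqrt (mu (lam n) + a))" and lim: "\<And>\<eta>. 0 < \<eta> \<Longrightarrow> \<forall>\<^sub>F T in at_top. \<forall>\<^sub>F \<delta> in at_right 0.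
     integral {\<delta>..1 - \<delta>} (\<lambda>x. integral {0..T} (\<lambda>t. t * (dens x * (4 * (\<sigma> *
       (heat_sum {1..N} c r (\<lambda>n. phi1 (lam n)) x t * heat_sum {2..N} (\<lambda>n. - r n * d n) r (\<lambda>n. phi1 (lam n)) x t)))))) \<le> X + \<eta>"
  shows "- \<sigma> * (\<Sum>n=2..N. c n * d n * mu (lam n) / r n) \<le> X"
proof -
  define q where "q m n = 4 * \<sigma> * c n * (- r m * d m)" for m n
  define J where "J m n T = integral {0..T} (\<lambda>t. t * (exp (- r n * t) * exp (- r m * t)))" for m n T
  define P where "P m n \<delta> = integral {\<delta>..1 - \<delta>} (\<lambda>x. dens x * (phi1 (lam m) x * phi1 (lam n) x))" for m n \<delta>
  \<comment> \<open>Each double integral factors into a time part \<open>J\<close> and a space part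
    \<open>P\<close>, so the two limits can be taken separately.\<close>
  have expand: "integral {\<delta>..1 - \<delta>} (\<lambda>x. integral {0..T} (\<lambda>t. t * (dens x * (4 * (\<sigma> *
       (heat_sum {1..N} c r (\<lambda>n. phi1 (lam n)) x t * heat_sum {2..N} (\<lambda>n. - r n * d n) r (\<lambda>n. phi1 (lam n)) x t)))))) =
     (\<Sum>m=2..N. \<Sum>n=1..N. q m n * J m n T * P m n \<delta>)" if \<delta>: "0 < \<delta>" "\<delta> < 1 / 2" for \<delta> T
  proof -
    have "integral {0..T} (\<lambda>t. t * (dens x * (4 * (\<sigma> *
       (heat_sum {1..N} c r (\<lambda>n. phi1 (lam n)) x t * heat_sum {2..N} (\<lambda>n. - r n * d n) r (\<lambda>n. phi1 (lam n)) x t))))) =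
       (\<Sum>m=2..N. \<Sum>n=1..N. q m n * J m n T * (dens x * (phi1 (lam m) x * phi1 (lam n) x)))" for x
    proof -
      have "t * (dens x * (4 * (\<sigma> *
       (heat_sum {1..N} c r (\<lambda>n. phi1 (lam n)) x t * heat_sum {2..N} (\<lambda>n. - r n * d n) r (\<lambda>n. phi1 (lam n)) x t)))) =
        (\<Sum>m=2..N. \<Sum>n=1..N. (q m n * (dens x * (phi1 (lam m) x * phi1 (lam n) x))) * (t * (exp (- r n * t) * exp (- r m * t))))" for t
      proof -
        have "t * (dens x * (4 * (\<sigma> *
       (heat_sum {1..N} c r (\<lambda>n. phi1 (lam n)) x t * heat_sum {2..N} (\<lambda>n. - r n * d n) r (\<lambda>n. phi1 (lam n)) x t)))) =
         (t * dens x * 4 * \<sigma>) * (heat_sum {2..N} (\<lambda>n. - r n * d n) r (\<lambda>n. phi1 (lam n)) x t * heat_sum {1..N} c r (\<lambda>n. phi1 (lam n)) x t)"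
          by (simp add: mult_ac)
        also have "heat_sum {2..N} (\<lambda>n. - r n * d n) r (\<lambda>n. phi1 (lam n)) x t * heat_sum {1..N} c r (\<lambda>n. phi1 (lam n)) x t =
          (\<Sum>m=2..N. \<Sum>n=1..N. (- r m * d m * exp (- r m * t) * phi1 (lam m) x) * (c n * exp (- r n * t) * phi1 (lam n) x))"
          by (simp only: heat_sum_def sum_product)
        finally show ?thesis unfolding sum_distrib_left
          by (simp only:) (intro sum.cong refl, simp add: q_def mult_ac)
      qed
      then have "integral {0..T} (\<lambda>t. t * (dens x * (4 * (\<sigma> *
       (heat_sum {1..N} c r (\<lambda>n. phi1 (lam n)) x t * heat_sum {2..N} (\<lambda>n. - r n * d n) r (\<lambda>n. phi1 (lam n)) x t))))) =
        integral {0..T} (\<lambda>t. \<Sum>m=2..N. \<Sum>n=1..N. (q m n * (dens x * (phi1 (lam m) x * phi1 (lam n) x))) * (t * (exp (- r n * t) * exp (- r m * t))))"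
        by (simp only:)
      also have "\<dots> = (\<Sum>m=2..N. \<Sum>n=1..N. (q m n * (dens x * (phi1 (lam m) x * phi1 (lam n) x))) * J m n T)"
        unfolding J_def integral_mult_right[symmetric]
        by (subst integral_sum; (intro sum.cong refl)?; (subst integral_sum)?)
           (auto intro!: integrable_continuous_real continuous_intros integrable_sum)
      finally show ?thesis by (simp add: mult_ac)
    qed
    then have "integral {\<delta>..1 - \<delta>} (\<lambda>x. integral {0..T} (\<lambda>t. t * (dens x * (4 * (\<sigma> *
       (heat_sum {1..N} c r (\<lambda>n. phi1 (lam n)) x t * heat_sum {2..N} (\<lambda>n. - r n * d n) r (\<lambda>n. phi1 (lam n)) x t)))))) =
       integral {\<delta>..1 - \<delta>} (\<lambda>x. \<Sum>m=2..N. \<Sum>n=1..N. q m n * J m n T * (dens x * (phi1 (lam m) x * phi1 (lam n) x)))"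
      by (simp only:)
    also have "\<dots> = (\<Sum>m=2..N. \<Sum>n=1..N. q m n * J m n T * P m n \<delta>)"
    proof -
      have i: "(\<lambda>x. q m n * J m n T * (dens x * (phi1 (lam m) x * phi1 (lam n) x))) integrable_on {\<delta>..1 - \<delta>}" for m n
      proof -
        have c: "continuous_on {\<delta>..1 - \<delta>} (phi1 (lam k))" for k
          by (rule continuous_on_subset[OF continuous_phi(2)]) (use \<delta> in auto)
        have "continuous_on {\<delta>..1 - \<delta>} dens"
          by (rule continuous_on_subset[OF continuous_dens]) (use \<delta> in auto)
        then show ?thesis by (intro integrable_continuous_real continuous_intros c)
      qed
      show ?thesis unfolding P_def integral_mult_right[symmetric]
        by (subst integral_sum; (intro sum.cong refl)?; (subst integral_sum)?) (auto intro!: i integrable_sum)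
    qed
    finally show ?thesis .
  qed
  define L where "L T = (\<Sum>m=2..N. q m m * J m m T * mu (lam m))" for T
  have limd: "((\<lambda>\<delta>. \<Sum>m=2..N. \<Sum>n=1..N. q m n * J m n T * P m n \<delta>) \<longlongrightarrow> L T) (at_right 0)" for T
  proof -
    have "((\<lambda>\<delta>. \<Sum>m=2..N. \<Sum>n=1..N. q m n * J m n T * P m n \<delta>) \<longlongrightarrow>
       (\<Sum>m=2..N. \<Sum>n=1..N. q m n * J m n T * (if lam m = lam n then mu (lam n) else 0))) (at_right 0)"
      unfolding P_def by (intro tendsto_sum tendsto_mult_left phi1_inner_limit lam(1)) auto
    moreover have "(\<Sum>n=1..N. q m n * J m n T * (if lam m = lam n then mu (lam n) else 0)) = q m m * J m m T * mu (lam m)"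
      if m: "m \<in> {2..N}" for m
    proof -
      have "(\<Sum>n=1..N. q m n * J m n T * (if lam m = lam n then mu (lam n) else 0)) =
         (\<Sum>n=1..N. if m = n then q m n * J m n T * mu (lam n) else 0)"
        using lam_inj m by (intro sum.cong) (auto simp: inj_on_def)
      then show ?thesis using m by (simp add: sum.delta')
    qed
    ultimately show ?thesis unfolding L_def by simp
  qed
  have LX: "\<forall>\<^sub>F T in at_top. L T \<le> X + \<eta>" if "0 < \<eta>" for \<eta>
    using lim[OF that]
  proof eventually_elim
    case (elim T)
    have "\<forall>\<^sub>F \<delta> in at_right (0::real). 0 < \<delta> \<and> \<delta> < 1 / 2"
      by (auto simp: eventually_at_right_field intro!: exI[of _ "1/2"])
    then have "\<forall>\<^sub>F \<delta> in at_right 0. (\<Sum>m=2..N. \<Sum>n=1..N. q m n * J m n T * P m n \<delta>) \<le> X + \<eta>"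
      using elim by eventually_elim (use expand in auto)
    then show ?case using tendsto_upperbound[OF limd] by simp
  qed
  have rpos: "0 < r m" if "2 \<le> m" for m using mu_pos[OF that] a by (simp add: r_def add_pos_nonneg)
  have "(L \<longlongrightarrow> (\<Sum>m=2..N. q m m * (1 / (4 * (r m)\<^sup>2)) * mu (lam m))) at_top"
    unfolding L_def J_def by (intro tendsto_intros integral_time_limit rpos) auto
  moreover have "(\<Sum>m=2..N. q m m * (1 / (4 * (r m)\<^sup>2)) * mu (lam m)) = - \<sigma> * (\<Sum>n=2..N. c n * d n * mu (lam n) / r n)"
    unfolding sum_distrib_left
  proof (intro sum.cong refl)
    fix m assume "m \<in> {2..N}"
    then have "r m \<noteq> 0" using rpos[of m] by simp
    then show "q m m * (1 / (4 * (r m)\<^sup>2)) * mu (lam m) = - \<sigma> * (c m * d m * mu (lam m) / r m)"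
      by (simp add: q_def power2_eq_square field_simps)
  qed
  ultimately have Ll: "(L \<longlongrightarrow> - \<sigma> * (\<Sum>n=2..N. c n * d n * mu (lam n) / r n)) at_top" by simp
  show ?thesis
  proof (rule field_le_epsilon)
    fix \<eta> :: real assume "0 < \<eta>"
    show "- \<sigma> * (\<Sum>n=2..N. c n * d n * mu (lam n) / r n) \<le> X + \<eta>"
      by (rule tendsto_upperbound[OF Ll LX[OF \<open>0 < \<eta>\<close>]]) simp
  qed
qed

lemma bilinear_estimate:
  fixes c d :: "nat \<Rightarrow> real" and N :: nat and a X e A :: real
  assumes a: "0 \<le> a" and e: "0 < e" and A: "1 \<le> A"
  defines "r \<equiv> \<lambda>n. sqrt (mu (lam n) + a)"
  defines "f \<equiv> \<lambda>x. \<Sum>n=1..N. c n * phi (lam n) x" and "g \<equiv> \<lambda>x. \<Sum>n=2..N. d n * phi1 (lam n) x"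
  assumes X: "(\<forall>p q. 0 < p \<and> p \<le> q \<and> q < 1 \<longrightarrow> integral {p..q} (\<lambda>x. dens x * bell A e (f x) (g x)) \<le> X) \<or>
     (\<forall>p q. 0 < p \<and> p \<le> q \<and> q < 1 \<longrightarrow> integral {p..q} (\<lambda>x. dens x * bell A e (g x) (f x)) \<le> X)"
  shows "\<bar>\<Sum>n=2..N. c n * d n * mu (lam n) / r n\<bar> \<le> X"
proof -
  define Ux Ut where "Ux = heat_sum {1..N} c r (\<lambda>n. phi1 (lam n))"
    and "Ut = heat_sum {2..N} (\<lambda>n. - r n * d n) r (\<lambda>n. phi1 (lam n))"
  have r: "r = (\<lambda>n. sqrt (mu (lam n) + a))" by (simp add: r_def)
  have F: "heat_family {1..N} r (\<lambda>n. phi (lam n)) (\<lambda>n. phi1 (lam n)) (\<lambda>n. phi2 (lam n))"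
    and G: "heat_family {2..N} r (\<lambda>n. phi1 (lam n)) (\<lambda>n. phi2 (lam n)) (\<lambda>n. phi3 (lam n))"
    unfolding r_def by (intro heat_family_phi a; force)+
  have f: "heat_sum {1..N} c r (\<lambda>n. phi (lam n)) x 0 = f x" and g: "heat_sum {2..N} d r (\<lambda>n. phi1 (lam n)) x 0 = g x" for x
    by (simp_all add: heat_sum_def f_def g_def)
  have "- \<sigma> * (\<Sum>n=2..N. c n * d n * mu (lam n) / r n) \<le> X" if \<sigma>: "\<bar>\<sigma>\<bar> = 1" for \<sigma>
  proof (rule bilinear_from_limit[OF a r, where c=c and d=d and N=N, folded Ux_def Ut_def])
    fix \<eta> :: real assume eta: "0 < \<eta>"
    have th: "\<sigma> * (Ux x t * Ut x t) \<le> \<bar>Ux x t * Ut x t\<bar>" for x t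
      using abs_ge_self[of "\<sigma> * (Ux x t * Ut x t)"] \<sigma> by (simp add: abs_mult)
    have cth: "continuous_on ({p..q} \<times> {0..T}) (\<lambda>z. \<sigma> * (Ux (fst z) (snd z) * Ut (fst z) (snd z)))" if "0 < p" "q < 1" for p q T
      unfolding Ux_def Ut_def using that
      by (intro continuous_intros continuous_heat_sum continuous_on_subset[OF continuous_phi(2)]) auto
    from X show "\<forall>\<^sub>F T in at_top. \<forall>\<^sub>F \<delta> in at_right 0.
       integral {\<delta>..1 - \<delta>} (\<lambda>x. integral {0..T} (\<lambda>t. t * (dens x * (4 * (\<sigma> * (Ux x t * Ut x t)))))) \<le> X + \<eta>"
    proof
      assume X: "\<forall>p q. 0 < p \<and> p \<le> q \<and> q < 1 \<longrightarrow> integral {p..q} (\<lambda>x. dens x * bell A e (f x) (g x)) \<le> X"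
      show ?thesis
      proof (rule box_limit[OF F G e A, where a=c and c=d, folded Ux_def Ut_def, unfolded f g])
        show "\<sigma> * (Ux x t * Ut x t) \<le> \<bar>Ux x t * Ut x t\<bar> \<or>
          \<sigma> * (Ux x t * Ut x t) \<le> \<bar>heat_sum {1..N} (\<lambda>n. - r n * c n) r (\<lambda>n. phi (lam n)) x t * heat_sum {2..N} d r (\<lambda>n. phi2 (lam n)) x t\<bar>" for x t
          using th by blast
      qed (use cth X eta in blast)+
    next
      assume X: "\<forall>p q. 0 < p \<and> p \<le> q \<and> q < 1 \<longrightarrow> integral {p..q} (\<lambda>x. dens x * bell A e (g x) (f x)) \<le> X"
      show ?thesis
      proof (rule box_limit[OF G F e A, where a=d and c=c, folded Ux_def Ut_def, unfolded f g])
        show "\<sigma> * (Ux x t * Ut x t) \<le> \<bar>heat_sum {2..N} d r (\<lambda>n. phi2 (lam n)) x t * heat_sum {1..N} (\<lambda>n. - r n * c n) r (\<lambda>n. phi (lam n)) x t\<bar> \<or>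
          \<sigma> * (Ux x t * Ut x t) \<le> \<bar>Ut x t * Ux x t\<bar>" for x t
          using th[of x t] by (simp only: mult.commute[of "Ut x t"] simp_thms)
        show "continuous_on ({p..q} \<times> {0..T}) (\<lambda>z. \<sigma> * (Ux (fst z) (snd z) * Ut (fst z) (snd z)))" if "0 < p" "q < 1" for p q T
          by (rule cth[OF that])
        show "integral {p..q} (\<lambda>x. dens x * bell A e (g x) (f x)) \<le> X" if "0 < p" "p \<le> q" "q < 1" for p q
          using X that by blast
      qed (rule eta)
    qed
  qed
  from this[of 1] this[of "-1"] show ?thesis by (simp add: abs_le_iff)
qed

end

section \<open>The Riesz transforms\<close>

subsection \<open>Approximation in \<open>L\<^sup>r\<close> by real functions\<close>

text \<open>Sequential closure within real functions; real and imaginary parts of complex functions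
  are approximated separately.\<close>

definition Lp_approx :: "real \<Rightarrow> 'a measure \<Rightarrow> ('a \<Rightarrow> real) set \<Rightarrow> ('a \<Rightarrow> real) \<Rightarrow> bool" where
  "Lp_approx r M F f \<longleftrightarrow> (\<exists>s. (\<forall>k::nat. s k \<in> F) \<and>
     Lp_tendsto r M (\<lambda>k x. complex_of_real (s k x)) (\<lambda>x. complex_of_real (f x)))"

lemma Lp_dominated:
  assumes r: "0 < r" and f [measurable]: "f \<in> borel_measurable M" and s [measurable]: "\<And>k. s k \<in> borel_measurable M"
    and G: "integrable M (\<lambda>x. G x powr r)"
    and lim: "AE x in M. (\<lambda>k. s k x) \<longlonglongrightarrow> f x" and dom: "\<And>k. AE x in M. cmod (s k x - f x) \<le> G x"
    and fL: "f \<in> Lp r M"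
  shows "Lp_tendsto r M s f"
proof -
  have d: "AE x in M. cmod (s k x - f x) powr r \<le> G x powr r" for k
    using dom[of k] by eventually_elim (use r in \<open>auto intro!: powr_mono2\<close>)
  have di: "(\<lambda>x. s k x - f x) \<in> Lp r M" for k
    using d[of k] by (intro Lp_I Bochner_Integration.integrable_bound[OF G]) auto
  have sL: "s k \<in> Lp r M" for k
    using Lp_add[OF di fL r, of k] by simp
  have "(\<lambda>k. LINT x|M. cmod (s k x - f x) powr r) \<longlonglongrightarrow> (LINT x|M. 0)"
  proof (rule integral_dominated_convergence[OF _ _ G])
    show "AE x in M. (\<lambda>k. cmod (s k x - f x) powr r) \<longlonglongrightarrow> 0"
      using lim
    proof eventually_elim
      case (elim x)
      then have "(\<lambda>k. cmod (s k x - f x)) \<longlonglongrightarrow> 0" by (simp add: LIM_zero_iff tendsto_norm_zero)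
      from tendsto_powr2[OF this tendsto_const _ r] show ?case by simp
    qed
  qed (use d in auto)
  then have l: "(\<lambda>k. LINT x|M. cmod (s k x - f x) powr r) \<longlonglongrightarrow> 0" by simp
  have "(\<lambda>k. Lp_norm r M (\<lambda>x. s k x - f x)) \<longlonglongrightarrow> 0"
    unfolding Lp_norm_def
    using tendsto_powr2[OF l tendsto_const[of "1 / r"]] r by (simp add: always_eventually integral_nonneg)
  then show ?thesis using sL fL by (simp add: Lp_tendsto_def)
qed

text \<open>The closure is closed: one approximant of \<open>f k\<close> within 1 / (k + 1) is taken
  for each k.\<close>

lemma Lp_approx_limit:
  assumes r: "1 \<le> r" and f: "\<And>k::nat. Lp_approx r M F (f k)"
    and l: "Lp_tendsto r M (\<lambda>k x. complex_of_real (f k x)) (\<lambda>x. complex_of_real (g x))"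
  shows "Lp_approx r M F g"
proof -
  have "\<exists>h\<in>F. (\<lambda>x. complex_of_real (h x)) \<in> Lp r M \<and>
      Lp_norm r M (\<lambda>x. complex_of_real (h x) - complex_of_real (f k x)) < 1 / (real k + 1)" for k
  proof -
    obtain s where s: "\<forall>j::nat. s j \<in> F" "Lp_tendsto r M (\<lambda>j x. complex_of_real (s j x)) (\<lambda>x. complex_of_real (f k x))"
      using f[of k] unfolding Lp_approx_def by (elim exE conjE)
    have "\<forall>\<^sub>F j in sequentially. Lp_norm r M (\<lambda>x. complex_of_real (s j x) - complex_of_real (f k x)) < 1 / (real k + 1)"
      using s(2) unfolding Lp_tendsto_def by (intro order_tendstoD) auto
    then obtain j where "Lp_norm r M (\<lambda>x. complex_of_real (s j x) - complex_of_real (f k x)) < 1 / (real k + 1)"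
      using eventually_happens' sequentially_bot by blast
    then show ?thesis using s by (intro bexI[of _ "s j"]) (auto simp: Lp_tendsto_def)
  qed
  then have "\<forall>k. \<exists>h. h \<in> F \<and> (\<lambda>x. complex_of_real (h x)) \<in> Lp r M \<and>
      Lp_norm r M (\<lambda>x. complex_of_real (h x) - complex_of_real (f k x)) < 1 / (real k + 1)" by blast
  then obtain h where h: "\<forall>k. h k \<in> F \<and> (\<lambda>x. complex_of_real (h k x)) \<in> Lp r M \<and>
      Lp_norm r M (\<lambda>x. complex_of_real (h k x) - complex_of_real (f k x)) < 1 / (real k + 1)"
    by (rule choice[THEN exE])
  have fL: "(\<lambda>x. complex_of_real (f k x)) \<in> Lp r M" "(\<lambda>x. complex_of_real (g x)) \<in> Lp r M" for k
    using l by (auto simp: Lp_tendsto_def)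
  have "(\<lambda>k. Lp_norm r M (\<lambda>x. complex_of_real (h k x) - complex_of_real (g x))) \<longlonglongrightarrow> 0"
  proof (rule tendsto_sandwich[OF _ _ tendsto_const])
    show "\<forall>\<^sub>F k in sequentially. 0 \<le> Lp_norm r M (\<lambda>x. complex_of_real (h k x) - complex_of_real (g x))" by simp
    show "(\<lambda>k. 1 / (real k + 1) + Lp_norm r M (\<lambda>x. complex_of_real (f k x) - complex_of_real (g x))) \<longlonglongrightarrow> 0"
      using l tendsto_add[OF LIMSEQ_inverse_real_of_nat, of "\<lambda>k. Lp_norm r M (\<lambda>x. complex_of_real (f k x) - complex_of_real (g x))" 0]
      by (simp add: Lp_tendsto_def inverse_eq_divide add.commute)
    show "\<forall>\<^sub>F k in sequentially. Lp_norm r M (\<lambda>x. complex_of_real (h k x) - complex_of_real (g x))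
       \<le> 1 / (real k + 1) + Lp_norm r M (\<lambda>x. complex_of_real (f k x) - complex_of_real (g x))"
    proof (intro always_eventually allI)
      fix k
      have hk: "(\<lambda>x. complex_of_real (h k x)) \<in> Lp r M" using h by blast
      have "Lp_norm r M (\<lambda>x. (complex_of_real (h k x) - complex_of_real (f k x)) + (complex_of_real (f k x) - complex_of_real (g x)))
        \<le> Lp_norm r M (\<lambda>x. complex_of_real (h k x) - complex_of_real (f k x)) + Lp_norm r M (\<lambda>x. complex_of_real (f k x) - complex_of_real (g x))"
        using r by (intro Lp_minkowski Lp_diff hk fL) auto
      moreover have "Lp_norm r M (\<lambda>x. complex_of_real (h k x) - complex_of_real (f k x)) < 1 / (real k + 1)" using h by blast
      ultimately show "Lp_norm r M (\<lambda>x. complex_of_real (h k x) - complex_of_real (g x))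
       \<le> 1 / (real k + 1) + Lp_norm r M (\<lambda>x. complex_of_real (f k x) - complex_of_real (g x))" by simp
    qed
  qed
  then show ?thesis unfolding Lp_approx_def Lp_tendsto_def using h fL by (intro exI[of _ h]) auto
qed

lemma Lp_bounded:
  assumes "finite_measure M" "f \<in> borel_measurable M" "AE x in M. cmod (f x) \<le> K" "0 < r"
  shows "f \<in> Lp r M"
proof -
  interpret finite_measure M by fact
  note [measurable] = assms(2)
  show ?thesis
  proof (intro Lp_I integrable_const_bound[where B="K powr r"])
    show "AE x in M. norm (cmod (f x) powr r) \<le> K powr r"
      using assms(3) by eventually_elim (use assms(4) in \<open>auto intro!: powr_mono2\<close>)
  qed (auto intro: assms)
qed

lemma Lp_approx_bounded_limit:
  assumes M: "finite_measure M" and r: "1 \<le> r" and s: "\<And>k::nat. Lp_approx r M F (s k)"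
    and f [measurable]: "f \<in> borel_measurable M" and sm [measurable]: "\<And>k. s k \<in> borel_measurable M"
    and b: "\<And>k. AE x in M. \<bar>s k x\<bar> \<le> K"
    and lim: "AE x in M. (\<lambda>k. s k x) \<longlonglongrightarrow> f x"
  shows "Lp_approx r M F f"
proof -
  interpret finite_measure M by fact
  have "AE x in M. \<forall>k. \<bar>s k x\<bar> \<le> K" using b by (simp add: AE_all_countable)
  with lim have bf: "AE x in M. \<bar>f x\<bar> \<le> K"
  proof eventually_elim
    case (elim x)
    show ?case by (rule tendsto_upperbound[OF tendsto_rabs[OF elim(1)]]) (use elim in auto)
  qed
  show ?thesis
  proof (rule Lp_approx_limit[OF r s])
    show "Lp_tendsto r M (\<lambda>k x. complex_of_real (s k x)) (\<lambda>x. complex_of_real (f x))"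
    proof (rule Lp_dominated[where G="\<lambda>_. 2 * K"])
      show "AE x in M. cmod (complex_of_real (s k x) - complex_of_real (f x)) \<le> 2 * K" for k
        using b[of k] bf by eventually_elim (simp flip: of_real_diff)
      show "AE x in M. (\<lambda>k. complex_of_real (s k x)) \<longlonglongrightarrow> complex_of_real (f x)"
        using lim by eventually_elim (rule tendsto_of_real)
      show "(\<lambda>x. complex_of_real (f x)) \<in> Lp r M"
        using r bf by (intro Lp_bounded[OF M, where K=K]) auto
    qed (use r in auto)
  qed
qed

lemma Lp_approx_from_bounded:
  assumes M: "finite_measure M" and r: "1 \<le> r"
    and bd: "\<And>g K. g \<in> borel_measurable M \<Longrightarrow> (\<And>x. \<bar>g x\<bar> \<le> K) \<Longrightarrow> Lp_approx r M F g"
    and f: "(\<lambda>x. complex_of_real (f x)) \<in> Lp r M"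
  shows "Lp_approx r M F f"
proof -
  have fc [measurable]: "(\<lambda>x. complex_of_real (f x)) \<in> borel_measurable M" using f by (rule Lp_measurable)
  have "(\<lambda>x. Re (complex_of_real (f x))) \<in> borel_measurable M" by measurable
  then have [measurable]: "f \<in> borel_measurable M" by simp
  define s where "s k x = (if \<bar>f x\<bar> \<le> real k then f x else 0)" for k x
  have [measurable]: "s k \<in> borel_measurable M" for k unfolding s_def[abs_def] by measurable
  have "Lp_approx r M F (s k)" for k by (rule bd[where K="real k"]) (auto simp: s_def)
  then show ?thesis
  proof (rule Lp_approx_limit[OF r])
    show "Lp_tendsto r M (\<lambda>k x. complex_of_real (s k x)) (\<lambda>x. complex_of_real (f x))"
    proof (rule Lp_dominated[where G="\<lambda>x. cmod (complex_of_real (f x))"])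
      show "integrable M (\<lambda>x. cmod (complex_of_real (f x)) powr r)" by (rule Lp_integrable[OF f])
      show "AE x in M. cmod (complex_of_real (s k x) - complex_of_real (f x)) \<le> cmod (complex_of_real (f x))" for k
        by (auto simp: s_def)
      show "AE x in M. (\<lambda>k. complex_of_real (s k x)) \<longlonglongrightarrow> complex_of_real (f x)"
      proof (intro AE_I2 tendsto_of_real tendsto_eventually)
        fix x
        obtain k0 where "\<bar>f x\<bar> \<le> real k0" using real_arch_simple by blast
        then show "\<forall>\<^sub>F k in sequentially. s k x = f x"
          by (intro eventually_sequentiallyI[of k0]) (auto simp: s_def)
      qed
    qed (use r f in auto)
  qed
qed

subsection \<open>The measure \<open>\<eta>\<^sub>\<nu>\<close>\<close>

context bessel_order
begin

abbreviation M :: "real measure" where "M \<equiv> bessel_measure \<nu>"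

text \<open>J_(\<nu>+1)(z) equals - (z / 2)^\<nu> times \<open>E1 z\<close>, so the powers of z / 2
  cancel, and the prefactor cancels the power of x.\<close>

lemma bessel_phi_eq:
  assumes n: "1 \<le> n" and x: "0 < x"
  shows "bessel_phi \<nu> n x = u (lam n) x"
proof -
  define z where "z = lam n"
  have z: "z \<in> Z" "0 < z" using lam(1)[OF n] Z_pos by (auto simp: z_def)
  have "bessel_J (\<nu> + 1) z = (z / 2) powr (\<nu> + 1) * bessel_E (\<nu> + 1) z"
    using nu by (intro bessel_J_eq z) simp
  also have "\<dots> = - ((z / 2) powr \<nu> * E1 z)"
    using z(2) by (simp add: bessel_E1_def powr_add)
  finally have J: "\<bar>bessel_J (\<nu> + 1) z\<bar> = (z / 2) powr \<nu> * \<bar>E1 z\<bar>" by (simp add: abs_mult)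
  have J': "bessel_J \<nu> (z * x) = (z / 2) powr \<nu> * x powr \<nu> * E (z * x)"
    using bessel_J_eq[OF nu, of "z * x"] z(2) x powr_mult[of "z / 2" x \<nu>] by (simp add: mult_ac)
  have "(z / 2) powr \<nu> \<noteq> 0" "x powr \<nu> \<noteq> 0" using z(2) x by auto
  then show ?thesis
    unfolding bessel_phi_def z_def[symmetric] J J' u_def nrm_def
    using E1_zero_nonzero[of z] z by (simp add: powr_minus field_simps)
qed

lemma bessel_varphi_eq: "1 \<le> n \<Longrightarrow> 0 < x \<Longrightarrow> bessel_varphi \<nu> n x = phi (lam n) x"
  by (simp add: bessel_varphi_def bessel_phi_eq phi_def)

lemma deriv_bessel_varphi:
  assumes "1 \<le> n" "0 < x" "x < 1"
  shows "deriv (bessel_varphi \<nu> n) x = phi1 (lam n) x"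
proof (rule DERIV_imp_deriv)
  have "(phi (lam n) has_real_derivative phi1 (lam n) x) (at x)" using assms by (intro DERIV_phi) auto
  then show "(bessel_varphi \<nu> n has_real_derivative phi1 (lam n) x) (at x)"
    by (rule has_field_derivative_transform_within_open[where S="{0<..}"]) (use assms in \<open>auto simp: bessel_varphi_eq\<close>)
qed

lemma measurable_restrict_01:
  assumes "continuous_on {0<..<1} (f::real \<Rightarrow> real)"
  shows "f \<in> borel_measurable (restrict_space lborel {0<..<1})"
  using borel_measurable_continuous_on_restrict[OF assms]
  by (simp cong: measurable_cong_sets add: sets_restrict_space)

lemma measurable_dens: "dens \<in> borel_measurable (restrict_space lborel {0<..<1})"
  by (intro measurable_restrict_01 continuous_on_subset[OF continuous_dens]) auto

lemma bessel_measure_eq: "M = density (restrict_space lborel {0<..<1}) (\<lambda>x. ennreal (dens x))"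
proof -
  let ?f = "\<lambda>x. x powr \<beta> * (bessel_phi \<nu> 1 x)\<^sup>2"
  have eq: "?f x = dens x" if "x \<in> space (restrict_space lborel {0<..<1})" for x
    using that by (auto simp: space_restrict_space bessel_phi_eq dens_def wt_pos_eq)
  have "?f \<in> borel_measurable (restrict_space lborel {0<..<1})"
    by (rule measurable_cong[OF eq, THEN iffD2, OF _ measurable_dens])
  then show ?thesis
    unfolding bessel_measure_def using measurable_dens eq by (intro density_cong) auto
qed

lemma space_M [simp]: "space M = {0<..<1}"
  by (simp add: bessel_measure_eq space_restrict_space)

lemma sets_M: "sets M = sets (restrict_space lborel {0<..<1})"
  by (simp add: bessel_measure_eq)

lemma measurable_M: "f \<in> borel_measurable M \<longleftrightarrow> f \<in> borel_measurable (restrict_space lborel {0<..<1})"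
  by (simp cong: measurable_cong_sets add: sets_M)

lemma measurable_M_continuous: "continuous_on {0<..<1} (f::real \<Rightarrow> real) \<Longrightarrow> f \<in> borel_measurable M"
  unfolding measurable_M by (rule measurable_restrict_01)

lemma AE_M: "(AE x in lborel. 0 < x \<longrightarrow> x < 1 \<longrightarrow> P x) \<Longrightarrow> AE x in M. P x"
  unfolding bessel_measure_eq using measurable_dens
  by (auto simp: AE_density AE_restrict_space_iff elim: eventually_mono)

lemma finite_M: "finite_measure M"
proof
  obtain K where K: "\<forall>x\<in>{0..1}. \<bar>dens x\<bar> \<le> K"
    using compact_continuous_image[OF continuous_dens] compact_imp_bounded by (fastforce simp: bounded_iff)
  have "emeasure M (space M) = (\<integral>\<^sup>+x. ennreal (dens x) * indicator {0<..<1} x \<partial>restrict_space lborel {0<..<1})"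
    using measurable_dens by (subst bessel_measure_eq, subst emeasure_density) (auto simp: sets_restrict_space_iff)
  also have "\<dots> \<le> (\<integral>\<^sup>+(x::real). ennreal K \<partial>restrict_space lborel {0<..<1})"
    by (rule nn_integral_mono) (use K in \<open>force simp: space_restrict_space intro!: ennreal_leI\<close>)
  also have "\<dots> < \<infinity>" by (simp add: emeasure_restrict_space space_restrict_space ennreal_mult_less_top)
  finally show "emeasure M (space M) \<noteq> \<infinity>" by simp
qed

text \<open>The bridge from Lebesgue integrals over \<open>M\<close> to the Henstock-Kurzweil
  integrals on [0, 1], for which orthogonality and the pairing were computed.\<close>

lemma integral_M:
  assumes h: "continuous_on {0<..<1} h" and K: "\<And>x. 0 < x \<Longrightarrow> x < 1 \<Longrightarrow> \<bar>h x\<bar> \<le> K"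
  shows "integrable M h" "((\<lambda>x. dens x * h x) has_integral (LINT x|M. h x)) {0..1}"
proof -
  interpret finite_measure M by (rule finite_M)
  have [measurable]: "h \<in> borel_measurable M" by (rule measurable_M_continuous[OF h])
  show i: "integrable M h" using K by (intro integrable_const_bound[where B=K] AE_M) auto
  have hm: "h \<in> borel_measurable (restrict_space lborel {0<..<1})" using measurable_M_continuous[OF h] measurable_M by blast
  have "integrable (restrict_space lborel {0<..<1}) (\<lambda>x. dens x * h x)"
    using i integrable_density[OF hm measurable_dens] unfolding bessel_measure_eq by simp
  then have si: "set_integrable lborel {0<..<1} (\<lambda>x. dens x * h x)"
    by (simp add: integrable_restrict_space set_integrable_def)
  have "(LINT x|M. h x) = (LINT x|restrict_space lborel {0<..<1}. dens x * h x)"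
    unfolding bessel_measure_eq using integral_density[OF hm measurable_dens] by simp
  also have "\<dots> = (LINT x:{0<..<1}|lborel. dens x * h x)"
    by (simp add: integral_restrict_space set_lebesgue_integral_def)
  finally have e: "(LINT x|M. h x) = (LINT x:{0<..<1}|lborel. dens x * h x)" .
  have "((\<lambda>x. dens x * h x) has_integral (LINT x|M. h x)) {0<..<1}"
    unfolding e using set_borel_integral_eq_integral[OF si] by (simp add: integrable_integral)
  then show "((\<lambda>x. dens x * h x) has_integral (LINT x|M. h x)) {0..1}"
    using has_integral_Icc_iff_Ioo by blast
qed

lemma M_interval_le:
  assumes h: "continuous_on {0<..<1} h" and K: "\<And>x. 0 < x \<Longrightarrow> x < 1 \<Longrightarrow> 0 \<le> h x \<and> h x \<le> K"
    and pq: "0 < p" "p \<le> q" "q < 1"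
  shows "integral {p..q} (\<lambda>x. dens x * h x) \<le> (LINT x|M. h x)"
proof -
  have "((\<lambda>x. dens x * h x) has_integral (LINT x|M. h x)) {0..1}"
    using K by (intro integral_M(2)[OF h, of K]) auto
  then have i: "((\<lambda>x. dens x * h x) has_integral (LINT x|M. h x)) {0<..<1}"
    using has_integral_Icc_iff_Ioo by blast
  have "integral {p..q} (\<lambda>x. dens x * h x) \<le> integral {0<..<1} (\<lambda>x. dens x * h x)"
  proof (rule integral_subset_le)
    show "(\<lambda>x. dens x * h x) integrable_on {p..q}"
      using pq by (intro integrable_continuous_real continuous_intros continuous_on_subset[OF h]
        continuous_on_subset[OF continuous_dens]) auto
  qed (use pq i K in auto)
  then show ?thesis using i by (simp add: integral_unique)
qed

lemma phi_bounded:
  assumes "1 \<le> n"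
  obtains K where "0 \<le> K" "\<And>x. 0 < x \<Longrightarrow> x < 1 \<Longrightarrow> \<bar>phi (lam n) x\<bar> \<le> K" "\<And>x. 0 < x \<Longrightarrow> x < 1 \<Longrightarrow> \<bar>phi1 (lam n) x\<bar> \<le> K"
proof -
  obtain K where K: "0 \<le> K" "\<forall>x\<in>{0<..<1}. \<bar>phi (lam n) x\<bar> \<le> K \<and> \<bar>phi1 (lam n) x\<bar> \<le> K * x"
    using phi_family_bound[of "{n}"] assms by auto
  have "K * x \<le> K" if "x < 1" for x using K(1) mult_left_mono[of x 1 K] that by simp
  then show ?thesis using K that[of K] by force
qed

lemma continuous_phi_lam:
  "continuous_on {0<..<1} (phi (lam n))" "continuous_on {0<..<1} (phi1 (lam n))"
  by (intro continuous_on_subset[OF continuous_phi(1)] continuous_on_subset[OF continuous_phi(2)]; auto)+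

lemma phi_measurable [measurable]: "phi (lam n) \<in> borel_measurable M" "phi1 (lam n) \<in> borel_measurable M"
  by (intro measurable_M_continuous continuous_phi_lam)+

lemma integral_phi:
  assumes m: "1 \<le> m" and n: "1 \<le> n"
  shows "(LINT x|M. phi (lam m) x * phi (lam n) x) = (if m = n then 1 else 0)"
    "(LINT x|M. phi1 (lam m) x * phi1 (lam n) x) = (if m = n then mu (lam n) else 0)"
proof -
  obtain K where K: "0 \<le> K" "\<And>x. 0 < x \<Longrightarrow> x < 1 \<Longrightarrow> \<bar>phi (lam m) x\<bar> \<le> K" "\<And>x. 0 < x \<Longrightarrow> x < 1 \<Longrightarrow> \<bar>phi1 (lam m) x\<bar> \<le> K"
    using phi_bounded[OF m] by metis
  obtain L where L: "0 \<le> L" "\<And>x. 0 < x \<Longrightarrow> x < 1 \<Longrightarrow> \<bar>phi (lam n) x\<bar> \<le> L" "\<And>x. 0 < x \<Longrightarrow> x < 1 \<Longrightarrow> \<bar>phi1 (lam n) x\<bar> \<le> L"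
    using phi_bounded[OF n] by metis
  have b: "\<bar>phi (lam m) x * phi (lam n) x\<bar> \<le> K * L" "\<bar>phi1 (lam m) x * phi1 (lam n) x\<bar> \<le> K * L" if "0 < x" "x < 1" for x
    unfolding abs_mult using K L that by (auto intro!: mult_mono)
  have z: "lam m \<in> Z" "lam n \<in> Z" "lam m = lam n \<longleftrightarrow> m = n"
    using lam(1) m n lam_inj by (auto dest: inj_onD)
  have e: "wt x * (u (lam m) x * u (lam n) x) = dens x * (phi (lam m) x * phi (lam n) x)" if "0 \<le> x" "x < 1" for x
    using u_z1_nz[OF that] unfolding dens_def phi_def by (simp add: power2_eq_square)
  note cp = continuous_on_mult[OF continuous_phi_lam(1) continuous_phi_lam(1)]
     continuous_on_mult[OF continuous_phi_lam(2) continuous_phi_lam(2)]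
  have "((\<lambda>x. dens x * (phi (lam m) x * phi (lam n) x)) has_integral (LINT x|M. phi (lam m) x * phi (lam n) x)) {0..1}"
    by (rule integral_M(2)[OF cp(1) b(1)])
  then have "((\<lambda>x. wt x * (u (lam m) x * u (lam n) x)) has_integral (LINT x|M. phi (lam m) x * phi (lam n) x)) {0..1}"
    by (rule has_integral_spike_finite[of "{1}", rotated 2]) (use e in auto)
  then have "(LINT x|M. phi (lam m) x * phi (lam n) x) = ip (u (lam m)) (u (lam n))"
    by (simp add: ip_def integral_unique)
  then show "(LINT x|M. phi (lam m) x * phi (lam n) x) = (if m = n then 1 else 0)"
    using ip_u_delta[OF z(1,2)] z(3) by simp
  have "((\<lambda>x. dens x * (phi1 (lam m) x * phi1 (lam n) x)) has_integral (LINT x|M. phi1 (lam m) x * phi1 (lam n) x)) {0..1}"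
    by (rule integral_M(2)[OF cp(2) b(2)])
  from has_integral_unique[OF this phi1_orthogonal[OF z(1,2)]]
  show "(LINT x|M. phi1 (lam m) x * phi1 (lam n) x) = (if m = n then mu (lam n) else 0)"
    using z(3) by simp
qed

text \<open>Density passes from polynomials in x^2 to continuous functions times the weight by
  Stone-Weierstrass, then to all continuous functions, then to bounded measurable ones, and by
  truncation to L^r. \<sigma> may vanish at the endpoints; \<open>v\<close> is the denominator of
  the expansion.\<close>

lemma Lp_approx_weighted:
  fixes F :: "(real \<Rightarrow> real) set" and \<sigma> v :: "real \<Rightarrow> real"
  assumes r: "1 < r" and \<sigma>: "cont01 \<sigma>" "\<And>x. 0 \<le> x \<Longrightarrow> x \<le> 1 \<Longrightarrow> 0 \<le> \<sigma> x" "\<And>x. 0 < x \<Longrightarrow> x < 1 \<Longrightarrow> 0 < \<sigma> x"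
    and v: "cont01 v" "\<And>x. 0 < x \<Longrightarrow> x < 1 \<Longrightarrow> 0 < v x"
    and K: "\<And>x. 0 < x \<Longrightarrow> x < 1 \<Longrightarrow> \<sigma> x / v x \<le> K"
    and poly: "\<And>Q. real_polynomial_function Q \<Longrightarrow> Lp_approx r M F (\<lambda>x. \<sigma> x / v x * Q (x\<^sup>2))"
    and f: "(\<lambda>x. complex_of_real (f x)) \<in> Lp r M"
  shows "Lp_approx r M F f"
proof (rule Lp_approx_from_bounded[OF finite_M _ _ f])
  have r1: "1 \<le> r" using r by simp
  have c1: "continuous_on {0<..<1} \<sigma>" "continuous_on {0<..<1} v"
    using \<sigma> v by (auto intro: continuous_on_subset)
  have c2: "continuous_on {0<..<1} (\<lambda>x. \<sigma> x / v x)"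
    using v by (intro continuous_intros c1) fastforce
  have one: "Lp_approx r M F (\<lambda>x. \<sigma> x / v x * g x)" if g: "cont01 g" for g
  proof -
    \<comment> \<open>On [0, 1] every continuous function of x is a continuous function of
      x^2.\<close>
    have "continuous_on {0..1} (\<lambda>s. g (sqrt s))"
      by (rule continuous_on_compose2[OF g continuous_on_real_sqrt[OF continuous_on_id]]) auto
    then have "\<exists>Q. real_polynomial_function Q \<and> (\<forall>s\<in>{0..1}. \<bar>g (sqrt s) - Q s\<bar> < 1 / (real k + 1))" for k :: nat
      by (rule Stone_Weierstrass_real_polynomial_function[OF compact_Icc, of 0 1 "\<lambda>s. g (sqrt s)" "1 / (real k + 1)"]) (simp, blast)
    then have "\<forall>k::nat. \<exists>Q. real_polynomial_function Q \<and> (\<forall>s\<in>{0..1}. \<bar>g (sqrt s) - Q s\<bar> < 1 / (real k + 1))" by blast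
    then obtain Q where Q: "\<forall>k. real_polynomial_function (Q k) \<and> (\<forall>s\<in>{0..1}. \<bar>g (sqrt s) - Q k s\<bar> < 1 / (real k + 1))"
      by (rule choice[THEN exE])
    have Qb: "\<bar>g x - Q k (x\<^sup>2)\<bar> < 1 / (real k + 1)" if "0 < x" "x < 1" for x k
    proof -
      have "x\<^sup>2 \<in> {0..1}" using that by (simp add: power_le_one)
      moreover have "sqrt (x\<^sup>2) = x" using that by simp
      ultimately show ?thesis using Q by metis
    qed
    obtain G where G: "\<And>x. x \<in> {0..1} \<Longrightarrow> \<bar>g x\<bar> \<le> G"
      using compact_continuous_image[OF g] compact_imp_bounded by (fastforce simp: bounded_iff)
    have cQ: "continuous_on {0<..<1} (\<lambda>x. Q k (x\<^sup>2))" for k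
    proof -
      have "continuous_on UNIV (Q k)" using Q by (intro smooth_continuous smooth_real_polynomial) blast
      then show ?thesis by (rule continuous_on_compose2) (intro continuous_intros, simp)
    qed
    show ?thesis
    proof (rule Lp_approx_bounded_limit[OF finite_M r1, where s="\<lambda>k x. \<sigma> x / v x * Q k (x\<^sup>2)" and K="K * (G + 1)"])
      show "Lp_approx r M F (\<lambda>x. \<sigma> x / v x * Q k (x\<^sup>2))" for k using Q by (intro poly) blast
      show "(\<lambda>x. \<sigma> x / v x * g x) \<in> borel_measurable M"
        by (intro measurable_M_continuous continuous_on_mult[OF c2] continuous_on_subset[OF g]) auto
      show "(\<lambda>x. \<sigma> x / v x * Q k (x\<^sup>2)) \<in> borel_measurable M" for k
        by (intro measurable_M_continuous continuous_on_mult[OF c2] cQ)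
      show "AE x in M. \<bar>\<sigma> x / v x * Q k (x\<^sup>2)\<bar> \<le> K * (G + 1)" for k
      proof (intro AE_M AE_I2 impI)
        fix x :: real assume x: "0 < x" "x < 1"
        have "1 / (real k + 1) \<le> 1" by simp
        moreover have "\<bar>g x\<bar> \<le> G" using G x by simp
        ultimately have "\<bar>Q k (x\<^sup>2)\<bar> \<le> G + 1" using Qb[OF x, of k] by linarith
        then show "\<bar>\<sigma> x / v x * Q k (x\<^sup>2)\<bar> \<le> K * (G + 1)"
          unfolding abs_mult using K[OF x] \<sigma>(3)[OF x] v(2)[OF x]
          by (intro mult_mono) (auto intro: order_trans[of 0 "\<sigma> x / v x"])
      qed
      show "AE x in M. (\<lambda>k. \<sigma> x / v x * Q k (x\<^sup>2)) \<longlonglongrightarrow> \<sigma> x / v x * g x"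
      proof (intro AE_M AE_I2 impI tendsto_mult_left)
        fix x :: real assume x: "0 < x" "x < 1"
        have "(\<lambda>k. 1 / (real k + 1)) \<longlonglongrightarrow> 0"
          using LIMSEQ_inverse_real_of_nat by (simp add: inverse_eq_divide add.commute)
        then have "(\<lambda>k. Q k (x\<^sup>2) - g x) \<longlonglongrightarrow> 0"
          by (rule Lim_null_comparison[rotated]) (use Qb[OF x] in \<open>auto intro!: always_eventually simp: abs_minus_commute less_imp_le\<close>)
        then show "(\<lambda>k. Q k (x\<^sup>2)) \<longlonglongrightarrow> g x" by (simp add: LIM_zero_iff)
      qed
    qed
  qed
  have two: "Lp_approx r M F g" if g: "cont01 g" for g
  proof -
    obtain G where G: "\<And>x. x \<in> {0..1} \<Longrightarrow> \<bar>g x\<bar> \<le> G"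
      using compact_continuous_image[OF g] compact_imp_bounded by (fastforce simp: bounded_iff)
    show ?thesis
    \<comment> \<open>As \<sigma> may vanish at the endpoints, the division is by \<sigma> + 1 / (k
      + 1); the quotient of \<sigma> by this tends to 1 inside and is bounded by 1.\<close>
    proof (rule Lp_approx_bounded_limit[OF finite_M r1, where s="\<lambda>k x. \<sigma> x / v x * (v x * g x / (\<sigma> x + 1 / (real k + 1)))" and K=G])
      have c: "cont01 (\<lambda>x. v x * g x / (\<sigma> x + 1 / (real k + 1)))" for k
        using \<sigma>(2) by (intro continuous_intros v(1) g \<sigma>(1)) (fastforce simp: add_nonneg_eq_0_iff)
      show "Lp_approx r M F (\<lambda>x. \<sigma> x / v x * (v x * g x / (\<sigma> x + 1 / (real k + 1))))" for k
        by (rule one[OF c])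
      show "g \<in> borel_measurable M"
        by (intro measurable_M_continuous continuous_on_subset[OF g]) auto
      show "(\<lambda>x. \<sigma> x / v x * (v x * g x / (\<sigma> x + 1 / (real k + 1)))) \<in> borel_measurable M" for k
        by (intro measurable_M_continuous continuous_on_mult[OF c2] continuous_on_subset[OF c]) auto
      show "AE x in M. \<bar>\<sigma> x / v x * (v x * g x / (\<sigma> x + 1 / (real k + 1)))\<bar> \<le> G" for k
      proof (intro AE_M AE_I2 impI)
        fix x :: real assume x: "0 < x" "x < 1"
        have "\<sigma> x / v x * (v x * g x / (\<sigma> x + 1 / (real k + 1))) = (\<sigma> x / (\<sigma> x + 1 / (real k + 1))) * g x"
          using v(2)[OF x] by simp
        moreover have "\<bar>\<sigma> x / (\<sigma> x + 1 / (real k + 1))\<bar> \<le> 1"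
        proof -
          have "0 < b \<longrightarrow> \<bar>a / (a + b)\<bar> \<le> 1" if "0 < a" for a b :: real using that by (simp add: divide_le_eq)
          from this[OF \<sigma>(3)[OF x]] show ?thesis by (rule mp) simp
        qed
        ultimately show "\<bar>\<sigma> x / v x * (v x * g x / (\<sigma> x + 1 / (real k + 1)))\<bar> \<le> G"
          using mult_mono[OF _ G[of x], of "\<bar>\<sigma> x / (\<sigma> x + 1 / (real k + 1))\<bar>" 1] x by (simp only: abs_mult) auto
      qed
      show "AE x in M. (\<lambda>k. \<sigma> x / v x * (v x * g x / (\<sigma> x + 1 / (real k + 1)))) \<longlonglongrightarrow> g x"
      proof (intro AE_M AE_I2 impI)
        fix x :: real assume x: "0 < x" "x < 1"
        have "(\<lambda>k. 1 / (real k + 1)) \<longlonglongrightarrow> 0"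
          using LIMSEQ_inverse_real_of_nat by (simp add: inverse_eq_divide add.commute)
        then have "(\<lambda>k. \<sigma> x / v x * (v x * g x / (\<sigma> x + 1 / (real k + 1)))) \<longlonglongrightarrow> \<sigma> x / v x * (v x * g x / (\<sigma> x + 0))"
          using \<sigma>(3)[OF x] by (intro tendsto_intros) auto
        then show "(\<lambda>k. \<sigma> x / v x * (v x * g x / (\<sigma> x + 1 / (real k + 1)))) \<longlonglongrightarrow> g x"
          using \<sigma>(3)[OF x] v(2)[OF x] by simp
      qed
    qed
  qed
  fix g :: "real \<Rightarrow> real" and B assume g: "g \<in> borel_measurable M" and B: "\<And>x. \<bar>g x\<bar> \<le> B"
  have "(\<lambda>x. indicator {0<..<1} x *\<^sub>R g x) \<in> borel_measurable lborel"
    using g unfolding measurable_M by (subst (asm) borel_measurable_restrict_space_iff) auto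
  then have "(\<lambda>x. indicator {0<..<1} x *\<^sub>R g x) \<in> borel_measurable lebesgue"
    by (rule measurable_completion)
  \<comment> \<open>A measurable function is almost everywhere a limit of continuous functions,
    which are then cut off at height \<open>B\<close>.\<close>
  from lebesgue_measurable_imp_measurable_on_real[OF this, of UNIV]
  have "\<exists>N h. negligible N \<and> (\<forall>n::nat. continuous_on UNIV (h n)) \<and>
      (\<forall>x. x \<notin> N \<longrightarrow> (\<lambda>n. h n x) \<longlonglongrightarrow> indicator {0<..<1} x *\<^sub>R g x)"
    by (simp add: measurable_on_def)
  then obtain N h where N: "negligible N" and h: "\<forall>n::nat. continuous_on UNIV (h n)"
    and lim: "\<forall>x. x \<notin> N \<longrightarrow> (\<lambda>n. h n x) \<longlonglongrightarrow> indicator {0<..<1} x *\<^sub>R g x"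
    by (elim exE conjE)
  have "N \<in> null_sets lebesgue" using N by (simp add: negligible_iff_null_sets)
  then have "AE x in lebesgue. x \<notin> N" by (rule AE_not_in)
  then have "AE x in lborel. x \<notin> N" by (simp add: AE_completion_iff)
  then have limM: "AE x in M. (\<lambda>n. max (- B) (min B (h n x))) \<longlonglongrightarrow> g x"
  proof (intro AE_M, eventually_elim, intro impI)
    fix x :: real assume x: "x \<notin> N" "0 < x" "x < 1"
    have "(\<lambda>n. max (- B) (min B (h n x))) \<longlonglongrightarrow> max (- B) (min B (g x))"
      using lim[rule_format, OF x(1)] x by (intro tendsto_intros) simp
    then show "(\<lambda>n. max (- B) (min B (h n x))) \<longlonglongrightarrow> g x" using B[of x] by (simp add: max_def min_def abs_le_iff split: if_splits)
  qed
  have ch: "continuous_on S (\<lambda>x. max (- B) (min B (h n x)))" for S n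
    by (intro continuous_intros continuous_on_subset[OF h[rule_format]]) auto
  have B0: "0 \<le> B" using B[of 0] by simp
  show "Lp_approx r M F g"
    by (rule Lp_approx_bounded_limit[OF finite_M r1 two[OF ch] g measurable_M_continuous[OF ch] _ limM, of B]) (use B0 in auto)
qed (use r in simp)

lemma Lp_approx_uniform:
  assumes r: "1 < r" and f [measurable]: "f \<in> borel_measurable M" and K: "\<And>x. 0 < x \<Longrightarrow> x < 1 \<Longrightarrow> \<bar>f x\<bar> \<le> K"
    and a: "\<And>e. 0 < e \<Longrightarrow> \<exists>s\<in>F. s \<in> borel_measurable M \<and> (\<forall>x\<in>{0<..<1}. \<bar>f x - s x\<bar> \<le> e)"
  shows "Lp_approx r M F f"
proof -
  interpret finite_measure M by (rule finite_M)
  have "\<forall>k. \<exists>s. s \<in> F \<and> s \<in> borel_measurable M \<and> (\<forall>x\<in>{0<..<1}. \<bar>f x - s x\<bar> \<le> 1 / (real k + 1))"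
    using a by (simp add: Bex_def)
  then obtain s where s: "\<forall>k. s k \<in> F \<and> s k \<in> borel_measurable M \<and> (\<forall>x\<in>{0<..<1}. \<bar>f x - s k x\<bar> \<le> 1 / (real k + 1))"
    by (rule choice[THEN exE])
  then have [measurable]: "s k \<in> borel_measurable M" for k by blast
  have sb: "\<bar>s k x - f x\<bar> \<le> 1 / (real k + 1)" if "0 < x" "x < 1" for x k
    using s that by (simp add: abs_minus_commute)
  have "Lp_tendsto r M (\<lambda>k x. complex_of_real (s k x)) (\<lambda>x. complex_of_real (f x))"
  proof (rule Lp_dominated[where G="\<lambda>_. 1"])
    show "AE x in M. cmod (complex_of_real (s k x) - complex_of_real (f x)) \<le> 1" for k
    proof (intro AE_M AE_I2 impI)
      fix x :: real assume x: "0 < x" "x < 1"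
      have "1 / (real k + 1) \<le> 1" by simp
      then show "cmod (complex_of_real (s k x) - complex_of_real (f x)) \<le> 1"
        using sb[OF x, of k] unfolding of_real_diff[symmetric] norm_of_real by linarith
    qed
    show "AE x in M. (\<lambda>k. complex_of_real (s k x)) \<longlonglongrightarrow> complex_of_real (f x)"
    proof (intro AE_M AE_I2 impI tendsto_of_real)
      fix x :: real assume x: "0 < x" "x < 1"
      have "(\<lambda>k. 1 / (real k + 1)) \<longlonglongrightarrow> 0"
        using LIMSEQ_inverse_real_of_nat by (simp add: inverse_eq_divide add.commute)
      then have "(\<lambda>k. s k x - f x) \<longlonglongrightarrow> 0"
        by (rule Lim_null_comparison[rotated]) (intro always_eventually allI, use sb[OF x] in simp)
      then show "(\<lambda>k. s k x) \<longlonglongrightarrow> f x" by (simp add: LIM_zero_iff)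
    qed
    show "(\<lambda>x. complex_of_real (f x)) \<in> Lp r M"
      using r K by (intro Lp_bounded[OF finite_M, where K=K] AE_M) auto
  qed (use r in auto)
  with s show ?thesis unfolding Lp_approx_def by blast
qed

text \<open>The weight (1 - x^2)^(2 m) divided by \<open>u z1\<close> is bounded, because
  \<open>u z1\<close> vanishes only to first order at 1.\<close>

lemma Lp_approx_phi:
  assumes r: "1 < r" and f: "(\<lambda>x. complex_of_real (f x)) \<in> Lp r M"
  shows "Lp_approx r M {g. \<exists>N c. g = (\<lambda>x. \<Sum>n=1..N. c n * phi (lam n) x)} f"
proof -
  obtain m where m: "1 \<le> m" "2 * \<beta> + 3 \<le> 2 * real m" using smooth_exponent by blast
  obtain c where c: "0 < c" "\<And>x. x \<in> {0..1} \<Longrightarrow> c * (1 - x) \<le> u z1 x" using u_z1_lower by blast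
  have K: "(1 - x\<^sup>2) ^ (2 * m) / u z1 x \<le> 2 / c" if x: "0 < x" "x < 1" for x
  proof -
    have "(1 - x\<^sup>2) ^ (2 * m) \<le> (1 - x\<^sup>2) ^ 1" using x m by (intro power_decreasing) (auto simp: power_le_one)
    also have "\<dots> \<le> 2 * (1 - x)" using zero_le_power2[of "1 - x"] by (simp add: power2_eq_square algebra_simps)
    finally have "(1 - x\<^sup>2) ^ (2 * m) * c \<le> 2 * (c * (1 - x))" using c(1) by (simp add: mult.commute)
    also have "\<dots> \<le> 2 * u z1 x" using c(2)[of x] x by simp
    finally show ?thesis using c(1) u_z1_pos[of x] x by (simp add: divide_le_eq le_divide_eq mult.commute)
  qed
  have pos: "0 < (1 - x\<^sup>2) ^ (2 * m)" if "0 < x" "x < 1" for x :: real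
    using that by (intro zero_less_power) (simp add: power_less_one_iff)
  have c1: "continuous_on {0<..<1} (\<lambda>x. (1 - x\<^sup>2) ^ (2 * m) / u z1 x)"
    using u_z1_nz by (intro continuous_intros continuous_on_subset[OF continuous_u(1)]) auto
  show ?thesis
  proof (rule Lp_approx_weighted[OF r _ _ pos continuous_u(1) u_z1_pos K _ f])
    fix Q :: "real \<Rightarrow> real" assume Q: "real_polynomial_function Q"
    have Qs: "smooth Q" by (rule smooth_real_polynomial[OF Q])
    have "continuous_on {0..1} (\<lambda>x. Q (x\<^sup>2))"
      by (rule continuous_on_compose2[OF smooth_continuous[OF Qs, of UNIV]]) (intro continuous_intros, simp)
    note cQ = this
    obtain B where B: "\<And>x. x \<in> {0..1} \<Longrightarrow> \<bar>Q (x\<^sup>2)\<bar> \<le> B"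
      using compact_continuous_image[OF cQ] compact_imp_bounded by (fastforce simp: bounded_iff)
    show "Lp_approx r M {g. \<exists>N c. g = (\<lambda>x. \<Sum>n=1..N. c n * phi (lam n) x)} (\<lambda>x. (1 - x\<^sup>2) ^ (2 * m) / u z1 x * Q (x\<^sup>2))"
    proof (rule Lp_approx_uniform[OF r, where K="2 / c * B"])
      show "(\<lambda>x. (1 - x\<^sup>2) ^ (2 * m) / u z1 x * Q (x\<^sup>2)) \<in> borel_measurable M"
        by (intro measurable_M_continuous continuous_on_mult[OF c1] continuous_on_subset[OF cQ]) auto
      show "\<bar>(1 - x\<^sup>2) ^ (2 * m) / u z1 x * Q (x\<^sup>2)\<bar> \<le> 2 / c * B" if x: "0 < x" "x < 1" for x
        unfolding abs_mult
      proof (rule mult_mono)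
        show "\<bar>(1 - x\<^sup>2) ^ (2 * m) / u z1 x\<bar> \<le> 2 / c" using K[OF x] pos[OF x] u_z1_pos[of x] x by (simp add: abs_divide)
      qed (use B[of x] x c in auto)
      fix e :: real assume "0 < e"
      from phi_expansion[OF Qs m this] obtain N d where
        "\<forall>x\<in>{0<..<1}. \<bar>(1-x\<^sup>2)^(2*m)*Q (x\<^sup>2) / u z1 x - (\<Sum>n=1..N. d n * phi (lam n) x)\<bar> \<le> e" by (elim exE)
      then show "\<exists>s\<in>{g. \<exists>N c. g = (\<lambda>x. \<Sum>n=1..N. c n * phi (lam n) x)}. s \<in> borel_measurable M \<and>
          (\<forall>x\<in>{0<..<1}. \<bar>(1 - x\<^sup>2) ^ (2 * m) / u z1 x * Q (x\<^sup>2) - s x\<bar> \<le> e)"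
        by (intro bexI[of _ "\<lambda>x. \<Sum>n=1..N. d n * phi (lam n) x"]) auto
    qed
  qed (auto intro!: continuous_intros simp: power_le_one)
qed

lemma Lp_approx_phi1:
  assumes r: "1 < r" and f: "(\<lambda>x. complex_of_real (f x)) \<in> Lp r M"
  shows "Lp_approx r M {g. \<exists>N c. g = (\<lambda>x. \<Sum>n=2..N. c n * phi1 (lam n) x)} f"
proof -
  obtain m where m: "1 \<le> m" "2 * \<beta> + 3 \<le> 2 * real m" using smooth_exponent by blast
  have pos: "0 < x * (1 - x\<^sup>2) ^ Suc (2 * m)" if "0 < x" "x < 1" for x :: real
    using that by (intro mult_pos_pos zero_less_power) (simp_all add: power_less_one_iff)
  have K: "x * (1 - x\<^sup>2) ^ Suc (2 * m) \<le> 1" if x: "0 < x" "x < 1" for x :: real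
  proof -
    have "(1 - x\<^sup>2) ^ Suc (2 * m) \<le> 1" using x by (intro power_le_one) (auto simp: power_le_one)
    then show ?thesis using x by (intro mult_le_one) (auto simp: power_le_one)
  qed
  have c1: "continuous_on S (\<lambda>x::real. x * (1 - x\<^sup>2) ^ Suc (2 * m))" for S by (intro continuous_intros)
  show ?thesis
  proof (rule Lp_approx_weighted[OF r c1 _ pos, where v="\<lambda>_. 1" and K=1, OF _ _ _ _ _ _ _ f])
    fix Q :: "real \<Rightarrow> real" assume Q: "real_polynomial_function Q"
    have Qs: "smooth Q" by (rule smooth_real_polynomial[OF Q])
    have "continuous_on {0..1} (\<lambda>x. Q (x\<^sup>2))"
      by (rule continuous_on_compose2[OF smooth_continuous[OF Qs, of UNIV]]) (intro continuous_intros, simp)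
    note cQ = this
    obtain B where B: "\<And>x. x \<in> {0..1} \<Longrightarrow> \<bar>Q (x\<^sup>2)\<bar> \<le> B"
      using compact_continuous_image[OF cQ] compact_imp_bounded by (fastforce simp: bounded_iff)
    show "Lp_approx r M {g. \<exists>N c. g = (\<lambda>x. \<Sum>n=2..N. c n * phi1 (lam n) x)} (\<lambda>x. x * (1 - x\<^sup>2) ^ Suc (2 * m) / 1 * Q (x\<^sup>2))"
    proof (rule Lp_approx_uniform[OF r, where K="1 * B"])
      show "(\<lambda>x. x * (1 - x\<^sup>2) ^ Suc (2 * m) / 1 * Q (x\<^sup>2)) \<in> borel_measurable M"
        unfolding div_by_1 by (intro measurable_M_continuous continuous_on_mult[OF c1] continuous_on_subset[OF cQ]) auto
      show "\<bar>x * (1 - x\<^sup>2) ^ Suc (2 * m) / 1 * Q (x\<^sup>2)\<bar> \<le> 1 * B" if x: "0 < x" "x < 1" for x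
        unfolding div_by_1 abs_mult[of "x * (1 - x\<^sup>2) ^ Suc (2 * m)"]
        using K[OF x] pos[OF x] B[of x] x by (intro mult_mono) simp_all
      fix e :: real assume "0 < e"
      from phi1_expansion[OF Qs m this] obtain N d where
        "\<forall>x\<in>{0<..<1}. \<bar>x*((1-x\<^sup>2)^Suc (2*m)*Q (x\<^sup>2)) - (\<Sum>n=2..N. d n * phi1 (lam n) x)\<bar> \<le> e" by (elim exE)
      then show "\<exists>s\<in>{g. \<exists>N c. g = (\<lambda>x. \<Sum>n=2..N. c n * phi1 (lam n) x)}. s \<in> borel_measurable M \<and>
          (\<forall>x\<in>{0<..<1}. \<bar>x * (1 - x\<^sup>2) ^ Suc (2 * m) / 1 * Q (x\<^sup>2) - s x\<bar> \<le> e)"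
        unfolding div_by_1 mult.assoc
        by (intro bexI[of _ "\<lambda>x. \<Sum>n=2..N. d n * phi1 (lam n) x"]) auto
    qed
  qed (use K in \<open>auto intro!: mult_nonneg_nonneg zero_le_power simp: power_le_one simp del: power_Suc\<close>)
qed

end

subsection \<open>The bilinear estimate in terms of norms\<close>

context bessel_order
begin

definition phi_sum :: "(nat \<Rightarrow> real) \<Rightarrow> nat \<Rightarrow> real \<Rightarrow> real" where
  "phi_sum c N x = (\<Sum>n=1..N. c n * phi (lam n) x)"

definition phi1_sum :: "(nat \<Rightarrow> real) \<Rightarrow> nat \<Rightarrow> real \<Rightarrow> real" where
  "phi1_sum d N x = (\<Sum>n=2..N. d n * phi1 (lam n) x)"

lemma continuous_phi_sum:
  "continuous_on {0<..<1} (phi_sum c N)" "continuous_on {0<..<1} (phi1_sum c N)"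
  unfolding phi_sum_def[abs_def] phi1_sum_def[abs_def] by (intro continuous_intros continuous_phi_lam)+

lemma phi_sum_measurable [measurable]:
  "phi_sum c N \<in> borel_measurable M" "phi1_sum c N \<in> borel_measurable M"
  by (intro measurable_M_continuous continuous_phi_sum)+

lemma phi_sum_bounded:
  obtains K where "0 \<le> K" "\<And>x. 0 < x \<Longrightarrow> x < 1 \<Longrightarrow> \<bar>phi_sum c N x\<bar> \<le> K" "\<And>x. 0 < x \<Longrightarrow> x < 1 \<Longrightarrow> \<bar>phi1_sum c N x\<bar> \<le> K"
proof -
  obtain K where K: "0 \<le> K" "\<forall>n\<in>{1..N}. \<forall>x\<in>{0<..<1}. \<bar>phi (lam n) x\<bar> \<le> K \<and> \<bar>phi1 (lam n) x\<bar> \<le> K * x"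
    using phi_family_bound[of "{1..N}"] by auto
  have K1: "K * x \<le> K" if "x < 1" for x using K(1) mult_left_mono[of x 1 K] that by simp
  have p: "\<bar>phi (lam n) x\<bar> \<le> K" "\<bar>phi1 (lam n) x\<bar> \<le> K" if "n \<in> {1..N}" "0 < x" "x < 1" for n x
    using K(2) that K1[of x] by force+
  have "\<bar>phi_sum c N x\<bar> \<le> (\<Sum>n=1..N. \<bar>c n\<bar> * K)" if "0 < x" "x < 1" for x
    unfolding phi_sum_def using p that
    by (intro order_trans[OF sum_abs] sum_mono) (auto simp: abs_mult intro!: mult_left_mono)
  moreover have "\<bar>phi1_sum c N x\<bar> \<le> (\<Sum>n=1..N. \<bar>c n\<bar> * K)" if x: "0 < x" "x < 1" for x
  proof -
    have "\<bar>phi1_sum c N x\<bar> \<le> (\<Sum>n=2..N. \<bar>c n\<bar> * K)"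
      unfolding phi1_sum_def using p x
      by (intro order_trans[OF sum_abs] sum_mono) (auto simp: abs_mult intro!: mult_left_mono)
    also have "\<dots> \<le> (\<Sum>n=1..N. \<bar>c n\<bar> * K)" using K by (intro sum_mono2) auto
    finally show ?thesis .
  qed
  ultimately show ?thesis using K(1) that[of "\<Sum>n=1..N. \<bar>c n\<bar> * K"] by (simp add: sum_nonneg)
qed

lemma phi_sum_Lp:
  assumes "0 < r"
  shows "(\<lambda>x. complex_of_real (phi_sum c N x)) \<in> Lp r M" "(\<lambda>x. complex_of_real (phi1_sum c N x)) \<in> Lp r M"
proof -
  obtain K where K: "\<And>x. 0 < x \<Longrightarrow> x < 1 \<Longrightarrow> \<bar>phi_sum c N x\<bar> \<le> K" "\<And>x. 0 < x \<Longrightarrow> x < 1 \<Longrightarrow> \<bar>phi1_sum c N x\<bar> \<le> K"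
    using phi_sum_bounded by metis
  show "(\<lambda>x. complex_of_real (phi_sum c N x)) \<in> Lp r M" "(\<lambda>x. complex_of_real (phi1_sum c N x)) \<in> Lp r M"
    using K by (intro Lp_bounded[OF finite_M _ _ assms, where K=K] AE_M; auto)+
qed

text \<open>Taking \<open>e = 1 / (k + 1)\<close> removes the regularisation in the limit by
  dominated convergence.\<close>

lemma regularised_powr:
  fixes h :: "real \<Rightarrow> real"
  assumes h: "continuous_on {0<..<1} h" and K: "\<forall>x\<in>{0<..<1}. \<bar>h x\<bar> \<le> K" and s: "0 < s"
  shows "0 < e \<Longrightarrow> continuous_on {0<..<1} (\<lambda>x. ((h x)\<^sup>2 + e) powr (s / 2))"
    "0 < e \<Longrightarrow> 0 < x \<Longrightarrow> x < 1 \<Longrightarrow> ((h x)\<^sup>2 + e) powr (s / 2) \<le> (K\<^sup>2 + e) powr (s / 2)"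
    "(\<lambda>k. LINT x|M. ((h x)\<^sup>2 + 1 / (real k + 1)) powr (s / 2)) \<longlonglongrightarrow> (LINT x|M. \<bar>h x\<bar> powr s)"
proof -
  interpret finite_measure M by (rule finite_M)
  have pos: "0 < y\<^sup>2 + e" if "0 < e" for y e :: real using that by (simp add: add_nonneg_pos)
  show c: "continuous_on {0<..<1} (\<lambda>x. ((h x)\<^sup>2 + e) powr (s / 2))" if "0 < e" for e
    using less_imp_neq[OF pos[OF that], symmetric] by (intro continuous_on_powr continuous_intros h) auto
  have sq: "(h x)\<^sup>2 \<le> K\<^sup>2" if "0 < x" "x < 1" for x
    using power_mono[OF K[rule_format], of x 2] that by simp
  show b: "((h x)\<^sup>2 + e) powr (s / 2) \<le> (K\<^sup>2 + e) powr (s / 2)" if "0 < e" "0 < x" "x < 1" for e x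
    using that s sq pos[OF that(1), of "h x"] by (intro powr_mono2) (auto intro: less_imp_le)
  have [measurable]: "(\<lambda>x. ((h x)\<^sup>2 + 1 / (real k + 1)) powr (s / 2)) \<in> borel_measurable M" for k
    by (intro measurable_M_continuous c) simp
  have [measurable]: "h \<in> borel_measurable M" by (rule measurable_M_continuous[OF h])
  show "(\<lambda>k. LINT x|M. ((h x)\<^sup>2 + 1 / (real k + 1)) powr (s / 2)) \<longlonglongrightarrow> (LINT x|M. \<bar>h x\<bar> powr s)"
  proof (rule integral_dominated_convergence[where w="\<lambda>_. (K\<^sup>2 + 1) powr (s / 2)"])
    show "AE x in M. norm (((h x)\<^sup>2 + 1 / (real k + 1)) powr (s / 2)) \<le> (K\<^sup>2 + 1) powr (s / 2)" for k
    proof (intro AE_M AE_I2 impI)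
      fix x :: real assume x: "0 < x" "x < 1"
      have k: "1 / (real k + 1) \<le> 1" "0 < 1 / (real k + 1)" by simp_all
      have "((h x)\<^sup>2 + 1 / (real k + 1)) powr (s / 2) \<le> (K\<^sup>2 + 1 / (real k + 1)) powr (s / 2)"
        by (rule b[OF k(2) x])
      also have "\<dots> \<le> (K\<^sup>2 + 1) powr (s / 2)" using k(1) s by (intro powr_mono2) auto
      finally show "norm (((h x)\<^sup>2 + 1 / (real k + 1)) powr (s / 2)) \<le> (K\<^sup>2 + 1) powr (s / 2)" by simp
    qed
    show "AE x in M. (\<lambda>k. ((h x)\<^sup>2 + 1 / (real k + 1)) powr (s / 2)) \<longlonglongrightarrow> \<bar>h x\<bar> powr s"
    proof (intro AE_I2)
      fix x
      have "(\<lambda>k. 1 / (real k + 1)) \<longlonglongrightarrow> 0"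
        using LIMSEQ_inverse_real_of_nat by (simp add: inverse_eq_divide add.commute)
      then have "(\<lambda>k. (h x)\<^sup>2 + 1 / (real k + 1)) \<longlonglongrightarrow> (h x)\<^sup>2 + 0" by (intro tendsto_intros)
      then have "(\<lambda>k. ((h x)\<^sup>2 + 1 / (real k + 1)) powr (s / 2)) \<longlonglongrightarrow> ((h x)\<^sup>2 + 0) powr (s / 2)"
        using s by (intro tendsto_powr2 tendsto_const) (auto intro!: always_eventually)
      moreover have "\<bar>h x\<bar> powr 2 = (h x)\<^sup>2" by (cases "h x = 0") simp_all
      then have "((h x)\<^sup>2 + 0) powr (s / 2) = \<bar>h x\<bar> powr s"
        using powr_powr[of "\<bar>h x\<bar>" 2 "s / 2"] by simp
      ultimately show "(\<lambda>k. ((h x)\<^sup>2 + 1 / (real k + 1)) powr (s / 2)) \<longlonglongrightarrow> \<bar>h x\<bar> powr s" by simp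
    qed
  qed auto
qed

text \<open>\<open>bell_le\<close> with \<open>a = p - 1\<close>, where its constant 10 a + 2 is 10
  p - 8.\<close>

lemma bell_integral_le:
  assumes f: "continuous_on {0<..<1} f" "\<forall>x\<in>{0<..<1}. \<bar>f x\<bar> \<le> K"
    and g: "continuous_on {0<..<1} g" "\<forall>x\<in>{0<..<1}. \<bar>g x\<bar> \<le> L"
    and e: "0 < e" and p: "2 \<le> p" and q: "q = p / (p - 1)" and ab: "0 < a" "a \<le> b" "b < 1"
  shows "integral {a..b} (\<lambda>x. dens x * bell (p - 1) e (f x) (g x)) \<le>
    (10 * p - 8) * (LINT x|M. ((g x)\<^sup>2 + e) powr (q / 2)) + 2 * (LINT x|M. ((f x)\<^sup>2 + e) powr (p / 2))"
proof -
  have q0: "0 < q" using p q by simp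
  have ex: "(p - 1 + 1) / (2 * (p - 1)) = q / 2" "(p - 1 + 1) / 2 = p / 2" "10 * (p - 1) + 2 = 10 * p - 8"
    using p q by (simp_all add: field_simps)
  note rf = regularised_powr[OF f, of p] and rg = regularised_powr[OF g q0]
  define h where "h x = (10 * p - 8) * ((g x)\<^sup>2 + e) powr (q / 2) + 2 * ((f x)\<^sup>2 + e) powr (p / 2)" for x
  have hc: "continuous_on {0<..<1} h"
    unfolding h_def[abs_def] using p e by (intro continuous_intros rf rg) auto
  have p0: "0 < p" using p by simp
  have "integrable M (\<lambda>x. ((g x)\<^sup>2 + e) powr (q / 2))"
    by (rule integral_M(1)[OF rg(1)[OF e], of "(L\<^sup>2 + e) powr (q / 2)"]) (use rg(2)[OF e] in simp)
  moreover have "integrable M (\<lambda>x. ((f x)\<^sup>2 + e) powr (p / 2))"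
    by (rule integral_M(1)[OF rf(1)[OF p0 e], of "(K\<^sup>2 + e) powr (p / 2)"]) (use rf(2)[OF p0 e] in simp)
  ultimately have i: "integrable M (\<lambda>x. ((g x)\<^sup>2 + e) powr (q / 2))" "integrable M (\<lambda>x. ((f x)\<^sup>2 + e) powr (p / 2))" .
  have "integral {a..b} (\<lambda>x. dens x * bell (p - 1) e (f x) (g x)) \<le> integral {a..b} (\<lambda>x. dens x * h x)"
  proof (rule integral_le)
    have sub: "{a..b} \<subseteq> {0<..<1}" "{a..b} \<subseteq> {0..1}" using ab by auto
    show "(\<lambda>x. dens x * bell (p - 1) e (f x) (g x)) integrable_on {a..b}" "(\<lambda>x. dens x * h x) integrable_on {a..b}"
      using e sub by (intro integrable_continuous_real continuous_on_mult continuous_on_bell(1) continuous_on_subset[OF continuous_dens]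
        continuous_on_subset[OF hc] continuous_on_subset[OF f(1)] continuous_on_subset[OF g(1)]; simp)+
    show "dens x * bell (p - 1) e (f x) (g x) \<le> dens x * h x" for x
      using bell_le[OF e, of "p - 1" "f x" "g x"] p unfolding ex h_def by (intro mult_left_mono) auto
  qed
  also have "\<dots> \<le> (LINT x|M. h x)"
  proof (rule M_interval_le[OF hc _ ab])
    show "0 \<le> h x \<and> h x \<le> (10 * p - 8) * (L\<^sup>2 + e) powr (q / 2) + 2 * (K\<^sup>2 + e) powr (p / 2)" if "0 < x" "x < 1" for x
      unfolding h_def using p rf(2)[OF _ e that] rg(2)[OF e that] by (auto intro!: add_mono mult_left_mono add_nonneg_nonneg)
  qed
  also have "(LINT x|M. h x) = (10 * p - 8) * (LINT x|M. ((g x)\<^sup>2 + e) powr (q / 2)) + 2 * (LINT x|M. ((f x)\<^sup>2 + e) powr (p / 2))"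
    unfolding h_def using i by (simp add: Bochner_Integration.integral_add)
  finally show ?thesis .
qed

text \<open>The function measured with the larger exponent has to be the first argument of
  \<open>bell\<close>; hence the cases.\<close>

lemma bilinear_unit:
  assumes a: "0 \<le> a" and p: "1 < p" and q: "q = p / (p - 1)"
    and f: "Lp_norm p M (\<lambda>x. complex_of_real (phi_sum c N x)) \<le> 1"
    and g: "Lp_norm q M (\<lambda>x. complex_of_real (phi1_sum d N x)) \<le> 1"
  shows "\<bar>\<Sum>n=2..N. c n * d n * mu (lam n) / sqrt (mu (lam n) + a)\<bar> \<le> 14 * (max p q - 1)"
proof -
  let ?S = "\<bar>\<Sum>n=2..N. c n * d n * mu (lam n) / sqrt (mu (lam n) + a)\<bar>"
  have "q - 1 = 1 / (p - 1)" using p q by (simp add: field_simps)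
  then have pq: "p = q / (q - 1)" "1 < q" using p q by (simp, simp add: less_divide_eq)
  obtain K where K: "\<forall>x\<in>{0<..<1}. \<bar>phi_sum c N x\<bar> \<le> K" using phi_sum_bounded[of c N] by (metis greaterThanLessThan_iff)
  obtain L where L: "\<forall>x\<in>{0<..<1}. \<bar>phi1_sum d N x\<bar> \<le> L" using phi_sum_bounded[of d N] by (metis greaterThanLessThan_iff)
  note cf = continuous_phi_sum(1)[of c N] and cg = continuous_phi_sum(2)[of d N]
  have If: "(LINT x|M. \<bar>phi_sum c N x\<bar> powr p) \<le> 1"
    using Lp_norm_powr[of p M "\<lambda>x. complex_of_real (phi_sum c N x)"] powr_mono2[OF _ _ f, of p] p by simp
  have Ig: "(LINT x|M. \<bar>phi1_sum d N x\<bar> powr q) \<le> 1"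
    using Lp_norm_powr[of q M "\<lambda>x. complex_of_real (phi1_sum d N x)"] powr_mono2[OF _ _ g, of q] pq(2) by simp
  have lf: "(\<lambda>k. LINT x|M. ((phi_sum c N x)\<^sup>2 + 1 / (real k + 1)) powr (p / 2)) \<longlonglongrightarrow> (LINT x|M. \<bar>phi_sum c N x\<bar> powr p)"
    using p by (intro regularised_powr(3)[OF cf K]) auto
  have lg: "(\<lambda>k. LINT x|M. ((phi1_sum d N x)\<^sup>2 + 1 / (real k + 1)) powr (q / 2)) \<longlonglongrightarrow> (LINT x|M. \<bar>phi1_sum d N x\<bar> powr q)"
    using pq by (intro regularised_powr(3)[OF cg L]) auto
  show ?thesis
  proof (cases "2 \<le> p")
    case True
    then have qp: "q \<le> p" using divide_left_mono[of 1 "p - 1" p] q by simp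
    let ?X = "\<lambda>k. (10 * p - 8) * (LINT x|M. ((phi1_sum d N x)\<^sup>2 + 1 / (real k + 1)) powr (q / 2)) +
        2 * (LINT x|M. ((phi_sum c N x)\<^sup>2 + 1 / (real k + 1)) powr (p / 2))"
    have "?S \<le> ?X k" for k
      by (rule bilinear_estimate[OF a, of "1 / (real k + 1)" "p - 1"], simp, use True in simp, rule disjI1,
        unfold phi_sum_def[symmetric] phi1_sum_def[symmetric], intro allI impI, elim conjE,
        rule bell_integral_le[OF cf K cg L _ True q]) simp_all
    moreover have "?X \<longlonglongrightarrow> (10 * p - 8) * (LINT x|M. \<bar>phi1_sum d N x\<bar> powr q) + 2 * (LINT x|M. \<bar>phi_sum c N x\<bar> powr p)"
      by (intro tendsto_intros lf lg)
    ultimately have "?S \<le> (10 * p - 8) * (LINT x|M. \<bar>phi1_sum d N x\<bar> powr q) + 2 * (LINT x|M. \<bar>phi_sum c N x\<bar> powr p)"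
      by (intro tendsto_lowerbound[where F=sequentially]) (auto intro!: always_eventually)
    also have "\<dots> \<le> (10 * p - 8) * 1 + 2 * 1" using If Ig True by (intro add_mono mult_left_mono) auto
    also have "\<dots> \<le> 14 * (max p q - 1)" using True qp by simp
    finally show ?thesis .
  next
    case False
    then have q2: "2 \<le> q" using p q by (simp add: le_divide_eq)
    then have qp: "p \<le> q" using False by simp
    let ?X = "\<lambda>k. (10 * q - 8) * (LINT x|M. ((phi_sum c N x)\<^sup>2 + 1 / (real k + 1)) powr (p / 2)) +
        2 * (LINT x|M. ((phi1_sum d N x)\<^sup>2 + 1 / (real k + 1)) powr (q / 2))"
    have "?S \<le> ?X k" for k
      by (rule bilinear_estimate[OF a, of "1 / (real k + 1)" "q - 1"], simp, use q2 in simp, rule disjI2,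
        unfold phi_sum_def[symmetric] phi1_sum_def[symmetric], intro allI impI, elim conjE,
        rule bell_integral_le[OF cg L cf K _ q2 pq(1)]) simp_all
    moreover have "?X \<longlonglongrightarrow> (10 * q - 8) * (LINT x|M. \<bar>phi_sum c N x\<bar> powr p) + 2 * (LINT x|M. \<bar>phi1_sum d N x\<bar> powr q)"
      by (intro tendsto_intros lf lg)
    ultimately have "?S \<le> (10 * q - 8) * (LINT x|M. \<bar>phi_sum c N x\<bar> powr p) + 2 * (LINT x|M. \<bar>phi1_sum d N x\<bar> powr q)"
      by (intro tendsto_lowerbound[where F=sequentially]) (auto intro!: always_eventually)
    also have "\<dots> \<le> (10 * q - 8) * 1 + 2 * 1" using If Ig q2 by (intro add_mono mult_left_mono) auto
    also have "\<dots> \<le> 14 * (max p q - 1)" using q2 qp by simp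
    finally show ?thesis .
  qed
qed

text \<open>Homogeneity reduces this to the unit case; the norms are enlarged by 1 / (k + 1) so that
  division is possible when one of them is 0.\<close>

lemma bilinear_norms:
  assumes a: "0 \<le> a" and p: "1 < p" and q: "q = p / (p - 1)"
  shows "\<bar>\<Sum>n=2..N. c n * d n * mu (lam n) / sqrt (mu (lam n) + a)\<bar> \<le> 14 * (max p q - 1) *
    (Lp_norm p M (\<lambda>x. complex_of_real (phi_sum c N x)) * Lp_norm q M (\<lambda>x. complex_of_real (phi1_sum d N x)))"
    (is "\<bar>?S c d\<bar> \<le> ?C * (?f * ?g)")
proof -
  have q0: "0 < q" and p0: "0 < p" using p q by simp_all
  have "\<bar>?S c d\<bar> \<le> ?C * ((?f + 1 / (real k + 1)) * (?g + 1 / (real k + 1)))" for k :: nat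
  proof -
    define s t where "s = ?f + 1 / (real k + 1)" and "t = ?g + 1 / (real k + 1)"
    have st: "0 < s" "0 < t" "?f \<le> s" "?g \<le> t" by (simp_all add: s_def t_def add_nonneg_pos)
    have "phi_sum (\<lambda>n. c n / s) N x = phi_sum c N x / s" "phi1_sum (\<lambda>n. d n / t) N x = phi1_sum d N x / t" for x
      by (simp_all add: phi_sum_def phi1_sum_def sum_divide_distrib)
    then have "Lp_norm p M (\<lambda>x. complex_of_real (phi_sum (\<lambda>n. c n / s) N x)) \<le> 1"
       "Lp_norm q M (\<lambda>x. complex_of_real (phi1_sum (\<lambda>n. d n / t) N x)) \<le> 1"
      using Lp_norm_cmult[OF p0, of M "complex_of_real (1 / s)"] Lp_norm_cmult[OF q0, of M "complex_of_real (1 / t)"] st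
      by (simp_all add: norm_divide divide_le_eq)
    from bilinear_unit[OF a p q this] have "\<bar>?S (\<lambda>n. c n / s) (\<lambda>n. d n / t)\<bar> \<le> ?C" .
    moreover have "?S (\<lambda>n. c n / s) (\<lambda>n. d n / t) = ?S c d / (s * t)"
      unfolding sum_divide_distrib by (intro sum.cong) auto
    ultimately show ?thesis unfolding s_def[symmetric] t_def[symmetric] using st
      by (simp add: abs_divide abs_mult divide_le_eq)
  qed
  moreover have "(\<lambda>k. ?C * ((?f + 1 / (real k + 1)) * (?g + 1 / (real k + 1)))) \<longlonglongrightarrow> ?C * ((?f + 0) * (?g + 0))"
    using LIMSEQ_inverse_real_of_nat by (intro tendsto_intros) (simp_all add: inverse_eq_divide add.commute)
  ultimately have "\<bar>?S c d\<bar> \<le> ?C * ((?f + 0) * (?g + 0))"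
    by (intro tendsto_lowerbound[where F=sequentially]) (auto intro!: always_eventually)
  then show ?thesis by simp
qed

end

subsection \<open>Duality\<close>

lemma Lp_norm_two: "Lp_norm 2 M f = sqrt (LINT x|M. (cmod (f x))\<^sup>2)"
  unfolding Lp_norm_def by (subst powr_half_sqrt[symmetric]) (simp_all add: integral_nonneg)

lemma Lp_norm_mono:
  assumes "g \<in> Lp p M" "f \<in> borel_measurable M" "\<And>x. cmod (f x) \<le> cmod (g x)" "0 < p"
  shows "f \<in> Lp p M" "Lp_norm p M f \<le> Lp_norm p M g"
proof -
  note [measurable] = assms(2)
  have le: "cmod (f x) powr p \<le> cmod (g x) powr p" for x using assms by (intro powr_mono2) auto
  show f: "f \<in> Lp p M"
    using le by (intro Lp_I Bochner_Integration.integrable_bound[OF Lp_integrable[OF assms(1)]] AE_I2) (auto intro: assms)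
  show "Lp_norm p M f \<le> Lp_norm p M g"
    unfolding Lp_norm_def using le f assms
    by (intro powr_mono2 integral_mono Lp_integrable) (auto simp: integral_nonneg)
qed

text \<open>The extremal function sgn(h) |h|^(p - 1) lies in L^q and is approximated from
  \<open>F\<close>. It gives I \<le> C I^(1/q) for the integral I of |h|^p, and division by I^(1/q)
  leaves the norm.\<close>

lemma Lp_norm_le_by_duality:
  fixes h :: "'a \<Rightarrow> real"
  assumes p: "1 < p" and q: "q = p / (p - 1)" and h: "(\<lambda>x. complex_of_real (h x)) \<in> Lp p M"
    and C0: "0 \<le> C" and F: "\<And>f. (\<lambda>x. complex_of_real (f x)) \<in> Lp q M \<Longrightarrow> Lp_approx q M F f"
    and C: "\<And>g. g \<in> F \<Longrightarrow> (LINT x|M. h x * g x) \<le> C * Lp_norm q M (\<lambda>x. complex_of_real (g x))"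
  shows "Lp_norm p M (\<lambda>x. complex_of_real (h x)) \<le> C"
proof -
  have q1: "1 < q" using p unfolding q by (simp add: less_divide_eq)
  have pq: "1 / p + 1 / q = 1" "q * (p - 1) = p"
    unfolding q using p by (simp_all add: add_divide_distrib[symmetric])
  define I where "I = (LINT x|M. \<bar>h x\<bar> powr p)"
  have I: "0 \<le> I" by (simp add: I_def integral_nonneg)
  have hc [measurable]: "(\<lambda>x. complex_of_real (h x)) \<in> borel_measurable M" using h by (rule Lp_measurable)
  have "(\<lambda>x. Re (complex_of_real (h x))) \<in> borel_measurable M" by measurable
  then have hm [measurable]: "h \<in> borel_measurable M" by simp
  define g where "g x = sgn (h x) * \<bar>h x\<bar> powr (p - 1)" for x
  have gm [measurable]: "g \<in> borel_measurable M" unfolding g_def[abs_def] by measurable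
  have gp: "\<bar>g x\<bar> powr q = \<bar>h x\<bar> powr p" for x
    using pq(2) by (cases "h x = 0") (simp_all add: g_def abs_mult powr_powr abs_sgn_eq mult.commute)
  have hg: "h x * g x = \<bar>h x\<bar> powr p" for x
  proof (cases "h x = 0")
    case False
    have "h x * g x = \<bar>h x\<bar> * \<bar>h x\<bar> powr (p - 1)" by (simp add: g_def abs_sgn mult_ac)
    also have "\<dots> = \<bar>h x\<bar> powr p" using False powr_add[of "\<bar>h x\<bar>" 1 "p - 1"] by simp
    finally show ?thesis .
  qed (use p in simp)
  have gL: "(\<lambda>x. complex_of_real (g x)) \<in> Lp q M"
    using Lp_integrable[OF h] by (intro Lp_I) (simp_all add: gp)
  obtain s where s: "\<forall>k::nat. s k \<in> F" "Lp_tendsto q M (\<lambda>k x. complex_of_real (s k x)) (\<lambda>x. complex_of_real (g x))"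
    using F[OF gL] unfolding Lp_approx_def by (elim exE conjE)
  have sL: "(\<lambda>x. complex_of_real (s k x)) \<in> Lp q M" for k using s(2) by (auto simp: Lp_tendsto_def)
  have int: "integrable M (\<lambda>x. h x * f x)" if "(\<lambda>x. complex_of_real (f x)) \<in> Lp q M" for f
  proof -
    have "integrable M (\<lambda>x. complex_of_real (h x) * complex_of_real (f x))" by (rule Lp_holder(1)[OF h that p q1 pq(1)])
    then show ?thesis unfolding of_real_mult[symmetric] complex_of_real_integrable_eq .
  qed
  have "(\<lambda>k. LINT x|M. h x * s k x) \<longlonglongrightarrow> (LINT x|M. h x * g x)"
  proof (rule LIM_zero_cancel, rule Lim_null_comparison)
    show "\<forall>\<^sub>F k in sequentially. norm ((LINT x|M. h x * s k x) - (LINT x|M. h x * g x)) \<le>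
       Lp_norm p M (\<lambda>x. complex_of_real (h x)) * Lp_norm q M (\<lambda>x. complex_of_real (s k x) - complex_of_real (g x))"
    proof (intro always_eventually allI)
      fix k
      have d: "(\<lambda>x. complex_of_real (s k x - g x)) \<in> Lp q M"
        using Lp_diff[OF sL[of k] gL] q1 by simp
      have "\<bar>(LINT x|M. h x * s k x) - (LINT x|M. h x * g x)\<bar> = \<bar>LINT x|M. h x * (s k x - g x)\<bar>"
        by (simp add: right_diff_distrib Bochner_Integration.integral_diff int sL gL)
      also have "\<dots> \<le> (LINT x|M. \<bar>h x * (s k x - g x)\<bar>)" by (rule integral_abs_bound)
      also have "\<dots> \<le> Lp_norm p M (\<lambda>x. complex_of_real (h x)) * Lp_norm q M (\<lambda>x. complex_of_real (s k x - g x))"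
        using Lp_holder(2)[OF h d p q1 pq(1)] by (simp add: abs_mult del: of_real_diff)
      finally show "norm ((LINT x|M. h x * s k x) - (LINT x|M. h x * g x)) \<le>
       Lp_norm p M (\<lambda>x. complex_of_real (h x)) * Lp_norm q M (\<lambda>x. complex_of_real (s k x) - complex_of_real (g x))" by simp
    qed
    show "(\<lambda>k. Lp_norm p M (\<lambda>x. complex_of_real (h x)) * Lp_norm q M (\<lambda>x. complex_of_real (s k x) - complex_of_real (g x))) \<longlonglongrightarrow> 0"
      using s(2) by (intro tendsto_mult_right_zero) (simp add: Lp_tendsto_def)
  qed
  moreover have "(\<lambda>k. C * Lp_norm q M (\<lambda>x. complex_of_real (s k x))) \<longlonglongrightarrow> C * Lp_norm q M (\<lambda>x. complex_of_real (g x))"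
    using q1 by (intro tendsto_mult_left Lp_tendsto_norm[OF s(2)]) simp
  ultimately have "(LINT x|M. h x * g x) \<le> C * Lp_norm q M (\<lambda>x. complex_of_real (g x))"
    by (rule LIMSEQ_le) (use C s(1) in blast)
  then have le: "I \<le> C * I powr (1 / q)" by (simp add: hg I_def Lp_norm_def gp)
  have n: "Lp_norm p M (\<lambda>x. complex_of_real (h x)) = I powr (1 / p)" by (simp add: Lp_norm_def I_def)
  show ?thesis
  proof (cases "I = 0")
    case True
    then show ?thesis using C0 n p by simp
  next
    case False
    then have I0: "0 < I" using I by simp
    have "I powr (1 / p) * I powr (1 / q) = I" using I0 by (simp flip: powr_add add: pq(1))
    then have "I powr (1 / p) * I powr (1 / q) \<le> C * I powr (1 / q)" using le by simp
    then show ?thesis unfolding n using I0 by simp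
  qed
qed

lemma integral_orthogonal_sum:
  fixes v :: "nat \<Rightarrow> 'a \<Rightarrow> real"
  assumes I: "finite I" and int: "\<And>m n. m \<in> I \<Longrightarrow> n \<in> I \<Longrightarrow> integrable M (\<lambda>x. v m x * v n x)"
    and orth: "\<And>m n. m \<in> I \<Longrightarrow> n \<in> I \<Longrightarrow> (LINT x|M. v m x * v n x) = (if m = n then k n else 0)"
  shows "integrable M (\<lambda>x. (\<Sum>n\<in>I. c n * v n x) * (\<Sum>n\<in>I. d n * v n x))"
    "(LINT x|M. (\<Sum>n\<in>I. c n * v n x) * (\<Sum>n\<in>I. d n * v n x)) = (\<Sum>n\<in>I. c n * d n * k n)"
proof -
  have int: "integrable M (\<lambda>x. (c m * d n) * (v m x * v n x))" if "m \<in> I" "n \<in> I" for m n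
    using int that by (intro integrable_mult_right)
  have e: "(\<Sum>n\<in>I. c n * v n x) * (\<Sum>n\<in>I. d n * v n x) = (\<Sum>m\<in>I. \<Sum>n\<in>I. (c m * d n) * (v m x * v n x))" for x
    by (simp add: sum_product mult_ac)
  show "integrable M (\<lambda>x. (\<Sum>n\<in>I. c n * v n x) * (\<Sum>n\<in>I. d n * v n x))"
    unfolding e by (intro Bochner_Integration.integrable_sum int)
  have "(LINT x|M. (\<Sum>m\<in>I. \<Sum>n\<in>I. (c m * d n) * (v m x * v n x))) = (\<Sum>m\<in>I. LINT x|M. (\<Sum>n\<in>I. (c m * d n) * (v m x * v n x)))"
    by (intro Bochner_Integration.integral_sum Bochner_Integration.integrable_sum int)
  also have "\<dots> = (\<Sum>m\<in>I. \<Sum>n\<in>I. LINT x|M. (c m * d n) * (v m x * v n x))"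
    by (intro sum.cong refl Bochner_Integration.integral_sum int)
  also have "\<dots> = (\<Sum>m\<in>I. \<Sum>n\<in>I. (c m * d n) * (LINT x|M. v m x * v n x))"
    by (simp only: integral_mult_right_zero)
  also have "\<dots> = (\<Sum>m\<in>I. \<Sum>n\<in>I. if n = m then c m * d m * k m else 0)"
    by (intro sum.cong) (auto simp: orth)
  also have "\<dots> = (\<Sum>n\<in>I. c n * d n * k n)" using I by (intro sum.cong) auto
  finally show "(LINT x|M. (\<Sum>n\<in>I. c n * v n x) * (\<Sum>n\<in>I. d n * v n x)) = (\<Sum>n\<in>I. c n * d n * k n)"
    unfolding e .
qed

lemma Lp_norm_orthogonal_sum:
  fixes v :: "nat \<Rightarrow> 'a \<Rightarrow> real"
  assumes "finite I" "\<And>m n. m \<in> I \<Longrightarrow> n \<in> I \<Longrightarrow> integrable M (\<lambda>x. v m x * v n x)"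
    "\<And>m n. m \<in> I \<Longrightarrow> n \<in> I \<Longrightarrow> (LINT x|M. v m x * v n x) = (if m = n then k n else 0)"
  shows "(Lp_norm 2 M (\<lambda>x. \<Sum>n\<in>I. z n * complex_of_real (v n x)))\<^sup>2 = (\<Sum>n\<in>I. (cmod (z n))\<^sup>2 * k n)"
proof -
  note r = integral_orthogonal_sum[OF assms, where c="\<lambda>n. Re (z n)" and d="\<lambda>n. Re (z n)"]
  note i = integral_orthogonal_sum[OF assms, where c="\<lambda>n. Im (z n)" and d="\<lambda>n. Im (z n)"]
  have "(cmod (\<Sum>n\<in>I. z n * complex_of_real (v n x)))\<^sup>2 =
      (\<Sum>n\<in>I. Re (z n) * v n x) * (\<Sum>n\<in>I. Re (z n) * v n x) + (\<Sum>n\<in>I. Im (z n) * v n x) * (\<Sum>n\<in>I. Im (z n) * v n x)" for x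
    unfolding cmod_power2 by (simp add: power2_eq_square)
  then have "(LINT x|M. (cmod (\<Sum>n\<in>I. z n * complex_of_real (v n x)))\<^sup>2) =
      (\<Sum>n\<in>I. Re (z n) * Re (z n) * k n) + (\<Sum>n\<in>I. Im (z n) * Im (z n) * k n)"
    using r i by (simp add: Bochner_Integration.integral_add)
  also have "\<dots> = (\<Sum>n\<in>I. (cmod (z n))\<^sup>2 * k n)"
    unfolding cmod_power2 sum.distrib[symmetric] by (simp add: power2_eq_square algebra_simps)
  finally have "(LINT x|M. (cmod (\<Sum>n\<in>I. z n * complex_of_real (v n x)))\<^sup>2) = (\<Sum>n\<in>I. (cmod (z n))\<^sup>2 * k n)" .
  moreover have "0 \<le> (LINT x|M. (cmod (\<Sum>n\<in>I. z n * complex_of_real (v n x)))\<^sup>2)" by (simp add: integral_nonneg)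
  ultimately show ?thesis unfolding Lp_norm_two by (simp only: real_sqrt_pow2)
qed

context bessel_order
begin

lemma phi_sum_pad:
  assumes "N \<le> N'"
  shows "phi_sum c N = phi_sum (\<lambda>n. if n \<le> N then c n else 0) N'"
    "phi1_sum c N = phi1_sum (\<lambda>n. if n \<le> N then c n else 0) N'"
proof -
  show "phi_sum c N = phi_sum (\<lambda>n. if n \<le> N then c n else 0) N'"
    unfolding phi_sum_def[abs_def] using assms by (intro ext sum.mono_neutral_cong_left) auto
  show "phi1_sum c N = phi1_sum (\<lambda>n. if n \<le> N then c n else 0) N'"
    unfolding phi1_sum_def[abs_def] using assms by (intro ext sum.mono_neutral_cong_left) auto
qed

lemma integrable_phi:
  assumes m: "1 \<le> m" and n: "1 \<le> n"
  shows "integrable M (\<lambda>x. phi (lam m) x * phi (lam n) x)" "integrable M (\<lambda>x. phi1 (lam m) x * phi1 (lam n) x)"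
proof -
  interpret finite_measure M by (rule finite_M)
  obtain K where K: "0 \<le> K" "\<And>x. 0 < x \<Longrightarrow> x < 1 \<Longrightarrow> \<bar>phi (lam m) x\<bar> \<le> K" "\<And>x. 0 < x \<Longrightarrow> x < 1 \<Longrightarrow> \<bar>phi1 (lam m) x\<bar> \<le> K"
    using phi_bounded[OF m] by metis
  obtain L where L: "0 \<le> L" "\<And>x. 0 < x \<Longrightarrow> x < 1 \<Longrightarrow> \<bar>phi (lam n) x\<bar> \<le> L" "\<And>x. 0 < x \<Longrightarrow> x < 1 \<Longrightarrow> \<bar>phi1 (lam n) x\<bar> \<le> L"
    using phi_bounded[OF n] by metis
  have "AE x in M. norm (phi (lam m) x * phi (lam n) x) \<le> K * L" "AE x in M. norm (phi1 (lam m) x * phi1 (lam n) x) \<le> K * L"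
    using K L by (intro AE_M AE_I2 impI; auto simp: abs_mult intro!: mult_mono)+
  then show "integrable M (\<lambda>x. phi (lam m) x * phi (lam n) x)" "integrable M (\<lambda>x. phi1 (lam m) x * phi1 (lam n) x)"
    by (auto intro!: integrable_const_bound[where B="K * L"])
qed

lemma integral_phi1_sum:
  "(LINT x|M. phi1_sum c N x * phi1_sum d N x) = (\<Sum>n=2..N. c n * d n * mu (lam n))"
  unfolding phi1_sum_def by (intro integral_orthogonal_sum integrable_phi integral_phi) auto

lemma riesz_real_bound:
  assumes a: "0 \<le> a" and p: "1 < p"
  shows "Lp_norm p M (\<lambda>x. complex_of_real (phi1_sum (\<lambda>n. c n / sqrt (mu (lam n) + a)) N x)) \<le>
    14 * (max p (p / (p - 1)) - 1) * Lp_norm p M (\<lambda>x. complex_of_real (phi_sum c N x))"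
proof (rule Lp_norm_le_by_duality[OF p refl])
  define q where "q = p / (p - 1)"
  have q1: "1 < q" using p unfolding q_def by (simp add: less_divide_eq)
  show "(\<lambda>x. complex_of_real (phi1_sum (\<lambda>n. c n / sqrt (mu (lam n) + a)) N x)) \<in> Lp p M"
    using p by (intro phi_sum_Lp) simp
  show "0 \<le> 14 * (max p (p / (p - 1)) - 1) * Lp_norm p M (\<lambda>x. complex_of_real (phi_sum c N x))"
    using p by (intro mult_nonneg_nonneg) auto
  show "Lp_approx (p / (p - 1)) M {g. \<exists>N c. g = (\<lambda>x. \<Sum>n=2..N. c n * phi1 (lam n) x)} f"
    if "(\<lambda>x. complex_of_real (f x)) \<in> Lp (p / (p - 1)) M" for f
    using q1 that by (intro Lp_approx_phi1) (auto simp: q_def)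
  fix g assume "g \<in> {g. \<exists>N c. g = (\<lambda>x. \<Sum>n=2..N. c n * phi1 (lam n) x)}"
  then obtain N' d where g: "g = phi1_sum d N'" unfolding phi1_sum_def[abs_def] by auto
  \<comment> \<open>The two sums are padded with zeros to a common length.\<close>
  define K where "K = max N N'"
  define c' where "c' = (\<lambda>n. if n \<le> N then c n else 0)"
  define d' where "d' = (\<lambda>n. if n \<le> N' then d n else 0)"
  have g': "g = phi1_sum d' K" and f': "phi_sum c N = phi_sum c' K"
    unfolding g c'_def d'_def by (intro phi_sum_pad; simp add: K_def)+
  have "phi1_sum (\<lambda>n. c n / sqrt (mu (lam n) + a)) N = phi1_sum (\<lambda>n. if n \<le> N then c n / sqrt (mu (lam n) + a) else 0) K"
    by (rule phi_sum_pad(2)) (simp add: K_def)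
  also have "\<dots> = phi1_sum (\<lambda>n. c' n / sqrt (mu (lam n) + a)) K"
    by (intro ext) (auto simp: phi1_sum_def c'_def intro!: sum.cong)
  finally have h': "phi1_sum (\<lambda>n. c n / sqrt (mu (lam n) + a)) N = phi1_sum (\<lambda>n. c' n / sqrt (mu (lam n) + a)) K" .
  have "(LINT x|M. phi1_sum (\<lambda>n. c n / sqrt (mu (lam n) + a)) N x * g x) = (\<Sum>n=2..K. c' n * d' n * mu (lam n) / sqrt (mu (lam n) + a))"
    unfolding g' h' integral_phi1_sum by (intro sum.cong) auto
  also have "\<dots> \<le> 14 * (max p q - 1) * (Lp_norm p M (\<lambda>x. complex_of_real (phi_sum c N x)) * Lp_norm q M (\<lambda>x. complex_of_real (g x)))"
    unfolding g' f' using bilinear_norms[OF a p q_def, of c' d' K] by (rule abs_le_D1)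
  finally show "(LINT x|M. phi1_sum (\<lambda>n. c n / sqrt (mu (lam n) + a)) N x * g x) \<le>
      14 * (max p (p / (p - 1)) - 1) * Lp_norm p M (\<lambda>x. complex_of_real (phi_sum c N x)) * Lp_norm (p / (p - 1)) M (\<lambda>x. complex_of_real (g x))"
    by (simp add: q_def mult.assoc)
qed

section \<open>Complex-valued sums\<close>

definition cphi_sum :: "(nat \<Rightarrow> complex) \<Rightarrow> nat \<Rightarrow> real \<Rightarrow> complex" where
  "cphi_sum z N x = (\<Sum>n=1..N. z n * complex_of_real (phi (lam n) x))"

definition cphi1_sum :: "(nat \<Rightarrow> complex) \<Rightarrow> nat \<Rightarrow> real \<Rightarrow> complex" where
  "cphi1_sum z N x = (\<Sum>n=2..N. z n * complex_of_real (phi1 (lam n) x))"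

lemma cphi_sum_eq:
  "cphi_sum z N x = 1 * complex_of_real (phi_sum (\<lambda>n. Re (z n)) N x) + \<i> * complex_of_real (phi_sum (\<lambda>n. Im (z n)) N x)"
  "cphi1_sum z N x = 1 * complex_of_real (phi1_sum (\<lambda>n. Re (z n)) N x) + \<i> * complex_of_real (phi1_sum (\<lambda>n. Im (z n)) N x)"
  by (simp_all add: complex_eq_iff cphi_sum_def cphi1_sum_def phi_sum_def phi1_sum_def)

lemma cphi_sum_Lp: "0 < r \<Longrightarrow> cphi_sum z N \<in> Lp r M" "0 < r \<Longrightarrow> cphi1_sum z N \<in> Lp r M"
  unfolding cphi_sum_eq[abs_def] by (intro Lp_add Lp_cmult phi_sum_Lp; simp)+

lemma riesz_complex_bound:
  assumes a: "0 \<le> a" and p: "1 < p"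
  shows "Lp_norm p M (cphi1_sum (\<lambda>n. complex_of_real (1 / sqrt (mu (lam n) + a)) * z n) N) \<le>
    28 * (max p (p / (p - 1)) - 1) * Lp_norm p M (cphi_sum z N)"
proof -
  let ?C = "14 * (max p (p / (p - 1)) - 1)"
  let ?h = "\<lambda>c. phi1_sum (\<lambda>n. c n / sqrt (mu (lam n) + a)) N"
  have p0: "0 < p" "1 \<le> p" using p by simp_all
  have C0: "0 \<le> ?C" using p by simp
  have e: "cphi1_sum (\<lambda>n. complex_of_real (1 / sqrt (mu (lam n) + a)) * z n) N =
     (\<lambda>x. 1 * complex_of_real (?h (\<lambda>n. Re (z n)) x) + \<i> * complex_of_real (?h (\<lambda>n. Im (z n)) x))"
    unfolding cphi_sum_eq[abs_def] by (simp add: Re_divide_of_real Im_divide_of_real mult.commute)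
  have "Lp_norm p M (cphi1_sum (\<lambda>n. complex_of_real (1 / sqrt (mu (lam n) + a)) * z n) N) \<le>
      Lp_norm p M (\<lambda>x. 1 * complex_of_real (?h (\<lambda>n. Re (z n)) x)) + Lp_norm p M (\<lambda>x. \<i> * complex_of_real (?h (\<lambda>n. Im (z n)) x))"
    unfolding e by (intro Lp_minkowski Lp_cmult phi_sum_Lp p0)
  also have "\<dots> = Lp_norm p M (\<lambda>x. complex_of_real (?h (\<lambda>n. Re (z n)) x)) + Lp_norm p M (\<lambda>x. complex_of_real (?h (\<lambda>n. Im (z n)) x))"
    unfolding Lp_norm_cmult[OF p0(1)] by simp
  also have "\<dots> \<le> ?C * Lp_norm p M (\<lambda>x. complex_of_real (phi_sum (\<lambda>n. Re (z n)) N x)) + ?C * Lp_norm p M (\<lambda>x. complex_of_real (phi_sum (\<lambda>n. Im (z n)) N x))"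
    by (intro add_mono riesz_real_bound a p)
  also have "\<dots> \<le> ?C * Lp_norm p M (cphi_sum z N) + ?C * Lp_norm p M (cphi_sum z N)"
  proof (intro add_mono mult_left_mono C0 Lp_norm_mono(2) cphi_sum_Lp p0)
    have "Re (cphi_sum z N x) = phi_sum (\<lambda>n. Re (z n)) N x" "Im (cphi_sum z N x) = phi_sum (\<lambda>n. Im (z n)) N x" for x
      by (simp_all add: cphi_sum_eq)
    then show "cmod (complex_of_real (phi_sum (\<lambda>n. Re (z n)) N x)) \<le> cmod (cphi_sum z N x)"
      "cmod (complex_of_real (phi_sum (\<lambda>n. Im (z n)) N x)) \<le> cmod (cphi_sum z N x)" for x
      using abs_Re_le_cmod[of "cphi_sum z N x"] abs_Im_le_cmod[of "cphi_sum z N x"] by simp_all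
  qed auto
  finally show ?thesis by (simp add: algebra_simps)
qed

end

subsection \<open>The Riesz transforms on \<open>L\<^sup>2\<close>\<close>

lemma Lp_product_integrable:
  assumes "f \<in> Lp 2 M" "g \<in> Lp 2 M"
  shows "integrable M (\<lambda>x. f x * g x)"
  by (rule Lp_holder(1)[OF assms]) simp_all

context bessel_order
begin

definition coef :: "(real \<Rightarrow> complex) \<Rightarrow> nat \<Rightarrow> complex" where
  "coef f n = (LINT x|M. f x * complex_of_real (phi (lam n) x))"

definition riesz_partial :: "real \<Rightarrow> (real \<Rightarrow> complex) \<Rightarrow> nat \<Rightarrow> real \<Rightarrow> complex" where
  "riesz_partial a f = cphi1_sum (\<lambda>n. complex_of_real (1 / sqrt (mu (lam n) + a)) * coef f n)"

lemma phi_Lp: "1 \<le> n \<Longrightarrow> 0 < r \<Longrightarrow> (\<lambda>x. complex_of_real (phi (lam n) x)) \<in> Lp r M"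
proof -
  assume n: "1 \<le> n" and r: "0 < r"
  obtain K where K: "0 \<le> K" "\<And>x. 0 < x \<Longrightarrow> x < 1 \<Longrightarrow> \<bar>phi (lam n) x\<bar> \<le> K" "\<And>x. 0 < x \<Longrightarrow> x < 1 \<Longrightarrow> \<bar>phi1 (lam n) x\<bar> \<le> K"
    using phi_bounded[OF n] by metis
  show ?thesis using K by (intro Lp_bounded[OF finite_M _ _ r, where K=K] AE_M) auto
qed

lemma coef_integrable: "f \<in> Lp 2 M \<Longrightarrow> 1 \<le> n \<Longrightarrow> integrable M (\<lambda>x. f x * complex_of_real (phi (lam n) x))"
  by (intro Lp_product_integrable phi_Lp) auto

lemma coef_lincomb:
  assumes "f \<in> Lp 2 M" "g \<in> Lp 2 M" "1 \<le> n"
  shows "coef (\<lambda>x. a * f x + b * g x) n = a * coef f n + b * coef g n"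
proof -
  have "coef (\<lambda>x. a * f x + b * g x) n =
      (LINT x|M. a * (f x * complex_of_real (phi (lam n) x)) + b * (g x * complex_of_real (phi (lam n) x)))"
    by (simp add: coef_def algebra_simps)
  also have "\<dots> = a * coef f n + b * coef g n"
    using coef_integrable assms by (simp add: coef_def)
  finally show ?thesis .
qed

lemma coef_cphi_sum:
  assumes "1 \<le> n"
  shows "coef (cphi_sum z N) n = (if n \<le> N then z n else 0)"
proof -
  have "coef (cphi_sum z N) n = (LINT x|M. (\<Sum>m=1..N. z m * complex_of_real (phi (lam m) x * phi (lam n) x)))"
    by (simp add: coef_def cphi_sum_def sum_distrib_right mult.assoc)
  also have "\<dots> = (\<Sum>m=1..N. LINT x|M. z m * complex_of_real (phi (lam m) x * phi (lam n) x))"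
    using integrable_phi(1) assms
    by (intro Bochner_Integration.integral_sum integrable_mult_right) (simp add: complex_of_real_integrable_eq del: of_real_mult)
  also have "\<dots> = (\<Sum>m=1..N. z m * complex_of_real (if m = n then 1 else 0))"
    using integral_phi(1) assms by (intro sum.cong) (simp_all del: of_real_mult)
  also have "\<dots> = (\<Sum>m=1..N. if n = m then z m else 0)" by (intro sum.cong) auto
  also have "\<dots> = (if n \<le> N then z n else 0)" using assms by simp
  finally show ?thesis .
qed

lemma Lp_norm_cphi_sum:
  "(Lp_norm 2 M (cphi_sum z N))\<^sup>2 = (\<Sum>n=1..N. (cmod (z n))\<^sup>2)"
  "(Lp_norm 2 M (cphi1_sum z N))\<^sup>2 = (\<Sum>n=2..N. (cmod (z n))\<^sup>2 * mu (lam n))"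
proof -
  have "(Lp_norm 2 M (cphi_sum z N))\<^sup>2 = (\<Sum>n=1..N. (cmod (z n))\<^sup>2 * 1)"
    unfolding cphi_sum_def[abs_def] by (intro Lp_norm_orthogonal_sum integrable_phi integral_phi) auto
  then show "(Lp_norm 2 M (cphi_sum z N))\<^sup>2 = (\<Sum>n=1..N. (cmod (z n))\<^sup>2)" by simp
  show "(Lp_norm 2 M (cphi1_sum z N))\<^sup>2 = (\<Sum>n=2..N. (cmod (z n))\<^sup>2 * mu (lam n))"
    unfolding cphi1_sum_def[abs_def] by (intro Lp_norm_orthogonal_sum integrable_phi integral_phi) auto
qed

text \<open>The Cauchy-Schwarz inequality for f and its own partial sum, whose squared norm equals
  its pairing with f.\<close>

lemma coef_bessel_inequality:
  assumes f: "f \<in> Lp 2 M"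
  shows "(\<Sum>n=1..N. (cmod (coef f n))\<^sup>2) \<le> (Lp_norm 2 M f)\<^sup>2"
proof -
  let ?g = "cphi_sum (coef f) N" and ?S = "\<Sum>n=1..N. (cmod (coef f n))\<^sup>2"
  have S: "0 \<le> ?S" by (simp add: sum_nonneg)
  have g: "?g \<in> Lp 2 M" by (intro cphi_sum_Lp) simp
  have cg: "(\<lambda>x. cnj (?g x)) \<in> Lp 2 M"
    using Lp_integrable[OF g]
    by (intro Lp_I measurable_compose[OF Lp_measurable[OF g] borel_measurable_continuous_onI[OF continuous_on_cnj[OF continuous_on_id]]]) simp
  have ng: "Lp_norm 2 M (\<lambda>x. cnj (?g x)) = Lp_norm 2 M ?g" by (simp add: Lp_norm_def)
  have "(LINT x|M. f x * cnj (?g x)) = (LINT x|M. (\<Sum>n=1..N. cnj (coef f n) * (f x * complex_of_real (phi (lam n) x))))"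
    by (simp add: cphi_sum_def sum_distrib_left mult_ac)
  also have "\<dots> = (\<Sum>n=1..N. LINT x|M. cnj (coef f n) * (f x * complex_of_real (phi (lam n) x)))"
    by (intro Bochner_Integration.integral_sum integrable_mult_right coef_integrable f) auto
  also have "\<dots> = (\<Sum>n=1..N. cnj (coef f n) * coef f n)"
    by (simp only: integral_mult_right_zero coef_def)
  also have "\<dots> = complex_of_real ?S"
    unfolding of_real_sum complex_norm_square by (simp only: mult.commute)
  finally have "?S = cmod (LINT x|M. f x * cnj (?g x))" using S by (simp only: norm_of_real abs_of_nonneg)
  also have "\<dots> \<le> (LINT x|M. cmod (f x * cnj (?g x)))" by (rule integral_norm_bound)
  also have "\<dots> \<le> Lp_norm 2 M f * Lp_norm 2 M ?g"
    using Lp_holder(2)[OF f cg] by (simp add: norm_mult ng)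
  finally have "?S\<^sup>2 \<le> (Lp_norm 2 M f * Lp_norm 2 M ?g)\<^sup>2" using S by (intro power_mono) auto
  then have "?S * ?S \<le> (Lp_norm 2 M f)\<^sup>2 * ?S"
    unfolding power_mult_distrib Lp_norm_cphi_sum by (simp add: power2_eq_square)
  then show ?thesis using S by (cases "?S = 0") (auto simp: mult_le_cancel_right)
qed

text \<open>The quotient of mu by mu + a is at most 1, which makes both transforms contractions on
  L^2.\<close>

lemma riesz_weight_le: "0 \<le> a \<Longrightarrow> 2 \<le> n \<Longrightarrow> (cmod (complex_of_real (1 / sqrt (mu (lam n) + a)) * w))\<^sup>2 * mu (lam n) \<le> (cmod w)\<^sup>2"
proof -
  assume "0 \<le> a" "2 \<le> n"
  then have m: "0 < mu (lam n)" "0 < mu (lam n) + a" using mu_pos[of n] by auto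
  have "(cmod (complex_of_real (1 / sqrt (mu (lam n) + a)) * w))\<^sup>2 * mu (lam n) = (cmod w)\<^sup>2 * (mu (lam n) / (mu (lam n) + a))"
    using m by (simp add: norm_mult norm_divide power_mult_distrib power_divide)
  also have "\<dots> \<le> (cmod w)\<^sup>2 * 1" using m \<open>0 \<le> a\<close> by (intro mult_left_mono) (auto simp: divide_le_eq)
  finally show ?thesis by simp
qed

lemma riesz_partial_Lp: "0 < r \<Longrightarrow> riesz_partial a f N \<in> Lp r M"
  unfolding riesz_partial_def by (rule cphi_sum_Lp)

lemma riesz_partial_norm:
  assumes a: "0 \<le> a" and f: "f \<in> Lp 2 M"
  shows "Lp_norm 2 M (riesz_partial a f N) \<le> Lp_norm 2 M f"
proof -
  have "(Lp_norm 2 M (riesz_partial a f N))\<^sup>2 \<le> (\<Sum>n=2..N. (cmod (coef f n))\<^sup>2)"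
    unfolding riesz_partial_def Lp_norm_cphi_sum using a by (intro sum_mono riesz_weight_le) auto
  also have "\<dots> \<le> (\<Sum>n=1..N. (cmod (coef f n))\<^sup>2)" by (intro sum_mono2) auto
  also have "\<dots> \<le> (Lp_norm 2 M f)\<^sup>2" by (rule coef_bessel_inequality[OF f])
  finally show ?thesis by (rule power2_le_imp_le) simp
qed

lemma riesz_partial_diff:
  assumes a: "0 \<le> a" and mn: "m \<le> n"
  shows "(Lp_norm 2 M (\<lambda>x. riesz_partial a f n x - riesz_partial a f m x))\<^sup>2 \<le> (\<Sum>k=m..<n. (cmod (coef f (Suc k)))\<^sup>2)"
proof -
  let ?w = "\<lambda>k. complex_of_real (1 / sqrt (mu (lam k) + a)) * coef f k"
  let ?v = "\<lambda>k. complex_of_real (1 / sqrt (mu (lam k) + a)) * (if m < k then coef f k else 0)"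
  have "riesz_partial a f n x - riesz_partial a f m x = cphi1_sum ?v n x" for x
  proof -
    have "riesz_partial a f m x = (\<Sum>k=2..n. (if k \<le> m then ?w k else 0) * complex_of_real (phi1 (lam k) x))"
      unfolding riesz_partial_def cphi1_sum_def using mn by (intro sum.mono_neutral_cong_left) auto
    then have "riesz_partial a f n x - riesz_partial a f m x =
        (\<Sum>k=2..n. ?w k * complex_of_real (phi1 (lam k) x) - (if k \<le> m then ?w k else 0) * complex_of_real (phi1 (lam k) x))"
      by (simp add: riesz_partial_def cphi1_sum_def sum_subtractf)
    also have "\<dots> = cphi1_sum ?v n x" unfolding cphi1_sum_def by (intro sum.cong) auto
    finally show ?thesis .
  qed
  then have "(Lp_norm 2 M (\<lambda>x. riesz_partial a f n x - riesz_partial a f m x))\<^sup>2 = (\<Sum>k=2..n. (cmod (?v k))\<^sup>2 * mu (lam k))"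
    by (simp only: Lp_norm_cphi_sum(2)[symmetric])
  also have "\<dots> \<le> (\<Sum>k=2..n. (cmod (if m < k then coef f k else 0))\<^sup>2)" using a by (intro sum_mono riesz_weight_le) auto
  also have "\<dots> = (\<Sum>k=2..n. if k \<in> {m<..} then (cmod (coef f k))\<^sup>2 else 0)" by (intro sum.cong) auto
  also have "\<dots> = (\<Sum>k\<in>{2..n} \<inter> {m<..}. (cmod (coef f k))\<^sup>2)" by (rule sum.inter_restrict[symmetric]) simp
  also have "\<dots> \<le> (\<Sum>k=Suc m..<Suc n. (cmod (coef f k))\<^sup>2)" by (intro sum_mono2) auto
  also have "\<dots> = (\<Sum>k=m..<n. (cmod (coef f (Suc k)))\<^sup>2)" by (rule sum.shift_bounds_Suc_ivl)
  finally show ?thesis .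
qed

lemma riesz_partial_convergent:
  assumes a: "0 \<le> a" and f: "f \<in> Lp 2 M"
  shows "\<exists>g. Lp_tendsto 2 M (riesz_partial a f) g"
proof -
  define b where "b k = (cmod (coef f (Suc k)))\<^sup>2" for k
  have "summable b"
  proof (rule summableI_nonneg_bounded)
    fix n
    have "sum b {..<n} = (\<Sum>k=1..n. (cmod (coef f k))\<^sup>2)"
      unfolding b_def using sum.shift_bounds_Suc_ivl[of "\<lambda>k. (cmod (coef f k))\<^sup>2" 0 n]
      by (simp add: lessThan_atLeast0 atLeastLessThanSuc_atLeastAtMost)
    then show "sum b {..<n} \<le> (Lp_norm 2 M f)\<^sup>2" using coef_bessel_inequality[OF f] by simp
  qed (simp add: b_def)
  have "\<exists>N. \<forall>m\<ge>N. \<forall>n\<ge>N. Lp_norm 2 M (\<lambda>x. riesz_partial a f m x - riesz_partial a f n x) \<le> e" if e: "0 < e" for e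
  proof -
    obtain N where N: "\<And>m n. m \<ge> N \<Longrightarrow> norm (sum b {m..<n}) < e\<^sup>2"
      using \<open>summable b\<close> e unfolding summable_Cauchy by (metis zero_less_power)
    have le: "Lp_norm 2 M (\<lambda>x. riesz_partial a f n x - riesz_partial a f m x) \<le> e" if "N \<le> m" "m \<le> n" for m n
    proof (rule power2_le_imp_le)
      show "(Lp_norm 2 M (\<lambda>x. riesz_partial a f n x - riesz_partial a f m x))\<^sup>2 \<le> e\<^sup>2"
        using riesz_partial_diff[OF a that(2), of f] N[OF that(1), of n] by (simp add: b_def)
    qed (use e in simp)
    show ?thesis
    proof (intro exI[of _ N] allI impI)
      fix m n assume mn: "N \<le> m" "N \<le> n"
      show "Lp_norm 2 M (\<lambda>x. riesz_partial a f m x - riesz_partial a f n x) \<le> e"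
      proof (cases "m \<le> n")
        case True
        show ?thesis by (subst Lp_norm_minus_commute) (rule le[OF mn(1) True])
      next
        case False
        then show ?thesis by (intro le mn) simp
      qed
    qed
  qed
  then show ?thesis
    by (rule Lp_complete[OF finite_M riesz_partial_Lp, of 2, rotated 2]) (assumption, erule exI, simp_all)
qed

text \<open>The choice in \<open>bessel_derivative_series\<close> finds a limit because one exists
  by \<open>riesz_partial_convergent\<close>. The two kinds of partial sums are identified only
  inside (0, 1), hence the passage through equality almost everywhere.\<close>

lemma riesz_tendsto:
  assumes a: "0 \<le> a" and \<alpha>: "\<forall>n\<ge>2. \<alpha> n = 1 / sqrt (mu (lam n) + a)" and f: "f \<in> Lp 2 M"
  shows "Lp_tendsto 2 M (riesz_partial a f) (bessel_derivative_series \<nu> \<alpha> f)"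
proof -
  define s where "s = (\<lambda>N x. \<Sum>n=2..N. complex_of_real (\<alpha> n) *
           L2_inner M f (\<lambda>y. complex_of_real (bessel_varphi \<nu> n y)) *
           complex_of_real (deriv (bessel_varphi \<nu> n) x))"
  have c: "L2_inner M f (\<lambda>y. complex_of_real (bessel_varphi \<nu> n y)) = coef f n" if "1 \<le> n" for n
    unfolding L2_inner_def coef_def using that
    by (intro Bochner_Integration.integral_cong) (auto simp: bessel_varphi_eq)
  have s: "s N x = riesz_partial a f N x" if "x \<in> space M" for N x
    unfolding s_def riesz_partial_def cphi1_sum_def using that
    by (intro sum.cong) (auto simp: c \<alpha> deriv_bessel_varphi)
  have rm: "riesz_partial a f N \<in> borel_measurable M" for N by (rule Lp_measurable[OF riesz_partial_Lp[of 2]]) simp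
  have sm: "s N \<in> borel_measurable M" for N by (rule measurable_cong[OF s, THEN iffD2, OF _ rm])
  obtain g where g: "Lp_tendsto 2 M (riesz_partial a f) g" using riesz_partial_convergent[OF a f] by (rule exE)
  have gm: "h \<in> borel_measurable M" if "Lp_tendsto 2 M t h" for t h using that by (auto simp: Lp_tendsto_def Lp_def)
  have "Lp_tendsto 2 M s g"
    by (rule Lp_tendsto_cong_AE[OF g sm gm[OF g]]) (auto simp: s)
  then have "Lp_tendsto 2 M s (SOME g. Lp_tendsto 2 M s g)" by (rule someI[where P="\<lambda>g. Lp_tendsto 2 M s g"])
  then have l: "Lp_tendsto 2 M s (bessel_derivative_series \<nu> \<alpha> f)" by (simp add: bessel_derivative_series_def s_def)
  show ?thesis
    by (rule Lp_tendsto_cong_AE[OF l rm gm[OF l]]) (auto simp: s)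
qed

text \<open>Linearity and the contraction bound hold for the partial sums and pass to their
  limit.\<close>

lemma riesz_bounded_linear:
  assumes a: "0 \<le> a" and \<alpha>: "\<forall>n\<ge>2. \<alpha> n = 1 / sqrt (mu (lam n) + a)"
  shows "Lp_bounded_linear 2 M (bessel_derivative_series \<nu> \<alpha>)"
proof -
  let ?R = "bessel_derivative_series \<nu> \<alpha>"
  have t: "Lp_tendsto 2 M (riesz_partial a f) (?R f)" if "f \<in> Lp 2 M" for f by (rule riesz_tendsto[OF a \<alpha> that])
  have lin: "AE x in M. ?R (\<lambda>y. b * f y + c * g y) x = b * ?R f x + c * ?R g x" if f: "f \<in> Lp 2 M" and g: "g \<in> Lp 2 M" for f g b c
  proof -
    have h: "(\<lambda>y. b * f y + c * g y) \<in> Lp 2 M" by (intro Lp_add Lp_cmult f g) simp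
    have "riesz_partial a (\<lambda>y. b * f y + c * g y) = (\<lambda>N x. b * riesz_partial a f N x + c * riesz_partial a g N x)"
      unfolding riesz_partial_def cphi1_sum_def sum_distrib_left sum.distrib[symmetric]
      by (intro ext sum.cong) (auto simp: coef_lincomb[OF f g] algebra_simps)
    with t[OF h] Lp_tendsto_lincomb[OF t[OF f] t[OF g], of b c]
    show ?thesis by (intro Lp_tendsto_unique[of 2 M]) simp_all
  qed
  show ?thesis
    unfolding Lp_bounded_linear_def
  proof (intro conjI ballI impI allI)
    fix f assume f: "f \<in> Lp 2 M"
    show "?R f \<in> Lp 2 M" using t[OF f] by (simp add: Lp_tendsto_def)
    show "AE x in M. ?R (\<lambda>y. c * f y) x = c * ?R f x" for c using lin[OF f f, of c 0] by simp
    fix g assume g: "g \<in> Lp 2 M"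
    show "AE x in M. ?R (\<lambda>y. f y + g y) x = ?R f x + ?R g x" using lin[OF f g, of 1 1] by simp
    assume ae: "AE x in M. f x = g x"
    note [measurable] = Lp_measurable[OF f] Lp_measurable[OF g]
    have "coef f n = coef g n" for n
      unfolding coef_def using ae by (intro integral_cong_AE) auto
    then have "riesz_partial a f = riesz_partial a g" by (simp add: riesz_partial_def)
    with t[OF f] t[OF g] show "AE x in M. ?R f x = ?R g x" by (intro Lp_tendsto_unique[of 2 M]) simp_all
  next
    have "Lp_norm 2 M (?R f) \<le> 1 * Lp_norm 2 M f" if f: "f \<in> Lp 2 M" for f
      using Lp_tendsto_norm[OF t[OF f]] riesz_partial_norm[OF a f]
      by (intro tendsto_upperbound[where F=sequentially]) (auto intro!: always_eventually)
    then show "\<exists>K. \<forall>f\<in>Lp 2 M. Lp_norm 2 M (?R f) \<le> K * Lp_norm 2 M f" by blast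
  qed
qed

text \<open>On a finite sum the partial sums of the series are constant from index N on.\<close>

lemma riesz_cphi_sum:
  assumes a: "0 \<le> a" and \<alpha>: "\<forall>n\<ge>2. \<alpha> n = 1 / sqrt (mu (lam n) + a)"
  shows "AE x in M. bessel_derivative_series \<nu> \<alpha> (cphi_sum z N) x = cphi1_sum (\<lambda>n. complex_of_real (1 / sqrt (mu (lam n) + a)) * z n) N x"
proof -
  let ?h = "cphi1_sum (\<lambda>n. complex_of_real (1 / sqrt (mu (lam n) + a)) * z n) N"
  have e: "riesz_partial a (cphi_sum z N) k = ?h" if "N \<le> k" for k
  proof
    fix x
    have "?h x = (\<Sum>n=2..k. (if n \<le> N then complex_of_real (1 / sqrt (mu (lam n) + a)) * z n else 0) * complex_of_real (phi1 (lam n) x))"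
      unfolding cphi1_sum_def using that by (intro sum.mono_neutral_cong_left) auto
    then show "riesz_partial a (cphi_sum z N) k x = ?h x"
      unfolding riesz_partial_def cphi1_sum_def by (auto simp: coef_cphi_sum intro!: sum.cong)
  qed
  have "(\<lambda>k. Lp_norm 2 M (\<lambda>x. riesz_partial a (cphi_sum z N) k x - ?h x)) \<longlonglongrightarrow> 0"
    by (intro tendsto_eventually eventually_sequentiallyI[of N]) (simp add: e)
  then have "Lp_tendsto 2 M (riesz_partial a (cphi_sum z N)) ?h"
    using riesz_partial_Lp[of 2] cphi_sum_Lp(2)[of 2] by (simp add: Lp_tendsto_def)
  from Lp_tendsto_unique[OF riesz_tendsto[OF a \<alpha> cphi_sum_Lp(1)] this]
  show ?thesis by simp
qed

subsection \<open>Extension to \<open>L\<^sup>p\<close>\<close>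

lemma cphi_sum_lincomb:
  "\<exists>N'' w. (\<lambda>x. a * cphi_sum y N x + b * cphi_sum z N' x) = cphi_sum w N''"
proof (intro exI ext)
  fix x
  let ?K = "max N N'"
  have pad: "cphi_sum y N x = cphi_sum (\<lambda>n. if n \<le> N then y n else 0) ?K x" if "N \<le> ?K" for y N
    unfolding cphi_sum_def using that by (intro sum.mono_neutral_cong_left) auto
  show "a * cphi_sum y N x + b * cphi_sum z N' x =
     cphi_sum (\<lambda>n. a * (if n \<le> N then y n else 0) + b * (if n \<le> N' then z n else 0)) ?K x"
    unfolding pad[of N y, OF max.cobounded1] pad[of N' z, OF max.cobounded2]
    by (simp add: cphi_sum_def sum_distrib_left sum.distrib algebra_simps)
qed

lemma cphi_sum_dense:
  assumes r: "1 < r" and f: "f \<in> Lp r M"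
  shows "\<exists>s. (\<forall>k::nat. s k \<in> {g. \<exists>z N. g = cphi_sum z N}) \<and> Lp_tendsto r M s f"
proof -
  have r0: "0 < r" "1 \<le> r" using r by simp_all
  note [measurable] = Lp_measurable[OF f]
  have "(\<lambda>x. complex_of_real (Re (f x))) \<in> Lp r M" "(\<lambda>x. complex_of_real (Im (f x))) \<in> Lp r M"
    using abs_Re_le_cmod abs_Im_le_cmod by (intro Lp_norm_mono(1)[OF f _ _ r0(1)]; simp)+
  from this[THEN Lp_approx_phi[OF r]] obtain s t where
    s: "\<forall>k. s k \<in> {g. \<exists>N c. g = (\<lambda>x. \<Sum>n=1..N. c n * phi (lam n) x)}" "Lp_tendsto r M (\<lambda>k x. complex_of_real (s k x)) (\<lambda>x. complex_of_real (Re (f x)))" and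
    t: "\<forall>k. t k \<in> {g. \<exists>N c. g = (\<lambda>x. \<Sum>n=1..N. c n * phi (lam n) x)}" "Lp_tendsto r M (\<lambda>k x. complex_of_real (t k x)) (\<lambda>x. complex_of_real (Im (f x)))"
    unfolding Lp_approx_def by (elim exE conjE)
  have c: "\<exists>z N. (\<lambda>x. complex_of_real (g x)) = cphi_sum z N" if "g \<in> {g. \<exists>N c. g = (\<lambda>x. \<Sum>n=1..N. c n * phi (lam n) x)}" for g
  proof -
    from that obtain N c where "g = (\<lambda>x. \<Sum>n=1..N. c n * phi (lam n) x)" unfolding mem_Collect_eq by (elim exE)
    then show ?thesis
      by (intro exI[of _ "\<lambda>n. complex_of_real (c n)"] exI[of _ N]) (simp add: cphi_sum_def[abs_def])
  qed
  show ?thesis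
  proof (intro exI conjI allI)
    show "Lp_tendsto r M (\<lambda>k x. 1 * complex_of_real (s k x) + \<i> * complex_of_real (t k x)) f"
      using Lp_tendsto_lincomb[OF s(2) t(2) r0(2), of 1 \<i>] by (simp add: complex_eq[symmetric])
    show "(\<lambda>x. 1 * complex_of_real (s k x) + \<i> * complex_of_real (t k x)) \<in> {g. \<exists>z N. g = cphi_sum z N}" for k
    proof -
      obtain y N where y: "(\<lambda>x. complex_of_real (s k x)) = cphi_sum y N" using c s(1) by blast
      obtain z N' where z: "(\<lambda>x. complex_of_real (t k x)) = cphi_sum z N'" using c t(1) by blast
      show ?thesis using cphi_sum_lincomb[of 1 y N \<i> z N'] fun_cong[OF y] fun_cong[OF z] by auto
    qed
  qed
qed

theorem riesz_extension:
  assumes a: "0 \<le> a" and \<alpha>: "\<forall>n\<ge>2. \<alpha> n = 1 / sqrt (mu (lam n) + a)" and p: "1 < p"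
  shows "\<exists>T. Lp_extension p M (bessel_derivative_series \<nu> \<alpha>) T \<and>
      (\<forall>S. Lp_extension p M (bessel_derivative_series \<nu> \<alpha>) S \<longrightarrow> (\<forall>f \<in> Lp p M. AE x in M. S f x = T f x)) \<and>
      Lp_opnorm p M T \<le> 28 * (max p (p / (p - 1)) - 1)"
proof (rule Lp_extension_exists[OF finite_M p riesz_bounded_linear[OF a \<alpha>], where D="{g. \<exists>z N. g = cphi_sum z N}"])
  show "f \<in> {g. \<exists>z N. g = cphi_sum z N} \<Longrightarrow> 1 < r \<Longrightarrow> f \<in> Lp r M" for f r
    using cphi_sum_Lp(1)[of r] by auto
  show "(\<lambda>x. a * f x + b * g x) \<in> {g. \<exists>z N. g = cphi_sum z N}"
    if "f \<in> {g. \<exists>z N. g = cphi_sum z N}" "g \<in> {g. \<exists>z N. g = cphi_sum z N}" for f g a b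
    using that cphi_sum_lincomb by blast
  show "0 \<le> 28 * (max p (p / (p - 1)) - 1)" using p by simp
  show "\<exists>s. (\<forall>k::nat. s k \<in> {g. \<exists>z N. g = cphi_sum z N}) \<and> Lp_tendsto r M s f" if "1 < r" "f \<in> Lp r M" for r f
    by (rule cphi_sum_dense[OF that])
  fix f assume "f \<in> {g. \<exists>z N. g = cphi_sum z N}"
  then obtain z N where f: "f = cphi_sum z N" by auto
  let ?h = "cphi1_sum (\<lambda>n. complex_of_real (1 / sqrt (mu (lam n) + a)) * z n) N"
  have h: "?h \<in> Lp p M" using p by (intro cphi_sum_Lp) simp
  have ae: "AE x in M. ?h x = bessel_derivative_series \<nu> \<alpha> f x"
    using riesz_cphi_sum[OF a \<alpha>, where z=z and N=N] unfolding f by eventually_elim simp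
  have m: "bessel_derivative_series \<nu> \<alpha> f \<in> borel_measurable M"
    unfolding f by (rule Lp_measurable[OF Lp_bounded_linearD(1)[OF riesz_bounded_linear[OF a \<alpha>] cphi_sum_Lp(1)]]) simp_all
  show "bessel_derivative_series \<nu> \<alpha> f \<in> Lp p M \<and>
    Lp_norm p M (bessel_derivative_series \<nu> \<alpha> f) \<le> 28 * (max p (p / (p - 1)) - 1) * Lp_norm p M f"
    using Lp_cong_AE[OF h m ae] Lp_norm_cong_AE[OF Lp_measurable[OF h] m ae, of p] riesz_complex_bound[OF a p, of z N] f by simp
qed

end

theorem theorem6p1:
  fixes \<nu> p :: real
  assumes "\<nu> \<ge> - 1 / 2" and "1 < p"
  shows "\<forall>R \<in> {riesz_transform \<nu>, riesz_transform_M \<nu>}.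
    \<exists>T. Lp_extension p (bessel_measure \<nu>) R T \<and>
      (\<forall>S. Lp_extension p (bessel_measure \<nu>) R S \<longrightarrow>
        (\<forall>f \<in> Lp p (bessel_measure \<nu>). AE x in bessel_measure \<nu>. S f x = T f x)) \<and>
      Lp_opnorm p (bessel_measure \<nu>) T \<le> 48 * (max p (p / (p - 1)) - 1)"
proof
  interpret bessel_order \<nu> by unfold_locales (use assms in simp)
  fix R assume R: "R \<in> {riesz_transform \<nu>, riesz_transform_M \<nu>}"
  have "\<exists>a \<alpha>. 0 \<le> a \<and> (\<forall>n\<ge>2. \<alpha> n = 1 / sqrt (mu (lam n) + a)) \<and> R = bessel_derivative_series \<nu> \<alpha>"
  proof (cases "R = riesz_transform \<nu>")
    case True
    \<comment> \<open>\<mu>_n + \<lambda>_1^2 is \<lambda>_n^2, so the shift is \<lambda>_1^2 here;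
      for the other transform it is 0.\<close>
    have "inverse (lam n) = 1 / sqrt (mu (lam n) + z1\<^sup>2)" if "2 \<le> n" for n
      using lam_pos[of n] that by (simp add: mu_def inverse_eq_divide)
    then show ?thesis using True
      by (intro exI[of _ "z1\<^sup>2"] exI[of _ "\<lambda>n. inverse (lam n)"]) (simp add: riesz_transform_def)
  next
    case False
    have "((lam n)\<^sup>2 - z1\<^sup>2) powr (- 1 / 2) = 1 / sqrt (mu (lam n) + 0)" if "2 \<le> n" for n
      using mu_pos[OF that] powr_minus_divide[of "mu (lam n)" "1 / 2"] by (simp add: mu_def powr_half_sqrt)
    then show ?thesis using False R
      by (intro exI[of _ 0] exI[of _ "\<lambda>n. ((lam n)\<^sup>2 - z1\<^sup>2) powr (- 1 / 2)"]) (simp add: riesz_transform_M_def)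
  qed
  then obtain a \<alpha> where a: "0 \<le> a" and \<alpha>: "\<forall>n\<ge>2. \<alpha> n = 1 / sqrt (mu (lam n) + a)" and R: "R = bessel_derivative_series \<nu> \<alpha>"
    by (elim exE conjE)
  have "28 * (max p (p / (p - 1)) - 1) \<le> 48 * (max p (p / (p - 1)) - 1)" using assms(2) by simp
  then show "\<exists>T. Lp_extension p (bessel_measure \<nu>) R T \<and>
      (\<forall>S. Lp_extension p (bessel_measure \<nu>) R S \<longrightarrow>
        (\<forall>f \<in> Lp p (bessel_measure \<nu>). AE x in bessel_measure \<nu>. S f x = T f x)) \<and>
      Lp_opnorm p (bessel_measure \<nu>) T \<le> 48 * (max p (p / (p - 1)) - 1)"
    using riesz_extension[OF a \<alpha> assms(2)] unfolding R by (meson order_trans)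
qed

end
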